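(* Let $d\in\mathbb N$, $T>0$, $\gamma>1$. Suppose that an augmented measure-valued solution $\mu$ of the incompressible Euler system on $(0,T)\times\mathbb T^d$ is generated in one of the following two ways: (a) (low Mach number limit with uniformly bounded pressure lifts) there are a constant $\bar\rho>0$, a sequence $\varepsilon_n\to 0$, $\varepsilon_n>0$, and for each $n$ a weak solution $(\rho^{\varepsilon_n},u^{\varepsilon_n})$ of the isentropic Euler system with Mach number $\sqrt{\varepsilon_n}$ such that the pressure lifts $P_{\bar\rho}^{\varepsilon_n}(\rho^{\varepsilon_n},u^{\varepsilon_n})=\left(u^{\varepsilon_n},\frac{1}{\varepsilon_n\bar\rho}\big((\rho^{\varepsilon_n})^\gamma-\bar\rho^\gamma\big)\right)$ are uniformly bounded in $L^\infty((0,T)\times\mathbb T^d)$ and generate $\mu$; or (b) there are weak solutions $u_n$ of the incompressible Euler system with corresponding pressures $P_n$ such that $(u_n)$ and $(P_n)$ are uniformly bounded in $L^\infty((0,T)\times\mathbb T^d)$ and $(u_n,P_n)$ generates $\mu$. Then there is a subset of $(0,T)\times\mathbb T^d$ of full measure on which $\mu$ satisfies the Jensen condition $$\left\langle S_{\#}\mu,f\right\rangle\geq Q_{\mathcal A_E}f\left(\left\langle S_{\#}\mu,\operatorname{id}\right\rangle\right)\quad\text{for all } f\in C(\mathbb R^N).$$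
   Context: Young measures: for $\Omega=(0,T)\times\mathbb T^d$, a Young measure is a weakly*-measurable map $\nu$ from $\Omega$ into the probability measures $\mathcal P(\mathbb R^m)$ (or on a subset of $\mathbb R^m$); write $\langle\nu,f\rangle(t,x)=\int f\,d\nu_{(t,x)}$. A sequence of measurable functions $z_n:\Omega\to\mathbb R^m$ generates $\nu$ if $f(z_n)\overset{*}{\rightharpoonup}\langle\nu,f\rangle$ in $L^\infty(\Omega)$ for all $f\in C_0(\mathbb R^m)$ (continuous functions vanishing at infinity). For a map $F$, $F_\#\nu$ is the pointwise pushforward. Weak solution of the isentropic Euler system with Mach number $\sqrt\varepsilon$: $(\rho,u)\in L^1((0,T)\times\mathbb T^d,\mathbb R^+\times\mathbb R^d)$ with some initial data $(\rho_0,u_0)\in L^1(\mathbb T^d)$ such that (all integrals being assumed to exist) $$\int_0^T\!\!\int_{\mathbb T^d}\partial_t\varphi\cdot\rho u+\nabla\varphi:(\rho u\otimes u)+\tfrac1\varepsilon\rho^\gamma\operatorname{div}\varphi\,dx\,dt=-\int_{\mathbb T^d}\varphi(0,\cdot)\cdot\rho_0u_0\,dx,$$ $$\int_0^T\!\!\int_{\mathbb T^d}\rho\,\partial_t\psi+\nabla\psi\cdot\rho u\,dx\,dt=-\int_{\mathbb T^d}\rho_0\psi(0,\cdot)\,dx$$ for all $\varphi\in C_c^\infty([0,T)\times\mathbb T^d,\mathbb R^d)$, $\psi\in C_c^\infty([0,T)\times\mathbb T^d)$. Augmented measure-valued solution of the incompressible Euler system ($\partial_tu+\operatorname{div}(u\otimes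 u)+\nabla P=0$, $\operatorname{div}u=0$) with initial data $u_0\in L^1(\mathbb T^d)$: a Young measure $\mu$ on $(0,T)\times\mathbb T^d$ with values in $\mathcal P(\mathbb R^d\times\mathbb R)$ (variables $(u,P)$) such that $\langle\mu,|u|^2\rangle\in L^\infty((0,T)\times\mathbb T^d)$ and $$\int_0^T\!\!\int_{\mathbb T^d}\partial_t\varphi\cdot\langle\mu,u\rangle+\nabla\varphi:\langle\mu,u\otimes u\rangle+\langle\mu,P\rangle\operatorname{div}\varphi\,dx\,dt=-\int_{\mathbb T^d}\varphi(0)\cdot u_0\,dx,\qquad \int_{\mathbb T^d}\nabla\psi\cdot\langle\mu,u\rangle\,dx=0\ \text{ (for a.e. }t)$$ for all $\varphi\in C_c^\infty([0,T)\times\mathbb T^d,\mathbb R^d)$ and $\psi\in C^\infty(\mathbb T^d)$. A weak solution $u$ with corresponding pressure $P$ is the case $\mu=\delta_{(u,P)}$ with $(u,P)\in L^1$; the corresponding average-free pressure is $P=(-\Delta)^{-1}\operatorname{div}\operatorname{div}(u\otimes u)$. Lift: $S(u,P)=\left(1,u,u\otimes u-\frac{|u|^2}{d}\mathbb E_d,P+\frac{|u|^2}{d}\right)\in\mathbb R\times\mathbb R^d\times S_0^d\times\mathbb R\cong\mathbb R^N$, where $\mathbb E_d$ is the identity matrix, $S_0^d$ is the space of symmetric trace-free $d\times d$ matrices and $N=\dim(\mathbb R\times\mathbb R^d\times S_0^d\times\mathbb R)$. Operator: $\mathcal A_E$ is the first-order constant-coefficient linear homogeneous differential operator in the $d+1$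 variables $(t,x)$ acting on $(\rho,m,M,Q)\in\mathbb R\times\mathbb R^d\times S_0^d\times\mathbb R$ by $\mathcal A_E(\rho,m,M,Q)=(\partial_tm+\operatorname{div}M+\nabla Q,\ \partial_t\rho+\operatorname{div}m)$. Quasiconvex envelope: for $f\in C(\mathbb R^N)$, $z\in\mathbb R^N$, $$Q_{\mathcal A_E}f(z)=\inf\left\{⨍_{\mathbb T^{d+1}}f(z+\varphi(y))\,dy:\ \varphi\in C^\infty(\mathbb T^{d+1},\mathbb R^N),\ \mathcal A_E\varphi=0,\ ⨍_{\mathbb T^{d+1}}\varphi\,dy=0\right\},$$ where ⨍ denotes the mean value integral. *)

theory Defs
  imports "HOL-Probability.Probability"
begin

text \<open>
  Conventions. The torus is the quotient of a Euclidean space by its integer lattice (period 1).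
  A function on the torus that has to be differentiated is a periodic function on the whole space;
  a function that is only integrated is given by its values on the half-open unit cell, which
  represents every point of the torus exactly once. The space \<^typ>\<open>real \<times> (real^'n)\<close> carries the
  variables \<open>(t, x)\<close>, so that \<open>d = CARD('n)\<close>. Measurability is Lebesgue measurability.
\<close>

section \<open>Torus, smooth functions, differential operators\<close>

definition unit_cell :: "'a::euclidean_space set" where
  "unit_cell = {x. \<forall>b\<in>Basis. 0 \<le> x \<bullet> b \<and> x \<bullet> b < 1}"

abbreviation torus :: "'a::euclidean_space measure" where
  "torus \<equiv> lebesgue_on unit_cell"

definition periodic :: "('a::euclidean_space \<Rightarrow> 'b) \<Rightarrow> bool" where
  "periodic f \<longleftrightarrow> (\<forall>x. \<forall>b\<in>Basis. f (x + b) = f x)"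

definition cylinder :: "real \<Rightarrow> (real \<times> (real^'n)) set" where
  "cylinder T = {0<..<T} \<times> unit_cell"

abbreviation cyl :: "real \<Rightarrow> (real \<times> (real^'n)) measure" where
  "cyl T \<equiv> lebesgue_on (cylinder T)"

primrec Ck :: "nat \<Rightarrow> ('a::euclidean_space \<Rightarrow> 'b::real_normed_vector) \<Rightarrow> bool" where
  "Ck 0 f \<longleftrightarrow> continuous_on UNIV f"
| "Ck (Suc k) f \<longleftrightarrow> (\<forall>x. f differentiable at x) \<and>
     (\<forall>b\<in>Basis. Ck k (\<lambda>x. frechet_derivative f (at x) b))"

definition smooth :: "('a::euclidean_space \<Rightarrow> 'b::real_normed_vector) \<Rightarrow> bool" where
  "smooth f \<longleftrightarrow> (\<forall>k. Ck k f)"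

text \<open>
  Smooth functions with compact support in \<open>[0,T) \<times> torus\<close>, as restrictions of smooth functions on
  \<open>\<real> \<times> torus\<close>. They need not vanish at \<open>t = 0\<close>; their values for \<open>t < 0\<close> play no role.
\<close>
definition test_function :: "real \<Rightarrow> (real \<times> (real^'n) \<Rightarrow> 'b::real_normed_vector) \<Rightarrow> bool" where
  "test_function T \<phi> \<longleftrightarrow> smooth \<phi> \<and> (\<forall>t. periodic (\<lambda>x. \<phi> (t, x))) \<and>
     (\<exists>s<T. \<forall>t\<ge>s. \<forall>x. \<phi> (t, x) = 0)"

definition dt :: "(real \<times> (real^'n) \<Rightarrow> 'b::real_normed_vector) \<Rightarrow> real \<times> (real^'n) \<Rightarrow> 'b" where
  "dt f p = frechet_derivative f (at p) (1, 0)"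

definition dx :: "'n \<Rightarrow> (real \<times> (real^'n) \<Rightarrow> 'b::real_normed_vector) \<Rightarrow> real \<times> (real^'n) \<Rightarrow> 'b" where
  "dx i f p = frechet_derivative f (at p) (0, axis i 1)"

definition grad_x :: "(real \<times> (real^'n) \<Rightarrow> real) \<Rightarrow> real \<times> (real^'n) \<Rightarrow> real^'n" where
  "grad_x f p = (\<chi> i. dx i f p)"

definition jac_x :: "(real \<times> (real^'n) \<Rightarrow> real^'n) \<Rightarrow> real \<times> (real^'n) \<Rightarrow> real^'n^'n" where
  "jac_x f p = (\<chi> i j. dx j (\<lambda>q. f q $ i) p)"

definition div_x :: "(real \<times> (real^'n) \<Rightarrow> real^'n) \<Rightarrow> real \<times> (real^'n) \<Rightarrow> real" where
  "div_x f p = (\<Sum>i\<in>UNIV. dx i (\<lambda>q. f q $ i) p)"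

definition Div_x :: "(real \<times> (real^'n) \<Rightarrow> real^'n^'n) \<Rightarrow> real \<times> (real^'n) \<Rightarrow> real^'n" where
  "Div_x F p = (\<chi> i. \<Sum>j\<in>UNIV. dx j (\<lambda>q. F q $ i $ j) p)"

definition space_grad :: "(real^'n \<Rightarrow> real) \<Rightarrow> real^'n \<Rightarrow> real^'n" where
  "space_grad f x = (\<chi> i. frechet_derivative f (at x) (axis i 1))"

definition outer :: "real^'n \<Rightarrow> real^'n \<Rightarrow> real^'n^'n" where
  "outer u v = (\<chi> i j. u $ i * v $ j)"

section \<open>Young measures\<close>

definition C0 :: "('b::euclidean_space \<Rightarrow> real) \<Rightarrow> bool" where
  "C0 f \<longleftrightarrow> continuous_on UNIV f \<and> (f \<longlongrightarrow> 0) at_infinity"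

definition pairing ::
    "('p \<Rightarrow> 'b measure) \<Rightarrow> ('b \<Rightarrow> 'c::{banach, second_countable_topology}) \<Rightarrow> 'p \<Rightarrow> 'c" where
  "pairing \<nu> f y = (LINT z|\<nu> y. f z)"

definition young_measure ::
    "real \<Rightarrow> (real \<times> (real^'n) \<Rightarrow> 'b::euclidean_space measure) \<Rightarrow> bool" where
  "young_measure T \<nu> \<longleftrightarrow>
     (\<forall>y\<in>cylinder T. prob_space (\<nu> y) \<and> sets (\<nu> y) = sets borel) \<and>
     (\<forall>f. C0 f \<longrightarrow> pairing \<nu> f \<in> borel_measurable (cyl T))"

text \<open>The last clause is weak* convergence in \<open>L\<^sup>\<infinity>\<close>, i.e. tested against all \<open>g \<in> L\<^sup>1\<close>.\<close>
definition generates ::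
    "real \<Rightarrow> (nat \<Rightarrow> real \<times> (real^'n) \<Rightarrow> 'b::euclidean_space) \<Rightarrow>
     (real \<times> (real^'n) \<Rightarrow> 'b measure) \<Rightarrow> bool" where
  "generates T z \<nu> \<longleftrightarrow>
     (\<forall>n. z n \<in> borel_measurable (cyl T)) \<and>
     (\<forall>f g. C0 f \<longrightarrow> integrable (cyl T) g \<longrightarrow>
        (\<lambda>n. LINT y|cyl T. f (z n y) * g y) \<longlonglongrightarrow> (LINT y|cyl T. pairing \<nu> f y * g y))"

definition bounded_in_Linfty ::
    "real \<Rightarrow> (nat \<Rightarrow> real \<times> (real^'n) \<Rightarrow> 'b::real_normed_vector) \<Rightarrow> bool" where
  "bounded_in_Linfty T z \<longleftrightarrow>
     (\<forall>n. z n \<in> borel_measurable (cyl T)) \<and> (\<exists>C. \<forall>n. AE y in cyl T. norm (z n y) \<le> C)"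

section \<open>Isentropic Euler system\<close>

text \<open>
  The Mach number is \<open>sqrt \<epsilon>\<close>. The inner product on \<^typ>\<open>real^'n^'n\<close> is the Frobenius
  product. The integrability clauses say that the integrals in the weak formulation exist.
\<close>
definition isentropic_weak_solution ::
    "real \<Rightarrow> real \<Rightarrow> real \<Rightarrow> (real \<times> (real^'n) \<Rightarrow> real) \<Rightarrow> (real \<times> (real^'n) \<Rightarrow> real^'n) \<Rightarrow> bool" where
  "isentropic_weak_solution T \<gamma> \<epsilon> \<rho> u \<longleftrightarrow>
     integrable (cyl T) \<rho> \<and> integrable (cyl T) u \<and> (AE y in cyl T. 0 \<le> \<rho> y) \<and>
     (\<exists>\<rho>0 u0. integrable torus \<rho>0 \<and> integrable torus u0 \<and>
       (\<forall>\<phi> :: real \<times> (real^'n) \<Rightarrow> real^'n. test_function T \<phi> \<longrightarrow>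
          (let I = (\<lambda>y. dt \<phi> y \<bullet> (\<rho> y *\<^sub>R u y) + jac_x \<phi> y \<bullet> (\<rho> y *\<^sub>R outer (u y) (u y))
                      + 1 / \<epsilon> * \<rho> y powr \<gamma> * div_x \<phi> y);
               I0 = (\<lambda>x. \<phi> (0, x) \<bullet> (\<rho>0 x *\<^sub>R u0 x))
           in integrable (cyl T) I \<and> integrable torus I0 \<and>
              (LINT y|cyl T. I y) = - (LINT x|torus. I0 x))) \<and>
       (\<forall>\<psi> :: real \<times> (real^'n) \<Rightarrow> real. test_function T \<psi> \<longrightarrow>
          (let J = (\<lambda>y. \<rho> y * dt \<psi> y + grad_x \<psi> y \<bullet> (\<rho> y *\<^sub>R u y));
               J0 = (\<lambda>x. \<rho>0 x * \<psi> (0, x))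
           in integrable (cyl T) J \<and> integrable torus J0 \<and>
              (LINT y|cyl T. J y) = - (LINT x|torus. J0 x))))"

definition pressure_lift :: "real \<Rightarrow> real \<Rightarrow> real \<Rightarrow> real \<Rightarrow> real^'n \<Rightarrow> (real^'n) \<times> real" where
  "pressure_lift \<gamma> \<rho>bar \<epsilon> r v = (v, 1 / (\<epsilon> * \<rho>bar) * (r powr \<gamma> - \<rho>bar powr \<gamma>))"

section \<open>Incompressible Euler system\<close>

text \<open>
  Points of the state space are pairs \<open>(v, q)\<close> of velocity and pressure. The second and third
  clauses give meaning to the brackets; integrability of \<open>v\<close> and \<open>v \<otimes> v\<close> follows
  from that of \<open>|v|\<^sup>2\<close>, since the \<open>\<mu> y\<close> are probability measures.
\<close>
definition augmented_mvs ::
    "real \<Rightarrow> (real^'n \<Rightarrow> real^'n) \<Rightarrow> (real \<times> (real^'n) \<Rightarrow> ((real^'n) \<times> real) measure) \<Rightarrow> bool" where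
  "augmented_mvs T u0 \<mu> \<longleftrightarrow>
     young_measure T \<mu> \<and>
     (AE y in cyl T. integrable (\<mu> y) (\<lambda>(v, q). (norm v)\<^sup>2)) \<and>
     (AE y in cyl T. integrable (\<mu> y) (\<lambda>(v, q). q)) \<and>
     pairing \<mu> (\<lambda>(v, q). (norm v)\<^sup>2) \<in> borel_measurable (cyl T) \<and>
     (\<exists>C. AE y in cyl T. pairing \<mu> (\<lambda>(v, q). (norm v)\<^sup>2) y \<le> C) \<and>
     integrable torus u0 \<and>
     (\<forall>\<phi> :: real \<times> (real^'n) \<Rightarrow> real^'n. test_function T \<phi> \<longrightarrow>
        (let I = (\<lambda>y. dt \<phi> y \<bullet> pairing \<mu> (\<lambda>(v, q). v) y
                    + jac_x \<phi> y \<bullet> pairing \<mu> (\<lambda>(v, q). outer v v) y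
                    + pairing \<mu> (\<lambda>(v, q). q) y * div_x \<phi> y)
         in integrable (cyl T) I \<and>
            (LINT y|cyl T. I y) = - (LINT x|torus. \<phi> (0, x) \<bullet> u0 x))) \<and>
     (\<forall>\<psi> :: real^'n \<Rightarrow> real. smooth \<psi> \<and> periodic \<psi> \<longrightarrow>
        (AE t in lebesgue_on {0<..<T}.
           (let J = (\<lambda>x. space_grad \<psi> x \<bullet> pairing \<mu> (\<lambda>(v, q). v) (t, x))
            in integrable torus J \<and> (LINT x|torus. J x) = 0)))"

text \<open>\<open>P\<close> is any pressure belonging to \<open>u\<close>; it is not normalised to have average zero.\<close>
definition incompressible_weak_solution ::
    "real \<Rightarrow> (real^'n \<Rightarrow> real^'n) \<Rightarrow> (real \<times> (real^'n) \<Rightarrow> real^'n) \<Rightarrow> (real \<times> (real^'n) \<Rightarrow> real) \<Rightarrow> bool"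
  where
  "incompressible_weak_solution T u0 u P \<longleftrightarrow>
     integrable (cyl T) u \<and> integrable (cyl T) P \<and>
     augmented_mvs T u0 (\<lambda>y. return borel (u y, P y))"

section \<open>Lift, operator and quasiconvex envelope\<close>

type_synonym 'n state = "real \<times> (real^'n) \<times> (real^'n^'n) \<times> real"

text \<open>
  The space \<open>\<real> \<times> \<real>\<^sup>d \<times> S\<^sub>0\<^sup>d \<times> \<real>\<close> is a linear subspace of \<^typ>\<open>'n state\<close>, so that a
  continuous function on it is an \<open>f\<close> with \<open>continuous_on lifted_space f\<close>.
\<close>
definition sym_trace_free :: "(real^'n^'n) set" where
  "sym_trace_free = {M. transpose M = M \<and> trace M = 0}"

definition lifted_space :: "('n::finite) state set" where
  "lifted_space = UNIV \<times> UNIV \<times> sym_trace_free \<times> UNIV"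

definition lift_S :: "(real^'n) \<times> real \<Rightarrow> 'n::finite state" where
  "lift_S = (\<lambda>(u, P). (1, u, outer u u - ((norm u)\<^sup>2 / real CARD('n)) *\<^sub>R mat 1,
                          P + (norm u)\<^sup>2 / real CARD('n)))"

definition pushforward_S :: "('p \<Rightarrow> ((real^'n) \<times> real) measure) \<Rightarrow> 'p \<Rightarrow> ('n::finite) state measure" where
  "pushforward_S \<mu> y = distr (\<mu> y) (restrict_space borel lifted_space) lift_S"

definition A_E :: "(real \<times> (real^'n) \<Rightarrow> 'n::finite state) \<Rightarrow> real \<times> (real^'n) \<Rightarrow> (real^'n) \<times> real" where
  "A_E z p =
     (let \<rho> = (\<lambda>q. fst (z q)); m = (\<lambda>q. fst (snd (z q)));
          M = (\<lambda>q. fst (snd (snd (z q)))); Q = (\<lambda>q. snd (snd (snd (z q))))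
      in (dt m p + Div_x M p + grad_x Q p, dt \<rho> p + div_x m p))"

definition A_free_perturbations :: "(real \<times> (real^'n) \<Rightarrow> 'n::finite state) set" where
  "A_free_perturbations =
     {\<phi>. smooth \<phi> \<and> periodic \<phi> \<and> range \<phi> \<subseteq> lifted_space \<and>
         (\<forall>p. A_E \<phi> p = 0) \<and> (LINT y|torus. \<phi> y) = 0}"

text \<open>
  The cell has volume 1, so integrals over it are mean values. The infimum is taken in the extended
  reals because it may be \<open>-\<infinity>\<close>.
\<close>
definition Q_env :: "('n::finite state \<Rightarrow> real) \<Rightarrow> 'n state \<Rightarrow> ereal" where
  "Q_env f z = (INF \<phi>\<in>A_free_perturbations. ereal (LINT y|torus. f (z + \<phi> y)))"

end

theory Submission
  imports Defs "HOL-Complex_Analysis.Great_Picard"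
begin

text \<open>
  A lifted state is a symmetric matrix in space-time, and \<open>A_E\<close> is its row-wise divergence. The equations
  say that the matrices \<open>(s, s u; s u, s u \<otimes> u + P mat 1)\<close> are divergence-free, with \<open>s = 1\<close> in the
  incompressible case and \<open>s = \<rho> / \<rho>bar\<close> uniformly close to \<open>1\<close> in the low Mach number limit: by the pressure
  bound \<open>\<rho> powr \<gamma> - \<rho>bar powr \<gamma>\<close> is of order \<open>\<epsilon>\<close>. So these matrices differ from the lifts by a null sequence.

  At a common Lebesgue point of the moments of the Young measure the generating sequence can be blown up;
  a diagonal sequence then generates the homogeneous measure \<open>\<mu>0\<close> on the unit cell. Mollified at a
  sufficiently small scale it becomes a sequence of smooth, divergence-free fields \<open>W k\<close> close in \<open>L1\<close> to
  the lifts. With \<open>bar\<close> the mean of the lift under \<open>\<mu>0\<close>, the oscillation \<open>W k - bar\<close> tends weakly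
  to zero. Multiplying it by a cutoff supported inside the cell makes it periodic, at the price of a
  divergence which is bounded, of mean zero and weakly null. The divergence of symmetric matrix fields on the torus has a
  right inverse on mean-zero fields which is bounded in the sup norm and maps bounded weakly null sequences to uniformly small
  ones, so this divergence can be removed by a uniformly small correction. The corrected field is
  bounded, so every continuous \<open>f\<close>, whatever its growth, can be compared along the sequence, and
  the field is admissible in the definition of the envelope.
\<close>

section \<open>Calculus of smooth functions\<close>

text \<open>Since \<open>f\<close> may grow arbitrarily, the competitors must stay bounded in the
  sup norm, where the usual Fourier projection onto divergence-free fields is unbounded. Hence the
  right inverse of the divergence is built by hand from averages along coordinate lines. Averaging
  at scale \<tau> leaves a potential of size \<tau> and a remainder with Lipschitz constant of order
  1/\<tau>. For fixed \<tau> the remainders of a bounded weakly null sequence are therefore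
  uniformly small, and averaging once more, over full periods, reduces them to their mean, which is
  zero.

  Symmetry is the only algebraic constraint on the correction: the trace of its spatial block is
  absorbed by the last component of the state.

  One set of full measure serves all \<open>f\<close> because only countably many moments enter: the
  measures concerned live on a common compact set, where polynomials are dense. Lebesgue points are
  needed only along a single sequence of radii, chosen so that the mean oscillations of these
  moments are summable almost everywhere.\<close>

definition partial :: "'a::euclidean_space \<Rightarrow> ('a \<Rightarrow> 'b::real_normed_vector) \<Rightarrow> 'a \<Rightarrow> 'b" where
  "partial b f x = frechet_derivative f (at x) b"

lemma partial_eqI: "(f has_derivative f') (at x) \<Longrightarrow> partial b f x = f' b"
  by (metis frechet_derivative_at partial_def)

lemma has_frechet_derivative:
  "f differentiable at x \<Longrightarrow> (f has_derivative frechet_derivative f (at x)) (at x)"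
  using frechet_derivative_works by blast

lemma Ck_Suc_iff:
  "Ck (Suc k) f \<longleftrightarrow> (\<forall>x. f differentiable at x) \<and> (\<forall>b\<in>Basis. Ck k (partial b f))"
  by (simp add: partial_def[abs_def])

declare Ck.simps(2)[simp del]

lemma Ck_SucD:
  assumes "Ck (Suc k) f"
  shows "f differentiable at x" "b \<in> Basis \<Longrightarrow> Ck k (partial b f)"
  using assms by (auto simp: Ck_Suc_iff)

lemma Ck_SucI:
  assumes "\<And>x. (f has_derivative f' x) (at x)" "\<And>b. b \<in> Basis \<Longrightarrow> Ck k (\<lambda>x. f' x b)"
  shows "Ck (Suc k) f"
proof -
  have "partial b f = (\<lambda>x. f' x b)" for b
    using partial_eqI[OF assms(1)] by blast
  then show ?thesis
    unfolding Ck_Suc_iff using assms by (auto simp: differentiable_def)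
qed

lemma Ck_Suc_imp_Ck: "Ck (Suc k) f \<Longrightarrow> Ck k f"
proof (induction k arbitrary: f)
  case 0
  then show ?case
    by (auto simp: Ck_Suc_iff continuous_on_eq_continuous_at intro: differentiable_imp_continuous_within)
next
  case (Suc k)
  show ?case
    unfolding Ck_Suc_iff[of k]
    using Suc.IH Suc.prems[unfolded Ck_Suc_iff[of "Suc k"]] by blast
qed

lemma Ck_continuous: "Ck k f \<Longrightarrow> continuous_on UNIV f"
  by (induction k) (auto dest: Ck_Suc_imp_Ck)

lemma has_derivative_partial:
  fixes f :: "'a::euclidean_space \<Rightarrow> 'b::real_normed_vector"
  assumes "f differentiable at x"
  shows "(f has_derivative (\<lambda>v. \<Sum>b\<in>Basis. (v \<bullet> b) *\<^sub>R partial b f x)) (at x)"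
proof -
  let ?D = "frechet_derivative f (at x)"
  have D: "(f has_derivative ?D) (at x)" using assms frechet_derivative_works by blast
  then have lin: "linear ?D" by (simp add: has_derivative_linear)
  have "?D v = (\<Sum>b\<in>Basis. (v \<bullet> b) *\<^sub>R partial b f x)" for v
  proof -
    have "?D v = ?D (\<Sum>b\<in>Basis. (v \<bullet> b) *\<^sub>R b)" by (simp add: euclidean_representation)
    also have "\<dots> = (\<Sum>b\<in>Basis. (v \<bullet> b) *\<^sub>R partial b f x)"
      by (simp add: linear_sum[OF lin] linear_cmul[OF lin] partial_def)
    finally show ?thesis .
  qed
  then have "?D = (\<lambda>v. \<Sum>b\<in>Basis. (v \<bullet> b) *\<^sub>R partial b f x)" by (rule ext)
  with D show ?thesis by simp
qed

lemma Ck_const: "Ck k (\<lambda>x::'a::euclidean_space. c)"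
  by (induction k arbitrary: c) (auto intro: Ck_SucI[where f'="\<lambda>_ _. 0"])

lemma Ck_add:
  assumes "Ck k f" "Ck k g" shows "Ck k (\<lambda>x. f x + g x)"
  using assms
proof (induction k arbitrary: f g)
  case 0 then show ?case by (auto intro: continuous_on_add)
next
  case (Suc k)
  have *: "((\<lambda>x. f x + g x) has_derivative
      (\<lambda>v. frechet_derivative f (at x) v + frechet_derivative g (at x) v)) (at x)" for x
    using Suc.prems[THEN Ck_SucD(1)] by (intro has_derivative_add) (simp_all add: has_frechet_derivative)
  show ?case
  proof (rule Ck_SucI[OF *])
    fix b :: 'a assume b: "b \<in> Basis"
    show "Ck k (\<lambda>x. frechet_derivative f (at x) b + frechet_derivative g (at x) b)"
      using Suc.IH[OF Ck_SucD(2)[OF Suc.prems(1) b] Ck_SucD(2)[OF Suc.prems(2) b]]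
      by (simp add: partial_def)
  qed
qed

lemma Ck_mult:
  fixes f g :: "'a::euclidean_space \<Rightarrow> real"
  assumes "Ck k f" "Ck k g" shows "Ck k (\<lambda>x. f x * g x)"
  using assms
proof (induction k arbitrary: f g)
  case 0 then show ?case by (auto intro: continuous_on_mult)
next
  case (Suc k)
  have *: "((\<lambda>x. f x * g x) has_derivative
      (\<lambda>v. f x * frechet_derivative g (at x) v + frechet_derivative f (at x) v * g x)) (at x)" for x
    using Suc.prems[THEN Ck_SucD(1)] by (intro has_derivative_mult) (simp_all add: has_frechet_derivative)
  show ?case
  proof (rule Ck_SucI[OF *])
    fix b :: 'a assume b: "b \<in> Basis"
    show "Ck k (\<lambda>x. f x * frechet_derivative g (at x) b + frechet_derivative f (at x) b * g x)"
      using Ck_SucD(2)[OF Suc.prems(1) b] Ck_SucD(2)[OF Suc.prems(2) b]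
        Suc.prems[THEN Ck_Suc_imp_Ck]
      unfolding partial_def[abs_def] by (intro Ck_add Suc.IH) auto
  qed
qed

lemma Ck_scaleR_vec:
  fixes f :: "'a::euclidean_space \<Rightarrow> real"
  assumes "Ck k f" shows "Ck k (\<lambda>x. f x *\<^sub>R v)"
  using assms
proof (induction k arbitrary: f)
  case 0 then show ?case by (auto intro: continuous_intros)
next
  case (Suc k)
  have *: "((\<lambda>x. f x *\<^sub>R v) has_derivative (\<lambda>u. frechet_derivative f (at x) u *\<^sub>R v)) (at x)" for x
    using Suc.prems[THEN Ck_SucD(1)] by (intro has_derivative_scaleR_left) (simp add: has_frechet_derivative)
  show ?case
  proof (rule Ck_SucI[OF *])
    fix b :: 'a assume b: "b \<in> Basis"
    show "Ck k (\<lambda>x. frechet_derivative f (at x) b *\<^sub>R v)"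
      using Suc.IH[OF Ck_SucD(2)[OF Suc.prems b]] by (simp add: partial_def)
  qed
qed

lemma Ck_sum:
  assumes "\<And>i. i \<in> I \<Longrightarrow> Ck k (f i)" shows "Ck k (\<lambda>x. \<Sum>i\<in>I. f i x)"
  using assms by (induction I rule: infinite_finite_induct) (auto intro: Ck_const Ck_add)

lemma Ck_compose_real:
  fixes F :: "real \<Rightarrow> real" and h :: "'a::euclidean_space \<Rightarrow> real"
  assumes "Ck k F" "Ck k h" shows "Ck k (\<lambda>x. F (h x))"
  using assms
proof (induction k arbitrary: F h)
  case 0 then show ?case
    by (auto intro: continuous_on_compose2)
next
  case (Suc k)
  have *: "((\<lambda>x. F (h x)) has_derivative
      (\<lambda>v. partial 1 F (h x) * frechet_derivative h (at x) v)) (at x)" for x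
  proof -
    have "(F has_derivative (\<lambda>v. v * partial 1 F (h x))) (at (h x))"
      using has_derivative_partial[OF Ck_SucD(1)[OF Suc.prems(1)], of "h x"] by simp
    from has_derivative_compose[OF has_frechet_derivative[OF Ck_SucD(1)[OF Suc.prems(2)]] this]
    show ?thesis by (simp add: mult.commute)
  qed
  show ?case
  proof (rule Ck_SucI[OF *])
    fix b :: 'a assume b: "b \<in> Basis"
    show "Ck k (\<lambda>x. partial 1 F (h x) * frechet_derivative h (at x) b)"
    proof (rule Ck_mult)
      show "Ck k (\<lambda>x. partial 1 F (h x))"
        by (rule Suc.IH[OF Ck_SucD(2)[OF Suc.prems(1)] Ck_Suc_imp_Ck[OF Suc.prems(2)]]) simp
      show "Ck k (\<lambda>x. frechet_derivative h (at x) b)"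
        using Ck_SucD(2)[OF Suc.prems(2) b] by (simp add: partial_def[abs_def])
    qed
  qed
qed

lemma Ck_affine:
  fixes h :: "'a::euclidean_space \<Rightarrow> 'b::real_normed_vector"
  assumes "Ck k h" shows "Ck k (\<lambda>x. h (a + r *\<^sub>R x))"
  using assms
proof (induction k arbitrary: h)
  case 0 then show ?case
    by (auto intro!: continuous_on_compose2[of UNIV h] continuous_intros)
next
  case (Suc k)
  have *: "((\<lambda>x. h (a + r *\<^sub>R x)) has_derivative
      (\<lambda>v. r *\<^sub>R frechet_derivative h (at (a + r *\<^sub>R x)) v)) (at x)" for x
  proof -
    have D: "(h has_derivative frechet_derivative h (at (a + r *\<^sub>R x))) (at (a + r *\<^sub>R x))"
      by (rule has_frechet_derivative[OF Ck_SucD(1)[OF Suc.prems]])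
    have "((\<lambda>x. a + r *\<^sub>R x) has_derivative (\<lambda>v. r *\<^sub>R v)) (at x)"
      by (auto intro!: derivative_eq_intros)
    from has_derivative_compose[OF this D] show ?thesis
      by (simp add: linear_cmul[OF has_derivative_linear[OF D]])
  qed
  show ?case
  proof (rule Ck_SucI[OF *])
    fix b :: 'a assume b: "b \<in> Basis"
    have "Ck k (\<lambda>x. partial b h (a + r *\<^sub>R x))" by (rule Suc.IH[OF Ck_SucD(2)[OF Suc.prems b]])
    moreover have "Ck k f \<Longrightarrow> Ck k (\<lambda>x. r *\<^sub>R f x)" for f :: "'a \<Rightarrow> 'b"
    proof (induction k arbitrary: f)
      case 0 then show ?case by (auto intro: continuous_intros)
    next
      case (Suc k)
      show ?case
        apply (rule Ck_SucI[where f'="\<lambda>x v. r *\<^sub>R frechet_derivative f (at x) v"])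
         apply (intro has_derivative_scaleR_right has_frechet_derivative Ck_SucD(1)[OF Suc.prems])
        using Suc.IH Ck_SucD(2)[OF Suc.prems] unfolding partial_def[abs_def] by blast
    qed
    ultimately show "Ck k (\<lambda>x. r *\<^sub>R frechet_derivative h (at (a + r *\<^sub>R x)) b)"
      unfolding partial_def by blast
  qed
qed

lemma smooth_Ck: "smooth f \<Longrightarrow> Ck k f"
  by (simp add: smooth_def)

lemma smooth_differentiable: "smooth f \<Longrightarrow> f differentiable at x"
  by (metis Ck_SucD(1) smooth_Ck)

lemma smooth_partial: "smooth f \<Longrightarrow> b \<in> Basis \<Longrightarrow> smooth (partial b f)"
  by (metis Ck_SucD(2) smooth_def)

lemma smooth_continuous: "smooth f \<Longrightarrow> continuous_on S f"
  by (metis Ck_continuous continuous_on_subset smooth_Ck top_greatest)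

lemma smooth_has_derivative:
  "smooth f \<Longrightarrow> (f has_derivative (\<lambda>v. \<Sum>b\<in>Basis. (v \<bullet> b) *\<^sub>R partial b f x)) (at x)"
  by (simp add: has_derivative_partial smooth_differentiable)

lemma smooth_const [simp]: "smooth (\<lambda>x. c)"
  by (simp add: smooth_def Ck_const)

lemma smooth_add: "smooth f \<Longrightarrow> smooth g \<Longrightarrow> smooth (\<lambda>x. f x + g x)"
  by (simp add: smooth_def Ck_add)

lemma smooth_mult:
  fixes f g :: "'a::euclidean_space \<Rightarrow> real"
  shows "smooth f \<Longrightarrow> smooth g \<Longrightarrow> smooth (\<lambda>x. f x * g x)"
  by (simp add: smooth_def Ck_mult)

lemma smooth_minus:
  fixes f :: "'a::euclidean_space \<Rightarrow> real"
  shows "smooth f \<Longrightarrow> smooth (\<lambda>x. - f x)"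
  using smooth_mult[of "\<lambda>x. -1" f] by simp

lemma smooth_diff:
  fixes f :: "'a::euclidean_space \<Rightarrow> real"
  shows "smooth f \<Longrightarrow> smooth g \<Longrightarrow> smooth (\<lambda>x. f x - g x)"
  using smooth_add[OF _ smooth_minus[of g], of f] by simp

lemma smooth_scaleR_vec:
  fixes f :: "'a::euclidean_space \<Rightarrow> real"
  shows "smooth f \<Longrightarrow> smooth (\<lambda>x. f x *\<^sub>R v)"
  by (simp add: smooth_def Ck_scaleR_vec)

lemma smooth_sum: "(\<And>i. i \<in> I \<Longrightarrow> smooth (f i)) \<Longrightarrow> smooth (\<lambda>x. \<Sum>i\<in>I. f i x)"
  by (simp add: smooth_def Ck_sum)

lemma smooth_prod:
  fixes f :: "'i \<Rightarrow> 'a::euclidean_space \<Rightarrow> real"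
  shows "(\<And>i. i \<in> I \<Longrightarrow> smooth (f i)) \<Longrightarrow> smooth (\<lambda>x. \<Prod>i\<in>I. f i x)"
  by (induction I rule: infinite_finite_induct) (auto intro: smooth_mult)

lemma smooth_compose_real:
  fixes F :: "real \<Rightarrow> real" and h :: "'a::euclidean_space \<Rightarrow> real"
  shows "smooth F \<Longrightarrow> smooth h \<Longrightarrow> smooth (\<lambda>x. F (h x))"
  by (simp add: smooth_def Ck_compose_real)

lemma smooth_affine: "smooth h \<Longrightarrow> smooth (\<lambda>x. h (a + r *\<^sub>R x))"
  by (simp add: smooth_def Ck_affine)

lemma partial_const [simp]: "partial b (\<lambda>x. c) x = 0"
  by (rule partial_eqI[of _ "\<lambda>_. 0"]) simp

lemma partial_add:
  "smooth f \<Longrightarrow> smooth g \<Longrightarrow> partial b (\<lambda>x. f x + g x) x = partial b f x + partial b g x"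
  unfolding partial_def[of b f] partial_def[of b g]
  by (rule partial_eqI) (auto intro!: derivative_intros has_frechet_derivative smooth_differentiable)

lemma partial_mult:
  fixes f g :: "'a::euclidean_space \<Rightarrow> real"
  shows "smooth f \<Longrightarrow> smooth g \<Longrightarrow>
    partial b (\<lambda>x. f x * g x) x = f x * partial b g x + partial b f x * g x"
  unfolding partial_def[of b f] partial_def[of b g]
  by (rule partial_eqI[OF has_derivative_mult]) (auto intro!: has_frechet_derivative smooth_differentiable)

lemma partial_cmult:
  fixes f :: "'a::euclidean_space \<Rightarrow> real"
  shows "smooth f \<Longrightarrow> partial b (\<lambda>x. c * f x) x = c * partial b f x"
  using partial_mult[of "\<lambda>_. c" f b x] by simp

lemma partial_diff:
  fixes f g :: "'a::euclidean_space \<Rightarrow> real"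
  shows "smooth f \<Longrightarrow> smooth g \<Longrightarrow> partial b (\<lambda>x. f x - g x) x = partial b f x - partial b g x"
  using partial_add[of f "\<lambda>x. - 1 * g x" b x] partial_cmult[of g b "-1" x] smooth_minus[of g] by simp

lemma partial_sum:
  "(\<And>i. i \<in> I \<Longrightarrow> smooth (f i)) \<Longrightarrow>
    partial b (\<lambda>x. \<Sum>i\<in>I. f i x) x = (\<Sum>i\<in>I. partial b (f i) x)"
  by (induction I rule: infinite_finite_induct) (auto simp: partial_add smooth_sum)

lemma partial_affine:
  assumes "smooth h"
  shows "partial b (\<lambda>x. h (a + r *\<^sub>R x)) x = r *\<^sub>R partial b h (a + r *\<^sub>R x)"
proof -
  have D: "(h has_derivative frechet_derivative h (at (a + r *\<^sub>R x))) (at (a + r *\<^sub>R x))"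
    by (rule has_frechet_derivative[OF smooth_differentiable[OF assms]])
  have "((\<lambda>x. a + r *\<^sub>R x) has_derivative (\<lambda>v. r *\<^sub>R v)) (at x)"
    by (auto intro!: derivative_eq_intros)
  from has_derivative_compose[OF this D] show ?thesis
    by (subst partial_eqI) (auto simp: linear_cmul[OF has_derivative_linear[OF D]] partial_def)
qed

lemma smooth_inner: "smooth (\<lambda>x::'a::euclidean_space. x \<bullet> b)"
  unfolding smooth_def
proof
  fix k show "Ck k (\<lambda>x::'a. x \<bullet> b)"
  proof (cases k)
    case 0 then show ?thesis by (auto intro: continuous_intros)
  next
    case (Suc m)
    show ?thesis unfolding Suc
      by (rule Ck_SucI[where f'="\<lambda>x v. v \<bullet> b"]) (auto intro: Ck_const derivative_eq_intros)
  qed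
qed

text \<open>Differentiation maps the span of \<open>cos\<close> and \<open>sin\<close> into itself,
  so the induction is run over all coefficients \<open>a\<close>, \<open>b\<close> at once.\<close>

lemma smooth_cos: "smooth (cos :: real \<Rightarrow> real)"
proof -
  have "Ck k (\<lambda>x::real. a * cos x + b * sin x)" for k a b
  proof (induction k arbitrary: a b)
    case 0 then show ?case by (auto intro!: continuous_intros)
  next
    case (Suc k)
    show ?case
    proof (rule Ck_SucI)
      show "((\<lambda>x. a * cos x + b * sin x) has_derivative (\<lambda>v. v * (b * cos x + (-a) * sin x))) (at x)" for x
        by (auto intro!: derivative_eq_intros simp: algebra_simps)
    qed (use Suc[of b "-a"] in simp)
  qed
  from this[of _ 1 0] show ?thesis by (simp add: smooth_def)
qed

section \<open>A smooth function that is flat at zero\<close>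

definition psi :: "real \<Rightarrow> real" where
  "psi t = (if t \<le> 0 then 0 else exp (- 1 / t))"

lemma psi_nonneg: "0 \<le> psi t" and psi_le_1: "psi t \<le> 1" and psi_pos: "0 < t \<Longrightarrow> 0 < psi t"
  and psi_eq_0: "t \<le> 0 \<Longrightarrow> psi t = 0"
  by (auto simp: psi_def)

lemma poly_times_exp_tendsto: "((\<lambda>s. poly p s * exp (- s)) \<longlongrightarrow> (0::real)) at_top"
proof -
  have "((\<lambda>s. \<Sum>i\<le>degree p. coeff p i * (s ^ i / exp s)) \<longlongrightarrow> (\<Sum>i\<le>degree p. coeff p i * 0)) at_top"
    by (intro tendsto_sum tendsto_mult tendsto_const tendsto_power_div_exp_0)
  then show ?thesis
    by (simp add: poly_altdef sum_distrib_right exp_minus divide_inverse mult.assoc)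
qed

text \<open>The functions p(1/t) exp(-1/t), continued by zero to t \<le> 0, form a family closed
  under differentiation; the induction therefore runs over all polynomials \<open>p\<close>.\<close>

lemma smooth_psi: "smooth psi"
proof -
  have "Ck k (\<lambda>t. if t \<le> 0 then 0 else poly p (1 / t) * exp (- 1 / t))" for k and p :: "real poly"
  proof (induction k arbitrary: p)
    case (Suc k)
    define f where "f q = (\<lambda>t. if t \<le> 0 then 0 else poly q (1 / t) * exp (- 1 / t))" for q :: "real poly"
    \<comment> \<open>Product rule for p(1/t) exp(-1/t): the inner derivative of 1/t supplies the
      factor X^2, and p' enters with a minus sign.\<close>
    define q where "q = [:0, 0, 1:] * (p - pderiv p)"
    have D: "(f p has_field_derivative f q t) (at t)" for t
    proof (cases t "0::real" rule: linorder_cases)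
      case less
      have "((\<lambda>_. 0) has_field_derivative f q t) (at t)" using less by (auto simp: f_def)
      then show ?thesis
        by (rule DERIV_cong_ev[THEN iffD1, rotated -1])
          (use less in \<open>auto simp: f_def eventually_nhds intro!: exI[of _ "{..<0}"]\<close>)
    next
      case equal
      have "((\<lambda>h. f p h / h) \<longlongrightarrow> 0) (at_right 0)"
      proof -
        \<comment> \<open>With s = 1/h the difference quotient at 0 gains one factor s, and exp(-s)
          still dominates.\<close>
        have "((\<lambda>s. poly ([:0,1:] * p) s * exp (- s)) \<longlongrightarrow> 0) at_top"
          by (rule poly_times_exp_tendsto)
        then have "((\<lambda>h. poly ([:0,1:] * p) (inverse h) * exp (- inverse h)) \<longlongrightarrow> 0) (at_right 0)"
          by (rule filterlim_compose[OF _ filterlim_inverse_at_top_right])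
        then show ?thesis
          by (rule Lim_transform_eventually)
            (auto simp: f_def eventually_at_right_less field_simps intro!: eventually_mono[OF eventually_at_right_less[of 0]])
      qed
      moreover have "((\<lambda>h. f p h / h) \<longlongrightarrow> 0) (at_left 0)"
        by (rule Lim_transform_eventually[of "\<lambda>_. 0"])
          (auto simp: f_def eventually_at_left[of "-1"] intro!: exI[of _ "-1"])
      ultimately have "((\<lambda>h. f p h / h) \<longlongrightarrow> 0) (at 0)"
        by (simp add: filterlim_at_split)
      then have "((\<lambda>h. (f p (0 + h) - f p 0) / h) \<longlongrightarrow> f q 0) (at 0)"
        by (simp add: f_def)
      then show ?thesis using equal by (simp add: DERIV_def)
    next
      case greater
      have "((\<lambda>t. poly p (1 / t) * exp (- 1 / t)) has_field_derivative f q t) (at t)"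
        using greater by (auto intro!: derivative_eq_intros simp: f_def q_def field_simps power2_eq_square)
      then show ?thesis
        by (rule DERIV_cong_ev[THEN iffD1, rotated -1])
          (use greater in \<open>auto simp: f_def eventually_nhds intro!: exI[of _ "{0<..}"]\<close>)
    qed
    show ?case
    proof (rule Ck_SucI)
      show "((\<lambda>t. if t \<le> 0 then 0 else poly p (1 / t) * exp (- 1 / t)) has_derivative (\<lambda>v. v * f q t)) (at t)" for t
        using D[of t] unfolding has_field_derivative_def f_def[of p] by (simp add: mult_commute_abs)
    qed (use Suc.IH[of q] in \<open>simp add: f_def\<close>)
  next
    case 0
    define f where "f = (\<lambda>t. if t \<le> 0 then 0 else poly p (1 / t) * exp (- 1 / t))"
    have "isCont f t" for t
    proof (cases t "0::real" rule: linorder_cases)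
      case less
      have "isCont (\<lambda>_. 0::real) t" by simp
      moreover have "eventually (\<lambda>x. f x = 0) (nhds t)"
        using less by (auto simp: f_def eventually_nhds intro!: exI[of _ "{..<0}"])
      ultimately show ?thesis using isCont_cong by fastforce
    next
      case equal
      have "((\<lambda>s. poly p s * exp (- s)) \<longlongrightarrow> 0) at_top"
        by (rule poly_times_exp_tendsto)
      then have "((\<lambda>h. poly p (inverse h) * exp (- inverse h)) \<longlongrightarrow> 0) (at_right 0)"
        by (rule filterlim_compose[OF _ filterlim_inverse_at_top_right])
      then have "(f \<longlongrightarrow> 0) (at_right 0)"
        by (rule Lim_transform_eventually)
          (auto simp: f_def field_simps intro!: eventually_mono[OF eventually_at_right_less[of 0]])
      moreover have "(f \<longlongrightarrow> 0) (at_left 0)"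
        by (rule Lim_transform_eventually[of "\<lambda>_. 0"])
          (auto simp: f_def eventually_at_left[of "-1"] intro!: exI[of _ "-1"])
      ultimately have "(f \<longlongrightarrow> 0) (at 0)"
        by (simp add: filterlim_at_split)
      then show ?thesis using equal by (simp add: isCont_def f_def)
    next
      case greater
      have "isCont (\<lambda>t. poly p (1 / t) * exp (- 1 / t)) t"
        using greater by (auto intro!: continuous_intros)
      moreover have "eventually (\<lambda>x. f x = poly p (1 / x) * exp (- 1 / x)) (nhds t)"
        using greater by (auto simp: f_def eventually_nhds intro!: exI[of _ "{0<..}"])
      ultimately show ?thesis using isCont_cong by fastforce
    qed
    then show ?case by (simp add: continuous_on_eq_continuous_at f_def)
  qed
  then have "Ck k (\<lambda>t. if t \<le> 0 then 0 else poly (1 :: real poly) (1 / t) * exp (- 1 / t))" for k by blast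
  moreover have "(\<lambda>t. if t \<le> 0 then 0 else poly (1 :: real poly) (1 / t) * exp (- 1 / t)) = psi" by (auto simp: psi_def)
  ultimately show ?thesis by (simp add: smooth_def)
qed

text \<open>The partial derivatives are uniformly continuous on a compact ball, so the remainder of
  the linear approximation is small uniformly in the base point \<open>y\<close>. This uniformity is
  what permits differentiation under the integral in \<open>conv_has_derivative\<close>.\<close>

lemma Ck_has_derivative_uniform:
  fixes h :: "'a::euclidean_space \<Rightarrow> real"
  assumes h: "Ck (Suc 0) h" and e: "e > 0"
  shows "\<exists>d>0. \<forall>y v. norm (y - x) \<le> R \<longrightarrow> norm v < d \<longrightarrow>
    \<bar>h (y + v) - h y - (\<Sum>b\<in>Basis. (v \<bullet> b) * partial b h y)\<bar> \<le> e * norm v"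
proof -
  \<comment> \<open>One unit larger than the range of \<open>y\<close>: as \<open>d0\<close> is at
    most 1, the segment from \<open>y\<close> to \<open>y + v\<close> stays inside.\<close>
  let ?K = "cball x (R + 1)"
  let ?n = "real DIM('a)"
  define e' where "e' = e / ?n"
  have e': "e' > 0" using e by (simp add: e'_def)
  have "\<exists>d>0. \<forall>y\<in>?K. \<forall>z\<in>?K. dist z y < d \<longrightarrow> dist (partial b h z) (partial b h y) < e'"
    if "b \<in> Basis" for b
  proof -
    have "continuous_on ?K (partial b h)"
      using Ck_SucD(2)[OF h that] by (auto intro: continuous_on_subset)
    then have "uniformly_continuous_on ?K (partial b h)"
      by (intro compact_uniformly_continuous compact_cball)
    with e' show ?thesis unfolding uniformly_continuous_on_def by blast
  qed
  then obtain d where d: "\<And>b. b \<in> Basis \<Longrightarrow> d b > 0"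
      "\<And>b y z. b \<in> Basis \<Longrightarrow> y \<in> ?K \<Longrightarrow> z \<in> ?K \<Longrightarrow> dist z y < d b \<Longrightarrow> dist (partial b h z) (partial b h y) < e'"
    by metis
  define d0 where "d0 = min 1 (Min (d ` Basis))"
  have d0: "d0 > 0" "d0 \<le> 1" "\<And>b. b \<in> Basis \<Longrightarrow> d0 \<le> d b"
    using d(1) by (auto simp: d0_def intro: min.coboundedI2)
  show ?thesis
  proof (intro exI[of _ d0] conjI allI impI)
    fix y v :: 'a assume y: "norm (y - x) \<le> R" and v: "norm v < d0"
    let ?D = "\<lambda>z v::'a. \<Sum>b\<in>Basis. (v \<bullet> b) * partial b h z"
    have "norm (h (y + v) - h y - ?D y (y + v - y)) \<le> norm (y + v - y) * e"
    proof (rule differentiable_bound_linearization[where S="ball y d0" and f'="?D"])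
      show "y + t *\<^sub>R (y + v - y) \<in> ball y d0" if "t \<in> {0..1}" for t
      proof -
        have "t * norm v \<le> norm v" using that by (simp add: mult_left_le_one_le)
        then show ?thesis using that v by (simp add: dist_norm)
      qed
      show "(h has_derivative ?D z) (at z within ball y d0)" for z
        using has_derivative_partial[OF Ck_SucD(1)[OF h], of z]
        by (auto intro: has_derivative_at_withinI)
      show "onorm (?D z - ?D y) \<le> e" if z: "z \<in> ball y d0" for z
      proof (rule onorm_bound)
        fix u :: 'a
        have *: "\<bar>u \<bullet> b\<bar> * \<bar>partial b h z - partial b h y\<bar> \<le> norm u * e'" if "b \<in> Basis" for b
        proof (rule mult_mono)
          have "dist z x \<le> R + 1"
            using y z d0(2) dist_triangle[of z x y] by (simp add: dist_norm norm_minus_commute)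
          moreover have "dist y x \<le> R + 1" using y by (simp add: dist_norm)
          ultimately have "dist (partial b h z) (partial b h y) < e'"
            using z d0(3)[OF that] by (intro d(2)[OF that]) (auto simp: dist_commute)
          then show "\<bar>partial b h z - partial b h y\<bar> \<le> e'" by (simp add: dist_real_def)
        qed (use that in \<open>auto intro: Basis_le_norm\<close>)
        have "norm ((?D z - ?D y) u) = \<bar>\<Sum>b\<in>Basis. (u \<bullet> b) * (partial b h z - partial b h y)\<bar>"
          by (simp add: sum_subtractf algebra_simps)
        also have "\<dots> \<le> (\<Sum>b\<in>(Basis::'a set). norm u * e')"
          by (rule order_trans[OF sum_abs], rule sum_mono) (simp only: abs_mult *)
        also have "\<dots> = e * norm u" by (simp add: e'_def)
        finally show "norm ((?D z - ?D y) u) \<le> e * norm u" .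
      qed (use e in simp)
    qed (use d0 in auto)
    then show "\<bar>h (y + v) - h y - ?D y v\<bar> \<le> e * norm v" by (simp add: mult.commute)
  qed (use d0 in auto)
qed

lemma continuous_bounded_cball:
  fixes h :: "'a::euclidean_space \<Rightarrow> real"
  assumes "continuous_on UNIV h"
  obtains B where "B \<ge> 0" "\<And>y. norm (y - x) \<le> R \<Longrightarrow> \<bar>h y\<bar> \<le> B"
proof -
  have "compact (h ` cball x R)"
    using assms by (intro compact_continuous_image) (auto intro: continuous_on_subset)
  then obtain B where "\<And>y. y \<in> cball x R \<Longrightarrow> norm (h y) \<le> B"
    by (metis bounded_iff compact_imp_bounded imageI)
  then show ?thesis
    by (intro that[of "max 0 B"]) (auto simp: dist_norm norm_minus_commute intro: max.coboundedI2)
qed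

text \<open>One setting for all integral operators of the proof: averages of translates over a cell
  or cylinder (\<open>k = 1\<close>, \<open>X\<close> the identity), averages along a line
  (\<open>k\<close> a kernel on an interval), and mollification (\<open>k\<close> the rough field,
  \<open>h\<close> the smooth kernel). All regularity comes from \<open>h\<close>; \<open>k\<close>
  and \<open>X\<close> are merely bounded and measurable.\<close>

locale bounded_shift = finite_measure N
  for N :: "'w measure" and k :: "'w \<Rightarrow> real" and X :: "'w \<Rightarrow> 'a::euclidean_space" and B R :: real +
  assumes k_meas [measurable]: "k \<in> borel_measurable N" and k_bound: "\<And>w. w \<in> space N \<Longrightarrow> \<bar>k w\<bar> \<le> B"
    and X_meas [measurable]: "X \<in> borel_measurable N" and X_bound: "\<And>w. w \<in> space N \<Longrightarrow> norm (X w) \<le> R"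
begin

definition conv :: "('a \<Rightarrow> real) \<Rightarrow> 'a \<Rightarrow> real" where
  "conv h x = (\<integral>w. k w * h (x + X w) \<partial>N)"

lemma integrable_conv:
  assumes "continuous_on UNIV h"
  shows "integrable N (\<lambda>w. k w * h (x + X w))"
proof -
  obtain C where C: "C \<ge> 0" "\<And>y. norm (y - x) \<le> R \<Longrightarrow> \<bar>h y\<bar> \<le> C"
    using continuous_bounded_cball[OF assms] by blast
  have [measurable]: "h \<in> borel_measurable borel" using assms by (rule borel_measurable_continuous_onI)
  show ?thesis
  proof (rule integrable_const_bound[where B="B * C"])
    show "AE w in N. norm (k w * h (x + X w)) \<le> B * C"
    proof (rule AE_I2)
      fix w assume w: "w \<in> space N"
      have "\<bar>k w\<bar> * \<bar>h (x + X w)\<bar> \<le> B * C"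
        using k_bound[OF w] X_bound[OF w] C by (intro mult_mono) auto
      then show "norm (k w * h (x + X w)) \<le> B * C" by (simp add: abs_mult)
    qed
  qed measurable
qed

lemma conv_has_derivative:
  assumes h: "Ck (Suc 0) h"
  shows "(conv h has_derivative (\<lambda>v. \<Sum>b\<in>Basis. (v \<bullet> b) * conv (partial b h) x)) (at x)"
proof -
  have cont: "continuous_on UNIV h" using h Ck_continuous by blast
  have cont': "continuous_on UNIV (partial b h)" if "b \<in> Basis" for b
    using Ck_SucD(2)[OF h that] by simp
  have int: "integrable N (\<lambda>w. \<bar>k w\<bar>)"
    using integrable_conv[of "\<lambda>_. 1" 0] by (auto intro: integrable_abs)
  define I where "I = (\<integral>w. \<bar>k w\<bar> \<partial>N)"
  have I: "I \<ge> 0" unfolding I_def by (rule integral_nonneg_AE) simp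
  show ?thesis
    unfolding has_derivative_at_alt
  proof (intro conjI allI impI)
    show "bounded_linear (\<lambda>v. \<Sum>b\<in>Basis. (v \<bullet> b) * conv (partial b h) x)"
      by (intro bounded_linear_sum bounded_linear_mult_const bounded_linear_inner_left)
    fix e :: real assume "e > 0"
    \<comment> \<open>The total weight \<open>I\<close> may vanish; the summand 1 keeps the quotient
      meaningful.\<close>
    define e' where "e' = e / (I + 1)"
    have e': "e' > 0" "e' * I \<le> e" using I \<open>e > 0\<close> by (auto simp: e'_def field_simps)
    obtain d where d: "d > 0" "\<And>y v. norm (y - x) \<le> R \<Longrightarrow> norm v < d \<Longrightarrow>
      \<bar>h (y + v) - h y - (\<Sum>b\<in>Basis. (v \<bullet> b) * partial b h y)\<bar> \<le> e' * norm v"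
      using Ck_has_derivative_uniform[OF h e'(1), of x R] by blast
    show "\<exists>d>0. \<forall>y. norm (y - x) < d \<longrightarrow>
      norm (conv h y - conv h x - (\<Sum>b\<in>Basis. ((y - x) \<bullet> b) * conv (partial b h) x)) \<le> e * norm (y - x)"
    proof (intro exI[of _ d] conjI allI impI)
      fix y assume y: "norm (y - x) < d"
      define v where "v = y - x"
      let ?r = "\<lambda>w. h (x + X w + v) - h (x + X w) - (\<Sum>b\<in>Basis. (v \<bullet> b) * partial b h (x + X w))"
      have int1: "integrable N (\<lambda>w. \<Sum>b\<in>Basis. (v \<bullet> b) * (k w * partial b h (x + X w)))"
        by (intro Bochner_Integration.integrable_sum integrable_mult_right integrable_conv cont')
      have eq: "(\<lambda>w. k w * ?r w) = (\<lambda>w. k w * h (y + X w) - k w * h (x + X w)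
          - (\<Sum>b\<in>Basis. (v \<bullet> b) * (k w * partial b h (x + X w))))"
        by (auto simp: v_def algebra_simps sum_distrib_left)
      have intr: "integrable N (\<lambda>w. k w * ?r w)"
        unfolding eq using int1 integrable_conv[OF cont] by auto
      have 1: "conv h y - conv h x - (\<Sum>b\<in>Basis. (v \<bullet> b) * conv (partial b h) x) = (\<integral>w. k w * ?r w \<partial>N)"
        unfolding eq conv_def using int1 integrable_conv[OF cont] integrable_conv[OF cont']
        by (simp add: Bochner_Integration.integral_sum)
      have 2: "norm (\<integral>w. k w * ?r w \<partial>N) \<le> (\<integral>w. norm (k w * ?r w) \<partial>N)" by (rule integral_norm_bound)
      have 3: "(\<integral>w. norm (k w * ?r w) \<partial>N) \<le> (\<integral>w. (e' * norm v) * \<bar>k w\<bar> \<partial>N)"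
      proof (rule integral_mono[OF integrable_norm[OF intr]])
        fix w assume w: "w \<in> space N"
        have "\<bar>?r w\<bar> \<le> e' * norm v"
          using d(2)[of "x + X w" v] X_bound[OF w] y by (simp add: v_def)
        then show "norm (k w * ?r w) \<le> (e' * norm v) * \<bar>k w\<bar>"
          using mult_left_mono[of _ _ "\<bar>k w\<bar>"] by (simp add: abs_mult mult.commute[of _ "\<bar>k w\<bar>"])
      qed (use int in simp)
      have 4: "(\<integral>w. (e' * norm v) * \<bar>k w\<bar> \<partial>N) = (e' * I) * norm v" by (simp add: I_def mult_ac)
      have 5: "(e' * I) * norm v \<le> e * norm v" using e'(2) by (simp add: mult_right_mono)
      show "norm (conv h y - conv h x - (\<Sum>b\<in>Basis. ((y - x) \<bullet> b) * conv (partial b h) x))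
          \<le> e * norm (y - x)"
        using 1 2 3 4 5 by (simp only: v_def[symmetric])
    qed (use d in auto)
  qed
qed

lemma conv_continuous:
  assumes h: "continuous_on UNIV h"
  shows "continuous_on UNIV (conv h)"
  proof (rule continuous_at_imp_continuous_on, rule ballI, subst continuous_at_sequentially, safe)
    fix x and u :: "nat \<Rightarrow> 'a" assume u: "u \<longlonglongrightarrow> x"
    have [measurable]: "h \<in> borel_measurable borel" using h by (rule borel_measurable_continuous_onI)
    obtain M where M: "\<And>n. norm (u n - x) \<le> M"
      using LIM_zero[OF u] by (metis Bseq_def convergentI convergent_imp_Bseq)
    obtain C where C: "C \<ge> 0" "\<And>y. norm (y - x) \<le> M + R \<Longrightarrow> \<bar>h y\<bar> \<le> C"
      using continuous_bounded_cball[OF h] by blast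
    have "(\<lambda>n. \<integral>w. k w * h (u n + X w) \<partial>N) \<longlonglongrightarrow> (\<integral>w. k w * h (x + X w) \<partial>N)"
    proof (rule integral_dominated_convergence[where w="\<lambda>_. B * C"])
      show "AE w in N. (\<lambda>n. k w * h (u n + X w)) \<longlonglongrightarrow> k w * h (x + X w)"
      proof (intro AE_I2 tendsto_mult tendsto_const)
        fix w show "(\<lambda>n. h (u n + X w)) \<longlonglongrightarrow> h (x + X w)"
          by (rule continuous_on_tendsto_compose[OF h]) (auto intro: tendsto_intros u)
      qed
      show "AE w in N. norm (k w * h (u n + X w)) \<le> B * C" for n
      proof (rule AE_I2)
        fix w assume w: "w \<in> space N"
        have "norm (u n + X w - x) \<le> M + R"
          using norm_triangle_ineq[of "u n - x" "X w"] M[of n] X_bound[OF w] by (simp add: algebra_simps)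
        then have "\<bar>k w\<bar> * \<bar>h (u n + X w)\<bar> \<le> B * C"
          using k_bound[OF w] C by (intro mult_mono) auto
        then show "norm (k w * h (u n + X w)) \<le> B * C" by (simp add: abs_mult)
      qed
    qed auto
    then show "(conv h \<circ> u) \<longlonglongrightarrow> conv h x" by (simp add: o_def conv_def)
  qed

lemma conv_smooth:
  assumes "smooth h" shows "smooth (conv h)"
proof -
  have "Ck m (conv h)" if "Ck m h" for m using that
  proof (induction m arbitrary: h)
    case 0
    then show ?case using conv_continuous by simp
  next
    case (Suc m)
    have h: "Ck (Suc 0) h"
      using Suc.prems by (metis Ck_Suc_iff Ck_continuous Ck.simps(1))
    show ?case
    proof (rule Ck_SucI[OF conv_has_derivative[OF h]])
      fix b :: 'a assume b: "b \<in> Basis"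
      have "(\<lambda>x. \<Sum>b'\<in>Basis. (b \<bullet> b') * conv (partial b' h) x) = conv (partial b h)"
        using b by (simp add: inner_Basis sum.delta if_distrib[of "\<lambda>c. c * _"] cong: if_cong)
      then show "Ck m (\<lambda>x. \<Sum>b'\<in>Basis. (b \<bullet> b') * conv (partial b' h) x)"
        using Suc.IH[OF Ck_SucD(2)[OF Suc.prems b]] by simp
    qed
  qed
  with assms show ?thesis by (simp add: smooth_def)
qed

lemma partial_conv:
  assumes "smooth h" "b \<in> Basis"
  shows "partial b (conv h) x = conv (partial b h) x"
  by (subst partial_eqI[OF conv_has_derivative])
    (use assms in \<open>auto simp: smooth_def inner_Basis if_distrib[of "\<lambda>c. c * _"] cong: if_cong\<close>)

end

section \<open>Integrals over the torus\<close>

text \<open>Bridge between two measures: the notions of the theorem are stated with Lebesgue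
  measure, whereas translation, scaling and Fubini are applied to \<open>lborel\<close>. For Borel
  integrands both give the same integral.\<close>

lemma lebesgue_on_eq_lborel:
  fixes f :: "'a::euclidean_space \<Rightarrow> 'b::{banach, second_countable_topology}"
  assumes [measurable]: "S \<in> sets borel" "f \<in> borel_measurable borel"
  shows "integral\<^sup>L (lebesgue_on S) f = (\<integral>x. indicator S x *\<^sub>R f x \<partial>lborel)"
    "integrable (lebesgue_on S) f \<longleftrightarrow> integrable lborel (\<lambda>x. indicator S x *\<^sub>R f x)"
proof -
  have S: "S \<inter> space lebesgue \<in> sets lebesgue" by simp
  have m: "(\<lambda>x. indicator S x *\<^sub>R f x) \<in> lborel \<rightarrow>\<^sub>M borel" by measurable
  show "integral\<^sup>L (lebesgue_on S) f = (\<integral>x. indicator S x *\<^sub>R f x \<partial>lborel)"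
    unfolding integral_restrict_space[OF S] by (rule integral_completion[OF m])
  show "integrable (lebesgue_on S) f \<longleftrightarrow> integrable lborel (\<lambda>x. indicator S x *\<^sub>R f x)"
    unfolding integrable_restrict_space[OF S] by (rule integrable_completion[OF m])
qed

lemma measurable_lebesgue_on_borel:
  "f \<in> borel_measurable borel \<Longrightarrow> f \<in> borel_measurable (lebesgue_on S)"
  by (simp add: measurable_completion measurable_restrict_space1)

lemma id_measurable_lebesgue_on: "(\<lambda>x. x) \<in> borel_measurable (lebesgue_on S)"
  by (simp add: measurable_lebesgue_on_borel)

lemma finite_measure_lebesgue_on_bounded:
  fixes S :: "'a::euclidean_space set"
  assumes "S \<in> sets borel" "bounded S"
  shows "finite_measure (lebesgue_on S)"
  using assms by (intro finite_measure_lebesgue_on bounded_set_imp_lmeasurable) auto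

lemma lborel_translate:
  fixes f :: "'a::euclidean_space \<Rightarrow> 'b::{banach, second_countable_topology}"
  assumes [measurable]: "f \<in> borel_measurable borel"
  shows "(\<integral>x. f (c + x) \<partial>lborel) = (\<integral>x. f x \<partial>lborel)"
    "integrable lborel (\<lambda>x. f (c + x)) \<longleftrightarrow> integrable lborel f"
proof -
  show "(\<integral>x. f (c + x) \<partial>lborel) = (\<integral>x. f x \<partial>lborel)"
    by (subst (2) lborel_distr_plus[of c, symmetric], subst integral_distr) auto
  show "integrable lborel (\<lambda>x. f (c + x)) \<longleftrightarrow> integrable lborel f"
    by (subst (2) lborel_distr_plus[of c, symmetric], subst integrable_distr_eq) auto
qed

lemma unit_cell_subset_cbox: "unit_cell \<subseteq> cbox 0 (One :: 'a::euclidean_space)"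
  by (fastforce simp: unit_cell_def mem_box)

lemma unit_cell_borel [measurable]: "unit_cell \<in> sets (borel :: 'a::euclidean_space measure)"
proof -
  have "(unit_cell :: 'a set) = (\<Inter>b\<in>Basis. {x. 0 \<le> x \<bullet> b} \<inter> {x. x \<bullet> b < 1})"
    by (auto simp: unit_cell_def)
  also have "\<dots> \<in> sets borel"
    by (intro sets.finite_INT) (auto intro!: borel_closed borel_open closed_Collect_le open_Collect_less continuous_intros)
  finally show ?thesis .
qed

lemma bounded_unit_cell: "bounded (unit_cell :: 'a::euclidean_space set)"
  using unit_cell_subset_cbox bounded_cbox bounded_subset by blast

lemma emeasure_unit_cell: "emeasure lborel (unit_cell :: 'a::euclidean_space set) = 1"
proof (rule antisym)
  have "emeasure lborel (unit_cell :: 'a set) \<le> emeasure lborel (cbox 0 (One::'a))"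
    by (intro emeasure_mono unit_cell_subset_cbox) auto
  then show "emeasure lborel (unit_cell :: 'a set) \<le> 1" by (simp add: emeasure_lborel_cbox_eq)
  have "emeasure lborel (box 0 (One::'a)) \<le> emeasure lborel (unit_cell :: 'a set)"
    by (intro emeasure_mono) (auto simp: unit_cell_def mem_box less_imp_le)
  then show "1 \<le> emeasure lborel (unit_cell :: 'a set)" by (simp add: emeasure_lborel_box_eq)
qed

lemma prob_space_torus: "prob_space (torus :: 'a::euclidean_space measure)"
proof
  have "emeasure torus (space (torus :: 'a measure)) = emeasure lebesgue (unit_cell :: 'a set)"
    by (simp add: emeasure_restrict_space)
  also have "\<dots> = emeasure lborel (unit_cell :: 'a set)"
    by simp
  finally show "emeasure torus (space (torus :: 'a measure)) = 1" by (simp add: emeasure_unit_cell)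
qed

interpretation torus: prob_space "torus :: 'a::euclidean_space measure"
  by (rule prob_space_torus)

lemma periodic_int:
  fixes h :: "'a::euclidean_space \<Rightarrow> 'b"
  assumes h: "\<And>x. h (x + b) = h x"
  shows "h (x + of_int n *\<^sub>R b) = h x"
proof -
  have nat: "h (x + real m *\<^sub>R b) = h x" for m x
  proof (induction m)
    case (Suc m)
    have "h (x + real (Suc m) *\<^sub>R b) = h ((x + real m *\<^sub>R b) + b)" by (simp add: algebra_simps)
    then show ?case using h Suc by simp
  qed simp
  show ?thesis
  proof (cases "n \<ge> 0")
    case True
    then show ?thesis using nat[of x "nat n"] by simp
  next
    case False
    then show ?thesis using nat[of "x + of_int n *\<^sub>R b" "nat (- n)"] by (simp add: algebra_simps)
  qed
qed

text \<open>The representative in \<open>unit_cell\<close> of the class of \<open>x\<close> modulo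
  the lattice; composing with it extends a function on the cell periodically.\<close>

definition frac_vec :: "'a::euclidean_space \<Rightarrow> 'a" where
  "frac_vec x = (\<Sum>b\<in>Basis. frac (x \<bullet> b) *\<^sub>R b)"

lemma frac_vec_inner: "b \<in> Basis \<Longrightarrow> frac_vec x \<bullet> b = frac (x \<bullet> b)"
  by (simp add: frac_vec_def)

lemma frac_vec_in_cell: "frac_vec x \<in> unit_cell"
  by (auto simp: unit_cell_def frac_vec_inner frac_lt_1)

lemma frac_vec_cell: "x \<in> unit_cell \<Longrightarrow> frac_vec x = x"
  by (rule euclidean_eqI) (auto simp: unit_cell_def frac_vec_inner frac_eq)

lemma frac_vec_add_Basis: "b \<in> Basis \<Longrightarrow> frac_vec (x + b) = frac_vec x"
  by (rule euclidean_eqI) (auto simp: frac_vec_inner inner_add_left inner_Basis frac_1_eq)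

lemma frac_vec_eq: "frac_vec x = x - (\<Sum>b\<in>Basis. of_int \<lfloor>x \<bullet> b\<rfloor> *\<^sub>R b)"
  by (rule euclidean_eqI) (auto simp: frac_vec_inner inner_diff_left frac_def)

lemma periodic_frac_vec:
  fixes h :: "'a::euclidean_space \<Rightarrow> 'b"
  assumes "periodic h"
  shows "h (frac_vec x) = h x"
proof -
  have "h (x + (\<Sum>b\<in>A. of_int (n b) *\<^sub>R b)) = h x" if "finite A" "A \<subseteq> Basis" for A x and n :: "'a \<Rightarrow> int"
    using that
  proof (induction A arbitrary: x)
    case (insert b A)
    have "h (x + (\<Sum>b\<in>insert b A. of_int (n b) *\<^sub>R b)) = h ((x + (\<Sum>b\<in>A. of_int (n b) *\<^sub>R b)) + of_int (n b) *\<^sub>R b)"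
      using insert by (simp add: algebra_simps)
    also have "\<dots> = h x"
      using insert assms by (subst periodic_int) (auto simp: periodic_def)
    finally show ?case .
  qed simp
  from this[of Basis x "\<lambda>b. - \<lfloor>x \<bullet> b\<rfloor>"] show ?thesis
    by (simp add: frac_vec_eq sum_negf)
qed

lemma periodic_bounded:
  fixes h :: "'a::euclidean_space \<Rightarrow> real"
  assumes "periodic h" "continuous_on UNIV h"
  obtains B where "B \<ge> 0" "\<And>x. \<bar>h x\<bar> \<le> B"
proof -
  have "compact (h ` cbox 0 One)"
    using assms by (intro compact_continuous_image) (auto intro: continuous_on_subset)
  then obtain B where B: "\<And>y. y \<in> cbox 0 One \<Longrightarrow> norm (h y) \<le> B"
    by (metis bounded_iff compact_imp_bounded imageI)
  show ?thesis
  proof (rule that[of "max 0 B"])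
    fix x show "\<bar>h x\<bar> \<le> max 0 B"
      using B[of "frac_vec x"] frac_vec_in_cell[of x] unit_cell_subset_cbox periodic_frac_vec[OF assms(1), of x]
      by (auto simp: max_def)
  qed simp
qed

lemma periodic_partial:
  fixes h :: "'a::euclidean_space \<Rightarrow> 'b::real_normed_vector"
  assumes "periodic h" "smooth h"
  shows "periodic (partial b h)"
  unfolding periodic_def
proof safe
  fix x c :: 'a assume c: "c \<in> Basis"
  have "(\<lambda>x. h (c + 1 *\<^sub>R x)) = h" using assms(1) c by (auto simp: periodic_def add.commute)
  with partial_affine[OF assms(2), of b c 1 x] show "partial b h (x + c) = partial b h x"
    by (simp add: add.commute)
qed

text \<open>The slab is cut at \<open>x \<bullet> b = s\<close>; one of the two pieces is translated back by the period.\<close>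
lemma slab_shift:
  fixes S S0 :: "'a::euclidean_space set" and h :: "'a \<Rightarrow> real"
  assumes b: "b \<in> Basis" and S: "S = {x\<in>S0. 0 \<le> x \<bullet> b \<and> x \<bullet> b < 1}"
    and S0 [measurable]: "S0 \<in> sets borel" and inv: "\<And>x s. x + s *\<^sub>R b \<in> S0 \<longleftrightarrow> x \<in> S0"
    and bd: "bounded S" and cont: "continuous_on UNIV h" and per: "\<And>x. h (x + b) = h x"
  shows "(\<integral>x. h (x + s *\<^sub>R b) \<partial>lebesgue_on S) = (\<integral>x. h x \<partial>lebesgue_on S)"
proof -
  define r where "r = frac s"
  have r: "0 \<le> r" "r < 1" by (auto simp: r_def frac_lt_1)
  have red: "h (x + s *\<^sub>R b) = h (x + r *\<^sub>R b)" for x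
    using periodic_int[where h=h and b=b, OF per, of "x + r *\<^sub>R b" "\<lfloor>s\<rfloor>"]
    by (simp add: r_def frac_def algebra_simps)
  have [measurable]: "h \<in> borel_measurable borel" using cont by (rule borel_measurable_continuous_onI)
  define A where "A = {x\<in>S0. r \<le> x \<bullet> b \<and> x \<bullet> b < 1}"
  define B where "B = {x\<in>S0. 0 \<le> x \<bullet> b \<and> x \<bullet> b < r}"
  have [measurable]: "S \<in> sets borel" "A \<in> sets borel" "B \<in> sets borel" unfolding S A_def B_def by measurable
  obtain R where R: "\<And>x. x \<in> S \<Longrightarrow> norm x \<le> R" using bd by (auto simp: bounded_iff)
  obtain C where C: "C \<ge> 0" "\<And>y. norm (y - 0) \<le> R \<Longrightarrow> \<bar>h y\<bar> \<le> C"
    using continuous_bounded_cball[OF cont, where x=0] by blast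
  have fin: "emeasure lborel S < \<infinity>" using bd by (rule emeasure_bounded_finite)
  have int: "integrable lborel (\<lambda>x. indicator D x * h x)" if [measurable]: "D \<in> sets borel" and "D \<subseteq> S" for D
  proof (rule Bochner_Integration.integrable_bound)
    show "integrable lborel (\<lambda>x. C * indicator S x :: real)"
      using fin by (intro integrable_mult_right integrable_real_indicator) auto
    show "AE x in lborel. norm (indicator D x * h x) \<le> norm (C * indicator S x :: real)"
      using C R that(2) by (intro AE_I2) (auto simp: indicator_def)
  qed measurable
  have sub: "A \<subseteq> S" "B \<subseteq> S" using r by (auto simp: A_def B_def S)
  have "(\<integral>x. h (x + r *\<^sub>R b) \<partial>lebesgue_on S) = (\<integral>x. indicator S x * h (x + r *\<^sub>R b) \<partial>lborel)"
    by (subst lebesgue_on_eq_lborel) auto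
  also have "\<dots> = (\<integral>x. indicator S (- r *\<^sub>R b + x) * h (- r *\<^sub>R b + x + r *\<^sub>R b) \<partial>lborel)"
    by (rule lborel_translate(1)[symmetric]) measurable
  also have "\<dots> = (\<integral>x. indicator A x * h x + indicator B (- b + x) * h (- b + x) \<partial>lborel)"
  proof (rule Bochner_Integration.integral_cong[OF refl])
    fix x
    have mem: "x - r *\<^sub>R b \<in> S0 \<longleftrightarrow> x \<in> S0" "x - b \<in> S0 \<longleftrightarrow> x \<in> S0"
      using inv[of x "-r"] inv[of x "-1"] by auto
    have "h (- b + x) = h x" using per[of "x - b"] by simp
    then show "indicator S (- r *\<^sub>R b + x) * h (- r *\<^sub>R b + x + r *\<^sub>R b)
        = indicator A x * h x + indicator B (- b + x) * h (- b + x)"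
      using b r mem by (auto simp: S A_def B_def indicator_def inner_diff_left inner_Basis)
  qed
  also have "\<dots> = (\<integral>x. indicator A x * h x \<partial>lborel) + (\<integral>x. indicator B (- b + x) * h (- b + x) \<partial>lborel)"
  proof (rule Bochner_Integration.integral_add[OF int])
    show "integrable lborel (\<lambda>x. indicator B (- b + x) * h (- b + x))"
      using lborel_translate(2)[of "\<lambda>x. indicator B x * h x" "-b"] int[of B] sub by simp
  qed (use sub in auto)
  also have "(\<integral>x. indicator B (- b + x) * h (- b + x) \<partial>lborel) = (\<integral>x. indicator B x * h x \<partial>lborel)"
    by (rule lborel_translate(1)) measurable
  also have "(\<integral>x. indicator A x * h x \<partial>lborel) + (\<integral>x. indicator B x * h x \<partial>lborel)
      = (\<integral>x. indicator A x * h x + indicator B x * h x \<partial>lborel)"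
    using int sub by (intro Bochner_Integration.integral_add[symmetric]) auto
  also have "\<dots> = (\<integral>x. indicator S x * h x \<partial>lborel)"
    using r by (intro Bochner_Integration.integral_cong) (auto simp: S A_def B_def indicator_def)
  also have "\<dots> = (\<integral>x. h x \<partial>lebesgue_on S)"
    by (subst lebesgue_on_eq_lborel) auto
  finally show ?thesis by (simp add: red)
qed

text \<open>By \<open>slab_shift\<close> the integral of the translates
  \<open>h (x + s *\<^sub>R b)\<close> is independent of \<open>s\<close>; its derivative at
  \<open>s = 0\<close> is the integral of the partial derivative. A general slab, and not only the
  unit cell, since the space-time cylinder is periodic in the spatial directions only.\<close>

lemma slab_partial:
  fixes S S0 :: "'a::euclidean_space set" and h :: "'a \<Rightarrow> real"
  assumes b: "b \<in> Basis" and S: "S = {x\<in>S0. 0 \<le> x \<bullet> b \<and> x \<bullet> b < 1}"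
    and S0 [measurable]: "S0 \<in> sets borel" and inv: "\<And>x s. x + s *\<^sub>R b \<in> S0 \<longleftrightarrow> x \<in> S0"
    and bd: "bounded S" and sm: "smooth h" and per: "\<And>x. h (x + b) = h x"
  shows "(\<integral>x. partial b h x \<partial>lebesgue_on S) = 0"
proof -
  have [measurable]: "S \<in> sets borel" unfolding S by measurable
  obtain R where R: "\<And>x. x \<in> S \<Longrightarrow> norm x \<le> R" using bd by (auto simp: bounded_iff)
  interpret finite_measure "lebesgue_on S" using bd by (intro finite_measure_lebesgue_on_bounded) auto
  interpret C: bounded_shift "lebesgue_on S" "\<lambda>_. 1" "\<lambda>x. x" 1 R
    using R by unfold_locales (auto simp: id_measurable_lebesgue_on)
  have "((\<lambda>s. C.conv h (0 + s *\<^sub>R b)) has_derivative (\<lambda>s. frechet_derivative (C.conv h) (at (0 + 0 *\<^sub>R b)) (s *\<^sub>R b))) (at 0)"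
    by (rule has_derivative_compose[where g="C.conv h" and f="\<lambda>s. 0 + s *\<^sub>R b"])
      (auto intro!: derivative_eq_intros has_frechet_derivative smooth_differentiable C.conv_smooth sm)
  moreover have "C.conv h (0 + s *\<^sub>R b) = C.conv h 0" for s
    using slab_shift[OF b S S0 inv bd smooth_continuous[OF sm] per, of s]
    by (simp add: C.conv_def add.commute)
  ultimately have "((\<lambda>s::real. C.conv h 0) has_derivative (\<lambda>s. frechet_derivative (C.conv h) (at 0) (s *\<^sub>R b))) (at 0)"
    by simp
  from has_derivative_unique[OF this has_derivative_const]
  have "frechet_derivative (C.conv h) (at 0) (1 *\<^sub>R b) = 0" by metis
  then have "partial b (C.conv h) 0 = 0" by (simp add: partial_def)
  then show ?thesis
    using C.partial_conv[OF sm b, of 0] by (simp add: C.conv_def)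
qed

lemma unit_cell_slab:
  fixes b :: "'a::euclidean_space"
  assumes "b \<in> Basis"
  defines "S0 \<equiv> {x. \<forall>c\<in>Basis - {b}. 0 \<le> x \<bullet> c \<and> x \<bullet> c < 1}"
  shows "unit_cell = {x\<in>S0. 0 \<le> x \<bullet> b \<and> x \<bullet> b < 1}" "S0 \<in> sets borel" "x + s *\<^sub>R b \<in> S0 \<longleftrightarrow> x \<in> S0"
proof -
  show "unit_cell = {x\<in>S0. 0 \<le> x \<bullet> b \<and> x \<bullet> b < 1}" using assms by (auto simp: unit_cell_def)
  show "x + s *\<^sub>R b \<in> S0 \<longleftrightarrow> x \<in> S0"
    using assms by (auto simp: inner_add_left inner_Basis)
  have "S0 = (\<Inter>c\<in>Basis. if c = b then UNIV else {x. 0 \<le> x \<bullet> c} \<inter> {x. x \<bullet> c < 1})"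
    by (auto simp: S0_def split: if_splits)
  also have "\<dots> \<in> sets borel"
    by (intro sets.finite_INT) (auto intro!: borel_closed borel_open closed_Collect_le open_Collect_less continuous_intros)
  finally show "S0 \<in> sets borel" .
qed

lemma torus_shift:
  fixes h :: "'a::euclidean_space \<Rightarrow> real"
  assumes "b \<in> Basis" "continuous_on UNIV h" "periodic h"
  shows "(\<integral>x. h (x + s *\<^sub>R b) \<partial>torus) = (\<integral>x. h x \<partial>torus)"
  using assms
  by (intro slab_shift[OF assms(1) unit_cell_slab[OF assms(1)] bounded_unit_cell]) (auto simp: periodic_def)

lemma torus_partial:
  fixes h :: "'a::euclidean_space \<Rightarrow> real"
  assumes "b \<in> Basis" "smooth h" "periodic h"
  shows "(\<integral>x. partial b h x \<partial>torus) = 0"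
  using assms
  by (intro slab_partial[OF assms(1) unit_cell_slab[OF assms(1)] bounded_unit_cell]) (auto simp: periodic_def)

lemma integrable_torus_continuous:
  fixes h :: "'a::euclidean_space \<Rightarrow> real"
  assumes "continuous_on UNIV h"
  shows "integrable torus h"
proof -
  have [measurable]: "h \<in> borel_measurable (torus :: 'a measure)"
    using assms by (intro measurable_lebesgue_on_borel borel_measurable_continuous_onI)
  obtain R where R: "\<And>x. x \<in> (unit_cell :: 'a set) \<Longrightarrow> norm x \<le> R"
    using bounded_unit_cell by (auto simp: bounded_iff)
  obtain C where "\<And>y. norm (y - 0) \<le> R \<Longrightarrow> \<bar>h y\<bar> \<le> C"
    using continuous_bounded_cball[OF assms, where x=0] by blast
  with R show ?thesis by (intro torus.integrable_const_bound[where B=C]) auto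
qed

section \<open>Averaging along coordinate directions\<close>

lemma periodic_const [simp]: "periodic (\<lambda>x. c)"
  by (simp add: periodic_def)

lemma periodic_uminus: "periodic f \<Longrightarrow> periodic (\<lambda>x. - f x :: real)"
  by (simp add: periodic_def)

lemma periodic_sum: "(\<And>i. i \<in> I \<Longrightarrow> periodic (f i)) \<Longrightarrow> periodic (\<lambda>x. \<Sum>i\<in>I. f i x)"
  by (simp add: periodic_def cong: sum.cong)

text \<open>Convolution along the line in direction \<open>b\<close> with the kernel
  \<open>k\<close> on [0,\<tau>], continued to [-\<tau>,\<tau>] as an even function for \<sigma> = 1
  and as an odd one for \<sigma> = -1. Folding it onto [0,\<tau>] keeps a jump or kink of the kernel
  at 0 at an endpoint of the integration.\<close>

definition line_op :: "(real \<Rightarrow> real) \<Rightarrow> real \<Rightarrow> real \<Rightarrow> 'a::euclidean_space \<Rightarrow> ('a \<Rightarrow> real) \<Rightarrow> 'a \<Rightarrow> real" where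
  "line_op k \<sigma> \<tau> b h x = (\<integral>s. k s * (h (x + s *\<^sub>R b) + \<sigma> * h (x - s *\<^sub>R b)) \<partial>lebesgue_on {0..\<tau>})"

lemma finite_measure_Icc: "finite_measure (lebesgue_on {0..\<tau>::real})"
  by (intro finite_measure_lebesgue_on_bounded) auto

lemma bounded_shift_line:
  assumes "continuous_on UNIV (k :: real \<Rightarrow> real)"
  obtains B R where "bounded_shift (lebesgue_on {0..\<tau>}) k (\<lambda>s. s *\<^sub>R (b::'a::euclidean_space)) B R"
proof -
  obtain B where B: "\<And>y. norm (y - 0) \<le> \<tau> \<Longrightarrow> \<bar>k y\<bar> \<le> B"
    using continuous_bounded_cball[OF assms, of 0 \<tau>] by blast
  interpret finite_measure "lebesgue_on {0..\<tau>}" by (rule finite_measure_Icc)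
  show ?thesis
  proof (rule that[of B "\<tau> * norm b"], unfold_locales)
    show "k \<in> borel_measurable (lebesgue_on {0..\<tau>})"
      by (intro measurable_lebesgue_on_borel borel_measurable_continuous_onI assms)
    show "(\<lambda>s. s *\<^sub>R b) \<in> borel_measurable (lebesgue_on {0..\<tau>})"
      by (intro measurable_lebesgue_on_borel) measurable
    fix s assume "s \<in> space (lebesgue_on {0..\<tau>})"
    then show "\<bar>k s\<bar> \<le> B" "norm (s *\<^sub>R b) \<le> \<tau> * norm b"
      using B[of s] by (auto intro!: mult_right_mono)
  qed
qed

lemma line_op_conv:
  fixes h :: "'a::euclidean_space \<Rightarrow> real"
  assumes "continuous_on UNIV k" "continuous_on UNIV h" and b': "b' = - b"
  shows "line_op k \<sigma> \<tau> b h x = bounded_shift.conv (lebesgue_on {0..\<tau>}) k (\<lambda>s. s *\<^sub>R b) h x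
    + \<sigma> * bounded_shift.conv (lebesgue_on {0..\<tau>}) k (\<lambda>s. s *\<^sub>R b') h x"
proof -
  obtain B R where "bounded_shift (lebesgue_on {0..\<tau>}) k (\<lambda>s. s *\<^sub>R b) B R"
    using bounded_shift_line[OF assms(1), of \<tau> b] by blast
  then interpret P: bounded_shift "lebesgue_on {0..\<tau>}" k "\<lambda>s. s *\<^sub>R b" B R .
  obtain B' R' where "bounded_shift (lebesgue_on {0..\<tau>}) k (\<lambda>s. s *\<^sub>R b') B' R'"
    using bounded_shift_line[OF assms(1), of \<tau> b'] by blast
  then interpret M: bounded_shift "lebesgue_on {0..\<tau>}" k "\<lambda>s. s *\<^sub>R b'" B' R' .
  have eq: "x - s *\<^sub>R b = x + s *\<^sub>R b'" for s by (simp add: b')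
  show ?thesis
    using P.integrable_conv[OF assms(2), of x] M.integrable_conv[OF assms(2), of x]
    unfolding line_op_def P.conv_def M.conv_def eq by (simp add: distrib_left mult.left_commute)
qed

lemma
  fixes h :: "'a::euclidean_space \<Rightarrow> real"
  assumes k: "continuous_on UNIV k" and h: "smooth h"
  shows line_op_smooth: "smooth (line_op k \<sigma> \<tau> b h)"
    and partial_line_op: "c \<in> Basis \<Longrightarrow> partial c (line_op k \<sigma> \<tau> b h) x = line_op k \<sigma> \<tau> b (partial c h) x"
proof -
  define b' where "b' = - b"
  obtain B R where "bounded_shift (lebesgue_on {0..\<tau>}) k (\<lambda>s. s *\<^sub>R b) B R"
    using bounded_shift_line[OF k, of \<tau> b] by blast
  then interpret P: bounded_shift "lebesgue_on {0..\<tau>}" k "\<lambda>s. s *\<^sub>R b" B R .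
  obtain B' R' where "bounded_shift (lebesgue_on {0..\<tau>}) k (\<lambda>s. s *\<^sub>R b') B' R'"
    using bounded_shift_line[OF k, of \<tau> b'] by blast
  then interpret M: bounded_shift "lebesgue_on {0..\<tau>}" k "\<lambda>s. s *\<^sub>R b'" B' R' .
  have eq: "line_op k \<sigma> \<tau> b f = (\<lambda>x. P.conv f x + \<sigma> * M.conv f x)" if "smooth f" for f
    using line_op_conv[OF k smooth_continuous[OF that] b'_def] by blast
  show "smooth (line_op k \<sigma> \<tau> b h)"
    unfolding eq[OF h] by (intro smooth_add smooth_mult smooth_const P.conv_smooth M.conv_smooth h)
  show "partial c (line_op k \<sigma> \<tau> b h) x = line_op k \<sigma> \<tau> b (partial c h) x" if "c \<in> Basis"
    using that h by (simp add: eq smooth_partial partial_add partial_cmult smooth_mult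
        P.conv_smooth M.conv_smooth P.partial_conv M.partial_conv)
qed

lemma line_op_periodic: "periodic h \<Longrightarrow> periodic (line_op k \<sigma> \<tau> b h)"
proof -
  assume h: "periodic h"
  have "h (x + c + y) = h (x + y)" "h (x + c - y) = h (x - y)" if "c \<in> Basis" for x y c
    using h that unfolding periodic_def by (metis add.commute add.left_commute, metis add_diff_eq diff_add_eq)
  then show ?thesis by (simp add: periodic_def line_op_def)
qed

lemma line_op_bound:
  fixes h :: "'a::euclidean_space \<Rightarrow> real"
  assumes k: "continuous_on UNIV k" and kb: "\<And>s. 0 \<le> s \<Longrightarrow> s \<le> \<tau> \<Longrightarrow> \<bar>k s\<bar> \<le> B" and "\<tau> \<ge> 0"
    and h: "continuous_on UNIV h" and hb: "\<And>x. \<bar>h x\<bar> \<le> A" and \<sigma>: "\<bar>\<sigma>\<bar> \<le> 1"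
  shows "\<bar>line_op k \<sigma> \<tau> b h x\<bar> \<le> \<tau> * B * (2 * A)"
proof -
  interpret finite_measure "lebesgue_on {0..\<tau>}" by (rule finite_measure_Icc)
  have [measurable]: "h \<in> borel_measurable borel" "k \<in> borel_measurable borel"
    using h k by (auto intro: borel_measurable_continuous_onI)
  have *: "\<bar>k s * (h (x + s *\<^sub>R b) + \<sigma> * h (x - s *\<^sub>R b))\<bar> \<le> B * (2 * A)" if "0 \<le> s" "s \<le> \<tau>" for s
  proof -
    have "\<bar>\<sigma> * h (x - s *\<^sub>R b)\<bar> \<le> 1 * A"
      unfolding abs_mult using \<sigma> hb by (intro mult_mono) auto
    then have "\<bar>h (x + s *\<^sub>R b) + \<sigma> * h (x - s *\<^sub>R b)\<bar> \<le> 2 * A" using hb[of "x + s *\<^sub>R b"] by linarith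
    with kb[OF that] show ?thesis
      unfolding abs_mult by (intro mult_mono) (auto intro: order_trans[OF abs_ge_zero])
  qed
  have int: "integrable (lebesgue_on {0..\<tau>}) (\<lambda>s. k s * (h (x + s *\<^sub>R b) + \<sigma> * h (x - s *\<^sub>R b)))"
    by (rule integrable_const_bound[where B="B * (2 * A)"])
      (use * in \<open>auto intro!: measurable_lebesgue_on_borel\<close>)
  have "\<bar>line_op k \<sigma> \<tau> b h x\<bar> \<le> (\<integral>s. \<bar>k s * (h (x + s *\<^sub>R b) + \<sigma> * h (x - s *\<^sub>R b))\<bar> \<partial>lebesgue_on {0..\<tau>})"
    unfolding line_op_def by (rule integral_abs_bound)
  also have "\<dots> \<le> (\<integral>s. B * (2 * A) \<partial>lebesgue_on {0..\<tau>})"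
    using * by (intro integral_mono integrable_abs int) auto
  also have "\<dots> = \<tau> * B * (2 * A)"
    using \<open>\<tau> \<ge> 0\<close> by (simp add: measure_restrict_space)
  finally show ?thesis .
qed

text \<open>The derivative of \<open>h (x - s *\<^sub>R b)\<close> in \<open>s\<close> carries a
  minus sign, so moving the derivative from the kernel to \<open>h\<close> reverses the parity
  \<sigma>; this is the fundamental theorem of calculus on [0,\<tau>].\<close>

lemma line_op_by_parts:
  fixes h :: "'a::euclidean_space \<Rightarrow> real"
  assumes k: "\<And>s. (k has_field_derivative k' s) (at s)" "continuous_on UNIV k'"
    and h: "smooth h" and b: "b \<in> Basis" and "\<tau> \<ge> 0"
  shows "line_op k' \<sigma> \<tau> b h x + line_op k (- \<sigma>) \<tau> b (partial b h) x
    = k \<tau> * (h (x + \<tau> *\<^sub>R b) + \<sigma> * h (x - \<tau> *\<^sub>R b)) - k 0 * ((1 + \<sigma>) * h x)"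
proof -
  have kc: "continuous_on UNIV k"
    using k(1) DERIV_isCont continuous_at_imp_continuous_on by blast
  define F where "F s = k s * (h (x + s *\<^sub>R b) + \<sigma> * h (x - s *\<^sub>R b))" for s
  define f1 where "f1 s = k' s * (h (x + s *\<^sub>R b) + \<sigma> * h (x - s *\<^sub>R b))" for s
  define f2 where "f2 s = k s * (partial b h (x + s *\<^sub>R b) + - \<sigma> * partial b h (x - s *\<^sub>R b))" for s
  have line: "((\<lambda>s. h (x + (c * s) *\<^sub>R b)) has_field_derivative c * partial b h (x + (c * s) *\<^sub>R b)) (at s)" for c s
  proof -
    have "((\<lambda>s. h (x + (c * s) *\<^sub>R b)) has_derivative
        (\<lambda>v. \<Sum>a\<in>Basis. (((c * v) *\<^sub>R b) \<bullet> a) *\<^sub>R partial a h (x + (c * s) *\<^sub>R b))) (at s)"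
      by (rule has_derivative_compose[where f="\<lambda>s. x + (c * s) *\<^sub>R b", OF _ smooth_has_derivative[OF h]])
        (auto intro!: derivative_eq_intros)
    moreover have "(\<Sum>a\<in>Basis. (((c * v) *\<^sub>R b) \<bullet> a) *\<^sub>R partial a h (x + (c * s) *\<^sub>R b))
        = c * partial b h (x + (c * s) *\<^sub>R b) * v" for v
      using b by (simp add: inner_Basis if_distrib[of "\<lambda>c. c * _"] if_distrib[of "(*) _"] mult_ac cong: if_cong)
    ultimately show ?thesis by (simp add: has_field_derivative_def)
  qed
  have DF: "(F has_field_derivative f1 s + f2 s) (at s)" for s
    unfolding F_def f1_def f2_def using line[of 1 s] line[of "-1" s]
    by (auto intro!: derivative_eq_intros k(1) simp: algebra_simps)
  have hc: "continuous_on UNIV h" "continuous_on UNIV (partial b h)"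
    using h b by (auto intro: smooth_continuous smooth_partial)
  have c1: "continuous_on UNIV f1" and c2: "continuous_on UNIV f2"
    unfolding f1_def f2_def
    by (auto intro!: continuous_intros k kc continuous_on_compose2[OF hc(1)] continuous_on_compose2[OF hc(2)])
  have [measurable]: "f1 \<in> borel_measurable borel" "f2 \<in> borel_measurable borel"
    using c1 c2 by (auto intro: borel_measurable_continuous_onI)
  have i: "integrable lborel (\<lambda>s. indicator {0..\<tau>} s *\<^sub>R f s)" if "continuous_on UNIV f" for f :: "real \<Rightarrow> real"
    using borel_integrable_compact[of "{0..\<tau>}" f] that continuous_on_subset by (auto simp: mult.commute)
  have "line_op k' \<sigma> \<tau> b h x + line_op k (- \<sigma>) \<tau> b (partial b h) x
      = (\<integral>s. indicator {0..\<tau>} s *\<^sub>R f1 s \<partial>lborel) + (\<integral>s. indicator {0..\<tau>} s *\<^sub>R f2 s \<partial>lborel)"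
    unfolding line_op_def f1_def[symmetric] f2_def[symmetric] by (simp add: lebesgue_on_eq_lborel)
  also have "\<dots> = (\<integral>s. indicator {0..\<tau>} s *\<^sub>R (f1 s + f2 s) \<partial>lborel)"
    unfolding scaleR_add_right by (rule Bochner_Integration.integral_add[symmetric]) (intro i c1 c2)+
  also have "\<dots> = F \<tau> - F 0"
    by (rule integral_FTC_Icc[OF \<open>\<tau> \<ge> 0\<close>])
      (auto intro!: has_field_derivative_at_within DF continuous_on_add continuous_on_subset[OF c1] continuous_on_subset[OF c2]
        simp: has_real_derivative_iff_has_vector_derivative[symmetric])
  finally show ?thesis by (simp add: F_def algebra_simps)
qed

text \<open>The mean over the segment of length 2\<tau> centred at \<open>x\<close>.\<close>

definition Mop :: "real \<Rightarrow> 'a::euclidean_space \<Rightarrow> ('a \<Rightarrow> real) \<Rightarrow> 'a \<Rightarrow> real" where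
  "Mop \<tau> = line_op (\<lambda>_. 1 / (2 * \<tau>)) 1 \<tau>"

text \<open>The primitive in direction \<open>b\<close> of the averaging error: its derivative is
  \<open>Mop\<close> minus the identity. The kernel vanishes at \<tau>, so no far boundary term
  appears, and its odd continuation jumps at 0 by exactly 1.\<close>

definition Lop :: "real \<Rightarrow> 'a::euclidean_space \<Rightarrow> ('a \<Rightarrow> real) \<Rightarrow> 'a \<Rightarrow> real" where
  "Lop \<tau> = line_op (\<lambda>s. (\<tau> - s) / (2 * \<tau>)) (-1) \<tau>"

text \<open>The primitive of \<open>Lop\<close> in direction \<open>b\<close>. Here the kernel is
  even and hence continuous at 0, so no term in \<open>h\<close> itself is produced.\<close>

definition Kop :: "real \<Rightarrow> 'a::euclidean_space \<Rightarrow> ('a \<Rightarrow> real) \<Rightarrow> 'a \<Rightarrow> real" where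
  "Kop \<tau> = line_op (\<lambda>s. (\<tau> - s)\<^sup>2 / (4 * \<tau>)) 1 \<tau>"

context
  fixes \<tau> :: real
  assumes \<tau>: "\<tau> > 0"
begin

lemma op_kernels:
  "continuous_on UNIV (\<lambda>_::real. 1 / (2 * \<tau>))"
  "continuous_on UNIV (\<lambda>s. (\<tau> - s) / (2 * \<tau>))"
  "continuous_on UNIV (\<lambda>s. (\<tau> - s)\<^sup>2 / (4 * \<tau>))"
  using \<tau> by (auto intro!: continuous_intros)

lemma op_smooth: "smooth h \<Longrightarrow> smooth (Mop \<tau> b h)" "smooth h \<Longrightarrow> smooth (Lop \<tau> b h)" "smooth h \<Longrightarrow> smooth (Kop \<tau> b h)"
  unfolding Mop_def Lop_def Kop_def by (intro line_op_smooth op_kernels; assumption)+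

lemma op_periodic: "periodic h \<Longrightarrow> periodic (Mop \<tau> b h)" "periodic h \<Longrightarrow> periodic (Lop \<tau> b h)"
    "periodic h \<Longrightarrow> periodic (Kop \<tau> b h)"
  unfolding Mop_def Lop_def Kop_def by (intro line_op_periodic; assumption)+

lemma op_partial:
  assumes "smooth h" "c \<in> Basis"
  shows "partial c (Mop \<tau> b h) = Mop \<tau> b (partial c h)" "partial c (Lop \<tau> b h) = Lop \<tau> b (partial c h)"
    "partial c (Kop \<tau> b h) = Kop \<tau> b (partial c h)"
  unfolding Mop_def Lop_def Kop_def using partial_line_op[OF op_kernels(1) assms]
    partial_line_op[OF op_kernels(2) assms] partial_line_op[OF op_kernels(3) assms] by blast+

lemma op_bound:
  assumes "continuous_on UNIV h" "\<And>x. \<bar>h x\<bar> \<le> A"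
  shows "\<bar>Mop \<tau> b h x\<bar> \<le> A" "\<bar>Lop \<tau> b h x\<bar> \<le> \<tau> * A" "\<bar>Kop \<tau> b h x\<bar> \<le> \<tau>\<^sup>2 * A"
proof -
  have A: "A \<ge> 0" using assms(2)[of 0] by linarith
  show "\<bar>Mop \<tau> b h x\<bar> \<le> A" unfolding Mop_def
    using line_op_bound[OF op_kernels(1) _ _ assms, of \<tau> "1 / (2 * \<tau>)" 1 b x] \<tau> by simp
  show "\<bar>Lop \<tau> b h x\<bar> \<le> \<tau> * A" unfolding Lop_def
    using line_op_bound[OF op_kernels(2) _ _ assms, of \<tau> "1 / 2" "-1" b x] \<tau> by (simp add: field_simps)
  have "\<bar>(\<tau> - s)\<^sup>2 / (4 * \<tau>)\<bar> \<le> \<tau> / 4" if "0 \<le> s" "s \<le> \<tau>" for s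
  proof -
    have "(\<tau> - s)\<^sup>2 \<le> \<tau>\<^sup>2" using that by (intro power_mono) auto
    then show ?thesis using \<tau> by (simp add: abs_mult field_simps power2_eq_square[of \<tau>])
  qed
  from line_op_bound[where \<sigma>=1 and b=b and x=x and \<tau>=\<tau>, OF op_kernels(3) this _ assms] \<tau>
  have "\<bar>Kop \<tau> b h x\<bar> \<le> \<tau> * (\<tau> / 4) * (2 * A)" unfolding Kop_def by simp
  also have "\<dots> \<le> \<tau>\<^sup>2 * A" using A by (simp add: power2_eq_square field_simps)
  finally show "\<bar>Kop \<tau> b h x\<bar> \<le> \<tau>\<^sup>2 * A" .
qed

lemma line_op_uminus_kernel: "line_op (\<lambda>s. - k s) \<sigma> \<tau> b h x = - line_op k \<sigma> \<tau> b h x"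
  by (simp add: line_op_def)

lemma
  fixes h :: "'a::euclidean_space \<Rightarrow> real"
  assumes h: "smooth h" and b: "b \<in> Basis"
  shows partial_Kop: "partial b (Kop \<tau> b h) x = Lop \<tau> b h x"
    and partial_Lop: "partial b (Lop \<tau> b h) x = Mop \<tau> b h x - h x"
    and partial_Mop: "partial b (Mop \<tau> b h) x = (h (x + \<tau> *\<^sub>R b) - h (x - \<tau> *\<^sub>R b)) / (2 * \<tau>)"
proof -
  have \<tau>0: "\<tau> \<ge> 0" using \<tau> by simp
  have "((\<lambda>s. (\<tau> - s)\<^sup>2 / (4 * \<tau>)) has_field_derivative - ((\<tau> - s) / (2 * \<tau>))) (at s)" for s
    using \<tau> by (auto intro!: derivative_eq_intros simp: field_simps)
  from line_op_by_parts[OF this _ h b \<tau>0, of "-1" x] \<tau>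
  show "partial b (Kop \<tau> b h) x = Lop \<tau> b h x"
    unfolding op_partial[OF h b] Kop_def Lop_def partial_line_op[OF op_kernels(3) h b]
    by (simp add: line_op_uminus_kernel op_kernels continuous_on_minus del: minus_divide_left)
  have "((\<lambda>s. (\<tau> - s) / (2 * \<tau>)) has_field_derivative - (1 / (2 * \<tau>))) (at s)" for s
    using \<tau> by (auto intro!: derivative_eq_intros simp: field_simps)
  from line_op_by_parts[OF this _ h b \<tau>0, of 1 x] \<tau>
  show "partial b (Lop \<tau> b h) x = Mop \<tau> b h x - h x"
    unfolding op_partial[OF h b] Mop_def Lop_def partial_line_op[OF op_kernels(2) h b]
    by (simp add: line_op_uminus_kernel op_kernels continuous_on_minus del: minus_divide_left)
  have "((\<lambda>s. 1 / (2 * \<tau>)) has_field_derivative 0) (at s)" for s by simp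
  from line_op_by_parts[OF this _ h b \<tau>0, of "-1" x] \<tau>
  show "partial b (Mop \<tau> b h) x = (h (x + \<tau> *\<^sub>R b) - h (x - \<tau> *\<^sub>R b)) / (2 * \<tau>)"
    unfolding Mop_def partial_line_op[OF op_kernels(1) h b] by (simp add: line_op_def)
qed

end

text \<open>On the torus a translation of one factor is the inverse translation of the other, and
  the kernel is even; Fubini does the rest. Self-adjointness carries weak nullity and mean values
  over to the averages.\<close>

lemma Mop_adjoint:
  fixes h g :: "'a::euclidean_space \<Rightarrow> real"
  assumes b: "b \<in> Basis" and h: "continuous_on UNIV h" "periodic h" and g: "continuous_on UNIV g" "periodic g"
  shows "(\<integral>x. Mop \<tau> b h x * g x \<partial>torus) = (\<integral>x. h x * Mop \<tau> b g x \<partial>torus)"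
proof -
  let ?L = "lebesgue_on {0..\<tau>}"
  interpret L: finite_measure ?L by (rule finite_measure_Icc)
  interpret P: pair_sigma_finite "torus :: 'a measure" ?L ..
  interpret PF: finite_measure "(torus :: 'a measure) \<Otimes>\<^sub>M ?L"
    by (rule finite_measure_pair_measure) unfold_locales
  have [measurable]: "h \<in> borel_measurable borel" "g \<in> borel_measurable borel"
    using h g by (auto intro: borel_measurable_continuous_onI)
  have [measurable]: "(\<lambda>x::'a. x) \<in> borel_measurable torus" "(\<lambda>x. x) \<in> borel_measurable ?L"
    by (simp_all add: id_measurable_lebesgue_on)
  obtain A where A: "\<And>x. \<bar>h x\<bar> \<le> A" using periodic_bounded[OF h(2,1)] by blast
  obtain G where G: "\<And>x. \<bar>g x\<bar> \<le> G" using periodic_bounded[OF g(2,1)] by blast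
  define q where "q p v = (1 / (2 * \<tau>)) * ((p (fst v + snd v *\<^sub>R b) + p (fst v - snd v *\<^sub>R b)))" for p :: "'a \<Rightarrow> real" and v
  have int: "integrable (torus \<Otimes>\<^sub>M ?L) (\<lambda>v. q p v * r (fst v))"
    if p: "p \<in> borel_measurable borel" "\<And>x. \<bar>p x\<bar> \<le> A" and r: "r \<in> borel_measurable borel" "\<And>x. \<bar>r x\<bar> \<le> B"
    for p r :: "'a \<Rightarrow> real" and A B
  proof (rule PF.integrable_const_bound[where B="\<bar>1 / (2 * \<tau>)\<bar> * (A + A) * B"])
    have [measurable]: "p \<in> borel_measurable borel" "r \<in> borel_measurable borel" using p r by auto
    have [measurable]: "(\<lambda>v. fst v + snd v *\<^sub>R b) \<in> borel_measurable ((torus::'a measure) \<Otimes>\<^sub>M ?L)"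
       "(\<lambda>v. fst v - snd v *\<^sub>R b) \<in> borel_measurable ((torus::'a measure) \<Otimes>\<^sub>M ?L)"
       "fst \<in> borel_measurable ((torus::'a measure) \<Otimes>\<^sub>M ?L)"
      using measurable_compose[OF measurable_fst id_measurable_lebesgue_on[of unit_cell]]
        measurable_compose[OF measurable_snd id_measurable_lebesgue_on[of "{0..\<tau>}"]]
      by (auto simp: eta_contract_eq intro!: borel_measurable_add borel_measurable_diff borel_measurable_scaleR)
    show "(\<lambda>v. q p v * r (fst v)) \<in> borel_measurable (torus \<Otimes>\<^sub>M ?L)"
      unfolding q_def by measurable
    have "\<bar>q p v * r (fst v)\<bar> \<le> \<bar>1 / (2 * \<tau>)\<bar> * (A + A) * B" for v
      unfolding q_def abs_mult using p(2) r(2)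
      by (intro mult_mono order_trans[OF abs_triangle_ineq] add_mono) (auto intro: order_trans[OF abs_ge_zero] add_nonneg_nonneg)
    then show "AE v in torus \<Otimes>\<^sub>M ?L. norm (q p v * r (fst v)) \<le> \<bar>1 / (2 * \<tau>)\<bar> * (A + A) * B" by simp
  qed
  have fub: "(\<integral>x. Mop \<tau> b p x * r x \<partial>torus) = (\<integral>s. (\<integral>x. q p (x, s) * r x \<partial>torus) \<partial>?L)"
    if "p \<in> borel_measurable borel" "\<And>x. \<bar>p x\<bar> \<le> A" "r \<in> borel_measurable borel" "\<And>x. \<bar>r x\<bar> \<le> B" for p r A B
  proof -
    have "(\<integral>x. Mop \<tau> b p x * r x \<partial>torus) = (\<integral>x. (\<integral>s. q p (x, s) * r x \<partial>?L) \<partial>torus)"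
      by (simp add: Mop_def line_op_def q_def)
    also have "\<dots> = (\<integral>s. (\<integral>x. q p (x, s) * r x \<partial>torus) \<partial>?L)"
    proof (rule P.Fubini_integral[symmetric])
      have "(\<lambda>(x, s). q p (x, s) * r x) = (\<lambda>v. q p v * r (fst v))" by auto
      then show "integrable (torus \<Otimes>\<^sub>M ?L) (\<lambda>(x, s). q p (x, s) * r x)" using int[OF that] by simp
    qed
    finally show ?thesis .
  qed
  have "(\<integral>x. q h (x, s) * g x \<partial>torus) = (\<integral>x. q g (x, s) * h x \<partial>torus)" for s
  proof -
    have c: "continuous_on UNIV (\<lambda>x. p (x + t *\<^sub>R b))" if "continuous_on UNIV p" for p :: "'a \<Rightarrow> real" and t
      by (rule continuous_on_compose2[OF that]) (auto intro: continuous_intros)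
    have sh: "(\<integral>x. h (x + t *\<^sub>R b) * g x \<partial>torus) = (\<integral>x. h x * g (x + (-t) *\<^sub>R b) \<partial>torus)" for t
    proof -
      have "periodic (\<lambda>x. h x * g (x + (-t) *\<^sub>R b))"
        using h(2) g(2) unfolding periodic_def by (metis add.commute add.left_commute)
      from torus_shift[OF b _ this, of t] show ?thesis
        using c[OF g(1), of "-t"] h(1) by (simp add: continuous_on_mult)
    qed
    have i: "integrable torus (\<lambda>x. p (x + t *\<^sub>R b) * r x)" if "continuous_on UNIV p" "continuous_on UNIV r"
      for p r :: "'a \<Rightarrow> real" and t
      by (intro integrable_torus_continuous continuous_on_mult c that)
    have "(\<integral>x. q p (x, s) * r x \<partial>torus) = (1 / (2 * \<tau>)) * ((\<integral>x. p (x + s *\<^sub>R b) * r x \<partial>torus) + (\<integral>x. p (x + (-s) *\<^sub>R b) * r x \<partial>torus))"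
      if "continuous_on UNIV p" "continuous_on UNIV r" for p r :: "'a \<Rightarrow> real"
      using i[OF that, of s] i[OF that, of "-s"] by (simp add: q_def distrib_right mult.assoc)
    from this[OF h(1) g(1)] this[OF g(1) h(1)] show ?thesis
      using sh[of s] sh[of "-s"] by (simp add: mult.commute)
  qed
  with fub[of h A g G] fub[of g G h A] A G show ?thesis by (simp add: mult.commute)
qed

section \<open>A bounded right inverse of the divergence of symmetric matrix fields\<close>

text \<open>The head of the list acts first, which is the order in which \<open>div_steps\<close>
  peels off directions.\<close>

definition Mlist :: "real \<Rightarrow> 'a::euclidean_space list \<Rightarrow> ('a \<Rightarrow> real) \<Rightarrow> 'a \<Rightarrow> real" where
  "Mlist \<tau> bs h = fold (Mop \<tau>) bs h"

lemma Mlist_Nil [simp]: "Mlist \<tau> [] h = h"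
  and Mlist_Cons [simp]: "Mlist \<tau> (b # bs) h = Mlist \<tau> bs (Mop \<tau> b h)"
  and Mlist_append: "Mlist \<tau> (bs @ cs) h = Mlist \<tau> cs (Mlist \<tau> bs h)"
  by (simp_all add: Mlist_def)

context
  fixes \<tau> :: real
  assumes \<tau>: "\<tau> > 0"
begin

lemma Mlist_smooth: "smooth h \<Longrightarrow> smooth (Mlist \<tau> bs h)"
  by (induction bs arbitrary: h) (auto intro: op_smooth \<tau>)

lemma Mlist_periodic: "periodic h \<Longrightarrow> periodic (Mlist \<tau> bs h)"
  by (induction bs arbitrary: h) (auto intro: op_periodic \<tau>)

lemma Mlist_bound: "smooth h \<Longrightarrow> (\<And>x. \<bar>h x\<bar> \<le> A) \<Longrightarrow> \<bar>Mlist \<tau> bs h x\<bar> \<le> A"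
proof (induction bs arbitrary: h)
  case (Cons b bs)
  show ?case unfolding Mlist_Cons
    by (rule Cons.IH[OF op_smooth(1)[OF \<tau>]])
      (use Cons.prems op_bound(1)[OF \<tau> smooth_continuous] in blast)+
qed simp

lemma partial_Mlist:
  "smooth h \<Longrightarrow> c \<in> Basis \<Longrightarrow> partial c (Mlist \<tau> bs h) = Mlist \<tau> bs (partial c h)"
  by (induction bs arbitrary: h) (auto simp: op_smooth \<tau> op_partial)

text \<open>Derivatives commute with averages, so \<partial> in direction \<open>b\<close> can be
  moved to the one average taken in that direction, where it becomes a difference quotient. No
  derivative of \<open>h\<close> is left.\<close>

lemma partial_Mlist_mem:
  assumes "b \<in> set bs" "b \<in> Basis" "smooth h"
  obtains l1 l2 where "partial b (Mlist \<tau> bs h)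
    = Mlist \<tau> l2 (\<lambda>x. (Mlist \<tau> l1 h (x + \<tau> *\<^sub>R b) - Mlist \<tau> l1 h (x - \<tau> *\<^sub>R b)) / (2 * \<tau>))"
proof -
  obtain l1 l2 where bs: "bs = l1 @ b # l2" using assms(1) by (auto dest: split_list)
  have "partial b (Mlist \<tau> bs h) = Mlist \<tau> l2 (partial b (Mop \<tau> b (Mlist \<tau> l1 h)))"
    unfolding bs Mlist_append Mlist_Cons by (intro partial_Mlist op_smooth Mlist_smooth assms \<tau>)
  also have "partial b (Mop \<tau> b (Mlist \<tau> l1 h))
      = (\<lambda>x. (Mlist \<tau> l1 h (x + \<tau> *\<^sub>R b) - Mlist \<tau> l1 h (x - \<tau> *\<^sub>R b)) / (2 * \<tau>))"
    using partial_Mop[OF \<tau> Mlist_smooth[OF assms(3)] assms(2)] by blast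
  finally show ?thesis by (rule that)
qed

lemma smooth_shift_diff:
  fixes h :: "'a::euclidean_space \<Rightarrow> real"
  assumes "smooth h" shows "smooth (\<lambda>x. (h (x + v) - h (x - v)) / c)"
proof -
  have "smooth (\<lambda>x. (1 / c) * (h (v + 1 *\<^sub>R x) - h (- v + 1 *\<^sub>R x)))"
    by (intro smooth_mult smooth_const smooth_diff smooth_affine assms)
  then show ?thesis by (simp add: add.commute)
qed

lemma partial_Mlist_bound:
  assumes "b \<in> set bs" "b \<in> Basis" "smooth h" "\<And>x. \<bar>h x\<bar> \<le> A"
  shows "\<bar>partial b (Mlist \<tau> bs h) x\<bar> \<le> A / \<tau>"
proof -
  obtain l1 l2 where eq: "partial b (Mlist \<tau> bs h)
    = Mlist \<tau> l2 (\<lambda>x. (Mlist \<tau> l1 h (x + \<tau> *\<^sub>R b) - Mlist \<tau> l1 h (x - \<tau> *\<^sub>R b)) / (2 * \<tau>))"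
    using partial_Mlist_mem[OF assms(1-3)] by blast
  show ?thesis unfolding eq
  proof (rule Mlist_bound[OF smooth_shift_diff[OF Mlist_smooth[OF assms(3)]]])
    fix x
    have "\<bar>Mlist \<tau> l1 h (x + \<tau> *\<^sub>R b) - Mlist \<tau> l1 h (x - \<tau> *\<^sub>R b)\<bar> \<le> 2 * A"
      using Mlist_bound[OF assms(3,4), of l1 "x + \<tau> *\<^sub>R b"] Mlist_bound[OF assms(3,4), of l1 "x - \<tau> *\<^sub>R b"]
      by linarith
    then show "\<bar>(Mlist \<tau> l1 h (x + \<tau> *\<^sub>R b) - Mlist \<tau> l1 h (x - \<tau> *\<^sub>R b)) / (2 * \<tau>)\<bar> \<le> A / \<tau>"
      using \<tau> by (simp add: abs_divide field_simps)
  qed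
qed

lemma Mlist_integral:
  assumes "set bs \<subseteq> Basis" "smooth h" "periodic h" "smooth g" "periodic g"
  shows "(\<integral>x. Mlist \<tau> bs h x * g x \<partial>torus) = (\<integral>x. h x * Mlist \<tau> (rev bs) g x \<partial>torus)"
  using assms
proof (induction bs arbitrary: h)
  case (Cons b bs)
  have "(\<integral>x. Mlist \<tau> (b # bs) h x * g x \<partial>torus) = (\<integral>x. Mop \<tau> b h x * Mlist \<tau> (rev bs) g x \<partial>torus)"
    using Cons by (simp add: op_smooth op_periodic \<tau>)
  also have "\<dots> = (\<integral>x. h x * Mop \<tau> b (Mlist \<tau> (rev bs) g) x \<partial>torus)"
    using Cons.prems by (intro Mop_adjoint smooth_continuous Mlist_smooth Mlist_periodic) auto
  finally show ?case by (simp add: Mlist_append)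
qed simp

lemma Mop_continuous:
  fixes h :: "'a::euclidean_space \<Rightarrow> real"
  assumes "continuous_on UNIV h"
  shows "continuous_on UNIV (Mop \<tau> b h)"
proof -
  have conv_cont: "continuous_on UNIV (bounded_shift.conv (lebesgue_on {0..\<tau>}) (\<lambda>_. 1 / (2 * \<tau>)) (\<lambda>s. s *\<^sub>R c) h)"
    for c :: 'a
  proof -
    obtain B R where "bounded_shift (lebesgue_on {0..\<tau>}) (\<lambda>_. 1 / (2 * \<tau>)) (\<lambda>s. s *\<^sub>R c) B R"
      using bounded_shift_line[OF op_kernels(1)[OF \<tau>], of \<tau> c] by blast
    then interpret P: bounded_shift "lebesgue_on {0..\<tau>}" "\<lambda>_. 1 / (2 * \<tau>)" "\<lambda>s. s *\<^sub>R c" B R .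
    show ?thesis by (rule P.conv_continuous[OF assms])
  qed
  have eq: "Mop \<tau> b h = (\<lambda>x. bounded_shift.conv (lebesgue_on {0..\<tau>}) (\<lambda>_. 1 / (2 * \<tau>)) (\<lambda>s. s *\<^sub>R b) h x
    + 1 * bounded_shift.conv (lebesgue_on {0..\<tau>}) (\<lambda>_. 1 / (2 * \<tau>)) (\<lambda>s. s *\<^sub>R (- b)) h x)"
    unfolding Mop_def by (rule ext) (rule line_op_conv[OF op_kernels(1)[OF \<tau>] assms refl])
  show ?thesis unfolding eq by (intro continuous_on_add continuous_on_mult continuous_on_const conv_cont)
qed

end

lemma smooth_partials_0_const:
  fixes h :: "'a::euclidean_space \<Rightarrow> real"
  assumes "smooth h" "\<And>b x. b \<in> Basis \<Longrightarrow> partial b h x = 0"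
  shows "h x = h y"
  using smooth_has_derivative[OF assms(1)] assms(2)
  by (metis (no_types, lifting) UNIV_I convex_UNIV has_derivative_zero_unique has_derivative_at_withinI
      scaleR_zero_right sum.neutral ext)

text \<open>For \<tau> = 1/2 the window is a full period: the difference quotient of
  \<open>partial_Mlist_mem\<close> vanishes by periodicity, so the result is constant. Its value
  follows by moving the averages to the constant function 1.\<close>

lemma Mlist_half:
  fixes h :: "'a::euclidean_space \<Rightarrow> real"
  assumes "set bs = Basis" "smooth h" "periodic h"
  shows "Mlist (1/2) bs h x = (\<integral>y. h y \<partial>torus)"
proof -
  have half: "(1/2::real) > 0" by simp
  let ?H = "Mlist (1/2) bs h"
  have "partial b ?H x = 0" if b: "b \<in> Basis" for b x
  proof -
    obtain l1 l2 where eq: "partial b ?H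
      = Mlist (1/2) l2 (\<lambda>x. (Mlist (1/2) l1 h (x + (1/2) *\<^sub>R b) - Mlist (1/2) l1 h (x - (1/2) *\<^sub>R b)) / (2 * (1/2)))"
      using partial_Mlist_mem[OF half, of b bs h] assms b by blast
    have "Mlist (1/2) l1 h (x + (1/2) *\<^sub>R b) = Mlist (1/2) l1 h (x - (1/2) *\<^sub>R b)" for x
    proof -
      have "Mlist (1/2) l1 h (x - (1/2) *\<^sub>R b + b) = Mlist (1/2) l1 h (x - (1/2) *\<^sub>R b)"
        using Mlist_periodic[OF half assms(3), of l1] b by (simp add: periodic_def)
      moreover have "x - (1/2) *\<^sub>R b + b = x + (1/2) *\<^sub>R b"
        using scaleR_left_distrib[of "1/2" "1/2" b] by (simp add: algebra_simps)
      ultimately show ?thesis by simp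
    qed
    then have eq0: "partial b ?H = Mlist (1/2) l2 (\<lambda>x. 0)" unfolding eq by simp
    have "\<bar>Mlist (1/2) l2 (\<lambda>x::'a. 0) x\<bar> \<le> 0" by (rule Mlist_bound[OF half]) auto
    then show ?thesis by (simp add: eq0)
  qed
  from smooth_partials_0_const[OF Mlist_smooth[OF half assms(2)] this]
  have const: "?H y = ?H x" for y by blast
  have one: "Mlist (1/2) cs (\<lambda>_::'a. 1) = (\<lambda>_. 1)" for cs
  proof (induction cs)
    case (Cons c cs)
    have "Mop (1/2) c (\<lambda>_. 1) = (\<lambda>_::'a. 1::real)"
      by (rule ext) (simp add: Mop_def line_op_def measure_restrict_space)
    with Cons show ?case by simp
  qed simp
  have "(\<integral>y. ?H y * 1 \<partial>torus) = (\<integral>y. ?H x \<partial>(torus :: 'a measure))"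
    using const by (intro Bochner_Integration.integral_cong) simp_all
  then have "?H x = (\<integral>y. ?H y * 1 \<partial>torus)"
    using torus.prob_space[where 'a='a] by simp
  also have "\<dots> = (\<integral>y. h y * Mlist (1/2) (rev bs) (\<lambda>_. 1) y \<partial>torus)"
    using assms by (intro Mlist_integral half) auto
  finally show ?thesis by (simp add: one)
qed

text \<open>
  After averaging in the direction \<open>b0\<close> a derivative \<open>\<partial>\<^bsub>b0\<^esub>\<close> costs only a factor \<open>1/\<tau>\<close>. So the
  off-diagonal entry \<open>- L\<^sub>i h\<close>, which produces \<open>h - M\<^sub>i h\<close> in row \<open>b0\<close>, can be compensated in row \<open>i\<close>
  by a diagonal entry.
\<close>
lemma div_steps:
  fixes h :: "'a::euclidean_space \<Rightarrow> real"
  assumes \<tau>: "\<tau> > 0" and b0: "b0 \<in> Basis" and bs: "set bs \<subseteq> Basis - {b0}"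
    and h: "smooth h" "periodic h" "\<And>x. \<bar>h x\<bar> \<le> A" "\<And>x. \<bar>partial b0 h x\<bar> \<le> A / \<tau>"
  shows "\<exists>U. (\<forall>b c. U b c = U c b) \<and> (\<forall>b c. smooth (U b c) \<and> periodic (U b c)) \<and>
    (\<forall>b c x. \<bar>U b c x\<bar> \<le> real (length bs) * (\<tau> * A)) \<and>
    (\<forall>b\<in>Basis. \<forall>x. (\<Sum>c\<in>Basis. partial c (U b c) x) = (if b = b0 then h x - Mlist \<tau> bs h x else 0))"
  using bs h
proof (induction bs arbitrary: h)
  case Nil
  show ?case by (rule exI[of _ "\<lambda>_ _ _. 0"]) auto
next
  case (Cons i bs h)
  note h = Cons.prems(2-)
  have i: "i \<in> Basis" "i \<noteq> b0" and bs: "set bs \<subseteq> Basis - {b0}" using Cons.prems(1) by auto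
  have A: "A \<ge> 0" using h(3)[of 0] by linarith
  have "\<bar>partial b0 (Mop \<tau> i h) x\<bar> \<le> A / \<tau>" for x
    unfolding op_partial(1)[OF \<tau> h(1) b0]
    by (rule op_bound(1)[OF \<tau> smooth_continuous[OF smooth_partial[OF h(1) b0]] h(4)])
  from Cons.IH[OF bs op_smooth(1)[OF \<tau> h(1)] op_periodic(1)[OF \<tau> h(2)]
      op_bound(1)[OF \<tau> smooth_continuous[OF h(1)] h(3)] this]
  obtain V where V: "\<And>b c. V b c = V c b" "\<And>b c. smooth (V b c)" "\<And>b c. periodic (V b c)"
    "\<And>b c x. \<bar>V b c x\<bar> \<le> real (length bs) * (\<tau> * A)"
    "\<And>b x. b \<in> Basis \<Longrightarrow> (\<Sum>c\<in>Basis. partial c (V b c) x)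
      = (if b = b0 then Mop \<tau> i h x - Mlist \<tau> (i # bs) h x else 0)"
    unfolding Mlist_Cons by blast
  define p where "p = partial b0 h"
  have p: "smooth p" "periodic p" "\<And>x. \<bar>p x\<bar> \<le> A / \<tau>"
    using h b0 by (auto simp: p_def smooth_partial periodic_partial)
  define W where "W b c = (if b = b0 \<and> c = i \<or> b = i \<and> c = b0 then (\<lambda>x. - Lop \<tau> i h x)
     else if b = i \<and> c = i then Kop \<tau> i p else (\<lambda>_. 0))" for b c
  \<comment> \<open>The diagonal entry obeys the same bound as the off-diagonal one:
    \<open>Kop\<close> gains \<tau>^2 and \<open>p\<close> is of size A/\<tau>.\<close>
  have Wb: "\<bar>W b c x\<bar> \<le> \<tau> * A" for b c x
    using op_bound(2)[OF \<tau> smooth_continuous[OF h(1)] h(3), of i x]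
      op_bound(3)[OF \<tau> smooth_continuous[OF p(1)] p(3), of i x] \<tau> A
    by (auto simp: W_def power2_eq_square)
  have Wsm: "smooth (W b c)" "periodic (W b c)" for b c
    using h p \<tau> by (auto simp: W_def op_smooth op_periodic smooth_minus periodic_uminus)
  have pL: "partial c (\<lambda>x. - Lop \<tau> i h x) x = - partial c (Lop \<tau> i h) x" for c x
    using partial_cmult[OF op_smooth(2)[OF \<tau> h(1)], of c "-1" i x] by simp
  have Wdiv: "(\<Sum>c\<in>Basis. partial c (W b c) x) = (if b = b0 then h x - Mop \<tau> i h x else 0)" if b: "b \<in> Basis" for b x
  proof -
    consider "b = b0" | "b = i" | "b \<noteq> b0" "b \<noteq> i" by blast
    then show ?thesis
    proof cases
      case 1
      have "(\<Sum>c\<in>Basis. partial c (W b c) x) = (\<Sum>c\<in>Basis. if c = i then partial i (W b i) x else 0)"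
        using 1 i by (intro sum.cong) (auto simp: W_def)
      also have "\<dots> = h x - Mop \<tau> i h x"
        using i 1 by (simp add: W_def pL partial_Lop[OF \<tau> h(1)])
      finally show ?thesis using 1 by simp
    next
      case 2
      have "(\<Sum>c\<in>Basis. partial c (W b c) x)
          = (\<Sum>c\<in>Basis. (if c = i then partial i (W b i) x else 0) + (if c = b0 then partial b0 (W b b0) x else 0))"
        using 2 i by (intro sum.cong) (auto simp: W_def)
      also have "\<dots> = Lop \<tau> i p x - Lop \<tau> i (partial b0 h) x"
        using i 2 b0 by (simp add: sum.distrib W_def pL partial_Kop[OF \<tau> p(1)] op_partial(2)[OF \<tau> h(1) b0])
      finally show ?thesis using 2 i by (simp add: p_def)
    next
      case 3
      then show ?thesis by (simp add: W_def)
    qed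
  qed
  show ?case
  proof (intro exI[of _ "\<lambda>b c x. W b c x + V b c x"] conjI allI ballI)
    fix b c
    show "(\<lambda>x. W b c x + V b c x) = (\<lambda>x. W c b x + V c b x)" using V(1)[of b c] by (auto simp: W_def)
    show "smooth (\<lambda>x. W b c x + V b c x)" "periodic (\<lambda>x. W b c x + V b c x)"
      using Wsm V by (auto simp: smooth_add periodic_def)
    fix x show "\<bar>W b c x + V b c x\<bar> \<le> real (length (i # bs)) * (\<tau> * A)"
      using Wb[of b c x] V(4)[of b c x] by (simp add: algebra_simps)
  next
    fix b x :: 'a assume b: "b \<in> Basis"
    show "(\<Sum>c\<in>Basis. partial c (\<lambda>x. W b c x + V b c x) x) = (if b = b0 then h x - Mlist \<tau> (i # bs) h x else 0)"
      using Wdiv[OF b, of x] V(5)[OF b, of x] Wsm V by (simp add: partial_add sum.distrib)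
  qed
qed

text \<open>The first average is taken in the direction \<open>b0\<close> itself: the diagonal entry
  \<open>- Lop\<close> then touches row \<open>b0\<close> only and needs no compensation, and the
  averaged function has the bound A/\<tau> on its derivative that \<open>div_steps\<close> requires
  for the other directions.\<close>

lemma div_component:
  fixes h :: "'a::euclidean_space \<Rightarrow> real"
  assumes \<tau>: "\<tau> > 0" and b0: "b0 \<in> Basis" and bs: "set bs \<subseteq> Basis - {b0}"
    and h: "smooth h" "periodic h" "\<And>x. \<bar>h x\<bar> \<le> A"
  shows "\<exists>U. (\<forall>b c. U b c = U c b) \<and> (\<forall>b c. smooth (U b c) \<and> periodic (U b c)) \<and>
    (\<forall>b c x. \<bar>U b c x\<bar> \<le> real (length (b0 # bs)) * (\<tau> * A)) \<and>
    (\<forall>b\<in>Basis. \<forall>x. (\<Sum>c\<in>Basis. partial c (U b c) x) = (if b = b0 then h x - Mlist \<tau> (b0 # bs) h x else 0))"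
proof -
  have "\<bar>partial b0 (Mop \<tau> b0 h) x\<bar> \<le> A / \<tau>" for x
    using partial_Mlist_bound[OF \<tau> _ b0 h(1,3), of "[b0]" x] by simp
  from div_steps[OF \<tau> b0 bs op_smooth(1)[OF \<tau> h(1)] op_periodic(1)[OF \<tau> h(2)]
      op_bound(1)[OF \<tau> smooth_continuous[OF h(1)] h(3)] this]
  obtain V where V: "\<And>b c. V b c = V c b" "\<And>b c. smooth (V b c)" "\<And>b c. periodic (V b c)"
    "\<And>b c x. \<bar>V b c x\<bar> \<le> real (length bs) * (\<tau> * A)"
    "\<And>b x. b \<in> Basis \<Longrightarrow> (\<Sum>c\<in>Basis. partial c (V b c) x)
      = (if b = b0 then Mop \<tau> b0 h x - Mlist \<tau> (b0 # bs) h x else 0)"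
    unfolding Mlist_Cons by blast
  define W where "W b c = (if b = b0 \<and> c = b0 then (\<lambda>x. - Lop \<tau> b0 h x) else (\<lambda>_. 0))" for b c
  have A: "A \<ge> 0" using h(3)[of 0] by linarith
  have Wb: "\<bar>W b c x\<bar> \<le> \<tau> * A" for b c x
    using op_bound(2)[OF \<tau> smooth_continuous[OF h(1)] h(3), of b0 x] \<tau> A by (auto simp: W_def)
  have Wsm: "smooth (W b c)" "periodic (W b c)" for b c
    using h \<tau> by (auto simp: W_def op_smooth op_periodic smooth_minus periodic_uminus)
  have pL: "partial c (\<lambda>x. - Lop \<tau> b0 h x) x = - partial c (Lop \<tau> b0 h) x" for c x
    using partial_cmult[OF op_smooth(2)[OF \<tau> h(1)], of c "-1" b0 x] by simp
  have Wdiv: "(\<Sum>c\<in>Basis. partial c (W b c) x) = (if b = b0 then h x - Mop \<tau> b0 h x else 0)" for b x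
  proof -
    have "(\<Sum>c\<in>Basis. partial c (W b c) x) = (\<Sum>c\<in>Basis. if c = b0 then partial b0 (W b b0) x else 0)"
      by (intro sum.cong) (auto simp: W_def)
    also have "\<dots> = (if b = b0 then h x - Mop \<tau> b0 h x else 0)"
      using b0 by (simp add: W_def pL partial_Lop[OF \<tau> h(1)])
    finally show ?thesis .
  qed
  show ?thesis
  proof (intro exI[of _ "\<lambda>b c x. W b c x + V b c x"] conjI allI ballI)
    fix b c
    show "(\<lambda>x. W b c x + V b c x) = (\<lambda>x. W c b x + V c b x)" using V(1)[of b c] by (auto simp: W_def)
    show "smooth (\<lambda>x. W b c x + V b c x)" "periodic (\<lambda>x. W b c x + V b c x)"
      using Wsm V by (auto simp: smooth_add periodic_def)
    fix x show "\<bar>W b c x + V b c x\<bar> \<le> real (length (b0 # bs)) * (\<tau> * A)"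
      using Wb[of b c x] V(4)[of b c x] by (simp add: algebra_simps)
  next
    fix b x :: 'a assume b: "b \<in> Basis"
    show "(\<Sum>c\<in>Basis. partial c (\<lambda>x. W b c x + V b c x) x) = (if b = b0 then h x - Mlist \<tau> (b0 # bs) h x else 0)"
      using Wdiv[of b x] V(5)[OF b, of x] Wsm V by (simp add: partial_add sum.distrib)
  qed
qed

text \<open>All directions with \<open>b\<close> in front, because averaging in \<open>b\<close> has
  to precede the others, see \<open>div_component\<close>.\<close>

definition basis_from :: "'a::euclidean_space \<Rightarrow> 'a list" where
  "basis_from b = b # (SOME bs. distinct bs \<and> set bs = Basis - {b})"

lemma basis_from:
  fixes b :: "'a::euclidean_space"
  assumes "b \<in> Basis"
  shows "\<exists>bs. basis_from b = b # bs \<and> set bs = Basis - {b}" "set (basis_from b) = Basis"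
    "length (basis_from b) = DIM('a)"
proof -
  have "finite (Basis - {b})" by simp
  from finite_distinct_list[OF this] have ex: "\<exists>bs. distinct bs \<and> set bs = Basis - {b}"
    by (simp add: conj_commute)
  have P: "distinct (SOME bs. distinct bs \<and> set bs = Basis - {b})"
      "set (SOME bs. distinct bs \<and> set bs = Basis - {b}) = Basis - {b}"
    using someI_ex[OF ex] by auto
  then show "\<exists>bs. basis_from b = b # bs \<and> set bs = Basis - {b}" "set (basis_from b) = Basis"
    using assms by (auto simp: basis_from_def)
  show "length (basis_from b) = DIM('a)"
  proof -
    have "distinct (basis_from b)" using P by (simp add: basis_from_def)
    from distinct_card[OF this] show ?thesis by (simp add: \<open>set (basis_from b) = Basis\<close>)
  qed
qed

definition sym_field :: "('a::euclidean_space \<Rightarrow> 'a \<Rightarrow> 'a \<Rightarrow> real) \<Rightarrow> bool" where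
  "sym_field U \<longleftrightarrow> (\<forall>b c. U b c = U c b) \<and> (\<forall>b c. smooth (U b c) \<and> periodic (U b c))"

lemma sym_field_add:
  "sym_field U \<Longrightarrow> sym_field V \<Longrightarrow> sym_field (\<lambda>b c x. U b c x + V b c x)"
  by (simp add: sym_field_def smooth_add periodic_def)

text \<open>Superposition: each component of \<open>g\<close> is treated as a right-hand side in one
  row only. One factor of the dimension is the number of averages, the other the number of
  components.\<close>

lemma div_averaged:
  fixes g :: "'a::euclidean_space \<Rightarrow> 'a \<Rightarrow> real"
  assumes \<tau>: "\<tau> > 0" and g: "\<And>b. b \<in> Basis \<Longrightarrow> smooth (g b)" "\<And>b. b \<in> Basis \<Longrightarrow> periodic (g b)"
    "\<And>b x. b \<in> Basis \<Longrightarrow> \<bar>g b x\<bar> \<le> A"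
  shows "\<exists>U. sym_field U \<and> (\<forall>b c x. \<bar>U b c x\<bar> \<le> (real DIM('a))\<^sup>2 * (\<tau> * A)) \<and>
    (\<forall>b\<in>Basis. \<forall>x. (\<Sum>c\<in>Basis. partial c (U b c) x) = g b x - Mlist \<tau> (basis_from b) (g b) x)"
proof -
  define Q where "Q a U \<longleftrightarrow> sym_field U \<and> (\<forall>b c x. \<bar>U b c x\<bar> \<le> real DIM('a) * (\<tau> * A)) \<and>
    (\<forall>b\<in>Basis. \<forall>x. (\<Sum>c\<in>Basis. partial c (U b c) x)
        = (if b = a then g a x - Mlist \<tau> (basis_from a) (g a) x else 0))" for a U
  have "\<exists>U. Q a U" if a: "a \<in> Basis" for a
  proof -
    obtain bs where bs: "basis_from a = a # bs" "set bs = Basis - {a}" using basis_from(1)[OF a] by blast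
    then have "set bs \<subseteq> Basis - {a}" by simp
    from div_component[OF \<tau> a this g(1)[OF a] g(2)[OF a] g(3)[OF a]]
    show ?thesis unfolding Q_def sym_field_def basis_from(3)[OF a, symmetric] bs(1) by blast
  qed
  then have "\<forall>a\<in>Basis. \<exists>U. Q a U" by blast
  from bchoice[OF this] obtain U where Q: "\<And>a. a \<in> Basis \<Longrightarrow> Q a (U a)" by blast
  have U: "\<And>a. a \<in> Basis \<Longrightarrow> sym_field (U a)"
    "\<And>a b c x. a \<in> Basis \<Longrightarrow> \<bar>U a b c x\<bar> \<le> real DIM('a) * (\<tau> * A)"
    "\<And>a b x. a \<in> Basis \<Longrightarrow> b \<in> Basis \<Longrightarrow> (\<Sum>c\<in>Basis. partial c (U a b c) x)
        = (if b = a then g a x - Mlist \<tau> (basis_from a) (g a) x else 0)"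
    using Q unfolding Q_def by blast+
  show ?thesis
  proof (intro exI[of _ "\<lambda>b c x. \<Sum>a\<in>Basis. U a b c x"] conjI allI ballI)
    show "sym_field (\<lambda>b c x. \<Sum>a\<in>Basis. U a b c x)"
      unfolding sym_field_def
    proof (intro conjI allI)
      fix b c
      show "(\<lambda>x. \<Sum>a\<in>Basis. U a b c x) = (\<lambda>x. \<Sum>a\<in>Basis. U a c b x)"
        using U(1) by (intro ext sum.cong) (auto simp: sym_field_def)
      show "smooth (\<lambda>x. \<Sum>a\<in>Basis. U a b c x)" "periodic (\<lambda>x. \<Sum>a\<in>Basis. U a b c x)"
        using U(1) by (auto intro!: smooth_sum periodic_sum simp: sym_field_def)
    qed
    fix b c x
    have "\<bar>\<Sum>a\<in>Basis. U a b c x\<bar> \<le> (\<Sum>a\<in>(Basis::'a set). real DIM('a) * (\<tau> * A))"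
      by (rule order_trans[OF sum_abs sum_mono[OF U(2)]])
    then show "\<bar>\<Sum>a\<in>Basis. U a b c x\<bar> \<le> (real DIM('a))\<^sup>2 * (\<tau> * A)" by (simp add: power2_eq_square mult_ac)
  next
    fix b x :: 'a assume b: "b \<in> Basis"
    have "(\<Sum>c\<in>Basis. partial c (\<lambda>x. \<Sum>a\<in>Basis. U a b c x) x) = (\<Sum>c\<in>Basis. \<Sum>a\<in>Basis. partial c (U a b c) x)"
      using U(1) by (intro sum.cong partial_sum) (auto simp: sym_field_def)
    also have "\<dots> = (\<Sum>a\<in>Basis. if b = a then g a x - Mlist \<tau> (basis_from a) (g a) x else 0)"
      by (subst sum.swap) (simp add: U(3) b)
    also have "\<dots> = g b x - Mlist \<tau> (basis_from b) (g b) x"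
      using b by simp
    finally show "(\<Sum>c\<in>Basis. partial c (\<lambda>x. \<Sum>a\<in>Basis. U a b c x) x) = g b x - Mlist \<tau> (basis_from b) (g b) x" .
  qed
qed

text \<open>Continuous periodic test functions are enough: in
  \<open>weak_null_lipschitz_uniform\<close> the test function is the uniform limit of the sequence
  itself.\<close>

definition weak_null :: "(nat \<Rightarrow> 'a::euclidean_space \<Rightarrow> real) \<Rightarrow> bool" where
  "weak_null g \<longleftrightarrow> (\<forall>\<kappa>. continuous_on UNIV \<kappa> \<longrightarrow> periodic \<kappa> \<longrightarrow> (\<lambda>n. \<integral>x. g n x * \<kappa> x \<partial>torus) \<longlonglongrightarrow> 0)"

lemma weak_null_Mlist:
  assumes \<tau>: "\<tau> > 0" and bs: "set bs \<subseteq> Basis" and g: "\<And>n. smooth (g n)" "\<And>n. periodic (g n)" "weak_null g"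
  shows "weak_null (\<lambda>n. Mlist \<tau> bs (g n))"
  using bs g
proof (induction bs arbitrary: g)
  case (Cons b bs)
  have "weak_null (\<lambda>n. Mop \<tau> b (g n))"
    unfolding weak_null_def
  proof (intro allI impI)
    fix \<kappa> :: "'a \<Rightarrow> real" assume \<kappa>: "continuous_on UNIV \<kappa>" "periodic \<kappa>"
    have "(\<integral>x. Mop \<tau> b (g n) x * \<kappa> x \<partial>torus) = (\<integral>x. g n x * Mop \<tau> b \<kappa> x \<partial>torus)" for n
      using Cons.prems by (intro Mop_adjoint smooth_continuous \<kappa>) auto
    moreover have "(\<lambda>n. \<integral>x. g n x * Mop \<tau> b \<kappa> x \<partial>torus) \<longlonglongrightarrow> 0"
      using Cons.prems(4) Mop_continuous[OF \<tau> \<kappa>(1)] op_periodic(1)[OF \<tau> \<kappa>(2)] unfolding weak_null_def by blast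
    ultimately show "(\<lambda>n. \<integral>x. Mop \<tau> b (g n) x * \<kappa> x \<partial>torus) \<longlonglongrightarrow> 0" by simp
  qed
  then show ?case unfolding Mlist_Cons
    using Cons.prems by (intro Cons.IH op_smooth op_periodic \<tau>) auto
qed simp

lemma smooth_lipschitz:
  fixes h :: "'a::euclidean_space \<Rightarrow> real"
  assumes h: "smooth h" and b: "\<And>b x. b \<in> Basis \<Longrightarrow> \<bar>partial b h x\<bar> \<le> L"
  shows "\<bar>h x - h y\<bar> \<le> real DIM('a) * L * norm (x - y)"
proof -
  have L: "L \<ge> 0" using b[OF SOME_Basis, of 0] by linarith
  have "norm (h x - h y) \<le> real DIM('a) * L * norm (x - y)"
  proof (rule differentiable_bound[OF convex_UNIV smooth_has_derivative[OF h]])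
    fix z
    show "onorm (\<lambda>v. \<Sum>b\<in>Basis. (v \<bullet> b) *\<^sub>R partial b h z) \<le> real DIM('a) * L"
    proof (rule onorm_bound)
      fix v
      have "norm (\<Sum>b\<in>Basis. (v \<bullet> b) *\<^sub>R partial b h z) \<le> (\<Sum>b\<in>(Basis::'a set). norm v * L)"
        using b by (intro order_trans[OF norm_sum] sum_mono) (auto simp: abs_mult Basis_le_norm intro!: mult_mono)
      then show "norm (\<Sum>b\<in>Basis. (v \<bullet> b) *\<^sub>R partial b h z) \<le> real DIM('a) * L * norm v"
        by (simp add: mult_ac)
    qed (use L in simp)
  qed auto
  then show ?thesis by simp
qed

text \<open>A vanishing integral of the square gives zero almost everywhere on the cell; continuity
  upgrades this to the open box and its closure, periodicity to the whole space.\<close>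

lemma periodic_integral_zero:
  fixes h :: "'a::euclidean_space \<Rightarrow> real"
  assumes h: "continuous_on UNIV h" "periodic h" and z: "(\<integral>x. h x * h x \<partial>torus) = 0"
  shows "h x = 0"
proof -
  have int: "integrable torus (\<lambda>x. h x * h x)"
    by (intro integrable_torus_continuous continuous_on_mult h)
  have "AE x in torus. h x * h x = 0"
    using integral_nonneg_eq_0_iff_AE[OF int] z by simp
  then have "AE x in lebesgue. x \<in> unit_cell \<longrightarrow> h x = 0"
    by (subst (asm) AE_restrict_space_iff) auto
  then obtain N where "{x. \<not> (x \<in> unit_cell \<longrightarrow> h x = 0)} \<subseteq> N" "N \<in> null_sets lebesgue"
    unfolding eventually_ae_filter by auto
  then have N: "negligible {x. \<not> (x \<in> unit_cell \<longrightarrow> h x = 0)}"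
    using negligible_iff_null_sets negligible_subset by blast
  have "open (box 0 One \<inter> {x. h x \<noteq> 0})"
    using h(1) by (intro open_Int open_box open_Collect_neq continuous_intros) 
  moreover have "negligible (box 0 One \<inter> {x. h x \<noteq> 0})"
    by (rule negligible_subset[OF N]) (auto simp: unit_cell_def mem_box less_imp_le)
  ultimately have "box 0 One \<inter> {x. h x \<noteq> 0} = {}"
    using open_not_negligible by blast
  then have "h y = 0" if "y \<in> closure (box 0 One)" for y
    using that by (intro continuous_constant_on_closure[of "box 0 One" h 0 y] continuous_on_subset[OF h(1)]) auto
  moreover have "frac_vec x \<in> closure (box 0 One)"
    using frac_vec_in_cell[of x] unit_cell_subset_cbox by (subst closure_box) (auto simp: box_eq_empty)
  ultimately show ?thesis using periodic_frac_vec[OF h(2), of x] by simp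
qed

text \<open>Otherwise a subsequence keeps sup norm at least \<open>e\<close>. By Arzela-Ascoli it
  has a uniformly convergent further subsequence; testing the weak convergence with its limit shows
  that the square of the limit has integral zero, a contradiction.\<close>

lemma weak_null_lipschitz_uniform:
  fixes H :: "nat \<Rightarrow> 'a::euclidean_space \<Rightarrow> real"
  assumes per: "\<And>n. periodic (H n)" and lip: "\<And>n x y. \<bar>H n x - H n y\<bar> \<le> L * norm (x - y)"
    and bd: "\<And>n x. \<bar>H n x\<bar> \<le> A" and weak: "weak_null H" and e: "e > 0"
  shows "eventually (\<lambda>n. \<forall>x. \<bar>H n x\<bar> < e) sequentially"
proof (rule ccontr)
  assume "\<not> ?thesis"
  then have "infinite {n. \<not> (\<forall>x. \<bar>H n x\<bar> < e)}"
    by (simp add: eventually_sequentially infinite_nat_iff_unbounded_le)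
  then obtain r :: "nat \<Rightarrow> nat" where r: "strict_mono r" "\<And>n. \<exists>x. \<bar>H (r n) x\<bar> \<ge> e"
    using infinite_enumerate[of "{n. \<not> (\<forall>x. \<bar>H n x\<bar> < e)}"] by (auto simp: not_less)
  have L: "L \<ge> 0"
  proof -
    obtain b :: 'a where "b \<in> Basis" using nonempty_Basis by blast
    then show ?thesis using lip[of 0 b 0] by (simp add: order_trans[OF abs_ge_zero])
  qed
  obtain G k where k: "strict_mono (k :: nat \<Rightarrow> nat)"
    and G: "\<And>\<epsilon>. 0 < \<epsilon> \<Longrightarrow> \<exists>N. \<forall>n x. n \<ge> N \<and> x \<in> cbox 0 (One::'a) \<longrightarrow> norm (H (r (k n)) x - G x) < \<epsilon>"
  proof (rule Arzela_Ascoli[of "cbox 0 (One::'a)" "\<lambda>n. H (r n)" A])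
    fix x :: 'a and \<epsilon> :: real assume "0 < \<epsilon>"
    show "\<exists>d>0. \<forall>n y. y \<in> cbox 0 One \<and> norm (x - y) < d \<longrightarrow> norm (H (r n) x - H (r n) y) < \<epsilon>"
    proof (intro exI[of _ "\<epsilon> / (L + 1)"] conjI allI impI)
      fix n y assume y: "y \<in> cbox 0 One \<and> norm (x - y) < \<epsilon> / (L + 1)"
      have "\<bar>H (r n) x - H (r n) y\<bar> \<le> L * norm (x - y)" by (rule lip)
      also have "\<dots> \<le> (L + 1) * norm (x - y)" by (simp add: mult_right_mono)
      also have "\<dots> < \<epsilon>" using y L by (simp add: field_simps)
      finally show "norm (H (r n) x - H (r n) y) < \<epsilon>" by simp
    qed (use L \<open>0 < \<epsilon>\<close> in auto)
  qed (use bd in auto)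
  \<comment> \<open>Compactness yields a limit on the closed cell only. Since the functions are
    periodic, convergence to this periodic extension is uniform on the whole space, which also makes
    the extension continuous across the faces.\<close>
  define g where "g x = G (frac_vec x)" for x
  have gper: "periodic g" by (simp add: periodic_def g_def frac_vec_add_Basis)
  have unif: "\<exists>N. \<forall>n x. n \<ge> N \<longrightarrow> \<bar>H (r (k n)) x - g x\<bar> < \<epsilon>" if eps: "\<epsilon> > 0" for \<epsilon>
  proof -
    obtain N where N: "\<forall>n x. n \<ge> N \<and> x \<in> cbox 0 (One::'a) \<longrightarrow> norm (H (r (k n)) x - G x) < \<epsilon>"
      using G[OF eps] by blast
    have "\<bar>H (r (k n)) x - g x\<bar> < \<epsilon>" if "n \<ge> N" for n x
      using N[rule_format, of n "frac_vec x"] that frac_vec_in_cell[of x] unit_cell_subset_cbox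
        periodic_frac_vec[OF per, of "r (k n)" x] by (auto simp: g_def)
    then show ?thesis by blast
  qed
  have ul: "uniform_limit UNIV (\<lambda>n. H (r (k n))) g sequentially"
    unfolding uniform_limit_sequentially_iff dist_real_def using unif by blast
  have Hc: "continuous_on UNIV (H n)" for n
  proof (rule continuous_onI)
    fix x and \<epsilon> :: real assume "\<epsilon> > 0"
    show "\<exists>d>0. \<forall>x'\<in>UNIV. dist x' x < d \<longrightarrow> dist (H n x') (H n x) \<le> \<epsilon>"
    proof (intro exI[of _ "\<epsilon> / (L + 1)"] conjI ballI impI)
      fix y assume y: "dist y x < \<epsilon> / (L + 1)"
      have "\<bar>H n y - H n x\<bar> \<le> L * norm (y - x)" by (rule lip)
      also have "\<dots> \<le> (L + 1) * norm (y - x)" by (simp add: mult_right_mono)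
      also have "\<dots> \<le> \<epsilon>" using y L by (simp add: field_simps dist_norm)
      finally show "dist (H n y) (H n x) \<le> \<epsilon>" by (simp add: dist_real_def)
    qed (use L \<open>0 < \<epsilon>\<close> in auto)
  qed
  have gc: "continuous_on UNIV g"
    by (rule uniform_limit_theorem[OF _ ul]) (use Hc in auto)
  obtain B where B: "\<And>x. \<bar>g x\<bar> \<le> B" using periodic_bounded[OF gper gc] by blast
  have [measurable]: "H n \<in> borel_measurable torus" "g \<in> borel_measurable torus" for n
    using Hc gc by (auto intro!: measurable_lebesgue_on_borel borel_measurable_continuous_onI)
  have "(\<lambda>n. \<integral>x. H (r (k n)) x * g x \<partial>torus) \<longlonglongrightarrow> (\<integral>x. g x * g x \<partial>torus)"
  proof (rule integral_dominated_convergence[where w="\<lambda>_. A * B"])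
    show "AE x in torus. (\<lambda>n. H (r (k n)) x * g x) \<longlonglongrightarrow> g x * g x"
      using tendsto_uniform_limitI[OF ul] by (intro AE_I2 tendsto_mult tendsto_const) auto
    show "AE x in torus. norm (H (r (k n)) x * g x) \<le> A * B" for n
      unfolding real_norm_def abs_mult using bd B order_trans[OF abs_ge_zero bd]
      by (intro AE_I2 mult_mono) auto
  qed auto
  moreover have "(\<lambda>n. \<integral>x. H (r (k n)) x * g x \<partial>torus) \<longlonglongrightarrow> 0"
  proof -
    have "(\<lambda>n. \<integral>x. H n x * g x \<partial>torus) \<longlonglongrightarrow> 0" using weak gc gper unfolding weak_null_def by blast
    from LIMSEQ_subseq_LIMSEQ[OF this strict_mono_o[OF r(1) k]] show ?thesis by (simp add: o_def)
  qed
  ultimately have "(\<integral>x. g x * g x \<partial>torus) = 0" by (rule LIMSEQ_unique)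
  then have g0: "g x = 0" for x by (rule periodic_integral_zero[OF gc gper])
  obtain N where "\<forall>n x. n \<ge> N \<longrightarrow> \<bar>H (r (k n)) x - g x\<bar> < e" using unif[OF e] by blast
  then have "\<bar>H (r (k N)) x\<bar> < e" for x using g0 by simp
  with r(2)[of "k N"] show False by (meson not_le)
qed

lemma Mlist_weak_null_uniform:
  fixes g :: "nat \<Rightarrow> 'a::euclidean_space \<Rightarrow> real"
  assumes \<tau>: "\<tau> > 0" and bs: "set bs = Basis" and g: "\<And>n. smooth (g n)" "\<And>n. periodic (g n)"
    "\<And>n x. \<bar>g n x\<bar> \<le> A" "weak_null g" and e: "e > 0"
  shows "eventually (\<lambda>n. \<forall>x. \<bar>Mlist \<tau> bs (g n) x\<bar> < e) sequentially"
proof (rule weak_null_lipschitz_uniform[OF _ _ _ _ e])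
  show "periodic (Mlist \<tau> bs (g n))" for n by (intro Mlist_periodic \<tau> g)
  show "\<bar>Mlist \<tau> bs (g n) x - Mlist \<tau> bs (g n) y\<bar> \<le> (real DIM('a) * (A / \<tau>)) * norm (x - y)" for n x y
    using bs by (intro smooth_lipschitz Mlist_smooth partial_Mlist_bound \<tau> g) auto
  show "\<bar>Mlist \<tau> bs (g n) x\<bar> \<le> A" for n x by (intro Mlist_bound \<tau> g)
  show "weak_null (\<lambda>n. Mlist \<tau> bs (g n))" using bs by (intro weak_null_Mlist \<tau> g) auto
qed

text \<open>Two scales. Averaging at a small \<tau> inverts the divergence up to
  \<open>Mlist \<tau>\<close> of \<open>g\<close>, at cost proportional to \<tau>; for this fixed
  \<tau> the remainder is uniformly small for late \<open>n\<close>. Applied to the remainder, scale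
  1/2 leaves only its mean, and that is zero.\<close>

lemma div_inverse_small:
  fixes g :: "nat \<Rightarrow> 'a::euclidean_space \<Rightarrow> 'a \<Rightarrow> real"
  assumes g: "\<And>n b. b \<in> Basis \<Longrightarrow> smooth (g n b)" "\<And>n b. b \<in> Basis \<Longrightarrow> periodic (g n b)"
    "\<And>n b x. b \<in> Basis \<Longrightarrow> \<bar>g n b x\<bar> \<le> A" "\<And>b. b \<in> Basis \<Longrightarrow> weak_null (\<lambda>n. g n b)"
    "\<And>n b. b \<in> Basis \<Longrightarrow> (\<integral>x. g n b x \<partial>torus) = 0"
    and e: "e > 0"
  shows "eventually (\<lambda>n. \<exists>U. sym_field U \<and> (\<forall>b c x. \<bar>U b c x\<bar> \<le> e) \<and>
    (\<forall>b\<in>Basis. \<forall>x. (\<Sum>c\<in>Basis. partial c (U b c) x) = g n b x)) sequentially"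
proof -
  let ?D = "(real DIM('a))\<^sup>2"
  have D: "?D > 0" by simp
  have A: "A \<ge> 0" using g(3)[OF SOME_Basis, of 0 0] by linarith
  \<comment> \<open>Half of \<open>e\<close> is spent on the potential at scale \<tau>, the other
    half on the potential of the remainder; \<open>A + 1\<close> covers the case
    \<open>A = 0\<close>.\<close>
  define \<tau> where "\<tau> = e / (2 * ?D * (A + 1))"
  have \<tau>: "\<tau> > 0" using e D A by (simp add: \<tau>_def)
  have "?D * (\<tau> * A) \<le> ?D * (\<tau> * (A + 1))" using \<tau> by (intro mult_left_mono) auto
  also have "\<dots> = e / 2"
  proof -
    have "D * (e / (2 * D * (A + 1)) * (A + 1)) = e / 2" if "D > 0" for D :: real
    proof -
      have "A + 1 \<noteq> 0" "D \<noteq> 0" using A that by auto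
      then show ?thesis by (simp add: divide_simps)
    qed
    from this[OF D] show ?thesis unfolding \<tau>_def .
  qed
  finally have \<tau>A: "?D * (\<tau> * A) \<le> e / 2" .
  \<comment> \<open>The bound of \<open>div_averaged\<close> at scale 1/2 and size \<open>e'\<close>
    is then exactly \<open>e / 2\<close>.\<close>
  define e' where "e' = e / ?D"
  have e': "e' > 0" "?D * (1/2 * e') = e / 2" using e D by (auto simp: e'_def)
  have "eventually (\<lambda>n. \<forall>b\<in>Basis. \<forall>x. \<bar>Mlist \<tau> (basis_from b) (g n b) x\<bar> < e') sequentially"
    by (intro eventually_ball_finite finite_Basis ballI)
      (rule Mlist_weak_null_uniform[OF \<tau> basis_from(2) g(1-4) e'(1)])
  then show ?thesis
  proof (rule eventually_mono)
    fix n assume small: "\<forall>b\<in>Basis. \<forall>x. \<bar>Mlist \<tau> (basis_from b) (g n b) x\<bar> < e'"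
    obtain U where U: "sym_field U" "\<And>b c x. \<bar>U b c x\<bar> \<le> ?D * (\<tau> * A)"
      "\<And>b x. b \<in> Basis \<Longrightarrow> (\<Sum>c\<in>Basis. partial c (U b c) x) = g n b x - Mlist \<tau> (basis_from b) (g n b) x"
      using div_averaged[OF \<tau>, of "g n" A, OF g(1-3)] by blast
    define h where "h b = Mlist \<tau> (basis_from b) (g n b)" for b
    have h: "\<And>b. b \<in> Basis \<Longrightarrow> smooth (h b)" "\<And>b. b \<in> Basis \<Longrightarrow> periodic (h b)"
      "\<And>b x. b \<in> Basis \<Longrightarrow> \<bar>h b x\<bar> \<le> e'"
      using small unfolding h_def by (auto intro!: Mlist_smooth Mlist_periodic \<tau> g less_imp_le)
    have half: "(1/2::real) > 0" by simp
    obtain V where V: "sym_field V" "\<And>b c x. \<bar>V b c x\<bar> \<le> ?D * (1/2 * e')"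
      "\<And>b x. b \<in> Basis \<Longrightarrow> (\<Sum>c\<in>Basis. partial c (V b c) x) = h b x - Mlist (1/2) (basis_from b) (h b) x"
      using div_averaged[OF half, of h e', OF h] by blast
    \<comment> \<open>Averages preserve constants; by self-adjointness they preserve mean values, so
      the remainder \<open>h b\<close> inherits mean zero from \<open>g n b\<close>.\<close>
    have one: "Mlist \<tau> cs (\<lambda>_::'a. 1) = (\<lambda>_. 1)" for cs
    proof (induction cs)
      case (Cons c cs)
      have "Mop \<tau> c (\<lambda>_. 1) = (\<lambda>_::'a. 1::real)"
        by (rule ext) (use \<tau> in \<open>simp add: Mop_def line_op_def measure_restrict_space\<close>)
      with Cons show ?case by simp
    qed simp
    have mean: "Mlist (1/2) (basis_from b) (h b) x = 0" if b: "b \<in> Basis" for b x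
    proof -
      have "Mlist (1/2) (basis_from b) (h b) x = (\<integral>y. h b y * 1 \<partial>torus)"
        using Mlist_half[OF basis_from(2)[OF b] h(1)[OF b] h(2)[OF b]] by simp
      also have "\<dots> = (\<integral>y. g n b y * Mlist \<tau> (rev (basis_from b)) (\<lambda>_. 1) y \<partial>torus)"
        unfolding h_def using b basis_from(2)[OF b] g by (intro Mlist_integral \<tau>) auto
      finally show ?thesis using g(5)[OF b] by (simp add: one)
    qed
    show "\<exists>U. sym_field U \<and> (\<forall>b c x. \<bar>U b c x\<bar> \<le> e) \<and>
      (\<forall>b\<in>Basis. \<forall>x. (\<Sum>c\<in>Basis. partial c (U b c) x) = g n b x)"
    proof (intro exI[of _ "\<lambda>b c x. U b c x + V b c x"] conjI allI ballI)
      show "sym_field (\<lambda>b c x. U b c x + V b c x)" by (intro sym_field_add U V)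
      show "\<bar>U b c x + V b c x\<bar> \<le> e" for b c x
        using U(2)[of b c x] V(2)[of b c x] \<tau>A e'(2) by linarith
      fix b x :: 'a assume b: "b \<in> Basis"
      have "partial c (\<lambda>x. U b c x + V b c x) x = partial c (U b c) x + partial c (V b c) x" for c
        using U(1) V(1) by (intro partial_add) (auto simp: sym_field_def)
      then show "(\<Sum>c\<in>Basis. partial c (\<lambda>x. U b c x + V b c x) x) = g n b x"
        using U(3)[OF b, of x] V(3)[OF b, of x] mean[OF b, of x] by (simp add: sum.distrib h_def)
    qed
  qed
qed

section \<open>Cutting off and periodic extension\<close>

text \<open>Vanishing near the grid and not merely on it: derivatives then vanish there too, and the
  jumps of \<open>frac_vec\<close> become invisible.\<close>

definition vanishes_on_grid :: "('a::euclidean_space \<Rightarrow> real) \<Rightarrow> bool" where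
  "vanishes_on_grid \<theta> \<longleftrightarrow> (\<forall>x. (\<exists>b\<in>Basis. x \<bullet> b \<in> \<int>) \<longrightarrow> eventually (\<lambda>y. \<theta> y = 0) (nhds x))"

lemma eventually_nhds_partial_0:
  assumes "eventually (\<lambda>y. \<theta> y = 0) (nhds x)"
  shows "eventually (\<lambda>y. partial b \<theta> y = 0) (nhds x)"
proof -
  obtain S where S: "open S" "x \<in> S" "\<And>y. y \<in> S \<Longrightarrow> \<theta> y = 0"
    using assms by (auto simp: eventually_nhds)
  have "partial b \<theta> y = 0" if "y \<in> S" for y
  proof (rule partial_eqI)
    show "(\<theta> has_derivative (\<lambda>_. 0)) (at y)"
      by (rule has_derivative_transform_within_open[OF has_derivative_const[of 0] S(1) that])
        (simp add: S(3))
  qed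
  with S show ?thesis by (auto simp: eventually_nhds)
qed

lemma vanishes_on_grid_partial: "vanishes_on_grid \<theta> \<Longrightarrow> vanishes_on_grid (partial b \<theta>)"
  by (simp add: vanishes_on_grid_def eventually_nhds_partial_0)

text \<open>At a grid point the product is locally zero; off the grid \<open>frac_vec\<close> is
  locally a translation by a lattice vector, so the ordinary product rule applies.\<close>

lemma cut_has_derivative:
  fixes h :: "'a::euclidean_space \<Rightarrow> real"
  assumes \<theta>: "vanishes_on_grid \<theta>" "smooth \<theta>" and h: "smooth h"
  shows "((\<lambda>x. \<theta> x * h (frac_vec x)) has_derivative
    (\<lambda>v. \<Sum>b\<in>Basis. (v \<bullet> b) *\<^sub>R (\<theta> x * partial b h (frac_vec x) + partial b \<theta> x * h (frac_vec x)))) (at x)"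
proof (cases "\<exists>b\<in>Basis. x \<bullet> b \<in> \<int>")
  case True
  then have ev: "eventually (\<lambda>y. \<theta> y = 0) (nhds x)" using \<theta> by (simp add: vanishes_on_grid_def)
  then obtain S where S: "open S" "x \<in> S" "\<And>y. y \<in> S \<Longrightarrow> \<theta> y = 0" by (auto simp: eventually_nhds)
  have "partial b \<theta> x = 0" for b
    using eventually_nhds_x_imp_x[OF eventually_nhds_partial_0[OF ev]] .
  moreover have "((\<lambda>x. \<theta> x * h (frac_vec x)) has_derivative (\<lambda>_. 0)) (at x)"
    by (rule has_derivative_transform_within_open[OF has_derivative_const[of 0] S(1,2)]) (simp add: S(3))
  ultimately show ?thesis using S by simp
next
  case False
  define c where "c = (\<Sum>b\<in>Basis. of_int \<lfloor>x \<bullet> b\<rfloor> *\<^sub>R b)"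
  define S where "S = box c (c + One)"
  have cb: "c \<bullet> b = of_int \<lfloor>x \<bullet> b\<rfloor>" if "b \<in> Basis" for b
    using that by (simp add: c_def)
  have xS: "x \<in> S"
    unfolding S_def mem_box
  proof
    fix b :: 'a assume b: "b \<in> Basis"
    then have "x \<bullet> b \<noteq> of_int \<lfloor>x \<bullet> b\<rfloor>" using False by (metis Ints_of_int)
    then show "c \<bullet> b < x \<bullet> b \<and> x \<bullet> b < (c + One) \<bullet> b"
      using b by (auto simp: cb inner_add_left) linarith+
  qed
  have fr: "frac_vec y = - c + 1 *\<^sub>R y" if "y \<in> S" for y
  proof -
    have "\<lfloor>y \<bullet> b\<rfloor> = \<lfloor>x \<bullet> b\<rfloor>" if "b \<in> Basis" for b
      using \<open>y \<in> S\<close> that by (auto simp: S_def mem_box cb inner_add_left floor_eq_iff less_imp_le)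
    then show ?thesis by (simp add: frac_vec_eq c_def)
  qed
  have "((\<lambda>x. \<theta> x * h (- c + 1 *\<^sub>R x)) has_derivative
    (\<lambda>v. \<Sum>b\<in>Basis. (v \<bullet> b) *\<^sub>R partial b (\<lambda>x. \<theta> x * h (- c + 1 *\<^sub>R x)) x)) (at x)"
    by (intro smooth_has_derivative smooth_mult smooth_affine \<theta> h)
  moreover have "partial b (\<lambda>x. \<theta> x * h (- c + 1 *\<^sub>R x)) x
      = \<theta> x * partial b h (frac_vec x) + partial b \<theta> x * h (frac_vec x)" for b
    unfolding partial_mult[OF \<theta>(2) smooth_affine[OF h]] partial_affine[OF h] fr[OF xS] by simp
  ultimately have D: "((\<lambda>x. \<theta> x * h (- c + 1 *\<^sub>R x)) has_derivative
    (\<lambda>v. \<Sum>b\<in>Basis. (v \<bullet> b) *\<^sub>R (\<theta> x * partial b h (frac_vec x) + partial b \<theta> x * h (frac_vec x)))) (at x)"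
    by (simp only:)
  have "open S" unfolding S_def by (rule open_box)
  show ?thesis
    by (rule has_derivative_transform_within_open[OF D \<open>open S\<close> xS]) (simp only: fr)
qed

lemma
  fixes h :: "'a::euclidean_space \<Rightarrow> real"
  assumes \<theta>: "vanishes_on_grid \<theta>" "smooth \<theta>" and h: "smooth h"
  shows cut_smooth: "smooth (\<lambda>x. \<theta> x * h (frac_vec x))"
    and partial_cut: "b \<in> Basis \<Longrightarrow> partial b (\<lambda>x. \<theta> x * h (frac_vec x)) x
      = \<theta> x * partial b h (frac_vec x) + partial b \<theta> x * h (frac_vec x)"
proof -
  have pick: "(\<Sum>a\<in>Basis. (b \<bullet> a) *\<^sub>R F a) = F b" if "b \<in> Basis" for b and F :: "'a \<Rightarrow> real"
    using that by (simp add: inner_Basis if_distrib[of "\<lambda>c. c * _"] cong: if_cong)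
  show "b \<in> Basis \<Longrightarrow> partial b (\<lambda>x. \<theta> x * h (frac_vec x)) x
      = \<theta> x * partial b h (frac_vec x) + partial b \<theta> x * h (frac_vec x)"
    using partial_eqI[OF cut_has_derivative[OF assms]] pick by simp
  have "Ck k (\<lambda>x. \<theta> x * h (frac_vec x))" for k
    using assms
  proof (induction k arbitrary: \<theta> h)
    case 0
    show ?case
      using cut_has_derivative[OF 0] by (auto intro!: continuous_at_imp_continuous_on has_derivative_continuous)
  next
    case (Suc k)
    show ?case
    proof (rule Ck_SucI[OF cut_has_derivative[OF Suc.prems]])
      fix b :: 'a assume b: "b \<in> Basis"
      show "Ck k (\<lambda>x. \<Sum>a\<in>Basis. (b \<bullet> a) *\<^sub>R (\<theta> x * partial a h (frac_vec x) + partial a \<theta> x * h (frac_vec x)))"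
        unfolding pick[OF b]
        by (intro Ck_add Suc.IH vanishes_on_grid_partial smooth_partial Suc.prems b)
    qed
  qed
  then show "smooth (\<lambda>x. \<theta> x * h (frac_vec x))" by (simp add: smooth_def)
qed

lemma cut_periodic: "periodic \<theta> \<Longrightarrow> periodic (\<lambda>x. \<theta> x * h (frac_vec x) :: real)"
  by (simp add: periodic_def frac_vec_add_Basis)

text \<open>Near an integer coordinate the term \<open>- real m\<close> makes the argument of
  \<open>psi\<close> negative, so the factor vanishes; at a fixed point off the grid the quadratic
  term wins and every factor tends to 1. The cosine provides periodicity.\<close>

definition cutoff :: "nat \<Rightarrow> 'a::euclidean_space \<Rightarrow> real" where
  "cutoff m x = (\<Prod>b\<in>Basis. psi ((real m)\<^sup>2 * (1 - cos (2 * pi * (x \<bullet> b))) - real m))"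

lemma cutoff_smooth: "smooth (cutoff m :: 'a::euclidean_space \<Rightarrow> real)"
proof -
  have "smooth (\<lambda>x::'a. (real m)\<^sup>2 * (1 - cos (2 * pi * (x \<bullet> b))) - real m)" for b
    by (intro smooth_diff smooth_mult smooth_const smooth_compose_real[OF smooth_cos] smooth_inner)
  then show ?thesis
    unfolding cutoff_def[abs_def] by (intro smooth_prod smooth_compose_real[OF smooth_psi])
qed

lemma cutoff_periodic: "periodic (cutoff m)"
proof -
  have "cos (2 * pi * (x + t)) = cos (2 * pi * x)" if "t = 0 \<or> t = 1" for x t :: real
    using that cos_periodic[of "2 * pi * x"] by (auto simp: distrib_left)
  then show ?thesis by (auto simp: periodic_def cutoff_def inner_add_left inner_Basis)
qed

lemma cutoff_bounds: "0 \<le> cutoff m x" "cutoff m x \<le> 1"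
  by (auto simp: cutoff_def psi_nonneg psi_le_1 intro!: prod_nonneg prod_le_1)

lemma cutoff_vanishes:
  assumes "m > 0" shows "vanishes_on_grid (cutoff m :: 'a::euclidean_space \<Rightarrow> real)"
  unfolding vanishes_on_grid_def
proof (intro allI impI)
  fix x :: 'a assume "\<exists>b\<in>Basis. x \<bullet> b \<in> \<int>"
  then obtain b where b: "b \<in> Basis" "x \<bullet> b \<in> \<int>" by blast
  define S where "S = {y::'a. (real m)\<^sup>2 * (1 - cos (2 * pi * (y \<bullet> b))) < real m}"
  have "open S" unfolding S_def by (intro open_Collect_less continuous_intros)
  moreover have "x \<in> S"
  proof -
    obtain n where "x \<bullet> b = of_int n" using b(2) by (auto elim: Ints_cases)
    then have "cos (2 * pi * (x \<bullet> b)) = 1" using cos_int_2pin[of n] by (simp add: mult_ac)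
    then show ?thesis using assms by (simp add: S_def)
  qed
  moreover have "cutoff m y = 0" if "y \<in> S" for y
    unfolding cutoff_def using that b(1) by (auto simp: S_def intro!: prod_zero bexI[of _ b] psi_eq_0)
  ultimately show "eventually (\<lambda>y. cutoff m y = 0) (nhds x)" by (auto simp: eventually_nhds)
qed

lemma psi_tendsto_1: "(psi \<longlongrightarrow> 1) at_top"
proof -
  have "((\<lambda>t::real. exp (- inverse t)) \<longlongrightarrow> exp (- 0)) at_top"
    by (intro tendsto_intros tendsto_inverse_0_at_top filterlim_ident)
  then show ?thesis
    by (auto elim!: Lim_transform_eventually intro!: eventually_mono[OF eventually_gt_at_top[of 0]]
        simp: psi_def field_simps)
qed

lemma cutoff_integral_tendsto: "(\<lambda>m. \<integral>x. 1 - cutoff m x \<partial>(torus :: 'a::euclidean_space measure)) \<longlonglongrightarrow> 0"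
proof -
  have "(\<lambda>m. \<integral>x. 1 - cutoff m x \<partial>(torus :: 'a measure)) \<longlonglongrightarrow> (\<integral>x. 0 \<partial>(torus :: 'a measure))"
  proof (rule integral_dominated_convergence[where w="\<lambda>_. 1"])
    show "(\<lambda>x. 1 - cutoff m x) \<in> borel_measurable (torus :: 'a measure)" for m
      by (intro measurable_lebesgue_on_borel borel_measurable_continuous_onI smooth_continuous
          smooth_diff cutoff_smooth smooth_const)
    show "AE x in (torus :: 'a measure). norm (1 - cutoff m x) \<le> 1" for m
    proof (rule AE_I2)
      fix x :: 'a show "norm (1 - cutoff m x) \<le> 1"
        using cutoff_bounds[of m x] by (simp add: abs_le_iff)
    qed
    have "AE x in (lebesgue :: 'a measure). \<forall>b\<in>Basis. x \<bullet> b \<noteq> 0"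
    proof (subst AE_finite_all[OF finite_Basis], rule ballI)
      fix b :: 'a assume b: "b \<in> Basis"
      show "AE x in (lebesgue :: 'a measure). x \<bullet> b \<noteq> 0"
        using negligible_standard_hyperplane[OF b, of 0] negligible_iff_null_sets
        by (intro AE_I'[of "{x. x \<bullet> b = 0}"]) auto
    qed
    then have "AE x in (torus :: 'a measure). \<forall>b\<in>Basis. x \<bullet> b \<noteq> 0"
      by (subst AE_restrict_space_iff) auto
    then show "AE x in (torus :: 'a measure). (\<lambda>m. 1 - cutoff m x) \<longlonglongrightarrow> 0"
    proof (rule AE_mp, intro AE_I2 impI)
      fix x :: 'a assume x: "x \<in> space torus" "\<forall>b\<in>Basis. x \<bullet> b \<noteq> 0"
      have "(\<lambda>m. cutoff m x) \<longlonglongrightarrow> (\<Prod>b\<in>(Basis::'a set). 1)"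
        unfolding cutoff_def
      proof (rule tendsto_prod)
        fix b :: 'a assume b: "b \<in> Basis"
        define t where "t = 1 - cos (2 * pi * (x \<bullet> b))"
        have xb: "0 < x \<bullet> b" "x \<bullet> b < 1" using x b by (auto simp: unit_cell_def order_less_le)
        have "cos (2 * pi * (x \<bullet> b)) \<noteq> 1"
        proof
          assume "cos (2 * pi * (x \<bullet> b)) = 1"
          then obtain n :: int where "2 * pi * (x \<bullet> b) = of_int n * 2 * pi" by (auto simp: cos_one_2pi_int)
          then have "x \<bullet> b = of_int n" by simp
          with xb have "0 < n" "n < 1" by (metis of_int_0_less_iff, metis of_int_less_1_iff)
          then show False by simp
        qed
        then have "t > 0" using cos_le_one[of "2 * pi * (x \<bullet> b)"] by (simp add: t_def order_less_le)
        then have "filterlim (\<lambda>m. (real m)\<^sup>2 * t - real m) at_top sequentially" by real_asymp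
        from filterlim_compose[OF psi_tendsto_1 this]
        show "(\<lambda>m. psi ((real m)\<^sup>2 * (1 - cos (2 * pi * (x \<bullet> b))) - real m)) \<longlonglongrightarrow> 1" by (simp add: t_def)
      qed
      then have "(\<lambda>m. 1 - cutoff m x) \<longlonglongrightarrow> 1 - 1" by (intro tendsto_diff tendsto_const) simp
      then show "(\<lambda>m. 1 - cutoff m x) \<longlonglongrightarrow> 0" by simp
    qed
  qed auto
  then show ?thesis by simp
qed

section \<open>The lift as a symmetric matrix in space-time\<close>

text \<open>
  A state \<open>(\<rho>, m, M, Q)\<close> is the symmetric \<open>(d+1) \<times> (d+1)\<close> matrix with rows \<open>(\<rho>, m)\<close> and
  \<open>(m, M + Q mat 1)\<close>, indexed by the basis vectors of space-time; \<open>A_E\<close> is its row-wise divergence.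
\<close>
abbreviation e_t :: "real \<times> (real^'n)" where "e_t \<equiv> (1, 0)"
abbreviation e_x :: "'n \<Rightarrow> real \<times> (real^'n)" where "e_x i \<equiv> (0, axis i 1)"

lemma axis_inj: "inj (\<lambda>i::'n::finite. axis i (1::real))"
  by (rule injI) (simp add: axis_eq_axis)

lemma e_basis: "e_t \<in> Basis" "e_x i \<in> Basis"
  by (auto simp: Basis_prod_def Basis_vec_def)

lemma sum_space_time:
  "(\<Sum>c\<in>(Basis :: (real \<times> (real^'n::finite)) set). F c) = F e_t + (\<Sum>i\<in>UNIV. F (e_x i))"
proof -
  have B: "(Basis :: (real^'n) set) = range (\<lambda>i. axis i 1)" by (auto simp: Basis_vec_def)
  have "(\<Sum>u\<in>(Basis :: (real^'n) set). F (0, u)) = (\<Sum>i\<in>UNIV. F (e_x i))"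
    unfolding B by (simp add: sum.reindex axis_inj)
  moreover have "(\<Sum>c\<in>(Basis :: (real \<times> (real^'n)) set). F c)
      = (\<Sum>c\<in>(\<lambda>u. (u, 0)) ` (Basis::real set). F c) + (\<Sum>c\<in>(\<lambda>u. (0, u)) ` (Basis::(real^'n) set). F c)"
    unfolding Basis_prod_def by (rule sum.union_disjoint) auto
  moreover have "inj_on (\<lambda>u. (0::real, u)) (Basis::(real^'n) set)" by (auto simp: inj_on_def)
  ultimately show ?thesis
    by (simp add: sum.reindex)
qed

lemma Basis_space_time_cases:
  assumes "b \<in> (Basis :: (real \<times> (real^'n::finite)) set)"
  obtains "b = e_t" | i where "b = e_x i"
  using assms by (auto simp: Basis_prod_def Basis_vec_def)

text \<open>Inverse of the matrix encoding: \<open>q\<close> is the mean of the spatial diagonal, so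
  subtracting it leaves the trace-free part. Only the values of \<open>A\<close> at pairs of basis
  vectors count, the rest of the function is irrelevant by \<open>to_state_cong\<close>.\<close>

definition to_state :: "(real \<times> (real^'n) \<Rightarrow> real \<times> (real^'n) \<Rightarrow> real) \<Rightarrow> 'n::finite state" where
  "to_state A = (let q = (\<Sum>k\<in>UNIV. A (e_x k) (e_x k)) / real CARD('n) in
     (A e_t e_t, \<chi> i. A e_t (e_x i), \<chi> i j. A (e_x i) (e_x j) - (if i = j then q else 0), q))"

lemma to_state_add: "to_state (\<lambda>b c. A b c + B b c) = to_state A + to_state B"
  by (simp add: to_state_def Let_def vec_eq_iff sum.distrib add_divide_distrib)

lemma to_state_cmult: "to_state (\<lambda>b c. r * A b c) = r *\<^sub>R to_state A"
  by (simp add: to_state_def Let_def vec_eq_iff sum_distrib_left[symmetric] algebra_simps)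

lemma to_state_0: "to_state (\<lambda>b c. 0) = 0"
  by (simp add: to_state_def Let_def vec_eq_iff zero_prod_def)

lemma to_state_diff: "to_state (\<lambda>b c. A b c - B b c) = to_state A - to_state B"
  using to_state_add[of A "\<lambda>b c. -1 * B b c"] by (simp only: to_state_cmult) simp

lemma to_state_sum: "to_state (\<lambda>b c. \<Sum>i\<in>I. A i b c) = (\<Sum>i\<in>I. to_state (A i))"
  by (induction I rule: infinite_finite_induct) (auto simp: to_state_0 to_state_add)

lemma to_state_cong:
  "(\<And>b c. b \<in> Basis \<Longrightarrow> c \<in> Basis \<Longrightarrow> A b c = B b c) \<Longrightarrow> to_state A = to_state B"
  by (simp add: to_state_def e_basis)

definition unit_state :: "real \<times> (real^'n) \<Rightarrow> real \<times> (real^'n) \<Rightarrow> 'n::finite state" where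
  "unit_state b c = to_state (\<lambda>b' c'. if b' = b \<and> c' = c then 1 else 0)"

text \<open>A finite linear expansion in the entries, by which smoothness, integrability, integrals
  and norm bounds of states are reduced to scalar functions.\<close>

lemma to_state_expand:
  fixes A :: "real \<times> (real^'n::finite) \<Rightarrow> real \<times> (real^'n) \<Rightarrow> real"
  shows "to_state A = (\<Sum>b\<in>Basis. \<Sum>c\<in>Basis. A b c *\<^sub>R unit_state b c)"
proof -
  have "to_state A = to_state (\<lambda>b' c'. \<Sum>b\<in>Basis. \<Sum>c\<in>Basis. A b c * (if b' = b \<and> c' = c then 1 else 0))"
  proof (rule to_state_cong)
    fix b' c' :: "real \<times> (real^'n)" assume "b' \<in> Basis" "c' \<in> Basis"
    have "(\<Sum>c\<in>Basis. A b c * (if b' = b \<and> c' = c then 1 else 0)) = (if b' = b then A b c' else 0)" for b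
      using \<open>c' \<in> Basis\<close> by (simp add: if_distrib[of "\<lambda>t. _ * t"] sum.delta cong: if_cong)
    then show "A b' c' = (\<Sum>b\<in>Basis. \<Sum>c\<in>Basis. A b c * (if b' = b \<and> c' = c then 1 else 0))"
      using \<open>b' \<in> Basis\<close> by simp
  qed
  then show ?thesis by (simp add: to_state_sum to_state_cmult unit_state_def)
qed

lemma to_state_norm_bound:
  obtains K where "K \<ge> 0"
    "\<And>A :: real \<times> (real^'n) \<Rightarrow> real \<times> (real^'n) \<Rightarrow> real.
       norm (to_state A :: 'n::finite state) \<le> K * (\<Sum>b\<in>Basis. \<Sum>c\<in>Basis. \<bar>A b c\<bar>)"
proof -
  define K where "K = (\<Sum>b\<in>Basis. \<Sum>c\<in>Basis. norm (unit_state b c :: 'n state))"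
  have le: "norm (unit_state b c :: 'n state) \<le> K" if "b \<in> Basis" "c \<in> Basis" for b c
  proof -
    have "norm (unit_state b c :: 'n state) \<le> (\<Sum>c\<in>Basis. norm (unit_state b c :: 'n state))"
      using that by (intro member_le_sum) auto
    also have "\<dots> \<le> K" unfolding K_def
      using that by (intro member_le_sum[of b Basis "\<lambda>b. \<Sum>c\<in>Basis. norm (unit_state b c :: 'n state)"] sum_nonneg) auto
    finally show ?thesis .
  qed
  show ?thesis
  proof (rule that[of K])
    show "K \<ge> 0" unfolding K_def by (intro sum_nonneg) auto
    fix A :: "real \<times> (real^'n) \<Rightarrow> real \<times> (real^'n) \<Rightarrow> real"
    have "norm (to_state A :: 'n state) \<le> (\<Sum>b\<in>Basis. \<Sum>c\<in>Basis. \<bar>A b c\<bar> * norm (unit_state b c :: 'n state))"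
      unfolding to_state_expand by (intro order_trans[OF norm_sum] sum_mono) simp
    also have "\<dots> \<le> (\<Sum>b\<in>Basis. \<Sum>c\<in>Basis. \<bar>A b c\<bar> * K)"
      by (intro sum_mono mult_left_mono le) auto
    finally show "norm (to_state A :: 'n state) \<le> K * (\<Sum>b\<in>Basis. \<Sum>c\<in>Basis. \<bar>A b c\<bar>)"
      by (simp add: sum_distrib_left mult.commute)
  qed
qed

lemma to_state_lifted:
  assumes "\<And>b c. b \<in> Basis \<Longrightarrow> c \<in> Basis \<Longrightarrow> A b c = A c b"
  shows "to_state A \<in> lifted_space"
proof -
  have "A (e_x i) (e_x j) = A (e_x j) (e_x i)" for i j using assms e_basis by blast
  then show ?thesis
    by (auto simp: to_state_def Let_def lifted_space_def sym_trace_free_def transpose_def vec_eq_iff trace_def sum_subtractf)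
qed

lemma closed_lifted_space: "closed (lifted_space :: ('n::finite) state set)"
proof -
  have "closed {M :: real^'n^'n. transpose M = M}"
  proof -
    have "{M :: real^'n^'n. transpose M = M} = (\<Inter>i. \<Inter>j. {M. M $ i $ j = M $ j $ i})"
      by (auto simp: transpose_def vec_eq_iff)
    also have "closed \<dots>" by (intro closed_INT ballI closed_Collect_eq continuous_intros)
    finally show ?thesis .
  qed
  moreover have "closed {M :: real^'n^'n. trace M = 0}"
    unfolding trace_def by (intro closed_Collect_eq continuous_intros)
  ultimately have "closed (sym_trace_free :: (real^'n^'n) set)"
    unfolding sym_trace_free_def by (simp add: Collect_conj_eq closed_Int)
  then show ?thesis unfolding lifted_space_def by (intro closed_Times closed_UNIV)
qed

lemma to_state_smooth:
  fixes G :: "real \<times> (real^'n::finite) \<Rightarrow> real \<times> (real^'n) \<Rightarrow> real \<times> (real^'n) \<Rightarrow> real"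
  assumes "\<And>b c. smooth (G b c)"
  shows "smooth (\<lambda>x. to_state (\<lambda>b c. G b c x))"
  unfolding to_state_expand by (intro smooth_sum smooth_scaleR_vec assms)

lemma partial_vec_nth:
  fixes f :: "'a::euclidean_space \<Rightarrow> real^'n::finite"
  assumes "f differentiable at p"
  shows "partial b f p $ i = partial b (\<lambda>q. f q $ i) p"
  by (subst partial_eqI[OF bounded_linear.has_derivative[OF bounded_linear_vec_nth has_frechet_derivative[OF assms]]])
    (simp add: partial_def)

text \<open>The diagonal part \<open>q\<close> removed from the spatial block is returned by the
  gradient of the last component, so the momentum rows see the full matrix. Symmetry identifies the
  first column, which is differentiated in time, with the first row.\<close>

lemma A_E_to_state:
  fixes G :: "real \<times> (real^'n::finite) \<Rightarrow> real \<times> (real^'n) \<Rightarrow> real \<times> (real^'n) \<Rightarrow> real"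
  assumes G: "\<And>b c. smooth (G b c)" and sym: "\<And>b c. G b c = G c b"
    and div: "\<And>b. b \<in> Basis \<Longrightarrow> (\<Sum>c\<in>Basis. partial c (G b c) p) = 0"
  shows "A_E (\<lambda>x. to_state (\<lambda>b c. G b c x)) p = 0"
proof -
  define q where "q = (\<lambda>x. (\<Sum>k\<in>UNIV. G (e_x k) (e_x k) x) / real CARD('n))"
  define m where "m = (\<lambda>x. \<chi> i. G e_t (e_x i) x)"
  have q: "smooth q"
  proof -
    have "smooth (\<lambda>x. (1 / real CARD('n)) * (\<Sum>k\<in>UNIV. G (e_x k) (e_x k) x))"
      by (intro smooth_mult smooth_const smooth_sum G)
    then show ?thesis by (simp add: q_def)
  qed
  have "smooth m"
  proof -
    have "m = (\<lambda>x. \<Sum>i\<in>UNIV. G e_t (e_x i) x *\<^sub>R axis i 1)"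
      by (auto simp: m_def vec_eq_iff axis_def if_distrib[of "(*) _"] cong: if_cong)
    then show ?thesis using G by (simp add: smooth_sum smooth_scaleR_vec)
  qed
  then have dm: "dt m p $ i = partial e_t (G e_t (e_x i)) p" for i
    using partial_vec_nth[OF smooth_differentiable[OF \<open>smooth m\<close>], of e_t p i]
    by (simp add: dt_def partial_def m_def)
  have S: "(\<lambda>x. to_state (\<lambda>b c. G b c x)) = (\<lambda>x. (G e_t e_t x, m x,
      \<chi> i j. G (e_x i) (e_x j) x - (if i = j then q x else 0), q x))"
    unfolding to_state_def Let_def q_def m_def by (rule refl)
  have dxe: "dx j f p = partial (e_x j) f p" for j and f :: "_ \<Rightarrow> real" by (simp add: dx_def partial_def)
  have row: "(dt m p + Div_x (\<lambda>x. \<chi> i j. G (e_x i) (e_x j) x - (if i = j then q x else 0)) p + grad_x q p) $ i = 0" for i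
  proof -
    have "(\<Sum>j\<in>UNIV. partial (e_x j) (\<lambda>x. G (e_x i) (e_x j) x - (if i = j then q x else 0)) p)
        = (\<Sum>j\<in>UNIV. partial (e_x j) (G (e_x i) (e_x j)) p - (if i = j then partial (e_x j) q p else 0))"
      by (intro sum.cong refl) (auto simp: partial_diff[OF G q])
    also have "\<dots> = (\<Sum>j\<in>UNIV. partial (e_x j) (G (e_x i) (e_x j)) p) - partial (e_x i) q p"
      by (simp add: sum_subtractf)
    finally show ?thesis
      using div[OF e_basis(2)[of i]] unfolding sum_space_time
      by (simp add: dm Div_x_def grad_x_def dxe sym[of e_t])
  qed
  have "dt (G e_t e_t) p + div_x m p = 0"
    using div[OF e_basis(1)] unfolding sum_space_time
    by (simp add: div_x_def m_def dxe dt_def partial_def)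
  moreover have "dt m p + Div_x (\<lambda>x. \<chi> i j. G (e_x i) (e_x j) x - (if i = j then q x else 0)) p + grad_x q p = 0"
    unfolding vec_eq_iff using row by simp
  ultimately show ?thesis unfolding A_E_def S Let_def by (simp add: zero_prod_def)
qed

text \<open>The matrix \<open>(1,u) \<otimes> (1,u)\<close> with the pressure added on the spatial
  diagonal, written as a bilinear form in the index vectors.\<close>

definition lift_entry :: "(real^'n) \<times> real \<Rightarrow> real \<times> (real^'n) \<Rightarrow> real \<times> (real^'n) \<Rightarrow> real" where
  "lift_entry z b c = ((1, fst z) \<bullet> b) * ((1, fst z) \<bullet> c) + snd z * (snd b \<bullet> snd c)"

lemma lift_entry_simps [simp]:
  "lift_entry z e_t e_t = 1" "lift_entry z e_t (e_x i) = fst z $ i" "lift_entry z (e_x i) e_t = fst z $ i"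
  "lift_entry z (e_x i) (e_x j) = fst z $ i * fst z $ j + (if i = j then snd z else 0)"
  by (auto simp: lift_entry_def inner_axis inner_axis_axis) (auto simp: axis_def)

lemma lift_entry_sym: "lift_entry z b c = lift_entry z c b"
  by (simp add: lift_entry_def inner_commute mult.commute)

lemma lift_S_to_state: "lift_S z = to_state (lift_entry z)"
proof -
  obtain u P where z: "z = (u, P)" by (cases z)
  have "(\<Sum>k\<in>UNIV. u $ k * u $ k) = (norm u)\<^sup>2"
    by (simp add: power2_norm_eq_inner inner_vec_def)
  then have q: "(\<Sum>k\<in>UNIV. lift_entry z (e_x k) (e_x k)) / real CARD('a) = P + (norm u)\<^sup>2 / real CARD('a)"
    by (simp add: z sum.distrib add_divide_distrib)
  show ?thesis
    unfolding to_state_def q Let_def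
    by (simp add: lift_S_def z vec_eq_iff outer_def mat_def)
qed

lemma continuous_lift_entry: "continuous_on S (\<lambda>z. lift_entry z b c)"
  unfolding lift_entry_def by (intro continuous_intros)

lemma continuous_to_state:
  assumes "\<And>b c. continuous_on S (A b c)" shows "continuous_on S (\<lambda>x. to_state (\<lambda>b c. A b c x))"
  unfolding to_state_expand by (intro continuous_intros assms)

lemma lift_entry_bound:
  assumes "norm z \<le> C" "b \<in> Basis" "c \<in> Basis"
  shows "\<bar>lift_entry z b c\<bar> \<le> (1 + C)\<^sup>2 + C"
proof -
  have n: "norm (fst z) \<le> C" "\<bar>snd z\<bar> \<le> C"
    using assms(1) norm_fst_le[of "fst z" "snd z"] norm_snd_le[of "snd z" "fst z"] by auto
  have "norm (1::real, fst z) \<le> 1 + C" using norm_Pair_le[of "1::real" "fst z"] n by simp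
  then have *: "\<bar>(1::real, fst z) \<bullet> b\<bar> \<le> 1 + C" if "b \<in> Basis" for b
    using Basis_le_norm[OF that, of "(1::real, fst z)"] by linarith
  have "\<bar>snd b \<bullet> snd c\<bar> \<le> 1"
    using assms(2,3) by (auto elim!: Basis_space_time_cases simp: inner_axis_axis)
  then have "\<bar>snd z * (snd b \<bullet> snd c)\<bar> \<le> C * 1"
    unfolding abs_mult using n by (intro mult_mono) auto
  moreover have "\<bar>((1, fst z) \<bullet> b) * ((1, fst z) \<bullet> c)\<bar> \<le> (1 + C) * (1 + C)"
    unfolding abs_mult using *[OF assms(2)] *[OF assms(3)] n by (intro mult_mono) auto
  ultimately show ?thesis unfolding lift_entry_def power2_eq_square by linarith
qed

section \<open>Jensen's inequality for homogeneous Young measures\<close>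

text \<open>On a compact set a continuous function is Lipschitz up to an error \<open>e\<close>: at
  distance at least \<open>d\<close> the oscillation, at most 2B, is below (2B/d) times the
  distance. Thus L1 closeness of bounded fields controls integrals of any continuous
  \<open>f\<close>.\<close>

lemma compact_modulus:
  fixes f :: "'a::euclidean_space \<Rightarrow> real"
  assumes f: "continuous_on S f" and S: "closed S" and e: "e > 0"
  obtains L where "L \<ge> 0"
    "\<And>a b. a \<in> S \<Longrightarrow> b \<in> S \<Longrightarrow> norm a \<le> R \<Longrightarrow> norm b \<le> R \<Longrightarrow> f a \<le> f b + e + L * norm (a - b)"
proof -
  let ?K = "S \<inter> cball 0 R"
  have K: "compact ?K" using S by (simp add: closed_Int_compact)
  have fK: "continuous_on ?K f" using f continuous_on_subset by blast
  obtain d where d: "d > 0" "\<And>a b. a \<in> ?K \<Longrightarrow> b \<in> ?K \<Longrightarrow> dist b a < d \<Longrightarrow> dist (f b) (f a) < e"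
    using compact_uniformly_continuous[OF fK K] e unfolding uniformly_continuous_on_def by metis
  have "bounded (f ` ?K)" using compact_continuous_image[OF fK K] compact_imp_bounded by blast
  then obtain B where B: "\<And>a. a \<in> ?K \<Longrightarrow> \<bar>f a\<bar> \<le> B"
    by (metis bounded_iff imageI real_norm_def)
  show ?thesis
  proof (rule that[of "2 * max 0 B / d"])
    show "2 * max 0 B / d \<ge> 0" using d by simp
    fix a b assume "a \<in> S" "b \<in> S" "norm a \<le> R" "norm b \<le> R"
    then have ab: "a \<in> ?K" "b \<in> ?K" by auto
    show "f a \<le> f b + e + 2 * max 0 B / d * norm (a - b)"
    proof (cases "dist a b < d")
      case True
      then have "f a \<le> f b + e" using d(2)[OF ab(2,1)] by (simp add: dist_real_def)
      moreover have "0 \<le> 2 * max 0 B / d * norm (a - b)" using d by simp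
      ultimately show ?thesis by linarith
    next
      case False
      then have "2 * max 0 B \<le> 2 * max 0 B / d * norm (a - b)"
        using d mult_left_mono[of d "norm (a - b)" "max 0 B"] by (simp add: field_simps dist_norm)
      moreover have "f a - f b \<le> 2 * max 0 B" using B[OF ab(1)] B[OF ab(2)] by linarith
      ultimately show ?thesis using e by linarith
    qed
  qed
qed

lemma integrable_torus_bounded:
  fixes h :: "'a::euclidean_space \<Rightarrow> real"
  assumes "h \<in> borel_measurable borel" "\<And>x. x \<in> unit_cell \<Longrightarrow> \<bar>h x\<bar> \<le> B"
  shows "integrable torus h"
  using assms by (intro torus.integrable_const_bound[where B=B] measurable_lebesgue_on_borel) auto

text \<open>What blow-up and mollification provide: \<open>V\<close> are the rescaled generating
  functions, \<open>W\<close> the smooth fields near their lifts. The test functions in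
  \<open>V_lim\<close> depend on the position too, which expresses that the limit measure is the
  same at every point. \<open>W\<close> is controlled on one cell only, hence the later cutting
  off.\<close>

locale homogeneous_limit =
  fixes \<mu>0 :: "((real^'n::finite) \<times> real) measure"
    and V :: "nat \<Rightarrow> real \<times> (real^'n) \<Rightarrow> (real^'n) \<times> real"
    and W :: "nat \<Rightarrow> real \<times> (real^'n) \<Rightarrow> real \<times> (real^'n) \<Rightarrow> real \<times> (real^'n) \<Rightarrow> real"
    and C C' :: real
  assumes prob: "prob_space \<mu>0" and sets_\<mu>0: "sets \<mu>0 = sets borel"
    and supp: "AE z in \<mu>0. norm z \<le> C"
    and V_meas: "\<And>k. V k \<in> borel_measurable borel" and V_bound: "\<And>k x. norm (V k x) \<le> C"
    and V_lim: "\<And>F :: ((real^'n) \<times> real) \<times> (real \<times> (real^'n)) \<Rightarrow> real. continuous_on UNIV F \<Longrightarrow>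
      (\<lambda>k. \<integral>x. F (V k x, x) \<partial>torus) \<longlonglongrightarrow> (\<integral>x. (\<integral>z. F (z, x) \<partial>\<mu>0) \<partial>torus)"
    and W_smooth: "\<And>k b c. smooth (W k b c)" and W_sym: "\<And>k b c. W k b c = W k c b"
    and W_bound: "\<And>k b c x. b \<in> Basis \<Longrightarrow> c \<in> Basis \<Longrightarrow> x \<in> unit_cell \<Longrightarrow> \<bar>W k b c x\<bar> \<le> C'"
    and W_div: "\<And>k b x. b \<in> Basis \<Longrightarrow> x \<in> unit_cell \<Longrightarrow> (\<Sum>c\<in>Basis. partial c (W k b c) x) = 0"
    and W_close: "\<And>b c. b \<in> Basis \<Longrightarrow> c \<in> Basis \<Longrightarrow>
      (\<lambda>k. \<integral>x. \<bar>W k b c x - lift_entry (V k x) b c\<bar> \<partial>torus) \<longlonglongrightarrow> 0"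
begin

sublocale mu0: prob_space \<mu>0 by (rule prob)

lemma C_nonneg: "C \<ge> 0"
  using V_bound[of 0 0] norm_ge_zero order_trans by blast

lemma mu0_meas: "h \<in> borel_measurable borel \<Longrightarrow> h \<in> borel_measurable \<mu>0"
  by (simp add: measurable_cong_sets[OF sets_\<mu>0 refl])

lemma integrable_mu0:
  fixes h :: "(real^'n) \<times> real \<Rightarrow> real"
  assumes "continuous_on UNIV h"
  shows "integrable \<mu>0 h"
proof -
  obtain B where B: "\<And>y. norm (y - 0) \<le> C \<Longrightarrow> \<bar>h y\<bar> \<le> B"
    using continuous_bounded_cball[OF assms, of 0 C] by blast
  show ?thesis
  proof (rule mu0.integrable_const_bound[where B=B])
    show "AE z in \<mu>0. norm (h z) \<le> B" using supp by eventually_elim (use B in auto)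
  qed (intro mu0_meas borel_measurable_continuous_onI assms)
qed

definition bar :: "real \<times> (real^'n) \<Rightarrow> real \<times> (real^'n) \<Rightarrow> real" where
  "bar b c = (\<integral>z. lift_entry z b c \<partial>\<mu>0)"

lemma bar_sym: "bar b c = bar c b"
  by (simp add: bar_def lift_entry_sym)

lemma integral_lift_S: "integrable \<mu>0 lift_S" "(\<integral>z. lift_S z \<partial>\<mu>0) = to_state bar"
proof -
  have i: "integrable \<mu>0 (\<lambda>z. lift_entry z b c)" for b c
    by (intro integrable_mu0 continuous_lift_entry)
  show "integrable \<mu>0 lift_S"
    unfolding lift_S_to_state[abs_def] to_state_expand
    by (intro Bochner_Integration.integrable_sum integrable_scaleR_left i)
  show "(\<integral>z. lift_S z \<partial>\<mu>0) = to_state bar"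
    unfolding lift_S_to_state[abs_def] to_state_expand
    by (simp add: Bochner_Integration.integral_sum Bochner_Integration.integrable_sum i bar_def)
qed

definition D :: real where "D = max C' ((1 + C)\<^sup>2 + C)"

lemma D_nonneg: "D \<ge> 0"
  using C_nonneg by (auto simp: D_def intro!: max.coboundedI2)

lemma entry_bounds:
  assumes "b \<in> Basis" "c \<in> Basis"
  shows "x \<in> unit_cell \<Longrightarrow> \<bar>W k b c x\<bar> \<le> D" "\<bar>lift_entry (V k x) b c\<bar> \<le> D" "\<bar>bar b c\<bar> \<le> D"
proof -
  show "x \<in> unit_cell \<Longrightarrow> \<bar>W k b c x\<bar> \<le> D" using W_bound[OF assms, of x k] by (simp add: D_def max.coboundedI1)
  show "\<bar>lift_entry (V k x) b c\<bar> \<le> D"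
    using lift_entry_bound[OF V_bound[of k x] assms] by (simp add: D_def max.coboundedI2)
  have int: "integrable \<mu>0 (\<lambda>z. \<bar>lift_entry z b c\<bar>)"
    by (intro integrable_abs integrable_mu0 continuous_lift_entry)
  have "\<bar>bar b c\<bar> \<le> (\<integral>z. \<bar>lift_entry z b c\<bar> \<partial>\<mu>0)"
    unfolding bar_def by (rule integral_abs_bound)
  also have "\<dots> \<le> (\<integral>z. D \<partial>\<mu>0)"
  proof (rule integral_mono_AE[OF int])
    show "AE z in \<mu>0. \<bar>lift_entry z b c\<bar> \<le> D"
      using supp by eventually_elim (use lift_entry_bound[OF _ assms] in \<open>auto simp: D_def intro: max.coboundedI2\<close>)
  qed simp
  finally show "\<bar>bar b c\<bar> \<le> D" by (simp add: mu0.prob_space)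
qed

lemma W_meas [measurable]: "W k b c \<in> borel_measurable borel"
  by (intro borel_measurable_continuous_onI smooth_continuous W_smooth)

lemma entry_meas [measurable]: "(\<lambda>x. lift_entry (V k x) b c) \<in> borel_measurable borel"
  by (rule measurable_compose[OF V_meas borel_measurable_continuous_onI[OF continuous_lift_entry]])

text \<open>\<open>W\<close> is replaced by the lift of \<open>V\<close> at an L1-small cost, and
  the lifts converge weakly to their mean \<open>bar\<close> by \<open>V_lim\<close>.\<close>

lemma oscillation_weak:
  assumes b: "b \<in> Basis" and c: "c \<in> Basis" and q: "continuous_on UNIV q"
  shows "(\<lambda>k. \<integral>x. q x * (W k b c x - bar b c) \<partial>torus) \<longlonglongrightarrow> 0"
proof -
  have [measurable]: "q \<in> borel_measurable borel" using q by (rule borel_measurable_continuous_onI)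
  obtain R where R: "\<And>x. x \<in> (unit_cell :: (real \<times> (real^'n)) set) \<Longrightarrow> norm x \<le> R"
    using bounded_unit_cell by (auto simp: bounded_iff)
  obtain B where B: "B \<ge> 0" "\<And>y. norm (y - 0) \<le> R \<Longrightarrow> \<bar>q y\<bar> \<le> B"
    using continuous_bounded_cball[OF q, of 0 R] by blast
  have qB: "\<bar>q x\<bar> \<le> B" if "x \<in> unit_cell" for x using B(2)[of x] R[OF that] by simp
  note eb = entry_bounds[OF b c]
  have i1: "integrable torus (\<lambda>x. q x * (W k b c x - lift_entry (V k x) b c))" for k
  proof (rule integrable_torus_bounded[where B="B * (D + D)"])
    fix x assume x: "x \<in> (unit_cell :: (real \<times> (real^'n)) set)"
    have "\<bar>W k b c x - lift_entry (V k x) b c\<bar> \<le> D + D" using eb(1)[OF x, of k] eb(2)[of k x] by linarith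
    then show "\<bar>q x * (W k b c x - lift_entry (V k x) b c)\<bar> \<le> B * (D + D)"
      unfolding abs_mult using qB[OF x] B by (intro mult_mono) auto
  qed measurable
  have i2: "integrable torus (\<lambda>x. q x * (lift_entry (V k x) b c - bar b c))" for k
  proof (rule integrable_torus_bounded[where B="B * (D + D)"])
    fix x assume x: "x \<in> (unit_cell :: (real \<times> (real^'n)) set)"
    have "\<bar>lift_entry (V k x) b c - bar b c\<bar> \<le> D + D" using eb(2)[of k x] eb(3) by linarith
    then show "\<bar>q x * (lift_entry (V k x) b c - bar b c)\<bar> \<le> B * (D + D)"
      unfolding abs_mult using qB[OF x] B by (intro mult_mono) auto
  qed measurable
  have i3: "integrable torus (\<lambda>x. \<bar>W k b c x - lift_entry (V k x) b c\<bar>)" for k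
  proof (rule integrable_torus_bounded[where B="D + D"])
    fix x :: "real \<times> (real^'n)" assume x: "x \<in> unit_cell"
    show "\<bar>\<bar>W k b c x - lift_entry (V k x) b c\<bar>\<bar> \<le> D + D" using eb(1)[OF x, of k] eb(2)[of k x] by linarith
  qed measurable
  have "(\<lambda>k. \<integral>x. q x * (W k b c x - lift_entry (V k x) b c) \<partial>torus) \<longlonglongrightarrow> 0"
  proof (rule Lim_null_comparison)
    show "(\<lambda>k. B * (\<integral>x. \<bar>W k b c x - lift_entry (V k x) b c\<bar> \<partial>torus)) \<longlonglongrightarrow> 0"
      using tendsto_mult_left[OF W_close[OF b c], of B] by simp
    show "eventually (\<lambda>k. norm (\<integral>x. q x * (W k b c x - lift_entry (V k x) b c) \<partial>torus)
        \<le> B * (\<integral>x. \<bar>W k b c x - lift_entry (V k x) b c\<bar> \<partial>torus)) sequentially"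
    proof (rule always_eventually, rule allI)
      fix k
      have "norm (\<integral>x. q x * (W k b c x - lift_entry (V k x) b c) \<partial>torus)
          \<le> (\<integral>x. norm (q x * (W k b c x - lift_entry (V k x) b c)) \<partial>torus)" by (rule integral_norm_bound)
      also have "\<dots> \<le> (\<integral>x. B * \<bar>W k b c x - lift_entry (V k x) b c\<bar> \<partial>torus)"
        using qB by (intro integral_mono integrable_norm i1 integrable_mult_right i3)
          (auto simp: abs_mult intro!: mult_right_mono)
      finally show "norm (\<integral>x. q x * (W k b c x - lift_entry (V k x) b c) \<partial>torus)
        \<le> B * (\<integral>x. \<bar>W k b c x - lift_entry (V k x) b c\<bar> \<partial>torus)" by simp
    qed
  qed
  moreover have "(\<lambda>k. \<integral>x. q x * (lift_entry (V k x) b c - bar b c) \<partial>torus) \<longlonglongrightarrow> 0"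
  proof -
    have zero: "(\<integral>z. q x * (lift_entry z b c - bar b c) \<partial>\<mu>0) = 0" for x
      using integrable_mu0[OF continuous_lift_entry, of b c] by (simp add: bar_def mu0.prob_space)
    have cont: "continuous_on UNIV (\<lambda>p. q (snd p) * (lift_entry (fst p) b c - bar b c))"
      by (auto intro!: continuous_intros continuous_on_compose2[OF q] continuous_on_compose2[OF continuous_lift_entry[of UNIV]])
    show ?thesis using V_lim[OF cont] by (simp only: fst_conv snd_conv zero Bochner_Integration.integral_zero)
  qed
  ultimately have "(\<lambda>k. (\<integral>x. q x * (W k b c x - lift_entry (V k x) b c) \<partial>torus)
      + (\<integral>x. q x * (lift_entry (V k x) b c - bar b c) \<partial>torus)) \<longlonglongrightarrow> 0 + 0" by (rule tendsto_add)
  moreover have "(\<integral>x. q x * (W k b c x - lift_entry (V k x) b c) \<partial>torus)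
      + (\<integral>x. q x * (lift_entry (V k x) b c - bar b c) \<partial>torus) = (\<integral>x. q x * (W k b c x - bar b c) \<partial>torus)" for k
    by (subst Bochner_Integration.integral_add[OF i1 i2, symmetric]) (simp add: algebra_simps)
  ultimately show ?thesis by simp
qed

definition F :: "nat \<Rightarrow> nat \<Rightarrow> real \<times> (real^'n) \<Rightarrow> real \<times> (real^'n) \<Rightarrow> real \<times> (real^'n) \<Rightarrow> real" where
  "F m k b c x = cutoff m x * (W k b c (frac_vec x) - bar b c)"

text \<open>The row-wise divergence of \<open>F\<close>, see \<open>div_F\<close>: inside the cell
  \<open>W\<close> is divergence-free and \<open>bar\<close> constant, so only derivatives of the
  cutoff remain. These carry no derivative of \<open>W\<close>, hence the bound uniform in
  \<open>k\<close>.\<close>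

definition g :: "nat \<Rightarrow> nat \<Rightarrow> real \<times> (real^'n) \<Rightarrow> real \<times> (real^'n) \<Rightarrow> real" where
  "g m k b x = (\<Sum>c\<in>Basis. partial c (cutoff m) x * (W k b c (frac_vec x) - bar b c))"

lemma osc_smooth: "smooth (\<lambda>x. W k b c x - bar b c)"
  by (intro smooth_diff W_smooth smooth_const)

lemma partial_osc: "partial a (\<lambda>x. W k b c x - bar b c) x = partial a (W k b c) x"
  by (simp add: partial_diff W_smooth)

context
  fixes m :: nat
  assumes m: "m > 0"
begin

lemma F_smooth: "smooth (F m k b c)" "periodic (F m k b c)"
proof -
  show "smooth (F m k b c)"
    unfolding F_def[abs_def] by (rule cut_smooth[OF cutoff_vanishes[OF m] cutoff_smooth osc_smooth])
  show "periodic (F m k b c)"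
    unfolding F_def[abs_def] by (rule cut_periodic[OF cutoff_periodic, of m "\<lambda>y. W k b c y - bar b c"])
qed

lemma g_smooth: "smooth (g m k b)" "periodic (g m k b)"
proof -
  have "smooth (\<lambda>x. partial c (cutoff m) x * (W k b c (frac_vec x) - bar b c))" if "c \<in> Basis" for c
    by (rule cut_smooth[OF vanishes_on_grid_partial[OF cutoff_vanishes[OF m]] smooth_partial[OF cutoff_smooth that] osc_smooth])
  then show "smooth (g m k b)" unfolding g_def[abs_def] by (rule smooth_sum)
  show "periodic (g m k b)"
    unfolding g_def[abs_def]
    by (rule periodic_sum) (rule cut_periodic[OF periodic_partial[OF cutoff_periodic cutoff_smooth], where h="\<lambda>y. W k b _ y - bar b _"])
qed

lemma div_F: "b \<in> Basis \<Longrightarrow> (\<Sum>c\<in>Basis. partial c (F m k b c) x) = g m k b x"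
proof -
  assume b: "b \<in> Basis"
  have "partial c (F m k b c) x = cutoff m x * partial c (W k b c) (frac_vec x)
      + partial c (cutoff m) x * (W k b c (frac_vec x) - bar b c)" if "c \<in> Basis" for c
    using partial_cut[OF cutoff_vanishes[OF m] cutoff_smooth osc_smooth that, of k b c x]
    unfolding F_def[abs_def] partial_osc .
  then have "(\<Sum>c\<in>Basis. partial c (F m k b c) x)
      = cutoff m x * (\<Sum>c\<in>Basis. partial c (W k b c) (frac_vec x)) + g m k b x"
    by (simp add: sum.distrib sum_distrib_left g_def)
  then show ?thesis by (simp add: W_div[OF b frac_vec_in_cell])
qed

lemma g_bound:
  obtains A where "\<And>k b x. b \<in> Basis \<Longrightarrow> \<bar>g m k b x\<bar> \<le> A"
proof -
  have "\<exists>B\<ge>0. \<forall>x. \<bar>partial c (cutoff m) x\<bar> \<le> B" if c: "c \<in> Basis" for c :: "real \<times> (real^'n)"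
    using periodic_bounded[OF periodic_partial[OF cutoff_periodic cutoff_smooth]
        smooth_continuous[OF smooth_partial[OF cutoff_smooth c]]] by metis
  then obtain B where B: "\<And>c. c \<in> Basis \<Longrightarrow> B c \<ge> 0"
    "\<And>c x. c \<in> (Basis :: (real \<times> (real^'n)) set) \<Longrightarrow> \<bar>partial c (cutoff m) x\<bar> \<le> B c" by metis
  show ?thesis
  proof (rule that[of "\<Sum>c\<in>Basis. B c * (D + D)"])
    fix k b and x :: "real \<times> (real^'n)" assume b: "b \<in> (Basis :: (real \<times> (real^'n)) set)"
    show "\<bar>g m k b x\<bar> \<le> (\<Sum>c\<in>Basis. B c * (D + D))"
      unfolding g_def
    proof (rule order_trans[OF sum_abs], rule sum_mono)
      fix c :: "real \<times> (real^'n)" assume c: "c \<in> Basis"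
      have "\<bar>W k b c (frac_vec x) - bar b c\<bar> \<le> D + D"
        using entry_bounds(1)[OF b c frac_vec_in_cell, of k x] entry_bounds(3)[OF b c] by linarith
      then show "\<bar>partial c (cutoff m) x * (W k b c (frac_vec x) - bar b c)\<bar> \<le> B c * (D + D)"
        unfolding abs_mult using B[OF c] by (intro mult_mono) auto
    qed
  qed
qed

lemma g_mean: "b \<in> Basis \<Longrightarrow> (\<integral>x. g m k b x \<partial>torus) = 0"
proof -
  assume b: "b \<in> Basis"
  have "(\<integral>x. g m k b x \<partial>torus) = (\<integral>x. (\<Sum>c\<in>Basis. partial c (F m k b c) x) \<partial>torus)"
    by (simp add: div_F[OF b])
  also have "\<dots> = (\<Sum>c\<in>Basis. \<integral>x. partial c (F m k b c) x \<partial>torus)"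
    by (intro Bochner_Integration.integral_sum integrable_torus_continuous smooth_continuous smooth_partial F_smooth)
  also have "\<dots> = 0" using F_smooth by (intro sum.neutral ballI torus_partial) auto
  finally show ?thesis .
qed

lemma g_weak: "b \<in> Basis \<Longrightarrow> weak_null (\<lambda>k. g m k b)"
  unfolding weak_null_def
proof (intro allI impI)
  fix \<kappa> :: "real \<times> (real^'n) \<Rightarrow> real"
  assume b: "b \<in> Basis" and \<kappa>: "continuous_on UNIV \<kappa>" "periodic \<kappa>"
  have q: "continuous_on UNIV (\<lambda>x. \<kappa> x * partial c (cutoff m) x)" if "c \<in> Basis" for c :: "real \<times> (real^'n)"
    by (intro continuous_on_mult \<kappa> smooth_continuous smooth_partial cutoff_smooth that)
  have "(\<integral>x. g m k b x * \<kappa> x \<partial>torus)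
      = (\<Sum>c\<in>Basis. \<integral>x. (\<kappa> x * partial c (cutoff m) x) * (W k b c x - bar b c) \<partial>torus)" for k
  proof -
    have "(\<integral>x. g m k b x * \<kappa> x \<partial>torus)
        = (\<integral>x. (\<Sum>c\<in>Basis. (\<kappa> x * partial c (cutoff m) x) * (W k b c x - bar b c)) \<partial>torus)"
      by (rule Bochner_Integration.integral_cong[OF refl])
        (simp add: g_def frac_vec_cell sum_distrib_right sum_distrib_left mult_ac)
    also have "\<dots> = (\<Sum>c\<in>Basis. \<integral>x. (\<kappa> x * partial c (cutoff m) x) * (W k b c x - bar b c) \<partial>torus)"
      by (intro Bochner_Integration.integral_sum integrable_torus_continuous)
        (intro continuous_on_mult[OF q] smooth_continuous osc_smooth)
    finally show ?thesis .
  qed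
  moreover have "(\<lambda>k. \<Sum>c\<in>Basis. \<integral>x. (\<kappa> x * partial c (cutoff m) x) * (W k b c x - bar b c) \<partial>torus)
      \<longlonglongrightarrow> (\<Sum>c\<in>(Basis :: (real \<times> (real^'n)) set). 0)"
    by (intro tendsto_sum oscillation_weak[OF b _ q])
  ultimately show "(\<lambda>k. \<integral>x. g m k b x * \<kappa> x \<partial>torus) \<longlonglongrightarrow> 0" by simp
qed

lemma F_mean: 
  assumes b: "b \<in> Basis" and c: "c \<in> Basis"
  shows "(\<lambda>k. \<integral>x. F m k b c x \<partial>torus) \<longlonglongrightarrow> 0"
proof -
  have "(\<integral>x. F m k b c x \<partial>torus) = (\<integral>x. cutoff m x * (W k b c x - bar b c) \<partial>torus)" for k
    by (rule Bochner_Integration.integral_cong[OF refl]) (simp add: F_def frac_vec_cell)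
  then show ?thesis using oscillation_weak[OF b c smooth_continuous[OF cutoff_smooth, of UNIV m]] by simp
qed

end

lemma continuous_f_lift:
  assumes "continuous_on lifted_space f"
  shows "continuous_on UNIV (\<lambda>z. f (lift_S z :: 'n state))"
  unfolding lift_S_to_state
  by (rule continuous_on_compose2[OF assms continuous_to_state[OF continuous_lift_entry]])
    (auto intro!: to_state_lifted simp: lift_entry_sym)

text \<open>Order of choices: \<open>R\<close> and \<open>L\<close> depend on \<open>f\<close> and
  \<eta> only; then come \<open>e\<close>, the cutoff index \<open>m\<close>, and last
  \<open>k\<close>, since the bound on \<open>g m k\<close> depends on \<open>m\<close>. Of the
  error \<eta>, one half is the modulus of \<open>f\<close>, one quarter the L1 distance of the
  competitor from the lifts, one quarter the convergence of the integrals of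
  \<open>f\<close>.\<close>

lemma jensen:
  fixes f :: "'n state \<Rightarrow> real"
  assumes f: "continuous_on lifted_space f"
  shows "Q_env f (to_state bar) \<le> ereal (\<integral>z. f (lift_S z) \<partial>\<mu>0)"
proof (rule ereal_le_epsilon2)
  fix \<eta> :: real assume \<eta>: "\<eta> > 0"
  let ?B = "Basis :: (real \<times> (real^'n)) set"
  define N where "N = real (card ?B)"
  obtain K where K: "K \<ge> 0" "\<And>A :: real \<times> (real^'n) \<Rightarrow> real \<times> (real^'n) \<Rightarrow> real.
       norm (to_state A :: 'n state) \<le> K * (\<Sum>b\<in>Basis. \<Sum>c\<in>Basis. \<bar>A b c\<bar>)"
    using to_state_norm_bound by blast
  \<comment> \<open>Bounds the lifts as well as the corrected states. Entrywise the latter differ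
    from the lifts by at most 4D + 3e, see \<open>diff\<close>, and \<open>e\<close> will be at most
    1.\<close>
  define R where "R = K * (N * (N * (6 * D + 3)))"
  have NK: "norm (to_state A :: 'n state) \<le> R"
    if "\<And>b c. b \<in> Basis \<Longrightarrow> c \<in> Basis \<Longrightarrow> \<bar>A b c\<bar> \<le> 6 * D + 3" for A
  proof -
    have "(\<Sum>b\<in>?B. \<Sum>c\<in>?B. \<bar>A b c\<bar>) \<le> (\<Sum>b\<in>?B. \<Sum>c\<in>?B. 6 * D + 3)"
      by (intro sum_mono that)
    then have "(\<Sum>b\<in>?B. \<Sum>c\<in>?B. \<bar>A b c\<bar>) \<le> N * (N * (6 * D + 3))" by (simp add: N_def)
    from mult_left_mono[OF this K(1)] K(2)[of A] show ?thesis unfolding R_def by linarith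
  qed
  have \<eta>2: "\<eta> / 2 > 0" using \<eta> by simp
  obtain L where L: "L \<ge> 0" "\<And>a b :: 'n state. a \<in> lifted_space \<Longrightarrow> b \<in> lifted_space \<Longrightarrow> norm a \<le> R \<Longrightarrow> norm b \<le> R
      \<Longrightarrow> f a \<le> f b + \<eta> / 2 + L * norm (a - b)"
    using compact_modulus[OF f closed_lifted_space \<eta>2, of R] by blast
  \<comment> \<open>Factor by which entrywise L1 errors enter the integral of
    \<open>f\<close>.\<close>
  define P where "P = L * K * (N * N)"
  have P: "P \<ge> 0" using L(1) K(1) by (simp add: P_def N_def)
  \<comment> \<open>An entry contributes e from the mollification, 2De from the cutoff and 3e from
    the correction and its mean, in all e(2D + 4).\<close>
  define e where "e = min 1 (\<eta> / (4 * (P + 1) * (2 * D + 4)))"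
  have e: "e > 0" "e \<le> 1" using \<eta> P D_nonneg by (auto simp: e_def)
  have Pe: "P * (e * (2 * D + 4)) \<le> \<eta> / 4"
  proof -
    have "e * (4 * (P + 1) * (2 * D + 4)) \<le> \<eta>"
      using P D_nonneg by (subst pos_le_divide_eq[symmetric]) (auto simp: e_def)
    moreover have "4 * (P * (e * (2 * D + 4))) \<le> e * (4 * (P + 1) * (2 * D + 4))"
      using e D_nonneg by (simp add: algebra_simps)
    ultimately show ?thesis by linarith
  qed
  have "eventually (\<lambda>m. (\<integral>x. 1 - cutoff m x \<partial>(torus :: (real \<times> (real^'n)) measure)) < e \<and> m > 0) sequentially"
    using order_tendstoD(2)[OF cutoff_integral_tendsto e(1)] eventually_gt_at_top[of "0::nat"]
    by (rule eventually_conj)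
  then obtain m where m: "m > 0" "(\<integral>x. 1 - cutoff m x \<partial>(torus :: (real \<times> (real^'n)) measure)) < e"
    by (auto simp: eventually_sequentially)
  obtain A where A: "\<And>k b x. b \<in> Basis \<Longrightarrow> \<bar>g m k b x\<bar> \<le> A" using g_bound[OF m(1)] by blast
  have ev1: "eventually (\<lambda>k. \<exists>U. sym_field U \<and> (\<forall>b c x. \<bar>U b c x\<bar> \<le> e) \<and>
    (\<forall>b\<in>Basis. \<forall>x. (\<Sum>c\<in>Basis. partial c (U b c) x) = g m k b x)) sequentially"
    by (rule div_inverse_small[OF g_smooth(1)[OF m(1)] g_smooth(2)[OF m(1)] A g_weak[OF m(1)] g_mean[OF m(1)] e(1)])
  have ev2: "eventually (\<lambda>k. \<forall>b\<in>?B. \<forall>c\<in>?B. (\<integral>x. \<bar>W k b c x - lift_entry (V k x) b c\<bar> \<partial>torus) < e) sequentially"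
    by (intro eventually_ball_finite finite_Basis ballI order_tendstoD(2)[OF W_close e(1)])
  have ev3: "eventually (\<lambda>k. \<forall>b\<in>?B. \<forall>c\<in>?B. norm (\<integral>x. F m k b c x \<partial>torus) < e) sequentially"
    by (intro eventually_ball_finite finite_Basis ballI order_tendstoD(2)[OF tendsto_norm_zero[OF F_mean[OF m(1)]] e(1)])
  have fcont: "continuous_on UNIV (\<lambda>z. f (lift_S z))" by (rule continuous_f_lift[OF f])
  have "(\<lambda>k. \<integral>x. f (lift_S (V k x)) \<partial>torus) \<longlonglongrightarrow> (\<integral>x. (\<integral>z. f (lift_S z) \<partial>\<mu>0) \<partial>(torus :: (real \<times> (real^'n)) measure))"
    using V_lim[OF continuous_on_compose2[OF fcont continuous_on_fst[OF continuous_on_id] subset_UNIV]]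
    by (simp only: fst_conv)
  then have lim: "(\<lambda>k. \<integral>x. f (lift_S (V k x)) \<partial>torus) \<longlonglongrightarrow> (\<integral>z. f (lift_S z) \<partial>\<mu>0)"
    using torus.prob_space[where 'a="real \<times> (real^'n)"] by simp
  have ev4: "eventually (\<lambda>k. (\<integral>x. f (lift_S (V k x)) \<partial>torus) < (\<integral>z. f (lift_S z) \<partial>\<mu>0) + \<eta> / 4) sequentially"
    using \<eta> by (intro order_tendstoD(2)[OF lim]) simp
  obtain k U where U: "sym_field U" "\<And>b c x. \<bar>U b c x\<bar> \<le> e"
      "\<And>b x. b \<in> Basis \<Longrightarrow> (\<Sum>c\<in>Basis. partial c (U b c) x) = g m k b x"
    and k: "\<And>b c. b \<in> Basis \<Longrightarrow> c \<in> Basis \<Longrightarrow> (\<integral>x. \<bar>W k b c x - lift_entry (V k x) b c\<bar> \<partial>torus) < e"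
      "\<And>b c. b \<in> Basis \<Longrightarrow> c \<in> Basis \<Longrightarrow> \<bar>\<integral>x. F m k b c x \<partial>torus\<bar> < e"
      "(\<integral>x. f (lift_S (V k x)) \<partial>torus) < (\<integral>z. f (lift_S z) \<partial>\<mu>0) + \<eta> / 4"
    using eventually_happens'[OF sequentially_bot eventually_conj[OF ev1 eventually_conj[OF ev2 eventually_conj[OF ev3 ev4]]]]
    unfolding real_norm_def by blast
  have Usm: "smooth (U b c)" "periodic (U b c)" "U b c = U c b" for b c
    using U(1) unfolding sym_field_def by blast+
  note Fsm = F_smooth[OF m(1)]
  have Fsym: "F m k b c = F m k c b" for b c by (simp add: F_def W_sym[of k b c] bar_sym[of b c] fun_eq_iff)
  \<comment> \<open>Neither the cut-off oscillation nor the correction has mean zero exactly; the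
    defect is at most 2e and is subtracted as a constant, which leaves the divergence
    unchanged.\<close>
  define mm where "mm b c = (\<integral>x. F m k b c x - U b c x \<partial>torus)" for b c
  define G where "G b c x = F m k b c x - U b c x - mm b c" for b c x
  define \<phi> :: "real \<times> (real^'n) \<Rightarrow> 'n state" where "\<phi> x = to_state (\<lambda>b c. G b c x)" for x
  have iF: "integrable torus (F m k b c)" and iU: "integrable torus (U b c)" for b c
    by (intro integrable_torus_continuous smooth_continuous Fsm Usm)+
  have mm_eq: "mm b c = (\<integral>x. F m k b c x \<partial>torus) - (\<integral>x. U b c x \<partial>torus)" for b c
    unfolding mm_def by (rule Bochner_Integration.integral_diff[OF iF iU])
  have Gsm: "smooth (G b c)" for b c
    unfolding G_def[abs_def] by (intro smooth_diff Fsm Usm smooth_const)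
  have Gsym: "G b c = G c b" for b c
    unfolding G_def[abs_def] mm_def using Fsym[of b c] Usm(3)[of b c] by simp
  have pG: "partial a (G b c) x = partial a (F m k b c) x - partial a (U b c) x" for a b c x
    unfolding G_def[abs_def] by (simp add: partial_diff smooth_diff Fsm Usm)
  have Gmean: "(\<integral>x. G b c x \<partial>torus) = 0" for b c
    using iF[of b c] iU[of b c] torus.prob_space[where 'a="real \<times> (real^'n)"] by (simp add: G_def mm_eq)
  have "\<phi> \<in> A_free_perturbations"
    unfolding A_free_perturbations_def
  proof (intro CollectI conjI allI)
    show "smooth \<phi>" unfolding \<phi>_def[abs_def] by (rule to_state_smooth[OF Gsm])
    have Gper: "G b c (x + a) = G b c x" if "a \<in> Basis" for a b c x
      using Fsm(2)[of k b c, unfolded periodic_def, rule_format, OF that, of x]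
        Usm(2)[of b c, unfolded periodic_def, rule_format, OF that, of x] by (simp only: G_def)
    show "periodic \<phi>" unfolding periodic_def \<phi>_def
      by (intro allI ballI arg_cong[where f=to_state] ext Gper)
    show "range \<phi> \<subseteq> lifted_space" unfolding \<phi>_def using Gsym by (auto intro!: to_state_lifted)
    show "A_E \<phi> p = 0" for p
      unfolding \<phi>_def[abs_def]
      by (rule A_E_to_state[OF Gsm Gsym]) (simp add: pG sum_subtractf div_F[OF m(1)] U(3))
    show "(\<integral>y. \<phi> y \<partial>torus) = 0"
      unfolding \<phi>_def to_state_expand using Gmean
      by (simp add: Bochner_Integration.integral_sum Bochner_Integration.integrable_sum
          integrable_torus_continuous smooth_continuous Gsm)
  qed
  then have Q1: "Q_env f (to_state bar) \<le> ereal (\<integral>x. f (to_state bar + \<phi> x) \<partial>torus)"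
    unfolding Q_env_def by (rule INF_lower)
  have Q2: "(\<integral>x. f (to_state bar + \<phi> x) \<partial>torus) \<le> (\<integral>z. f (lift_S z) \<partial>\<mu>0) + \<eta>"
  proof -
    define a where "a x = to_state (\<lambda>b c. bar b c + G b c x)" for x
    have a: "to_state bar + \<phi> x = a x" for x
      by (simp add: a_def \<phi>_def to_state_add)
    have al: "a x \<in> lifted_space" for x
      unfolding a_def using Gsym bar_sym by (intro to_state_lifted) metis
    have ll: "lift_S z \<in> (lifted_space :: 'n state set)" for z
      unfolding lift_S_to_state by (intro to_state_lifted lift_entry_sym)
    have ac: "continuous_on UNIV (\<lambda>x. f (a x))"
    proof (rule continuous_on_compose2[OF f])
      show "continuous_on UNIV a" unfolding a_def[abs_def]
        by (intro continuous_to_state continuous_on_add continuous_on_const smooth_continuous Gsm)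
    qed (use al in blast)
    have mmb: "\<bar>mm b c\<bar> \<le> 2 * e" if "b \<in> Basis" "c \<in> Basis" for b c
    proof -
      have "\<bar>\<integral>x. U b c x \<partial>torus\<bar> \<le> (\<integral>x. \<bar>U b c x\<bar> \<partial>torus)" by (rule integral_abs_bound)
      also have "\<dots> \<le> (\<integral>x. e \<partial>(torus :: (real \<times> (real^'n)) measure))"
        using U(2) by (intro integral_mono integrable_abs iU) auto
      finally have "\<bar>\<integral>x. U b c x \<partial>torus\<bar> \<le> e" using torus.prob_space[where 'a="real \<times> (real^'n)"] by simp
      then show ?thesis using k(2)[OF that] unfolding mm_eq by linarith
    qed
    have diff: "\<bar>bar b c + G b c x - lift_entry (V k x) b c\<bar>
        \<le> \<bar>W k b c x - lift_entry (V k x) b c\<bar> + 2 * D * (1 - cutoff m x) + 3 * e"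
      if x: "x \<in> unit_cell" and b: "b \<in> Basis" and c: "c \<in> Basis" for x b c
    proof -
      \<comment> \<open>On the cell the competitor is the mollified field, minus what the cutoff
        removes of its oscillation, minus the correction and the constant.\<close>
      have "bar b c + G b c x - lift_entry (V k x) b c = (W k b c x - lift_entry (V k x) b c)
          - (1 - cutoff m x) * (W k b c x - bar b c) - U b c x - mm b c"
        by (simp add: G_def F_def frac_vec_cell[OF x] algebra_simps)
      moreover have "\<bar>(1 - cutoff m x) * (W k b c x - bar b c)\<bar> \<le> (1 - cutoff m x) * (2 * D)"
        unfolding abs_mult
        using cutoff_bounds[of m x] entry_bounds(1)[OF b c x, of k] entry_bounds(3)[OF b c]
        by (intro mult_mono) auto
      ultimately show ?thesis using U(2)[of b c x] mmb[OF b c] by (simp add: mult.commute)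
    qed
    have bnd: "\<bar>bar b c + G b c x\<bar> \<le> 6 * D + 3" if b: "b \<in> Basis" and c: "c \<in> Basis" and x: "x \<in> unit_cell" for b c x
    proof -
      have "2 * D * (1 - cutoff m x) \<le> 2 * D * 1"
        using cutoff_bounds[of m x] D_nonneg by (intro mult_left_mono) auto
      then show ?thesis
        using diff[OF x b c] entry_bounds(1)[OF b c x, of k] entry_bounds(2)[OF b c, of k x] e D_nonneg by linarith
    qed
    define q where "q x = (\<Sum>b\<in>?B. \<Sum>c\<in>?B. \<bar>W k b c x - lift_entry (V k x) b c\<bar> + 2 * D * (1 - cutoff m x) + 3 * e)" for x
    have pw: "f (a x) \<le> f (lift_S (V k x)) + \<eta> / 2 + L * K * q x" if x: "x \<in> unit_cell" for x
    proof -
      have n1: "norm (a x) \<le> R" unfolding a_def by (rule NK) (rule bnd[OF _ _ x])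
      have n2: "norm (lift_S (V k x) :: 'n state) \<le> R" unfolding lift_S_to_state
        using D_nonneg entry_bounds(2)[of _ _ k x] by (intro NK) (smt (verit))
      have "norm (a x - lift_S (V k x)) \<le> K * (\<Sum>b\<in>?B. \<Sum>c\<in>?B. \<bar>bar b c + G b c x - lift_entry (V k x) b c\<bar>)"
        unfolding a_def lift_S_to_state to_state_diff[symmetric] by (rule K(2))
      also have "\<dots> \<le> K * q x"
        unfolding q_def by (intro mult_left_mono sum_mono diff x K(1))
      finally have "L * norm (a x - lift_S (V k x)) \<le> L * (K * q x)" using L(1) by (rule mult_left_mono)
      then show ?thesis using L(2)[OF al[of x] ll[of "V k x"] n1 n2] by (simp add: mult.assoc)
    qed
    have i1: "integrable torus (\<lambda>x. \<bar>W k b c x - lift_entry (V k x) b c\<bar>)" if "b \<in> Basis" "c \<in> Basis" for b c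
    proof (rule integrable_torus_bounded[where B="D + D"])
      fix x :: "real \<times> (real^'n)" assume x: "x \<in> unit_cell"
      show "\<bar>\<bar>W k b c x - lift_entry (V k x) b c\<bar>\<bar> \<le> D + D"
        using entry_bounds(1)[OF that x, of k] entry_bounds(2)[OF that, of k x] by linarith
    qed measurable
    have i2: "integrable (torus :: (real \<times> (real^'n)) measure) (\<lambda>x. 1 - cutoff m x)"
      by (intro integrable_torus_continuous continuous_intros smooth_continuous cutoff_smooth)
    have iq: "integrable torus q"
      unfolding q_def[abs_def] using i1 i2 by (intro Bochner_Integration.integrable_sum) auto
    have q_int: "(\<integral>x. q x \<partial>torus) \<le> N * N * (e * (2 * D + 4))"
    proof -
      have "(\<integral>x. q x \<partial>torus) = (\<Sum>b\<in>?B. \<Sum>c\<in>?B. (\<integral>x. \<bar>W k b c x - lift_entry (V k x) b c\<bar> \<partial>torus)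
          + 2 * D * (\<integral>x. 1 - cutoff m x \<partial>(torus :: (real \<times> (real^'n)) measure)) + 3 * e)"
        unfolding q_def using i1 i2 torus.prob_space[where 'a="real \<times> (real^'n)"]
        by (simp add: Bochner_Integration.integral_sum Bochner_Integration.integrable_sum)
      also have "\<dots> \<le> (\<Sum>b\<in>?B. \<Sum>c\<in>?B. e + 2 * D * e + 3 * e)"
        using k(1) m(2) D_nonneg by (intro sum_mono add_mono mult_left_mono order_refl) (auto intro: less_imp_le)
      also have "\<dots> = N * N * (e * (2 * D + 4))" by (simp add: N_def algebra_simps)
      finally show ?thesis .
    qed
    have i3: "integrable torus (\<lambda>x. f (lift_S (V k x)))"
    proof -
      obtain B where "\<And>y. norm (y - 0) \<le> C \<Longrightarrow> \<bar>f (lift_S y)\<bar> \<le> B"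
        using continuous_bounded_cball[OF fcont, of 0 C] by blast
      then show ?thesis
        using V_bound by (intro integrable_torus_bounded[where B=B] measurable_compose[OF V_meas borel_measurable_continuous_onI[OF fcont]]) auto
    qed
    have "(\<integral>x. f (a x) \<partial>torus) \<le> (\<integral>x. f (lift_S (V k x)) + \<eta> / 2 + L * K * q x \<partial>torus)"
      using pw by (intro integral_mono integrable_torus_continuous ac Bochner_Integration.integrable_add
          i3 integrable_mult_right iq) auto
    also have "\<dots> = (\<integral>x. f (lift_S (V k x)) \<partial>torus) + \<eta> / 2 + L * K * (\<integral>x. q x \<partial>torus)"
      using i3 iq torus.prob_space[where 'a="real \<times> (real^'n)"] by simp
    also have "L * K * (\<integral>x. q x \<partial>torus) \<le> L * K * (N * N * (e * (2 * D + 4)))"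
      using q_int L(1) K(1) by (intro mult_left_mono) auto
    also have "L * K * (N * N * (e * (2 * D + 4))) = P * (e * (2 * D + 4))" by (simp add: P_def mult_ac)
    also note Pe
    finally show ?thesis using k(3) unfolding a by simp
  qed
  show "Q_env f (to_state bar) \<le> ereal (\<integral>z. f (lift_S z) \<partial>\<mu>0) + ereal \<eta>"
    using order_trans[OF Q1 iffD2[OF ereal_less_eq(3) Q2]] by simp
qed

end

section \<open>Translations in L1 and Lebesgue points\<close>

lemma integrable_cball: "integrable lborel (\<lambda>x. c * indicator (cball a R) (x::'a::euclidean_space) :: real)"
  by (intro integrable_mult_right integrable_real_indicator emeasure_bounded_finite bounded_cball) simp

text \<open>Uniform continuity makes the integrand small, and for shifts shorter than 1 it lives in
  a ball of fixed radius.\<close>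

lemma continuous_compact_support_translation:
  fixes g :: "'a::euclidean_space \<Rightarrow> real"
  assumes g: "continuous_on UNIV g" and R: "\<And>x. norm x > R \<Longrightarrow> g x = 0" and e: "e > 0"
  shows "\<exists>d>0. \<forall>s. norm s < d \<longrightarrow> integrable lborel (\<lambda>x. \<bar>g (x + s) - g x\<bar>) \<and> (\<integral>x. \<bar>g (x + s) - g x\<bar> \<partial>lborel) < e"
proof -
  have [measurable]: "g \<in> borel_measurable borel" using g by (rule borel_measurable_continuous_onI)
  let ?K = "cball 0 (R + 2) :: 'a set"
  define M where "M = measure lborel (cball 0 (R + 1) :: 'a set)"
  define e' where "e' = e / (2 * (M + 1))"
  have M: "M \<ge> 0" by (simp add: M_def)
  have e': "e' > 0" "e' * M < e" using e M by (auto simp: e'_def field_simps add_nonneg_pos)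
  have "uniformly_continuous_on ?K g"
    by (intro compact_uniformly_continuous compact_cball continuous_on_subset[OF g]) auto
  then obtain d where d: "d > 0" "\<And>x y. x \<in> ?K \<Longrightarrow> y \<in> ?K \<Longrightarrow> dist y x < d \<Longrightarrow> dist (g y) (g x) < e'"
    using e'(1) unfolding uniformly_continuous_on_def by metis
  show ?thesis
  proof (intro exI[of _ "min 1 d"] conjI allI impI)
    fix s :: 'a assume s: "norm s < min 1 d"
    have b: "\<bar>g (x + s) - g x\<bar> \<le> e' * indicator (cball 0 (R + 1)) x" for x
    proof (cases "norm x \<le> R + 1")
      case True
      have "norm (x + s) \<le> R + 2" using norm_triangle_ineq[of x s] True s by linarith
      then have "dist (g (x + s)) (g x) < e'" using True s by (intro d(2)) (auto simp: mem_cball_0 dist_norm simp del: mem_cball)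
      then show ?thesis using True by (simp add: dist_real_def)
    next
      case False
      have "norm (x + s) > R" using norm_triangle_ineq2[of x "- s"] False s by simp
      then show ?thesis using False R e'(1) by simp
    qed
    have i: "integrable lborel (\<lambda>x. e' * indicator (cball 0 (R + 1)) (x::'a) :: real)"
      by (rule integrable_cball)
    show int: "integrable lborel (\<lambda>x. \<bar>g (x + s) - g x\<bar>)"
      by (rule Bochner_Integration.integrable_bound[OF i])
        (use b e'(1) in \<open>auto intro!: order_trans[OF b]\<close>)
    have "(\<integral>x. \<bar>g (x + s) - g x\<bar> \<partial>lborel) \<le> (\<integral>x. e' * indicator (cball 0 (R + 1)) (x::'a) \<partial>lborel)"
      by (rule integral_mono[OF int i b])
    also have "\<dots> = e' * M" by (simp add: M_def)
    finally show "(\<integral>x. \<bar>g (x + s) - g x\<bar> \<partial>lborel) < e" using e'(2) by simp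
  qed (use d in auto)
qed

definition bdd_supp :: "('a::euclidean_space \<Rightarrow> real) \<Rightarrow> bool" where
  "bdd_supp h \<longleftrightarrow> h \<in> borel_measurable borel \<and> (\<exists>B. \<forall>x. \<bar>h x\<bar> \<le> B) \<and> (\<exists>R. \<forall>x. norm x > R \<longrightarrow> h x = 0)"

lemma bdd_supp_integrable:
  assumes "bdd_supp (h :: 'a::euclidean_space \<Rightarrow> real)"
  shows "integrable lborel h"
proof -
  obtain B R where B: "\<And>x. \<bar>h x\<bar> \<le> B" and R: "\<And>x. norm x > R \<Longrightarrow> h x = 0" and [measurable]: "h \<in> borel_measurable borel"
    using assms by (auto simp: bdd_supp_def)
  have i: "integrable lborel (\<lambda>x. B * indicator (cball 0 R) (x::'a) :: real)"
    by (rule integrable_cball)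
  have "norm (h x) \<le> norm (B * indicator (cball 0 R) x :: real)" for x
    using B[of x] R[of x] by (cases "norm x \<le> R") (auto simp: indicator_def)
  then show ?thesis by (intro Bochner_Integration.integrable_bound[OF i]) auto
qed

text \<open>Lebesgue measurability supplies continuous functions converging almost everywhere but
  without any domination; truncating them in size and in space makes dominated convergence
  applicable and does not disturb the limit \<open>h\<close>.\<close>

lemma bdd_supp_approx:
  assumes h: "bdd_supp (h :: 'a::euclidean_space \<Rightarrow> real)" and e: "e > 0"
  obtains g R where "continuous_on UNIV g" "\<And>x. norm x > R \<Longrightarrow> g x = 0"
    "integrable lborel g" "(\<integral>x. \<bar>g x - h x\<bar> \<partial>lborel) < e"
proof -
  obtain B R where B: "\<And>x. \<bar>h x\<bar> \<le> B" and R: "\<And>x. norm x > R \<Longrightarrow> h x = 0" and [measurable]: "h \<in> borel_measurable borel"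
    using h by (auto simp: bdd_supp_def)
  have B0: "B \<ge> 0" using B[of 0] by linarith
  have "h \<in> borel_measurable (lebesgue_on UNIV)" by (rule measurable_lebesgue_on_borel) measurable
  then have "h measurable_on UNIV" by (subst measurable_on_iff_borel_measurable) auto
  then obtain N g where N: "negligible N" and g: "\<And>n. continuous_on UNIV (g n)"
      "\<And>x. x \<notin> N \<Longrightarrow> (\<lambda>n. g n x) \<longlonglongrightarrow> h x"
    unfolding measurable_on_def by auto
  \<comment> \<open>Equal to 1 on the ball of radius \<open>R\<close> that carries \<open>h\<close>,
    and zero beyond \<open>R + 1\<close>.\<close>
  define \<kappa> where "\<kappa> x = max 0 (min 1 (R + 1 - norm x))" for x :: 'a
  define G where "G n x = \<kappa> x * max (-B) (min B (g n x))" for n x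
  have Gc: "continuous_on UNIV (G n)" for n
    unfolding G_def \<kappa>_def by (intro continuous_intros g)
  have Gs: "G n x = 0" if "norm x > R + 1" for n x using that by (simp add: G_def \<kappa>_def)
  have \<kappa>: "0 \<le> \<kappa> x" "\<kappa> x \<le> 1" for x by (auto simp: \<kappa>_def)
  have Gb: "\<bar>G n x\<bar> \<le> B" for n x
  proof -
    have "\<bar>max (-B) (min B (g n x))\<bar> \<le> B" using B0 by (auto simp: abs_le_iff max_def min_def)
    then have "\<kappa> x * \<bar>max (-B) (min B (g n x))\<bar> \<le> 1 * B" using \<kappa> by (intro mult_mono) auto
    then show ?thesis using \<kappa> by (simp add: G_def abs_mult)
  qed
  have Gm [measurable]: "G n \<in> borel_measurable borel" for n using Gc by (rule borel_measurable_continuous_onI)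
  have Gi: "integrable lborel (G n)" for n
    by (rule bdd_supp_integrable, unfold bdd_supp_def) (use Gm[of n] Gb[of n] Gs[of _ n] in blast)
  have "(\<lambda>n. \<integral>x. \<bar>G n x - h x\<bar> \<partial>lborel) \<longlonglongrightarrow> (\<integral>x. 0 \<partial>(lborel :: 'a measure))"
  proof (rule integral_dominated_convergence[where w="\<lambda>x. (2 * B) * indicator (cball 0 (R + 1)) x"])
    show "integrable lborel (\<lambda>x. (2 * B) * indicator (cball 0 (R + 1)) (x::'a) :: real)"
      by (rule integrable_cball)
    show "AE x in lborel. norm \<bar>G n x - h x\<bar> \<le> (2 * B) * indicator (cball 0 (R + 1)) x" for n
    proof (rule AE_I2)
      fix x show "norm \<bar>G n x - h x\<bar> \<le> (2 * B) * indicator (cball 0 (R + 1)) x"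
      proof (cases "norm x \<le> R + 1")
        case True
        have "\<bar>G n x - h x\<bar> \<le> 2 * B" using Gb[of n x] B[of x] by linarith
        then show ?thesis using True by simp
      qed (simp add: Gs R)
    qed
    have "AE x in lebesgue. x \<notin> N" using N by (simp add: negligible_iff_null_sets AE_not_in)
    then have "AE x in lborel. x \<notin> N" by (simp add: AE_completion_iff)
    then show "AE x in lborel. (\<lambda>n. \<bar>G n x - h x\<bar>) \<longlonglongrightarrow> 0"
    proof eventually_elim
      fix x assume x: "x \<notin> N"
      have "(\<lambda>n. G n x) \<longlonglongrightarrow> \<kappa> x * max (-B) (min B (h x))"
        unfolding G_def by (intro tendsto_intros g(2) x)
      moreover have "\<kappa> x * max (-B) (min B (h x)) = h x"
        using B[of x] R[of x] by (cases "norm x \<le> R") (auto simp: \<kappa>_def abs_le_iff max_def min_def)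
      ultimately have "(\<lambda>n. \<bar>G n x - h x\<bar>) \<longlonglongrightarrow> \<bar>h x - h x\<bar>" by (intro tendsto_intros) simp
      then show "(\<lambda>n. \<bar>G n x - h x\<bar>) \<longlonglongrightarrow> 0" by simp
    qed
  qed auto
  then have "eventually (\<lambda>n. (\<integral>x. \<bar>G n x - h x\<bar> \<partial>lborel) < e) sequentially"
    using e by (intro order_tendstoD(2)) simp_all
  then obtain n where "(\<integral>x. \<bar>G n x - h x\<bar> \<partial>lborel) < e" by (auto simp: eventually_sequentially)
  then show ?thesis using that[of "G n" "R + 1"] Gc Gs Gi by blast
qed

lemma lborel_translate':
  fixes f :: "'a::euclidean_space \<Rightarrow> 'b::{banach, second_countable_topology}"
  assumes [measurable]: "f \<in> borel_measurable borel"
  shows "(\<integral>x. f (x + c) \<partial>lborel) = (\<integral>x. f x \<partial>lborel)"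
    "integrable lborel (\<lambda>x. f (x + c)) \<longleftrightarrow> integrable lborel f"
  using lborel_translate[OF assms, of c] by (simp_all add: add.commute)

lemma translation_continuous:
  assumes h: "bdd_supp (h :: 'a::euclidean_space \<Rightarrow> real)" and e: "e > 0"
  shows "\<exists>d>0. \<forall>s. norm s < d \<longrightarrow> (\<integral>x. \<bar>h (x + s) - h x\<bar> \<partial>lborel) < e"
proof -
  have [measurable]: "h \<in> borel_measurable borel" using h by (simp add: bdd_supp_def)
  have hi: "integrable lborel h" by (rule bdd_supp_integrable[OF h])
  have e3: "e / 3 > 0" using e by simp
  obtain g R where g: "continuous_on UNIV g" "\<And>x. norm x > R \<Longrightarrow> g x = 0" "integrable lborel g"
      "(\<integral>x. \<bar>g x - h x\<bar> \<partial>lborel) < e / 3"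
    using bdd_supp_approx[OF h e3] by blast
  have [measurable]: "g \<in> borel_measurable borel" using g(1) by (rule borel_measurable_continuous_onI)
  obtain d where d: "d > 0" "\<And>s. norm s < d \<Longrightarrow> integrable lborel (\<lambda>x. \<bar>g (x + s) - g x\<bar>)"
      "\<And>s. norm s < d \<Longrightarrow> (\<integral>x. \<bar>g (x + s) - g x\<bar> \<partial>lborel) < e / 3"
    using continuous_compact_support_translation[OF g(1,2) e3] by blast
  have gh: "integrable lborel (\<lambda>x. \<bar>g x - h x\<bar>)" using g(3) hi by auto
  have "(\<integral>x. \<bar>h (x + s) - h x\<bar> \<partial>lborel) < e" if s: "norm s < d" for s
  proof -
    have gs: "integrable lborel (\<lambda>x. \<bar>g (x + s) - h (x + s)\<bar>)"
      using lborel_translate'(2)[of "\<lambda>x. \<bar>g x - h x\<bar>" s] gh by simp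
    have hs: "integrable lborel (\<lambda>x. \<bar>h (x + s) - h x\<bar>)"
      using lborel_translate'(2)[of h s] hi by auto
    have "(\<integral>x. \<bar>h (x + s) - h x\<bar> \<partial>lborel)
        \<le> (\<integral>x. \<bar>g (x + s) - h (x + s)\<bar> + \<bar>g (x + s) - g x\<bar> + \<bar>g x - h x\<bar> \<partial>lborel)"
      by (intro integral_mono hs Bochner_Integration.integrable_add gs d(2) s gh) linarith
    also have "\<dots> = (\<integral>x. \<bar>g (x + s) - h (x + s)\<bar> \<partial>lborel) + (\<integral>x. \<bar>g (x + s) - g x\<bar> \<partial>lborel) + (\<integral>x. \<bar>g x - h x\<bar> \<partial>lborel)"
      using gs d(2)[OF s] gh by simp
    also have "(\<integral>x. \<bar>g (x + s) - h (x + s)\<bar> \<partial>lborel) = (\<integral>x. \<bar>g x - h x\<bar> \<partial>lborel)"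
      by (rule lborel_translate'(1)[of "\<lambda>x. \<bar>g x - h x\<bar>" s]) measurable
    finally show ?thesis using g(4) d(3)[OF s] by linarith
  qed
  with d(1) show ?thesis by blast
qed

lemma unit_cell_norm: "x \<in> unit_cell \<Longrightarrow> norm (x :: 'a::euclidean_space) \<le> real DIM('a)"
proof -
  assume "x \<in> unit_cell"
  then have "(\<Sum>b\<in>Basis. \<bar>x \<bullet> b\<bar>) \<le> (\<Sum>b\<in>(Basis::'a set). 1)"
    by (intro sum_mono) (auto simp: unit_cell_def)
  then show ?thesis using norm_le_l1[of x] by simp
qed

text \<open>The mean oscillation of \<open>h\<close> about its value at \<open>y\<close> over the
  cube of side \<open>r\<close> with corner \<open>y\<close>, in blown-up coordinates.\<close>

definition osc :: "('a::euclidean_space \<Rightarrow> real) \<Rightarrow> real \<Rightarrow> 'a \<Rightarrow> real" where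
  "osc h r y = (\<integral>x. \<bar>h (y + r *\<^sub>R x) - h y\<bar> \<partial>torus)"

text \<open>By Fubini the integral of the oscillation is an average, over shifts in the scaled cell,
  of L1 distances between \<open>h\<close> and its translates.\<close>

lemma osc_nn_integral:
  assumes h: "bdd_supp (h :: 'a::euclidean_space \<Rightarrow> real)"
    and d: "\<And>s. norm s < d \<Longrightarrow> (\<integral>x. \<bar>h (x + s) - h x\<bar> \<partial>lborel) < e" and r: "0 \<le> r" "r * real DIM('a) < d"
  shows "(\<lambda>y. osc h r y) \<in> borel_measurable borel"
    "(\<integral>\<^sup>+y. ennreal (osc h r y) \<partial>lborel) \<le> ennreal e"
proof -
  obtain B where B: "\<And>x. \<bar>h x\<bar> \<le> B" and [measurable]: "h \<in> borel_measurable borel"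
    using h by (auto simp: bdd_supp_def)
  have hi: "integrable lborel h" by (rule bdd_supp_integrable[OF h])
  have osc: "osc h r y = (\<integral>x. indicator unit_cell x *\<^sub>R \<bar>h (y + r *\<^sub>R x) - h y\<bar> \<partial>lborel)" for y
    unfolding osc_def by (rule lebesgue_on_eq_lborel(1)) measurable
  show [measurable]: "(\<lambda>y. osc h r y) \<in> borel_measurable borel"
    unfolding osc by measurable
  have int: "integrable torus (\<lambda>x. \<bar>h (y + r *\<^sub>R x) - h y\<bar>)" for y
  proof (rule integrable_torus_bounded[where B="2 * B"])
    fix x show "\<bar>\<bar>h (y + r *\<^sub>R x) - h y\<bar>\<bar> \<le> 2 * B" using B[of "y + r *\<^sub>R x"] B[of y] by linarith
  qed measurable
  have "ennreal (osc h r y) = (\<integral>\<^sup>+x. ennreal (indicator unit_cell x * \<bar>h (y + r *\<^sub>R x) - h y\<bar>) \<partial>lborel)" for y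
  proof -
    have "integrable lborel (\<lambda>x. indicator unit_cell x * \<bar>h (y + r *\<^sub>R x) - h y\<bar>)"
      using int[of y] by (subst (asm) lebesgue_on_eq_lborel(2)) auto
    then show ?thesis unfolding osc by (simp add: nn_integral_eq_integral)
  qed
  then have "(\<integral>\<^sup>+y. ennreal (osc h r y) \<partial>lborel)
      = (\<integral>\<^sup>+y. (\<integral>\<^sup>+x. ennreal (indicator unit_cell x * \<bar>h (y + r *\<^sub>R x) - h y\<bar>) \<partial>lborel) \<partial>lborel)" by simp
  also have "\<dots> = (\<integral>\<^sup>+x. (\<integral>\<^sup>+y. ennreal (indicator unit_cell x * \<bar>h (y + r *\<^sub>R x) - h y\<bar>) \<partial>lborel) \<partial>lborel)"
    by (rule lborel_pair.Fubini') measurable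
  also have "\<dots> \<le> (\<integral>\<^sup>+x. ennreal e * indicator (unit_cell :: 'a set) x \<partial>lborel)"
  proof (rule nn_integral_mono)
    fix x :: 'a
    show "(\<integral>\<^sup>+y. ennreal (indicator unit_cell x * \<bar>h (y + r *\<^sub>R x) - h y\<bar>) \<partial>lborel) \<le> ennreal e * indicator unit_cell x"
    proof (cases "x \<in> unit_cell")
      case True
      have "norm (r *\<^sub>R x) \<le> r * real DIM('a)"
        using r(1) unit_cell_norm[OF True] by (simp add: mult_left_mono)
      then have "(\<integral>y. \<bar>h (y + r *\<^sub>R x) - h y\<bar> \<partial>lborel) < e" using d r(2) by force
      moreover have "integrable lborel (\<lambda>y. \<bar>h (y + r *\<^sub>R x) - h y\<bar>)"
        using lborel_translate'(2)[of h "r *\<^sub>R x"] hi by auto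
      ultimately show ?thesis using True by (simp add: nn_integral_eq_integral ennreal_leI)
    qed simp
  qed
  also have "\<dots> = ennreal e" by (simp add: nn_integral_cmult emeasure_unit_cell)
  finally show "(\<integral>\<^sup>+y. ennreal (osc h r y) \<partial>lborel) \<le> ennreal e" .
qed

text \<open>In place of differentiation theorems: the radii shrink so fast that for each
  \<open>j\<close> the integrals of the oscillations are eventually below a geometric series. The
  series of oscillations is then finite almost everywhere and its terms tend to zero. Countably many
  functions share the radii and the null set.\<close>

lemma common_Lebesgue_points:
  fixes h :: "nat \<Rightarrow> 'a::euclidean_space \<Rightarrow> real"
  assumes h: "\<And>j. bdd_supp (h j)"
  obtains r :: "nat \<Rightarrow> real" where "\<And>k. r k > 0" "r \<longlonglongrightarrow> 0"
    "AE y in lborel. \<forall>j. (\<lambda>k. osc (h j) (r k) y) \<longlonglongrightarrow> 0"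
proof -
  have "\<exists>d>0. \<forall>s. norm s < d \<longrightarrow> (\<integral>x. \<bar>h j (x + s) - h j x\<bar> \<partial>lborel) < (1/2) ^ k" for j k
    using translation_continuous[OF h[of j], of "(1/2) ^ k"] by simp
  then obtain d where d: "\<And>j k. d j k > 0"
    "\<And>j k s. norm s < d j k \<Longrightarrow> (\<integral>x. \<bar>h j (x + s) - h j x\<bar> \<partial>lborel) < (1/2) ^ k" by metis
  \<comment> \<open>At stage \<open>k\<close> only the first functions, up to index
    \<open>k\<close>, are controlled; each is controlled from some stage on.\<close>
  define d' where "d' k = Min ((\<lambda>j. d j k) ` {..k})" for k
  have d': "d' k > 0" "j \<le> k \<Longrightarrow> d' k \<le> d j k" for j k
    using d(1) by (auto simp: d'_def)
  \<comment> \<open>Points of the cell have norm at most the dimension; the factor 2 makes the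
    inequality strict, and \<open>1 / real (Suc k)\<close> forces convergence to 0.\<close>
  define r where "r k = min (1 / real (Suc k)) (d' k / (2 * real DIM('a)))" for k
  have r: "r k > 0" "r k * real DIM('a) < d' k" for k
  proof -
    show "r k > 0" using d' by (simp add: r_def)
    have "r k * real DIM('a) \<le> d' k / (2 * real DIM('a)) * real DIM('a)"
      unfolding r_def by (intro mult_right_mono) auto
    also have "\<dots> < d' k" using d'(1)[of k] by simp
    finally show "r k * real DIM('a) < d' k" .
  qed
  have r0: "r \<longlonglongrightarrow> 0"
  proof (rule tendsto_sandwich[OF _ _ tendsto_const LIMSEQ_inverse_real_of_nat])
    show "eventually (\<lambda>k. 0 \<le> r k) sequentially" using r(1) by (auto intro!: always_eventually less_imp_le)
    show "eventually (\<lambda>k. r k \<le> inverse (real (Suc k))) sequentially" by (simp add: r_def inverse_eq_divide)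
  qed
  have "AE y in lborel. (\<lambda>k. osc (h j) (r k) y) \<longlonglongrightarrow> 0" for j
  proof -
    \<comment> \<open>Shifted by \<open>j\<close>, because the estimate for the function
      \<open>h j\<close> starts at stage \<open>j\<close>.\<close>
    define a where "a i y = ennreal (osc (h j) (r (i + j)) y)" for i y
    have am [measurable]: "a i \<in> borel_measurable lborel" and ai: "(\<integral>\<^sup>+y. a i y \<partial>lborel) \<le> ennreal ((1/2) ^ i)" for i
    proof -
      have lt: "r (i + j) * real DIM('a) < d j (i + j)"
        using r(2)[of "i + j"] d'(2)[of j "i + j"] by simp
      note o = osc_nn_integral[OF h[of j] d(2)[of _ j "i + j"] less_imp_le[OF r(1)] lt]
      show "a i \<in> borel_measurable lborel" unfolding a_def using o(1) by simp
      have "((1/2) ^ (i + j) :: real) \<le> (1/2) ^ i" by (rule power_decreasing) auto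
      then show "(\<integral>\<^sup>+y. a i y \<partial>lborel) \<le> ennreal ((1/2) ^ i)"
        unfolding a_def using o(2) by (meson ennreal_leI order_trans)
    qed
    have "(\<integral>\<^sup>+y. (\<Sum>i. a i y) \<partial>lborel) = (\<Sum>i. \<integral>\<^sup>+y. a i y \<partial>lborel)"
      by (rule nn_integral_suminf) simp
    also have "\<dots> \<le> (\<Sum>i. ennreal ((1/2) ^ i))" by (intro suminf_le ai) auto
    also have "\<dots> = ennreal (\<Sum>i. (1/2) ^ i)" by (rule suminf_ennreal2) (auto intro: summable_geometric)
    also have "\<dots> < \<infinity>" by simp
    finally have "(\<integral>\<^sup>+y. (\<Sum>i. a i y) \<partial>lborel) \<noteq> \<infinity>" by simp
    then have "AE y in lborel. (\<Sum>i. a i y) \<noteq> \<infinity>" by (intro nn_integral_PInf_AE) auto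
    then show ?thesis
    proof eventually_elim
      fix y assume fin: "(\<Sum>i. a i y) \<noteq> \<infinity>"
      have nn: "0 \<le> osc (h j) (r k) y" for k unfolding osc_def by (rule integral_nonneg_AE) simp
      have "summable (\<lambda>i. osc (h j) (r (i + j)) y)"
        by (rule summable_suminf_not_top) (use nn fin in \<open>auto simp: a_def\<close>)
      from LIMSEQ_offset[OF summable_LIMSEQ_zero[OF this]] show "(\<lambda>k. osc (h j) (r k) y) \<longlonglongrightarrow> 0" .
    qed
  qed
  then have "AE y in lborel. \<forall>j. (\<lambda>k. osc (h j) (r k) y) \<longlonglongrightarrow> 0" by (subst AE_all_countable) blast
  with r(1) r0 show ?thesis by (rule that)
qed

section \<open>Monomials\<close>

definition pmono :: "'b::euclidean_space list \<Rightarrow> 'b \<Rightarrow> real" where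
  "pmono bs z = prod_list (map (\<lambda>b. z \<bullet> b) bs)"

lemma pmono_append: "pmono (as @ bs) z = pmono as z * pmono bs z"
  by (simp add: pmono_def)

lemma continuous_pmono: "continuous_on S (pmono bs)"
  unfolding pmono_def by (induction bs) (auto intro!: continuous_intros)

text \<open>Built from products of a monomial in the value and a monomial in the position: these are
  the test functions for which the blow-up limit is computed as a moment times a spatial
  integral.\<close>

inductive pspan :: "('z::euclidean_space \<times> 'a::euclidean_space \<Rightarrow> real) \<Rightarrow> bool" where
  mono: "set as \<subseteq> Basis \<Longrightarrow> set bs \<subseteq> Basis \<Longrightarrow> pspan (\<lambda>p. c * (pmono as (fst p) * pmono bs (snd p)))"
| add: "pspan f \<Longrightarrow> pspan g \<Longrightarrow> pspan (\<lambda>p. f p + g p)"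

lemma pspan_const: "pspan (\<lambda>_. c)"
  using pspan.mono[of "[]" "[]" c] by (simp add: pmono_def)

lemma pspan_sum: "(\<And>i. i \<in> I \<Longrightarrow> pspan (f i)) \<Longrightarrow> pspan (\<lambda>p. \<Sum>i\<in>I. f i p)"
  by (induction I rule: infinite_finite_induct) (auto intro: pspan_const pspan.add)

lemma pspan_mult: "pspan f \<Longrightarrow> pspan g \<Longrightarrow> pspan (\<lambda>p. f p * g p)"
proof (induction f rule: pspan.induct)
  case (mono as bs c)
  from mono(3) show ?case
  proof (induction g rule: pspan.induct)
    case (mono as' bs' c')
    have "pspan (\<lambda>p. (c * c') * (pmono (as @ as') (fst p) * pmono (bs @ bs') (snd p)))"
      using mono \<open>set as \<subseteq> Basis\<close> \<open>set bs \<subseteq> Basis\<close> by (intro pspan.mono) auto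
    then show ?case by (simp add: pmono_append mult_ac)
  next
    case (add f g)
    then show ?case using pspan.add by (simp add: distrib_left)
  qed
next
  case (add f1 f2)
  then show ?case using pspan.add by (simp add: distrib_right)
qed

lemma real_polynomial_function_pspan:
  assumes "real_polynomial_function (f :: 'z::euclidean_space \<times> 'a::euclidean_space \<Rightarrow> real)"
  shows "pspan f"
  using assms
proof (induction f rule: real_polynomial_function.induct)
  case (linear f)
  then interpret bounded_linear f .
  have "f p = (\<Sum>b\<in>Basis. f (b, 0) * (pmono [b] (fst p) * pmono [] (snd p)))
      + (\<Sum>b\<in>Basis. f (0, b) * (pmono [] (fst p) * pmono [b] (snd p)))" for p
  proof -
    have "f (\<Sum>b\<in>Basis. (p \<bullet> b) *\<^sub>R b) = (\<Sum>b\<in>Basis. (p \<bullet> b) * f b)" by (simp add: sum scaleR)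
    then have "f p = (\<Sum>b\<in>Basis. (p \<bullet> b) * f b)" by (simp only: euclidean_representation)
    also have "\<dots> = (\<Sum>b\<in>Basis. (fst p \<bullet> b) * f (b, 0)) + (\<Sum>b\<in>Basis. (snd p \<bullet> b) * f (0, b))"
    proof -
      have "(\<Sum>b\<in>Basis. (p \<bullet> b) * f b) = (\<Sum>b\<in>(\<lambda>u. (u, 0)) ` (Basis::'z set). (p \<bullet> b) * f b)
          + (\<Sum>b\<in>(\<lambda>u. (0, u)) ` (Basis::'a set). (p \<bullet> b) * f b)"
        unfolding Basis_prod_def by (rule sum.union_disjoint) auto
      also have "\<dots> = (\<Sum>b\<in>Basis. (fst p \<bullet> b) * f (b, 0)) + (\<Sum>b\<in>Basis. (snd p \<bullet> b) * f (0, b))"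
        by (cases p) (simp add: sum.reindex inj_on_def)
      finally show ?thesis .
    qed
    finally show ?thesis by (simp add: pmono_def mult.commute)
  qed
  then have "f = (\<lambda>p. (\<Sum>b\<in>Basis. f (b, 0) * (pmono [b] (fst p) * pmono [] (snd p)))
      + (\<Sum>b\<in>Basis. f (0, b) * (pmono [] (fst p) * pmono [b] (snd p))))" by blast
  moreover have "pspan \<dots>" by (intro pspan.add pspan_sum pspan.mono) auto
  ultimately show ?case by metis
qed (auto intro: pspan_const pspan.add pspan_mult)

section \<open>Blow-up of a Young measure\<close>

lemma integrable_compact_supp:
  fixes F :: "'b::euclidean_space \<Rightarrow> real"
  assumes "prob_space \<nu>" "sets \<nu> = sets borel" "AE p in \<nu>. p \<in> K" "compact K" "continuous_on UNIV F"
  shows "integrable \<nu> F"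
proof -
  interpret prob_space \<nu> by fact
  have "bounded (F ` K)"
    using compact_continuous_image[OF continuous_on_subset[OF assms(5) subset_UNIV] assms(4)] compact_imp_bounded by blast
  then obtain B where B: "\<And>p. p \<in> K \<Longrightarrow> norm (F p) \<le> B" unfolding bounded_iff by blast
  have "F \<in> borel_measurable \<nu>"
    using borel_measurable_continuous_onI[OF assms(5)] by (simp add: measurable_cong_sets[OF assms(2) refl])
  moreover have "AE p in \<nu>. norm (F p) \<le> B" using assms(3) by eventually_elim (rule B)
  ultimately show ?thesis by (intro integrable_const_bound[where B=B])
qed

text \<open>Method of moments: on a common compact set polynomials are uniformly dense, and
  integration against a probability measure is a contraction in the sup norm.\<close>

lemma polynomial_moments_limit:
  fixes \<nu> :: "nat \<Rightarrow> ('z::euclidean_space \<times> 'a::euclidean_space) measure"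
  assumes \<nu>: "\<And>k. prob_space (\<nu> k)" "\<And>k. sets (\<nu> k) = sets borel" "\<And>k. AE p in \<nu> k. p \<in> K"
    and \<nu>0: "prob_space \<nu>0" "sets \<nu>0 = sets borel" "AE p in \<nu>0. p \<in> K" and K: "compact K"
    and mom: "\<And>as bs. set as \<subseteq> Basis \<Longrightarrow> set bs \<subseteq> Basis \<Longrightarrow>
      (\<lambda>k. \<integral>p. pmono as (fst p) * pmono bs (snd p) \<partial>\<nu> k) \<longlonglongrightarrow> (\<integral>p. pmono as (fst p) * pmono bs (snd p) \<partial>\<nu>0)"
    and F: "continuous_on UNIV (F :: 'z \<times> 'a \<Rightarrow> real)"
  shows "(\<lambda>k. \<integral>p. F p \<partial>\<nu> k) \<longlonglongrightarrow> (\<integral>p. F p \<partial>\<nu>0)"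
proof -
  note int = integrable_compact_supp[OF \<nu>(1,2,3) K] and int0 = integrable_compact_supp[OF \<nu>0 K]
  have span: "continuous_on UNIV f \<and> (\<lambda>k. \<integral>p. f p \<partial>\<nu> k) \<longlonglongrightarrow> (\<integral>p. f p \<partial>\<nu>0)" if "pspan f" for f
    using that
  proof (induction f rule: pspan.induct)
    case (mono as bs c)
    have "continuous_on UNIV (\<lambda>p :: 'z \<times> 'a. c * (pmono as (fst p) * pmono bs (snd p)))"
      by (intro continuous_intros continuous_on_compose2[OF continuous_pmono[of UNIV]]) auto
    then show ?case using tendsto_mult_left[OF mom[OF mono], of c] by simp
  next
    case (add f g)
    then have c: "continuous_on UNIV f" "continuous_on UNIV g" by auto
    have "(\<lambda>k. (\<integral>p. f p \<partial>\<nu> k) + (\<integral>p. g p \<partial>\<nu> k)) \<longlonglongrightarrow> (\<integral>p. f p \<partial>\<nu>0) + (\<integral>p. g p \<partial>\<nu>0)"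
      using add by (intro tendsto_add) auto
    then show ?case
      using c int[OF c(1)] int[OF c(2)] int0[OF c(1)] int0[OF c(2)]
      by (simp add: continuous_on_add)
  qed
  show ?thesis
  proof (rule LIMSEQ_I)
    fix e :: real assume e: "e > 0"
    obtain g where g: "real_polynomial_function g" "\<And>p. p \<in> K \<Longrightarrow> \<bar>F p - g p\<bar> < e / 4"
      using Stone_Weierstrass_real_polynomial_function[OF K continuous_on_subset[OF F subset_UNIV], of "e / 4"] e
      by auto
    note gs = span[OF real_polynomial_function_pspan[OF g(1)]]
    have close: "\<bar>(\<integral>p. F p \<partial>m) - (\<integral>p. g p \<partial>m)\<bar> \<le> e / 4"
      if m: "prob_space m" "sets m = sets borel" "AE p in m. p \<in> K" for m
    proof -
      interpret prob_space m by fact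
      have i: "integrable m F" "integrable m g" using integrable_compact_supp[OF m K] F gs by auto
      have "\<bar>(\<integral>p. F p \<partial>m) - (\<integral>p. g p \<partial>m)\<bar> = \<bar>\<integral>p. F p - g p \<partial>m\<bar>" using i by simp
      also have "\<dots> \<le> (\<integral>p. \<bar>F p - g p\<bar> \<partial>m)" by (rule integral_abs_bound)
      also have "\<dots> \<le> (\<integral>p. e / 4 \<partial>m)"
      proof (rule integral_mono_AE)
        show "AE p in m. \<bar>F p - g p\<bar> \<le> e / 4" using m(3) by eventually_elim (use g(2) in force)
      qed (use i in auto)
      finally show ?thesis by (simp add: prob_space)
    qed
    obtain N where N: "\<And>k. k \<ge> N \<Longrightarrow> norm ((\<integral>p. g p \<partial>\<nu> k) - (\<integral>p. g p \<partial>\<nu>0)) < e / 4"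
      using LIMSEQ_D[OF conjunct2[OF gs], of "e / 4"] e by auto
    show "\<exists>N. \<forall>k\<ge>N. norm ((\<integral>p. F p \<partial>\<nu> k) - (\<integral>p. F p \<partial>\<nu>0)) < e"
    proof (intro exI[of _ N] allI impI)
      fix k assume "k \<ge> N"
      from N[OF this] close[OF \<nu>(1,2,3)[of k]] close[OF \<nu>0] e
      show "norm ((\<integral>p. F p \<partial>\<nu> k) - (\<integral>p. F p \<partial>\<nu>0)) < e" unfolding real_norm_def by linarith
    qed
  qed
qed

lemma C0_bounded:
  assumes "C0 (F :: 'b::euclidean_space \<Rightarrow> real)"
  obtains B where "B \<ge> 0" "\<And>z. \<bar>F z\<bar> \<le> B"
proof -
  have c: "continuous_on UNIV F" and l: "(F \<longlongrightarrow> 0) at_infinity" using assms by (auto simp: C0_def)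
  have "eventually (\<lambda>z. dist (F z) 0 < 1) at_infinity" using l by (rule tendstoD) simp
  then obtain R where R: "\<And>z. norm z \<ge> R \<Longrightarrow> \<bar>F z\<bar> < 1" by (auto simp: eventually_at_infinity)
  obtain B where B: "B \<ge> 0" "\<And>y. norm (y - 0) \<le> R \<Longrightarrow> \<bar>F y\<bar> \<le> B"
    using continuous_bounded_cball[OF c, of 0 R] by blast
  have "\<bar>F z\<bar> \<le> max B 1" for z
    using R[of z] B(2)[of z] by (cases "norm z \<le> R") (auto simp: max_def)
  then show ?thesis using that[of "max B 1"] B(1) by auto
qed

lemma C0_compact_support:
  assumes "continuous_on UNIV (F :: 'b::euclidean_space \<Rightarrow> real)" "\<And>z. norm z > R \<Longrightarrow> F z = 0"
  shows "C0 F"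
proof -
  have "eventually (\<lambda>z. F z = 0) at_infinity"
    unfolding eventually_at_infinity using assms(2) by (intro exI[of _ "R + 1"]) auto
  then show ?thesis using assms(1) by (auto simp: C0_def intro: tendsto_eventually)
qed

text \<open>Turns an integral over the blown-up cell into the pairing of \<open>q\<close> with a
  fixed integrable weight, the form in which weak* convergence can be used.\<close>

lemma torus_rescale:
  fixes q :: "'a::euclidean_space \<Rightarrow> real"
  assumes r: "r > 0" and [measurable]: "q \<in> borel_measurable borel" "p \<in> borel_measurable borel"
  shows "(\<integral>x. q (y0 + r *\<^sub>R x) * p x \<partial>torus)
    = (1 / r ^ DIM('a)) * (\<integral>y. q y * (indicator unit_cell ((1 / r) *\<^sub>R (y - y0)) * p ((1 / r) *\<^sub>R (y - y0))) \<partial>lborel)"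
proof -
  have "(\<integral>y. q y * (indicator unit_cell ((1 / r) *\<^sub>R (y - y0)) * p ((1 / r) *\<^sub>R (y - y0))) \<partial>lborel)
      = (\<integral>y. q y * (indicator unit_cell ((1 / r) *\<^sub>R (y - y0)) * p ((1 / r) *\<^sub>R (y - y0)))
          \<partial>density (distr lborel borel (\<lambda>x. y0 + r *\<^sub>R x)) (\<lambda>_. ennreal (\<bar>r\<bar> ^ DIM('a))))"
    using lborel_affine[of r y0] r by simp
  also have "\<dots> = (\<integral>x. \<bar>r\<bar> ^ DIM('a) *\<^sub>R (q x * (indicator unit_cell ((1 / r) *\<^sub>R (x - y0)) * p ((1 / r) *\<^sub>R (x - y0))))
          \<partial>distr lborel borel (\<lambda>x. y0 + r *\<^sub>R x))"
    by (rule integral_density) auto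
  also have "\<dots> = (\<integral>x. \<bar>r\<bar> ^ DIM('a) *\<^sub>R (q (y0 + r *\<^sub>R x) * (indicator unit_cell ((1 / r) *\<^sub>R (y0 + r *\<^sub>R x - y0))
      * p ((1 / r) *\<^sub>R (y0 + r *\<^sub>R x - y0)))) \<partial>lborel)"
    by (rule integral_distr) auto
  also have "\<dots> = (\<integral>x. r ^ DIM('a) * (indicator unit_cell x *\<^sub>R (q (y0 + r *\<^sub>R x) * p x)) \<partial>lborel)"
    using r by (intro Bochner_Integration.integral_cong) (auto simp: mult_ac)
  also have "\<dots> = r ^ DIM('a) * (\<integral>x. indicator unit_cell x *\<^sub>R (q (y0 + r *\<^sub>R x) * p x) \<partial>lborel)"
    by (rule integral_mult_right_zero)
  also have "(\<integral>x. indicator unit_cell x *\<^sub>R (q (y0 + r *\<^sub>R x) * p x) \<partial>lborel) = (\<integral>x. q (y0 + r *\<^sub>R x) * p x \<partial>torus)"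
    by (rule lebesgue_on_eq_lborel(1)[symmetric]) measurable
  finally show ?thesis using r by simp
qed

text \<open>Stated for Borel functions bounded at every point, so that the rescaled functions
  \<open>z n (y0 + r *\<^sub>R x)\<close> are measurable and bounded without exceptional
  sets.\<close>

locale generated =
  fixes \<Omega> :: "'a::euclidean_space set" and z :: "nat \<Rightarrow> 'a \<Rightarrow> 'z::euclidean_space" and \<mu> :: "'a \<Rightarrow> 'z measure" and C :: real
  assumes \<Omega> [measurable]: "\<Omega> \<in> sets borel" and bdd: "bounded \<Omega>"
    and z_meas [measurable]: "\<And>n. z n \<in> borel_measurable borel" and z_bound: "\<And>n y. norm (z n y) \<le> C"
    and prob: "\<And>y. y \<in> \<Omega> \<Longrightarrow> prob_space (\<mu> y)" and sets_\<mu>: "\<And>y. y \<in> \<Omega> \<Longrightarrow> sets (\<mu> y) = sets borel"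
    and meas: "\<And>F. C0 F \<Longrightarrow> pairing \<mu> F \<in> borel_measurable (lebesgue_on \<Omega>)"
    and gen: "\<And>F g. C0 F \<Longrightarrow> integrable (lebesgue_on \<Omega>) g \<Longrightarrow>
      (\<lambda>n. \<integral>y. F (z n y) * g y \<partial>lebesgue_on \<Omega>) \<longlonglongrightarrow> (\<integral>y. pairing \<mu> F y * g y \<partial>lebesgue_on \<Omega>)"
begin

sublocale fin: finite_measure "lebesgue_on \<Omega>"
  by (rule finite_measure_lebesgue_on_bounded[OF \<Omega> bdd])

lemma C0_integrable:
  assumes F: "C0 F" and y: "y \<in> \<Omega>"
  shows "integrable (\<mu> y) F"
proof -
  interpret prob_space "\<mu> y" by (rule prob[OF y])
  obtain B where "\<And>z. \<bar>F z\<bar> \<le> B" using C0_bounded[OF F] by blast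
  moreover have "F \<in> borel_measurable (\<mu> y)"
    using F borel_measurable_continuous_onI by (auto simp: measurable_cong_sets[OF sets_\<mu>[OF y] refl] C0_def)
  ultimately show ?thesis by (intro integrable_const_bound[where B=B]) auto
qed

lemma pairing_bound:
  assumes F: "C0 F" and B: "\<And>z. \<bar>F z\<bar> \<le> B" and y: "y \<in> \<Omega>"
  shows "\<bar>pairing \<mu> F y\<bar> \<le> B"
proof -
  interpret prob_space "\<mu> y" by (rule prob[OF y])
  have "\<bar>pairing \<mu> F y\<bar> \<le> (\<integral>z. \<bar>F z\<bar> \<partial>\<mu> y)" unfolding pairing_def by (rule integral_abs_bound)
  also have "\<dots> \<le> (\<integral>z. B \<partial>\<mu> y)" using B by (intro integral_mono integrable_abs C0_integrable[OF F y]) auto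
  finally show ?thesis by (simp add: prob_space)
qed

text \<open>Test with a nonnegative function in \<open>C0\<close> which is positive exactly outside
  the ball of radius \<open>C\<close>. It vanishes along the sequence, so its pairing has integral
  zero and hence vanishes almost everywhere.\<close>

lemma support: "AE y in lebesgue_on \<Omega>. AE v in \<mu> y. norm v \<le> C"
proof -
  \<comment> \<open>The numerator grows linearly; the quadratic denominator makes the quotient
    vanish at infinity.\<close>
  define F where "F v = max 0 (norm v - C) / (1 + norm v)\<^sup>2" for v :: 'z
  have C: "C \<ge> 0" using z_bound[of 0 0] norm_ge_zero order_trans by blast
  have Fc: "continuous_on UNIV F"
    unfolding F_def by (intro continuous_intros) (auto simp: add_nonneg_eq_0_iff)
  have Fle: "norm (F v) \<le> 1 / (1 + norm v)" for v
  proof -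
    have "max 0 (norm v - C) \<le> 1 + norm v" using C by auto
    then have "max 0 (norm v - C) * (1 + norm v) \<le> (1 + norm v) * (1 + norm v)" by (intro mult_right_mono) auto
    moreover have "1 + norm v > 0" by (simp add: add_pos_nonneg)
    ultimately show ?thesis unfolding F_def by (simp add: divide_simps power2_eq_square)
  qed
  have "(F \<longlongrightarrow> 0) at_infinity"
  proof (rule Lim_null_comparison)
    show "eventually (\<lambda>v. norm (F v) \<le> 1 / (1 + norm v)) at_infinity" using Fle by simp
    have "filterlim (\<lambda>v::'z. 1 + norm v) at_top at_infinity"
      by (intro filterlim_tendsto_add_at_top[OF tendsto_const] filterlim_norm_at_top)
    then show "((\<lambda>v::'z. 1 / (1 + norm v)) \<longlongrightarrow> 0) at_infinity"
      by (intro tendsto_divide_0[OF tendsto_const] filterlim_at_top_imp_at_infinity)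
  qed
  then have F: "C0 F" using Fc by (simp add: C0_def)
  obtain B where B: "\<And>v. \<bar>F v\<bar> \<le> B" using C0_bounded[OF F] by blast
  have F0: "F v \<ge> 0" for v by (simp add: F_def)
  have Fz: "F (z n y) = 0" for n y using z_bound[of n y] by (simp add: F_def)
  have "integrable (lebesgue_on \<Omega>) (\<lambda>_. 1::real)" by simp
  from gen[OF F this] have "(\<lambda>n::nat. 0::real) \<longlonglongrightarrow> (\<integral>y. pairing \<mu> F y * 1 \<partial>lebesgue_on \<Omega>)"
    unfolding Fz by simp
  then have "(\<integral>y. pairing \<mu> F y \<partial>lebesgue_on \<Omega>) = 0" by (simp add: LIMSEQ_const_iff)
  moreover have "integrable (lebesgue_on \<Omega>) (pairing \<mu> F)"
    using pairing_bound[OF F B] by (intro fin.integrable_const_bound[where B=B] AE_I2 meas F) auto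
  moreover have "AE y in lebesgue_on \<Omega>. 0 \<le> pairing \<mu> F y"
    unfolding pairing_def using F0 by (intro AE_I2 integral_nonneg_AE) auto
  ultimately have "AE y in lebesgue_on \<Omega>. pairing \<mu> F y = 0"
    using integral_nonneg_eq_0_iff_AE by blast
  with AE_space show ?thesis
  proof eventually_elim
    fix y assume "y \<in> space (lebesgue_on \<Omega>)" and p: "pairing \<mu> F y = 0"
    then have y: "y \<in> \<Omega>" by simp
    have "AE v in \<mu> y. F v = 0"
      using integral_nonneg_eq_0_iff_AE[OF C0_integrable[OF F y]] F0 p by (simp add: pairing_def)
    then show "AE v in \<mu> y. norm v \<le> C"
    proof eventually_elim
      fix v assume "F v = 0"
      moreover have "1 + norm v \<noteq> 0" by (metis add_pos_nonneg less_irrefl norm_ge_zero zero_less_one)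
      ultimately show "norm v \<le> C" by (auto simp: F_def max_def split: if_splits)
    qed
  qed
qed

text \<open>A pairing is only Lebesgue measurable and lives on \<Omega>, whereas the oscillation
  estimates ask for a bounded Borel function of bounded support. Clipping by \<open>B\<close> and by
  \<Omega> restores both at the cost of a null set.\<close>

lemma borel_version:
  assumes F: "C0 F"
  obtains h where "bdd_supp h" "AE y in lebesgue_on \<Omega>. h y = pairing \<mu> F y"
proof -
  obtain B where B: "\<And>v. \<bar>F v\<bar> \<le> B" using C0_bounded[OF F] by blast
  have "(\<lambda>y. if y \<in> \<Omega> then pairing \<mu> F y else 0) \<in> borel_measurable lebesgue"
    using meas[OF F] by (subst borel_measurable_if_D borel_measurable_if) auto
  then obtain h' where h' [measurable]: "h' \<in> borel_measurable lborel"
    and ae: "AE y in lborel. (if y \<in> \<Omega> then pairing \<mu> F y else 0) = h' y"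
    using completion_ex_borel_measurable_real by blast
  define h where "h y = (if y \<in> \<Omega> \<and> \<bar>h' y\<bar> \<le> B then h' y else 0)" for y
  have B0: "B \<ge> 0" using B[of 0] by linarith
  obtain R where R: "\<And>x. x \<in> \<Omega> \<Longrightarrow> norm x \<le> R" using bdd by (auto simp: bounded_iff)
  have "h \<in> borel_measurable borel" unfolding h_def using h' by measurable
  moreover have "\<bar>h x\<bar> \<le> B" for x using B0 by (auto simp: h_def)
  moreover have "h x = 0" if "norm x > R" for x using R[of x] that by (auto simp: h_def)
  ultimately have "bdd_supp h" unfolding bdd_supp_def by blast
  moreover have "AE y in lebesgue. (if y \<in> \<Omega> then pairing \<mu> F y else 0) = h' y"
    using ae by (simp add: AE_completion_iff)
  then have "AE y in lebesgue_on \<Omega>. h y = pairing \<mu> F y"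
  proof (subst AE_restrict_space_iff, simp, elim eventually_mono, intro impI)
    fix y assume "(if y \<in> \<Omega> then pairing \<mu> F y else 0) = h' y" "y \<in> \<Omega>"
    then show "h y = pairing \<mu> F y" using pairing_bound[OF F B, of y] by (simp add: h_def)
  qed
  ultimately show ?thesis by (rule that)
qed

definition lz :: "nat \<Rightarrow> 'z list" where "lz = from_nat_into (lists Basis)"
definition la :: "nat \<Rightarrow> 'a list" where "la = from_nat_into (lists Basis)"

lemma range_lists_Basis: "range (from_nat_into (lists (Basis :: 'b::euclidean_space set))) = lists Basis"
  by (rule range_from_nat_into[OF _ countable_lists[OF countable_finite[OF finite_Basis]]]) auto

lemma lz_surj: "set as \<subseteq> Basis \<Longrightarrow> \<exists>j. lz j = as" and la_surj: "set bs \<subseteq> Basis \<Longrightarrow> \<exists>l. la l = bs"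
  using range_lists_Basis[where 'b='z] range_lists_Basis[where 'b='a]
  unfolding lz_def la_def by (metis in_lists_conv_set rangeE subsetD)+

text \<open>A monomial cut off beyond radius \<open>C\<close>, so that it is admissible as a test
  function in \<open>C0\<close>; the cutoff is not seen by values of norm at most
  \<open>C\<close>.\<close>

definition mom :: "nat \<Rightarrow> 'z \<Rightarrow> real" where
  "mom j v = pmono (lz j) v * max 0 (min 1 (C + 1 - norm v))"

lemma mom_C0: "C0 (mom j)"
  by (rule C0_compact_support[of _ "C + 1"])
    (auto simp: mom_def[abs_def] intro!: continuous_intros continuous_pmono)

lemma mom_eq: "norm v \<le> C \<Longrightarrow> mom j v = pmono (lz j) v"
  by (simp add: mom_def)

text \<open>Two limits are joined: for a fixed radius, n \<rightarrow> \<infinity> replaces the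
  moments of the sequence by those of the Young measure; then the radius shrinks, and at a Lebesgue
  point these become constant. A diagonal choice \<open>n k\<close> handles more and more moments,
  and density of polynomials gives all continuous \<open>F\<close>.\<close>

lemma blowup_at:
  assumes y0: "y0 \<in> interior \<Omega>" and supp: "AE v in \<mu> y0. norm v \<le> C"
    and h: "\<And>j. bdd_supp (h j)" "\<And>j. AE y in lebesgue_on \<Omega>. h j y = pairing \<mu> (mom j) y"
    and hy0: "\<And>j. h j y0 = pairing \<mu> (mom j) y0"
    and r: "\<And>k. r k > 0" "r \<longlonglongrightarrow> 0" and o: "\<And>j. (\<lambda>k. osc (h j) (r k) y0) \<longlonglongrightarrow> 0"
  shows "\<exists>n. (\<forall>k. n k \<ge> (k::nat)) \<and> (\<forall>F :: 'z \<times> 'a \<Rightarrow> real. continuous_on UNIV F \<longrightarrow>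
    (\<lambda>k. \<integral>x. F (z (n k) (y0 + r k *\<^sub>R x), x) \<partial>torus) \<longlonglongrightarrow> (\<integral>x. (\<integral>v. F (v, x) \<partial>\<mu> y0) \<partial>torus))"
proof -
  have y0\<Omega>: "y0 \<in> \<Omega>" using y0 interior_subset by blast
  obtain d where d: "d > 0" "ball y0 d \<subseteq> \<Omega>" using y0 by (meson mem_interior)
  define inside where "inside k \<longleftrightarrow> r k * real DIM('a) < d" for k
  have inside: "y0 + r k *\<^sub>R x \<in> \<Omega>" if "inside k" "x \<in> unit_cell" for k x
  proof -
    have "norm (r k *\<^sub>R x) \<le> r k * real DIM('a)"
      using r(1)[of k] unit_cell_norm[OF that(2)] by (simp add: mult_left_mono)
    then have "y0 + r k *\<^sub>R x \<in> ball y0 d" using that(1) by (simp add: inside_def dist_norm)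
    then show ?thesis using d(2) by blast
  qed
  have ev_inside: "eventually inside sequentially"
  proof -
    have "(\<lambda>k. r k * real DIM('a)) \<longlonglongrightarrow> 0" using tendsto_mult_right[OF r(2), of "real DIM('a)"] by simp
    from order_tendstoD(2)[OF this d(1)] show ?thesis by (simp add: inside_def[abs_def])
  qed
  define p where "p l = pmono (la l)" for l
  have pc: "continuous_on UNIV (p l)" for l unfolding p_def by (rule continuous_pmono)
  have pm [measurable]: "p l \<in> borel_measurable borel" for l using pc by (rule borel_measurable_continuous_onI)
  have "\<exists>B\<ge>0. \<forall>x\<in>unit_cell. \<bar>p l x\<bar> \<le> B" for l
  proof -
    obtain B where "B \<ge> 0" "\<And>y. norm (y - 0) \<le> real DIM('a) \<Longrightarrow> \<bar>p l y\<bar> \<le> B"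
      using continuous_bounded_cball[OF pc, of 0 "real DIM('a)" l] by blast
    then show ?thesis using unit_cell_norm by auto
  qed
  then obtain Bp where Bp: "\<And>l. Bp l \<ge> 0" "\<And>l x. x \<in> unit_cell \<Longrightarrow> \<bar>p l x\<bar> \<le> Bp l" by metis
  have hm [measurable]: "h j \<in> borel_measurable borel" for j using h(1) by (simp add: bdd_supp_def)
  have momm [measurable]: "mom j \<in> borel_measurable borel" for j
    using mom_C0[of j] borel_measurable_continuous_onI by (auto simp: C0_def)
  define I where "I n k j l = (\<integral>x. mom j (z n (y0 + r k *\<^sub>R x)) * p l x \<partial>torus)" for n k j l
  define H where "H k j l = (\<integral>x. h j (y0 + r k *\<^sub>R x) * p l x \<partial>torus)" for k j l
  have step1: "(\<lambda>n. I n k j l) \<longlonglongrightarrow> H k j l" if k: "inside k" for k j l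
  proof -
    define w where "w y = indicator unit_cell ((1 / r k) *\<^sub>R (y - y0)) * p l ((1 / r k) *\<^sub>R (y - y0))" for y
    have [measurable]: "w \<in> borel_measurable borel" unfolding w_def by measurable
    have w0: "w y = 0" if "y \<notin> \<Omega>" for y
    proof -
      have "(1 / r k) *\<^sub>R (y - y0) \<notin> unit_cell"
        using inside[OF k, of "(1 / r k) *\<^sub>R (y - y0)"] that r(1)[of k] by auto
      then show ?thesis by (simp add: w_def)
    qed
    have wb: "\<bar>w y\<bar> \<le> Bp l" for y using Bp by (simp add: w_def indicator_def)
    have wi: "integrable (lebesgue_on \<Omega>) w"
      using wb by (intro fin.integrable_const_bound[where B="Bp l"]) (auto intro: measurable_lebesgue_on_borel)
    have conv: "(\<integral>x. q (y0 + r k *\<^sub>R x) * p l x \<partial>torus) = (1 / r k ^ DIM('a)) * (\<integral>y. q y * w y \<partial>lebesgue_on \<Omega>)"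
      if [measurable]: "q \<in> borel_measurable borel" for q
    proof -
      have "(\<integral>y. q y * w y \<partial>lebesgue_on \<Omega>) = (\<integral>y. indicator \<Omega> y *\<^sub>R (q y * w y) \<partial>lborel)"
        by (rule lebesgue_on_eq_lborel(1)) measurable
      also have "\<dots> = (\<integral>y. q y * w y \<partial>lborel)"
        using w0 by (intro Bochner_Integration.integral_cong) (auto simp: indicator_def)
      finally show ?thesis using torus_rescale[OF r(1)[of k] that pm[of l], of y0] by (simp add: w_def)
    qed
    have "(\<lambda>n. \<integral>y. mom j (z n y) * w y \<partial>lebesgue_on \<Omega>) \<longlonglongrightarrow> (\<integral>y. pairing \<mu> (mom j) y * w y \<partial>lebesgue_on \<Omega>)"
      by (rule gen[OF mom_C0 wi])
    moreover have "(\<integral>y. pairing \<mu> (mom j) y * w y \<partial>lebesgue_on \<Omega>) = (\<integral>y. h j y * w y \<partial>lebesgue_on \<Omega>)"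
    proof (rule integral_cong_AE)
      show "(\<lambda>y. pairing \<mu> (mom j) y * w y) \<in> borel_measurable (lebesgue_on \<Omega>)"
        by (intro borel_measurable_times meas mom_C0 measurable_lebesgue_on_borel) measurable
      show "(\<lambda>y. h j y * w y) \<in> borel_measurable (lebesgue_on \<Omega>)"
        by (intro measurable_lebesgue_on_borel) measurable
      show "AE y in lebesgue_on \<Omega>. pairing \<mu> (mom j) y * w y = h j y * w y"
        using h(2)[of j] by eventually_elim simp
    qed
    ultimately have "(\<lambda>n. (1 / r k ^ DIM('a)) * (\<integral>y. mom j (z n y) * w y \<partial>lebesgue_on \<Omega>))
        \<longlonglongrightarrow> (1 / r k ^ DIM('a)) * (\<integral>y. h j y * w y \<partial>lebesgue_on \<Omega>)" by (intro tendsto_mult_left) simp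
    then show ?thesis unfolding I_def H_def using conv[of "\<lambda>y. mom j (z _ y)"] conv[of "h j"] by simp
  qed
  \<comment> \<open>Only finitely many pairs of moment and weight at stage \<open>k\<close>, so one
    index serves them all. Requiring it to be at least \<open>k\<close> later sends the fluxes to
    the lifts along the diagonal.\<close>
  have "\<exists>n\<ge>k. inside k \<longrightarrow> (\<forall>j\<in>{..k}. \<forall>l\<in>{..k}. \<bar>I n k j l - H k j l\<bar> < 1 / real (Suc k))" for k
  proof (cases "inside k")
    case True
    have "eventually (\<lambda>n. \<forall>j\<in>{..k}. \<forall>l\<in>{..k}. \<bar>I n k j l - H k j l\<bar> < 1 / real (Suc k)) sequentially"
    proof (intro eventually_ball_finite finite_atMost ballI)
      fix j l
      have "eventually (\<lambda>n. dist (I n k j l) (H k j l) < 1 / real (Suc k)) sequentially"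
        by (rule tendstoD[OF step1[OF True]]) simp
      then show "eventually (\<lambda>n. \<bar>I n k j l - H k j l\<bar> < 1 / real (Suc k)) sequentially" by (simp add: dist_real_def)
    qed
    from eventually_happens'[OF sequentially_bot eventually_conj[OF eventually_ge_at_top[of k] this]]
    show ?thesis by blast
  qed auto
  then obtain n where n: "\<And>k. n k \<ge> k" "\<And>k j l. inside k \<Longrightarrow> j \<le> k \<Longrightarrow> l \<le> k \<Longrightarrow> \<bar>I (n k) k j l - H k j l\<bar> < 1 / real (Suc k)"
    by (metis atMost_iff)
  \<comment> \<open>The error is at most the sup of the spatial monomial times the mean oscillation
    at \<open>y0\<close>.\<close>
  have step3: "(\<lambda>k. H k j l) \<longlonglongrightarrow> h j y0 * (\<integral>x. p l x \<partial>torus)" for j l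
  proof -
    obtain B where B: "\<And>x. \<bar>h j x\<bar> \<le> B" using h(1)[of j] by (auto simp: bdd_supp_def)
    have B0: "B \<ge> 0" using B[of 0] by linarith
    have i1: "integrable torus (\<lambda>x. h j (y0 + r k *\<^sub>R x) * p l x)" for k
    proof (rule integrable_torus_bounded[where B="B * Bp l"])
      fix x :: 'a assume "x \<in> unit_cell"
      then show "\<bar>h j (y0 + r k *\<^sub>R x) * p l x\<bar> \<le> B * Bp l"
        unfolding abs_mult using B Bp B0 by (intro mult_mono) auto
    qed measurable
    have i2: "integrable torus (p l)" by (rule integrable_torus_continuous[OF pc])
    have i3: "integrable torus (\<lambda>x. \<bar>h j (y0 + r k *\<^sub>R x) - h j y0\<bar>)" for k
    proof (rule integrable_torus_bounded[where B="2 * B"])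
      fix x show "\<bar>\<bar>h j (y0 + r k *\<^sub>R x) - h j y0\<bar>\<bar> \<le> 2 * B" using B[of "y0 + r k *\<^sub>R x"] B[of y0] by linarith
    qed measurable
    have "(\<lambda>k. H k j l - h j y0 * (\<integral>x. p l x \<partial>torus)) \<longlonglongrightarrow> 0"
    proof (rule Lim_null_comparison)
      show "(\<lambda>k. Bp l * osc (h j) (r k) y0) \<longlonglongrightarrow> 0" using tendsto_mult_left[OF o, of "Bp l" j] by simp
      show "eventually (\<lambda>k. norm (H k j l - h j y0 * (\<integral>x. p l x \<partial>torus)) \<le> Bp l * osc (h j) (r k) y0) sequentially"
      proof (rule always_eventually, rule allI)
        fix k
        have "H k j l - h j y0 * (\<integral>x. p l x \<partial>torus) = (\<integral>x. h j (y0 + r k *\<^sub>R x) * p l x - h j y0 * p l x \<partial>torus)"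
          unfolding H_def using i1[of k] i2 by simp
        also have "norm \<dots> \<le> (\<integral>x. norm (h j (y0 + r k *\<^sub>R x) * p l x - h j y0 * p l x) \<partial>torus)"
          by (rule integral_norm_bound)
        also have "\<dots> \<le> (\<integral>x. Bp l * \<bar>h j (y0 + r k *\<^sub>R x) - h j y0\<bar> \<partial>torus)"
        proof (rule integral_mono)
          fix x :: 'a assume "x \<in> space torus"
          then have "\<bar>p l x\<bar> * \<bar>h j (y0 + r k *\<^sub>R x) - h j y0\<bar> \<le> Bp l * \<bar>h j (y0 + r k *\<^sub>R x) - h j y0\<bar>"
            using Bp by (intro mult_right_mono) auto
          then show "norm (h j (y0 + r k *\<^sub>R x) * p l x - h j y0 * p l x) \<le> Bp l * \<bar>h j (y0 + r k *\<^sub>R x) - h j y0\<bar>"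
            by (simp add: abs_mult[symmetric] right_diff_distrib mult.commute)
        qed (use i1[of k] i2 i3[of k] in auto)
        finally show "norm (H k j l - h j y0 * (\<integral>x. p l x \<partial>torus)) \<le> Bp l * osc (h j) (r k) y0"
          by (simp add: osc_def)
      qed
    qed
    then show ?thesis by (rule LIM_zero_cancel)
  qed
  have step4: "(\<lambda>k. I (n k) k j l) \<longlonglongrightarrow> h j y0 * (\<integral>x. p l x \<partial>torus)" for j l
  proof -
    have "(\<lambda>k. I (n k) k j l - H k j l) \<longlonglongrightarrow> 0"
    proof (rule Lim_null_comparison[OF _ LIMSEQ_inverse_real_of_nat])
      show "eventually (\<lambda>k. norm (I (n k) k j l - H k j l) \<le> inverse (real (Suc k))) sequentially"
        using ev_inside eventually_ge_at_top[of j] eventually_ge_at_top[of l]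
        by eventually_elim (use n(2) in \<open>auto simp: inverse_eq_divide intro: less_imp_le\<close>)
    qed
    from tendsto_add[OF this step3[of j l]] show ?thesis by simp
  qed
  interpret M: prob_space "\<mu> y0" by (rule prob[OF y0\<Omega>])
  interpret PP: pair_prob_space "\<mu> y0" "torus :: 'a measure" ..
  define V where "V k x = z (n k) (y0 + r k *\<^sub>R x)" for k x
  have [measurable]: "V k \<in> borel_measurable borel" for k unfolding V_def by measurable
  define \<nu> where "\<nu> k = distr torus borel (\<lambda>x. (V k x, x))" for k
  have idm: "(\<lambda>p. p) \<in> \<mu> y0 \<Otimes>\<^sub>M (torus :: 'a measure) \<rightarrow>\<^sub>M borel"
  proof -
    have "fst \<in> borel_measurable (\<mu> y0 \<Otimes>\<^sub>M (torus :: 'a measure))"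
      by (rule measurable_compose[OF measurable_fst, of "\<lambda>v. v", unfolded eta_contract_eq]) (simp add: measurable_ident_sets sets_\<mu>[OF y0\<Omega>])
    moreover have "snd \<in> borel_measurable (\<mu> y0 \<Otimes>\<^sub>M (torus :: 'a measure))"
      by (rule measurable_compose[OF measurable_snd id_measurable_lebesgue_on[of unit_cell], unfolded eta_contract_eq])
    ultimately have "(\<lambda>p. (fst p, snd p)) \<in> borel_measurable (\<mu> y0 \<Otimes>\<^sub>M (torus :: 'a measure))" by (rule borel_measurable_Pair)
    then show ?thesis by simp
  qed
  \<comment> \<open>The product carries Lebesgue sets in the second factor; the image under the
    identity is the same measure on the Borel sets, as the moment argument expects.\<close>
  define \<nu>0 where "\<nu>0 = distr (\<mu> y0 \<Otimes>\<^sub>M (torus :: 'a measure)) borel (\<lambda>p. p)"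
  define K where "K = cball (0::'z) C \<times> cbox (0::'a) One"
  have Vm: "(\<lambda>x. (V k x, x)) \<in> borel_measurable torus" for k
    by (intro borel_measurable_Pair measurable_lebesgue_on_borel id_measurable_lebesgue_on) measurable
  have K: "compact K" "closed K" unfolding K_def by (auto intro: compact_Times closed_Times)
  have Kb [measurable]: "K \<in> sets borel" using K(2) by (rule borel_closed)
  have \<nu>: "prob_space (\<nu> k)" "sets (\<nu> k) = sets borel" "AE p in \<nu> k. p \<in> K" for k
  proof -
    show "prob_space (\<nu> k)" unfolding \<nu>_def by (rule torus.prob_space_distr[OF Vm])
    show "sets (\<nu> k) = sets borel" by (simp add: \<nu>_def)
    have "(V k x, x) \<in> K" if "x \<in> unit_cell" for x
      using z_bound unit_cell_subset_cbox that by (auto simp: K_def V_def)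
    then show "AE p in \<nu> k. p \<in> K"
      unfolding \<nu>_def by (subst AE_distr_iff[OF Vm]) auto
  qed
  have \<nu>0: "prob_space \<nu>0" "sets \<nu>0 = sets borel" "AE p in \<nu>0. p \<in> K"
  proof -
    show "prob_space \<nu>0" unfolding \<nu>0_def by (rule PP.prob_space_distr[OF idm])
    show "sets \<nu>0 = sets borel" by (simp add: \<nu>0_def)
    have "AE p in \<mu> y0 \<Otimes>\<^sub>M (torus :: 'a measure). p \<in> K"
    proof (rule PP.AE_pair_measure)
      have "(\<lambda>p. p) -` K \<inter> space (\<mu> y0 \<Otimes>\<^sub>M (torus :: 'a measure)) \<in> sets (\<mu> y0 \<Otimes>\<^sub>M torus)"
        by (rule measurable_sets[OF idm Kb])
      then show "{p \<in> space (\<mu> y0 \<Otimes>\<^sub>M (torus :: 'a measure)). p \<in> K} \<in> sets (\<mu> y0 \<Otimes>\<^sub>M torus)"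
        by (simp add: Int_def conj_commute)
      show "AE v in \<mu> y0. AE x in (torus :: 'a measure). (v, x) \<in> K"
        using supp
      proof eventually_elim
        fix v :: 'z assume "norm v \<le> C"
        then show "AE x in (torus :: 'a measure). (v, x) \<in> K"
          using unit_cell_subset_cbox by (intro AE_I2) (auto simp: K_def)
      qed
    qed
    then show "AE p in \<nu>0. p \<in> K"
      unfolding \<nu>0_def by (subst AE_distr_iff[OF idm]) auto
  qed
  have int\<nu>: "(\<integral>p. F p \<partial>\<nu> k) = (\<integral>x. F (V k x, x) \<partial>torus)" if "continuous_on UNIV F" for F :: "'z \<times> 'a \<Rightarrow> real" and k
    unfolding \<nu>_def by (rule integral_distr[OF Vm borel_measurable_continuous_onI[OF that]])
  have int\<nu>0: "(\<integral>p. F p \<partial>\<nu>0) = (\<integral>x. (\<integral>v. F (v, x) \<partial>\<mu> y0) \<partial>torus)" if "continuous_on UNIV F" for F :: "'z \<times> 'a \<Rightarrow> real"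
  proof -
    have Fm: "F \<in> borel_measurable borel" using that by (rule borel_measurable_continuous_onI)
    have "integrable \<nu>0 F" by (rule integrable_compact_supp[OF \<nu>0 K(1) that])
    then have "integrable (\<mu> y0 \<Otimes>\<^sub>M (torus :: 'a measure)) F"
      unfolding \<nu>0_def by (subst (asm) integrable_distr_eq[OF idm Fm]) simp
    then have i: "integrable (\<mu> y0 \<Otimes>\<^sub>M (torus :: 'a measure)) (\<lambda>(v, x). F (v, x))"
      by (simp add: case_prod_eta)
    have "(\<integral>p. F p \<partial>\<nu>0) = (\<integral>p. F p \<partial>(\<mu> y0 \<Otimes>\<^sub>M (torus :: 'a measure)))"
      unfolding \<nu>0_def by (rule integral_distr[OF idm Fm])
    also have "\<dots> = (\<integral>x. (\<integral>v. F (v, x) \<partial>\<mu> y0) \<partial>torus)"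
      using PP.integral_snd[OF i] by (simp add: case_prod_eta)
    finally show ?thesis .
  qed
  have pmc: "continuous_on UNIV (\<lambda>p :: 'z \<times> 'a. pmono as (fst p) * pmono bs (snd p))" for as bs
    by (intro continuous_intros continuous_on_compose2[OF continuous_pmono[of UNIV]]) auto
  have lim: "(\<lambda>k. \<integral>p. F p \<partial>\<nu> k) \<longlonglongrightarrow> (\<integral>p. F p \<partial>\<nu>0)" if F: "continuous_on UNIV F" for F :: "'z \<times> 'a \<Rightarrow> real"
  proof (rule polynomial_moments_limit[OF \<nu> \<nu>0 K(1) _ F])
    fix as :: "'z list" and bs :: "'a list" assume "set as \<subseteq> Basis" "set bs \<subseteq> Basis"
    then obtain j l where jl: "lz j = as" "la l = bs" using lz_surj la_surj by metis
    have "(\<integral>p. pmono as (fst p) * pmono bs (snd p) \<partial>\<nu> k) = I (n k) k j l" for k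
      unfolding int\<nu>[OF pmc] I_def p_def V_def by (simp add: mom_eq z_bound jl)
    moreover have "(\<integral>p. pmono as (fst p) * pmono bs (snd p) \<partial>\<nu>0) = h j y0 * (\<integral>x. p l x \<partial>torus)"
    proof -
      have "(\<integral>v. pmono as v \<partial>\<mu> y0) = (\<integral>v. mom j v \<partial>\<mu> y0)"
      proof (rule integral_cong_AE)
        show "AE v in \<mu> y0. pmono as v = mom j v" using supp by eventually_elim (simp add: mom_eq jl)
      qed (use borel_measurable_continuous_onI[OF continuous_pmono] momm in
            \<open>simp_all add: measurable_cong_sets[OF sets_\<mu>[OF y0\<Omega>] refl]\<close>)
      then show ?thesis unfolding int\<nu>0[OF pmc] hy0 pairing_def p_def by (simp add: jl mult.commute)
    qed
    ultimately show "(\<lambda>k. \<integral>p. pmono as (fst p) * pmono bs (snd p) \<partial>\<nu> k) \<longlonglongrightarrow> (\<integral>p. pmono as (fst p) * pmono bs (snd p) \<partial>\<nu>0)"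
      using step4 by simp
  qed
  show ?thesis
  proof (intro exI[of _ n] conjI allI impI)
    fix F :: "'z \<times> 'a \<Rightarrow> real" assume F: "continuous_on UNIV F"
    show "(\<lambda>k. \<integral>x. F (z (n k) (y0 + r k *\<^sub>R x), x) \<partial>torus) \<longlonglongrightarrow> (\<integral>x. (\<integral>v. F (v, x) \<partial>\<mu> y0) \<partial>torus)"
      using lim[OF F] unfolding int\<nu>[OF F] int\<nu>0[OF F] V_def .
  qed (rule n(1))
qed

text \<open>The exceptional set is fixed by countably many moments before any test function
  \<open>F\<close> is chosen; that is the source of a set of full measure common to all
  \<open>f\<close>.\<close>

theorem blowup:
  obtains r :: "nat \<Rightarrow> real" where "\<And>k. r k > 0" "r \<longlonglongrightarrow> 0"
    "AE y0 in lebesgue_on \<Omega>. y0 \<in> interior \<Omega> \<longrightarrow> (AE v in \<mu> y0. norm v \<le> C) \<and>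
      (\<exists>n. (\<forall>k. n k \<ge> (k::nat)) \<and> (\<forall>F :: 'z \<times> 'a \<Rightarrow> real. continuous_on UNIV F \<longrightarrow>
      (\<lambda>k. \<integral>x. F (z (n k) (y0 + r k *\<^sub>R x), x) \<partial>torus) \<longlonglongrightarrow> (\<integral>x. (\<integral>v. F (v, x) \<partial>\<mu> y0) \<partial>torus)))"
proof -
  have "\<exists>h. bdd_supp h \<and> (AE y in lebesgue_on \<Omega>. h y = pairing \<mu> (mom j) y)" for j
    using borel_version[OF mom_C0[of j]] by blast
  then have "\<exists>h. \<forall>j. bdd_supp (h j) \<and> (AE y in lebesgue_on \<Omega>. h j y = pairing \<mu> (mom j) y)"
    by (intro choice allI)
  then obtain h where hh: "\<forall>j. bdd_supp (h j) \<and> (AE y in lebesgue_on \<Omega>. h j y = pairing \<mu> (mom j) y)"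
    by (rule exE)
  note h = spec[OF hh, THEN conjunct1] spec[OF hh, THEN conjunct2]
  obtain r :: "nat \<Rightarrow> real" where r: "\<And>k. r k > 0" "r \<longlonglongrightarrow> 0"
    and o: "AE y in lborel. \<forall>j. (\<lambda>k. osc (h j) (r k) y) \<longlonglongrightarrow> 0"
    by (rule common_Lebesgue_points[where h=h, OF h(1)]) (rule that)
  have o': "AE y in lebesgue_on \<Omega>. \<forall>j. (\<lambda>k. osc (h j) (r k) y) \<longlonglongrightarrow> 0"
  proof (subst AE_restrict_space_iff)
    have "AE y in lebesgue. \<forall>j. (\<lambda>k. osc (h j) (r k) y) \<longlonglongrightarrow> 0" using o by (simp add: AE_completion_iff)
    then show "AE y in lebesgue. y \<in> \<Omega> \<longrightarrow> (\<forall>j. (\<lambda>k. osc (h j) (r k) y) \<longlonglongrightarrow> 0)" by eventually_elim simp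
  qed simp
  have h': "AE y in lebesgue_on \<Omega>. \<forall>j. h j y = pairing \<mu> (mom j) y"
    using h(2) by (subst AE_all_countable) blast
  show ?thesis
  proof (rule that[OF r], use o' h' support in eventually_elim, intro impI conjI)
    fix y0 assume 1: "\<forall>j. (\<lambda>k. osc (h j) (r k) y0) \<longlonglongrightarrow> 0" and 2: "\<forall>j. h j y0 = pairing \<mu> (mom j) y0"
      and 3: "AE v in \<mu> y0. norm v \<le> C" and y0: "y0 \<in> interior \<Omega>"
    show "AE v in \<mu> y0. norm v \<le> C" by (rule 3)
    show "\<exists>n. (\<forall>k. n k \<ge> (k::nat)) \<and> (\<forall>F :: 'z \<times> 'a \<Rightarrow> real. continuous_on UNIV F \<longrightarrow>
      (\<lambda>k. \<integral>x. F (z (n k) (y0 + r k *\<^sub>R x), x) \<partial>torus) \<longlonglongrightarrow> (\<integral>x. (\<integral>v. F (v, x) \<partial>\<mu> y0) \<partial>torus))"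
      by (rule blowup_at[OF y0 3 h spec[OF 2] r spec[OF 1]])
  qed
qed

end

section \<open>Mollification in the cylinder\<close>

lemma Ck_fst_snd:
  fixes f :: "'a::euclidean_space \<Rightarrow> real" and h :: "'b::euclidean_space \<Rightarrow> real"
  shows "Ck k f \<Longrightarrow> Ck k (\<lambda>p::'a \<times> 'b. f (fst p))" "Ck k h \<Longrightarrow> Ck k (\<lambda>p::'a \<times> 'b. h (snd p))"
proof -
  show "Ck k (\<lambda>p::'a \<times> 'b. f (fst p))" if "Ck k f" using that
  proof (induction k arbitrary: f)
    case 0 then show ?case by (auto intro!: continuous_on_compose2[of UNIV f] continuous_intros)
  next
    case (Suc k)
    show ?case
    proof (rule Ck_SucI)
      show "((\<lambda>p::'a \<times> 'b. f (fst p)) has_derivative (\<lambda>v. frechet_derivative f (at (fst p)) (fst v))) (at p)" for p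
        by (rule has_derivative_compose[OF _ has_frechet_derivative[OF Ck_SucD(1)[OF Suc.prems]]])
          (auto intro!: derivative_eq_intros)
      fix b :: "'a \<times> 'b" assume b: "b \<in> Basis"
      then consider "fst b \<in> Basis" | "fst b = 0" by (auto simp: Basis_prod_def)
      then show "Ck k (\<lambda>p::'a \<times> 'b. frechet_derivative f (at (fst p)) (fst b))"
      proof cases
        case 1 then show ?thesis using Suc.IH[OF Ck_SucD(2)[OF Suc.prems]] by (simp add: partial_def)
      next
        case 2
        have "frechet_derivative f (at x) 0 = 0" for x
          using has_derivative_linear[OF has_frechet_derivative[OF Ck_SucD(1)[OF Suc.prems]]] by (rule linear_0)
        with 2 show ?thesis by (simp add: Ck_const)
      qed
    qed
  qed
  show "Ck k (\<lambda>p::'a \<times> 'b. h (snd p))" if "Ck k h" using that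
  proof (induction k arbitrary: h)
    case 0 then show ?case by (auto intro!: continuous_on_compose2[of UNIV h] continuous_intros)
  next
    case (Suc k)
    show ?case
    proof (rule Ck_SucI)
      show "((\<lambda>p::'a \<times> 'b. h (snd p)) has_derivative (\<lambda>v. frechet_derivative h (at (snd p)) (snd v))) (at p)" for p
        by (rule has_derivative_compose[OF _ has_frechet_derivative[OF Ck_SucD(1)[OF Suc.prems]]])
          (auto intro!: derivative_eq_intros)
      fix b :: "'a \<times> 'b" assume b: "b \<in> Basis"
      then consider "snd b \<in> Basis" | "snd b = 0" by (auto simp: Basis_prod_def)
      then show "Ck k (\<lambda>p::'a \<times> 'b. frechet_derivative h (at (snd p)) (snd b))"
      proof cases
        case 1 then show ?thesis using Suc.IH[OF Ck_SucD(2)[OF Suc.prems]] by (simp add: partial_def)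
      next
        case 2
        have "frechet_derivative h (at x) 0 = 0" for x
          using has_derivative_linear[OF has_frechet_derivative[OF Ck_SucD(1)[OF Suc.prems]]] by (rule linear_0)
        with 2 show ?thesis by (simp add: Ck_const)
      qed
    qed
  qed
qed

lemma smooth_fst: "smooth f \<Longrightarrow> smooth (\<lambda>p::'a::euclidean_space \<times> 'b::euclidean_space. f (fst p) :: real)"
  and smooth_snd: "smooth h \<Longrightarrow> smooth (\<lambda>p::'a::euclidean_space \<times> 'b::euclidean_space. h (snd p) :: real)"
  by (simp_all add: smooth_def Ck_fst_snd)

lemma
  fixes f :: "'a::euclidean_space \<Rightarrow> real" and h :: "'b::euclidean_space \<Rightarrow> real"
  shows partial_fst: "smooth f \<Longrightarrow> partial b (\<lambda>p::'a \<times> 'b. f (fst p)) p = partial (fst b) f (fst p)"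
    and partial_snd: "smooth h \<Longrightarrow> partial b (\<lambda>p::'a \<times> 'b. h (snd p)) p = partial (snd b) h (snd p)"
proof -
  show "partial b (\<lambda>p::'a \<times> 'b. f (fst p)) p = partial (fst b) f (fst p)" if "smooth f"
    unfolding partial_def[of "fst b"]
    by (rule partial_eqI, rule has_derivative_compose[OF _ has_frechet_derivative[OF smooth_differentiable[OF that]]])
      (auto intro!: derivative_eq_intros)
  show "partial b (\<lambda>p::'a \<times> 'b. h (snd p)) p = partial (snd b) h (snd p)" if "smooth h"
    unfolding partial_def[of "snd b"]
    by (rule partial_eqI, rule has_derivative_compose[OF _ has_frechet_derivative[OF smooth_differentiable[OF that]]])
      (auto intro!: derivative_eq_intros)
qed

lemma partial_0 [simp]: "smooth f \<Longrightarrow> partial 0 f x = 0"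
  unfolding partial_def
  by (rule linear_0[OF has_derivative_linear[OF has_frechet_derivative[OF smooth_differentiable]]])

section \<open>Weak divergence constraints and a kernel periodic in space\<close>

definition interior_time :: "real \<Rightarrow> (real \<Rightarrow> real) \<Rightarrow> bool" where
  "interior_time T a \<longleftrightarrow> smooth a \<and> (\<exists>s1 s2. 0 < s1 \<and> s2 < T \<and> (\<forall>t. t < s1 \<or> s2 < t \<longrightarrow> a t = 0))"

text \<open>Products of a function of time and a function of space suffice, because the mollifying
  kernel is such a product. Vanishing of the time factor near both ends removes the initial
  data.\<close>

definition weakly_div_free ::
    "real \<Rightarrow> (real \<times> (real^'n::finite) \<Rightarrow> real \<times> (real^'n) \<Rightarrow> real \<times> (real^'n) \<Rightarrow> real) \<Rightarrow> bool" where
  "weakly_div_free T w \<longleftrightarrow> (\<forall>b\<in>Basis. \<forall>a \<beta>. interior_time T a \<longrightarrow> smooth \<beta> \<longrightarrow> periodic \<beta> \<longrightarrow>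
     (\<Sum>c\<in>Basis. \<integral>y. w b c y * partial c (\<lambda>p. a (fst p) * \<beta> (snd p)) y \<partial>cyl T) = 0)"

definition time_bump :: "real \<Rightarrow> real \<Rightarrow> real" where
  "time_bump \<delta> t = psi (\<delta>\<^sup>2 - t\<^sup>2)"

text \<open>Through the cosine the bump is periodic on the whole space: each factor is nonzero only
  within distance \<delta> of an integer. Reflected translates of it are thus admissible periodic
  test functions.\<close>

definition space_bump :: "real \<Rightarrow> (real^'n::finite) \<Rightarrow> real" where
  "space_bump \<delta> x = (\<Prod>i\<in>UNIV. psi (cos (2 * pi * (x $ i)) - cos (2 * pi * \<delta>)))"

lemma smooth_time_bump: "smooth (time_bump \<delta>)"
proof -
  have "smooth (\<lambda>t::real. \<delta>\<^sup>2 - (t \<bullet> 1) * (t \<bullet> 1))"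
    by (intro smooth_diff smooth_const smooth_mult smooth_inner)
  from smooth_compose_real[OF smooth_psi this] show ?thesis
    by (simp add: time_bump_def[abs_def] power2_eq_square)
qed

lemma smooth_space_bump: "smooth (space_bump \<delta> :: (real^'n::finite) \<Rightarrow> real)"
proof -
  have "smooth (\<lambda>x::real^'n. \<Prod>i\<in>UNIV. psi (cos (2 * pi * (x \<bullet> axis i 1)) - cos (2 * pi * \<delta>)))"
    by (intro smooth_prod smooth_compose_real[OF smooth_psi] smooth_diff smooth_compose_real[OF smooth_cos]
        smooth_mult smooth_const smooth_inner)
  then show ?thesis by (simp add: space_bump_def[abs_def] inner_axis)
qed

lemma space_bump_periodic: "b \<in> Basis \<Longrightarrow> space_bump \<delta> (x + r *\<^sub>R b) = space_bump \<delta> x" if "r = 1 \<or> r = -1"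
proof -
  assume "b \<in> Basis"
  then obtain j where b: "b = axis j 1" by (auto simp: Basis_vec_def)
  have "cos (2 * pi * ((x + r *\<^sub>R b) $ i)) = cos (2 * pi * (x $ i))" for i
    using that cos_periodic[of "2 * pi * (x $ i)"] cos_periodic[of "2 * pi * (x $ i) - 2 * pi"]
    by (auto simp: b axis_def algebra_simps)
  then show ?thesis by (simp add: space_bump_def)
qed

lemma bumps_nonneg: "0 \<le> time_bump \<delta> t" "0 \<le> space_bump \<delta> x" "time_bump \<delta> t \<le> 1" "space_bump \<delta> x \<le> 1"
  by (auto simp: time_bump_def space_bump_def psi_nonneg psi_le_1 intro!: prod_nonneg prod_le_1)

lemma time_bump_support: "0 < \<delta> \<Longrightarrow> time_bump \<delta> t \<noteq> 0 \<Longrightarrow> \<bar>t\<bar> < \<delta>"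
  unfolding time_bump_def using psi_eq_0[of "\<delta>\<^sup>2 - t\<^sup>2"] abs_le_square_iff[of \<delta> t] by force

text \<open>The cosine decreases over the half period, and the remaining range 1/2 < |s| \<le> 1 -
  \<delta> is reflected to it by |s| \<mapsto> 1 - |s|.\<close>

lemma cos_near_1:
  assumes \<delta>: "0 < \<delta>" "\<delta> < 1/4" and s: "\<bar>s\<bar> \<le> 1 - \<delta>" and c: "cos (2 * pi * \<delta>) < cos (2 * pi * s)"
  shows "\<bar>s\<bar> < \<delta>"
proof (rule ccontr)
  assume n: "\<not> \<bar>s\<bar> < \<delta>"
  have le: "cos (2 * pi * u) \<le> cos (2 * pi * \<delta>)" if "\<delta> \<le> u" "u \<le> 1/2" for u
    using \<delta> that by (intro cos_monotone_0_pi_le) auto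
  have abs: "cos (2 * pi * s) = cos (2 * pi * \<bar>s\<bar>)" by (cases "s \<ge> 0") auto
  show False
  proof (cases "\<bar>s\<bar> \<le> 1/2")
    case True
    then show False using le[of "\<bar>s\<bar>"] n c abs by simp
  next
    case False
    have "cos (2 * pi * (1 - \<bar>s\<bar>)) = cos (2 * pi - 2 * pi * \<bar>s\<bar>)" by (simp add: algebra_simps)
    also have "\<dots> = cos (2 * pi * \<bar>s\<bar>)" by (simp add: cos_diff)
    finally show False using le[of "1 - \<bar>s\<bar>"] False s c abs by simp
  qed
qed

lemma space_bump_support:
  assumes "0 < \<delta>" "\<delta> < 1/4" "\<bar>x $ i\<bar> \<le> 1 - \<delta>" "space_bump \<delta> x \<noteq> 0"
  shows "\<bar>x $ i\<bar> < \<delta>"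
proof (rule cos_near_1[OF assms(1-3)])
  have "psi (cos (2 * pi * (x $ i)) - cos (2 * pi * \<delta>)) \<noteq> 0"
    using assms(4) by (auto simp: space_bump_def)
  then show "cos (2 * pi * \<delta>) < cos (2 * pi * (x $ i))"
    using psi_eq_0[of "cos (2 * pi * (x $ i)) - cos (2 * pi * \<delta>)"] by (metis diff_gt_0_iff_gt not_le)
qed

definition bump :: "real \<Rightarrow> real \<times> (real^'n::finite) \<Rightarrow> real" where
  "bump \<delta> p = time_bump \<delta> (fst p) * space_bump \<delta> (snd p)"

text \<open>A period cell centred at the origin, which isolates one copy of the periodic kernel;
  that copy is an ordinary mollifier.\<close>

definition centre_cell :: "(real \<times> (real^'n::finite)) set" where
  "centre_cell = {p. \<bar>fst p\<bar> < 1/2 \<and> (\<forall>i. \<bar>snd p $ i\<bar> < 1/2)}"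

lemma open_centre_cell: "open (centre_cell :: (real \<times> (real^'n::finite)) set)"
proof -
  have "centre_cell = {p::real \<times> (real^'n). \<bar>fst p\<bar> < 1/2} \<inter> (\<Inter>i. {p. \<bar>snd p $ i\<bar> < 1/2})"
    by (auto simp: centre_cell_def)
  also have "open \<dots>" by (intro open_Int open_INT ballI finite open_Collect_less continuous_intros)
  finally show ?thesis .
qed

lemma smooth_bump: "smooth (bump \<delta>)"
  unfolding bump_def[abs_def] by (intro smooth_mult smooth_fst smooth_snd smooth_time_bump smooth_space_bump)

lemma space_time_norm_le:
  fixes p :: "real \<times> (real^'n::finite)"
  assumes "\<bar>fst p\<bar> \<le> \<delta>" "\<And>i. \<bar>snd p $ i\<bar> \<le> \<delta>"
  shows "norm p \<le> real (CARD('n) + 1) * \<delta>"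
proof -
  have "norm p \<le> norm (fst p) + norm (snd p)" using norm_Pair_le[of "fst p" "snd p"] by simp
  also have "norm (snd p) \<le> (\<Sum>i\<in>UNIV. \<bar>snd p $ i\<bar>)" by (rule norm_le_l1_cart)
  also have "\<dots> \<le> (\<Sum>i\<in>(UNIV::'n set). \<delta>)" by (intro sum_mono assms)
  finally show ?thesis using assms(1) by (simp add: algebra_simps)
qed

lemma centre_bump_support:
  assumes "0 < \<delta>" "\<delta> < 1/4" "p \<in> centre_cell" "bump \<delta> p \<noteq> 0"
  shows "\<bar>fst p\<bar> < \<delta>" "\<bar>snd p $ i\<bar> < \<delta>"
proof -
  have "time_bump \<delta> (fst p) \<noteq> 0" "space_bump \<delta> (snd p) \<noteq> 0" using assms(4) by (auto simp: bump_def)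
  moreover have "\<bar>snd p $ i\<bar> < 1/2" using assms(3) by (simp add: centre_cell_def)
  then have "\<bar>snd p $ i\<bar> \<le> 1 - \<delta>" using assms(2) by linarith
  ultimately show "\<bar>fst p\<bar> < \<delta>" "\<bar>snd p $ i\<bar> < \<delta>"
    using time_bump_support space_bump_support assms(1,2) by blast+
qed

lemma centre_bump_integral:
  assumes \<delta>: "0 < \<delta>" "\<delta> < 1/4"
  shows "integrable lborel (\<lambda>p :: real \<times> (real^'n::finite). indicator centre_cell p * bump \<delta> p)"
    "(\<integral>p. indicator centre_cell p * bump \<delta> p \<partial>(lborel :: (real \<times> (real^'n::finite)) measure)) > 0"
proof -
  let ?f = "\<lambda>p :: real \<times> (real^'n). indicator centre_cell p * bump \<delta> p"
  have [measurable]: "bump \<delta> \<in> borel_measurable (borel :: (real \<times> (real^'n)) measure)"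
    by (intro borel_measurable_continuous_onI smooth_continuous smooth_bump)
  have [measurable]: "centre_cell \<in> sets (borel :: (real \<times> (real^'n)) measure)"
    using open_centre_cell by (rule borel_open)
  have nn: "0 \<le> ?f p" for p by (simp add: bump_def bumps_nonneg)
  have le: "?f p \<le> 1" for p
    using mult_mono[of "time_bump \<delta> (fst p)" 1 "space_bump \<delta> (snd p)" 1]
    by (auto simp: bump_def bumps_nonneg indicator_def)
  have "bdd_supp ?f"
    unfolding bdd_supp_def
  proof (intro conjI)
    show "\<exists>B. \<forall>p. \<bar>?f p\<bar> \<le> B" using nn le by (intro exI[of _ 1]) (auto simp: abs_of_nonneg)
    have "?f p = 0" if "norm p > real (CARD('n) + 1) * \<delta>" for p
    proof (rule ccontr)
      assume "?f p \<noteq> 0"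
      then have "p \<in> centre_cell" "bump \<delta> p \<noteq> 0" by (auto simp: indicator_def split: if_splits)
      from centre_bump_support[OF \<delta> this] have "norm p \<le> real (CARD('n) + 1) * \<delta>"
        by (intro space_time_norm_le) (auto intro: less_imp_le)
      then show False using that by simp
    qed
    then show "\<exists>R. \<forall>p. norm p > R \<longrightarrow> ?f p = 0" by blast
  qed measurable
  then show int: "integrable lborel ?f" by (rule bdd_supp_integrable)
  show "(\<integral>p. ?f p \<partial>lborel) > 0"
  proof (rule ccontr)
    assume "\<not> ?thesis"
    moreover have "(\<integral>p. ?f p \<partial>lborel) \<ge> 0" using nn by (intro integral_nonneg_AE) auto
    ultimately have "AE p in lborel. ?f p = 0"
      using integral_nonneg_eq_0_iff_AE[OF int] nn by auto
    then have "AE p in lebesgue. ?f p = 0" by (simp add: AE_completion_iff)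
    then obtain N where N: "{p. \<not> ?f p = 0} \<subseteq> N" "N \<in> null_sets lebesgue"
      unfolding eventually_ae_filter by auto
    have "open (centre_cell \<inter> {p :: real \<times> (real^'n). bump \<delta> p \<noteq> 0})"
      by (intro open_Int open_centre_cell open_Collect_neq smooth_continuous smooth_bump continuous_on_const)
    moreover have "0 \<in> centre_cell \<inter> {p :: real \<times> (real^'n). bump \<delta> p \<noteq> 0}"
    proof -
      have "cos (2 * pi * \<delta>) < cos 0" using \<delta> by (intro cos_monotone_0_pi) auto
      then have "psi (cos 0 - cos (2 * pi * \<delta>)) \<noteq> 0" using psi_pos[of "1 - cos (2 * pi * \<delta>)"] by simp
      moreover have "psi (\<delta>\<^sup>2) \<noteq> 0" using psi_pos[of "\<delta>\<^sup>2"] \<delta> by simp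
      ultimately show ?thesis by (simp add: centre_cell_def bump_def time_bump_def space_bump_def)
    qed
    moreover have "negligible (centre_cell \<inter> {p :: real \<times> (real^'n). bump \<delta> p \<noteq> 0})"
    proof (rule negligible_subset)
      show "negligible N" using N(2) by (simp add: negligible_iff_null_sets)
      show "centre_cell \<inter> {p :: real \<times> (real^'n). bump \<delta> p \<noteq> 0} \<subseteq> N" using N(1) by auto
    qed
    ultimately show False using open_not_negligible by blast
  qed
qed

lemma lborel_reflect:
  fixes f :: "'a::euclidean_space \<Rightarrow> real"
  assumes [measurable]: "f \<in> borel_measurable borel"
  shows "(\<integral>x. f (c - x) \<partial>lborel) = (\<integral>x. f x \<partial>lborel)"
proof -
  have "lborel = density (distr lborel borel (\<lambda>x::'a. c + (-1) *\<^sub>R x)) (\<lambda>_. 1)"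
    using lborel_affine[of "-1" c] by simp
  then have "(lborel :: 'a measure) = distr lborel borel (\<lambda>x. c - x)" by (simp add: density_1)
  then have "(\<integral>x. f x \<partial>lborel) = (\<integral>x. f x \<partial>distr lborel borel (\<lambda>x. c - x))" by simp
  also have "\<dots> = (\<integral>x. f (c - x) \<partial>lborel)" by (rule integral_distr) auto
  finally show ?thesis by simp
qed

lemma cylinder_borel [measurable]: "cylinder T \<in> sets (borel :: (real \<times> (real^'n::finite)) measure)"
proof -
  have "fst -` {0<..<T} \<in> sets (borel :: (real \<times> (real^'n)) measure)"
    by (rule measurable_sets_borel[OF borel_measurable_continuous_onI[OF continuous_on_fst[OF continuous_on_id]]]) simp
  moreover have "snd -` unit_cell \<in> sets (borel :: (real \<times> (real^'n)) measure)"
    by (rule measurable_sets_borel[OF borel_measurable_continuous_onI[OF continuous_on_snd[OF continuous_on_id]]]) simp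
  moreover have "cylinder T = (fst -` {0<..<T} \<inter> snd -` unit_cell :: (real \<times> (real^'n)) set)"
    by (auto simp: cylinder_def)
  ultimately show ?thesis by simp
qed

lemma bounded_cylinder: "bounded (cylinder T :: (real \<times> (real^'n::finite)) set)"
  unfolding cylinder_def by (intro bounded_Times bounded_unit_cell) simp

text \<open>The obstacle is that the constraint allows only periodic test functions, while
  \<open>w\<close> is given on one cell and set to zero outside. For points at distance \<delta>0
  from the boundary only one copy of the periodic kernel meets the cylinder, so convolution with it
  is both an ordinary mollification, hence close to \<open>w\<close> in L1, and a pairing with an
  admissible test function, hence divergence-free.\<close>

lemma mollify:
  fixes w :: "real \<times> (real^'n::finite) \<Rightarrow> real \<times> (real^'n) \<Rightarrow> real \<times> (real^'n) \<Rightarrow> real"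
  assumes wm: "\<And>b c. w b c \<in> borel_measurable borel" and wB: "\<And>b c y. \<bar>w b c y\<bar> \<le> B"
    and w0: "\<And>b c y. y \<notin> cylinder T \<Longrightarrow> w b c y = 0" and sym: "\<And>b c. w b c = w c b"
    and div: "weakly_div_free T w"
    and r: "r > 0" and \<delta>0: "\<delta>0 > 0"
    and inner: "\<And>x. x \<in> unit_cell \<Longrightarrow> \<delta>0 < fst (y0 + r *\<^sub>R x) \<and> fst (y0 + r *\<^sub>R x) < T - \<delta>0"
      "\<And>x i. x \<in> unit_cell \<Longrightarrow> \<delta>0 < snd (y0 + r *\<^sub>R x) $ i \<and> snd (y0 + r *\<^sub>R x) $ i < 1 - \<delta>0"
    and \<epsilon>: "\<epsilon> > 0"
  shows "\<exists>W. (\<forall>b c. smooth (W b c)) \<and> (\<forall>b c. W b c = W c b) \<and>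
    (\<forall>b c. \<forall>x\<in>unit_cell. \<bar>W b c x\<bar> \<le> B) \<and>
    (\<forall>b\<in>Basis. \<forall>x\<in>unit_cell. (\<Sum>c\<in>Basis. partial c (W b c) x) = 0) \<and>
    (\<forall>b\<in>Basis. \<forall>c\<in>Basis. (\<integral>x. \<bar>W b c x - w b c (y0 + r *\<^sub>R x)\<bar> \<partial>torus) \<le> \<epsilon>)"
proof -
  let ?B = "Basis :: (real \<times> (real^'n)) set"
  have [measurable]: "w b c \<in> borel_measurable borel" for b c by (rule wm)
  define D where "D = real (CARD('n) + 1)"
  have D: "D > 0" by (simp add: D_def)
  \<comment> \<open>Passing to blown-up coordinates divides the L1 distance by this power of
    \<open>r\<close>.\<close>
  define \<epsilon>' where "\<epsilon>' = \<epsilon> * r ^ DIM(real \<times> (real^'n))"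
  have \<epsilon>': "\<epsilon>' > 0" using \<epsilon> r by (simp add: \<epsilon>'_def)
  obtain Rc where Rc: "\<And>y. y \<in> (cylinder T :: (real \<times> (real^'n)) set) \<Longrightarrow> norm y \<le> Rc"
    using bounded_cylinder[of T] by (auto simp: bounded_iff)
  have supp: "bdd_supp (w b c)" for b c
    unfolding bdd_supp_def
  proof (intro conjI)
    show "\<exists>B. \<forall>x. \<bar>w b c x\<bar> \<le> B" using wB by blast
    show "\<exists>R. \<forall>x. R < norm x \<longrightarrow> w b c x = 0" using w0 Rc by (metis not_le)
  qed (rule wm)
  have "\<exists>d>0. \<forall>s. norm s < d \<longrightarrow> (\<integral>x. \<bar>w (fst q) (snd q) (x + s) - w (fst q) (snd q) x\<bar> \<partial>lborel) < \<epsilon>'" for q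
    by (rule translation_continuous[OF supp \<epsilon>'])
  then have "\<exists>d. \<forall>q. d q > 0 \<and> (\<forall>s. norm s < d q \<longrightarrow>
      (\<integral>x. \<bar>w (fst q) (snd q) (x + s) - w (fst q) (snd q) x\<bar> \<partial>lborel) < \<epsilon>')"
    by (intro choice allI)
  then obtain d where d: "\<And>q. d q > 0"
    "\<And>q s. norm s < d q \<Longrightarrow> (\<integral>x. \<bar>w (fst q) (snd q) (x + s) - w (fst q) (snd q) x\<bar> \<partial>lborel) < \<epsilon>'" by blast
  define d0 where "d0 = Min (d ` (?B \<times> ?B))"
  have d0: "d0 > 0" "\<And>b c. b \<in> ?B \<Longrightarrow> c \<in> ?B \<Longrightarrow> d0 \<le> d (b, c)"
    using d(1) by (auto simp: d0_def)
  \<comment> \<open>1/8 isolates the copies of the kernel, \<delta>0/2 keeps its support away from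
    the boundary, and the last term keeps all shifts shorter than \<open>d0\<close>, since a point
    with coordinates below \<delta> has norm at most D\<delta>.\<close>
  define \<delta> where "\<delta> = min (min (1/8) (\<delta>0 / 2)) (d0 / (2 * D))"
  have \<delta>: "0 < \<delta>" "\<delta> < 1/4" "\<delta> < \<delta>0" using \<delta>0 d0(1) D by (auto simp: \<delta>_def)
  have D\<delta>: "D * \<delta> < d0"
  proof -
    have "D * \<delta> \<le> D * (d0 / (2 * D))" using D by (intro mult_left_mono) (auto simp: \<delta>_def)
    also have "\<dots> < d0" using D d0(1) by simp
    finally show ?thesis .
  qed
  define N where "N = (\<integral>p. indicator centre_cell p * bump \<delta> p \<partial>(lborel :: (real \<times> (real^'n)) measure))"
  have N: "N > 0" unfolding N_def by (rule centre_bump_integral(2)[OF \<delta>(1,2)])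
  define \<eta> where "\<eta> p = (1 / N) * bump \<delta> p" for p :: "real \<times> (real^'n)"
  define \<eta>0 where "\<eta>0 p = indicator centre_cell p * \<eta> p" for p :: "real \<times> (real^'n)"
  have sm: "smooth \<eta>" unfolding \<eta>_def[abs_def] by (intro smooth_mult smooth_const smooth_bump)
  have [measurable]: "\<eta> \<in> borel_measurable borel" by (intro borel_measurable_continuous_onI smooth_continuous sm)
  have [measurable]: "centre_cell \<in> sets (borel :: (real \<times> (real^'n)) measure)" using open_centre_cell by (rule borel_open)
  have [measurable]: "\<eta>0 \<in> borel_measurable borel" unfolding \<eta>0_def by measurable
  have \<eta>0_int: "integrable lborel \<eta>0" "(\<integral>p. \<eta>0 p \<partial>lborel) = 1"
  proof -
    have eq: "\<eta>0 = (\<lambda>p. (1 / N) * (indicator centre_cell p * bump \<delta> p))" by (auto simp: \<eta>0_def \<eta>_def)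
    show "integrable lborel \<eta>0" unfolding eq by (intro integrable_mult_right centre_bump_integral(1)[OF \<delta>(1,2)])
    show "(\<integral>p. \<eta>0 p \<partial>lborel) = 1" unfolding eq using N by (simp add: N_def)
  qed
  have \<eta>0_nn: "0 \<le> \<eta>0 p" for p using N by (simp add: \<eta>0_def \<eta>_def bump_def bumps_nonneg)
  have \<eta>0_supp: "\<bar>fst p\<bar> < \<delta>" "\<bar>snd p $ i\<bar> < \<delta>" if "\<eta>0 p \<noteq> 0" for p i
    using that centre_bump_support(1)[OF \<delta>(1,2), of p] centre_bump_support(2)[OF \<delta>(1,2), of p i] by (auto simp: \<eta>0_def \<eta>_def indicator_def split: if_splits)
  have \<eta>0_norm: "norm p < d0" if "\<eta>0 p \<noteq> 0" for p
    using space_time_norm_le[of p \<delta>] \<eta>0_supp[OF that] D\<delta> by (force simp: D_def intro: less_imp_le)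
  define inn where "inn y \<longleftrightarrow> (\<delta>0 < fst y \<and> fst y < T - \<delta>0) \<and> (\<forall>i. \<delta>0 < snd y $ i \<and> snd y $ i < 1 - \<delta>0)" for y :: "real \<times> (real^'n)"
  have inn: "inn (y0 + r *\<^sub>R x)" if "x \<in> unit_cell" for x using inner that unfolding inn_def by blast
  have cell_iff: "x \<in> unit_cell \<longleftrightarrow> (\<forall>i. 0 \<le> x $ i \<and> x $ i < 1)" for x :: "real^'n"
    by (auto simp: unit_cell_def Basis_vec_def inner_axis)
  \<comment> \<open>The spatial coordinates of y - y' stay below 1 - \<delta> in modulus, so a
    nonzero value of the periodic kernel can only come from the central copy.\<close>
  have kernel: "indicator (cylinder T) y' * (w b c y' * \<eta> (y - y')) = w b c y' * \<eta>0 (y - y')" if y: "inn y" for b c y y'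
  proof (cases "y' \<in> cylinder T")
    case True
    have "\<eta> (y - y') = \<eta>0 (y - y')"
    proof (cases "\<eta> (y - y') = 0")
      case False
      then have t: "time_bump \<delta> (fst (y - y')) \<noteq> 0" and sp: "space_bump \<delta> (snd (y - y')) \<noteq> 0"
        by (auto simp: \<eta>_def bump_def)
      have l1: "\<bar>fst (y - y')\<bar> < \<delta>" by (rule time_bump_support[OF \<delta>(1) t])
      have l2: "\<bar>snd (y - y') $ i\<bar> < \<delta>" for i
      proof (rule space_bump_support[OF \<delta>(1,2) _ sp])
        have "0 \<le> snd y' $ i" "snd y' $ i < 1" using True by (auto simp: cylinder_def cell_iff)
        moreover have "\<delta>0 < snd y $ i" "snd y $ i < 1 - \<delta>0" using y by (auto simp: inn_def)
        ultimately show "\<bar>snd (y - y') $ i\<bar> \<le> 1 - \<delta>" using \<delta>(3) by simp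
      qed
      have "\<bar>fst (y - y')\<bar> < 1/2" using l1 \<delta>(2) by linarith
      moreover have "\<bar>snd (y - y') $ i\<bar> < 1/2" for i using l2[of i] \<delta>(2) by linarith
      ultimately have "y - y' \<in> centre_cell" unfolding centre_cell_def by blast
      then show ?thesis by (simp add: \<eta>0_def)
    qed (simp add: \<eta>0_def)
    then show ?thesis using True by simp
  qed (simp add: w0)
  define w' where "w' b c y = (\<integral>y'. w b c y' * \<eta> (y + - y') \<partial>cyl T)" for b c y
  have shift: "bounded_shift (cyl T) (w b c) (\<lambda>y'. - y') B Rc" for b c
  proof -
    interpret finite_measure "cyl T :: (real \<times> (real^'n)) measure"
      by (intro finite_measure_lebesgue_on_bounded bounded_cylinder cylinder_borel)
    show ?thesis
    proof
      show "(\<lambda>y'. - y') \<in> borel_measurable (cyl T :: (real \<times> (real^'n)) measure)" by (rule measurable_lebesgue_on_borel) measurable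
      show "w b c \<in> borel_measurable (cyl T)" by (intro measurable_lebesgue_on_borel wm)
    qed (use wB Rc in auto)
  qed
  have w'conv: "w' b c = bounded_shift.conv (cyl T) (w b c) (\<lambda>y'. - y') \<eta>" for b c
    unfolding w'_def[abs_def] bounded_shift.conv_def[OF shift, abs_def] by (rule refl)
  have w'sm: "smooth (w' b c)" for b c
    unfolding w'conv by (rule bounded_shift.conv_smooth[OF shift sm])
  have w'eq: "w' b c y = (\<integral>s. w b c (y - s) * \<eta>0 s \<partial>lborel)" if y: "inn y" for b c y
  proof -
    have "w' b c y = (\<integral>y'. indicator (cylinder T) y' *\<^sub>R (w b c y' * \<eta> (y + - y')) \<partial>lborel)"
      unfolding w'_def by (rule lebesgue_on_eq_lborel(1)) measurable
    also have "\<dots> = (\<integral>y'. w b c y' * \<eta>0 (y - y') \<partial>lborel)"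
      by (simp only: real_scaleR_def add_uminus_conv_diff kernel[OF y])
    also have "\<dots> = (\<integral>s. w b c (y - s) * \<eta>0 (y - (y - s)) \<partial>lborel)"
      by (rule lborel_reflect[symmetric]) measurable
    finally show ?thesis by simp
  qed
  have int_w\<eta>: "integrable lborel (\<lambda>s. q s * \<eta>0 s)" if [measurable]: "q \<in> borel_measurable borel" and "\<And>s. \<bar>q s\<bar> \<le> A" for q A
  proof (rule Bochner_Integration.integrable_bound)
    show "integrable lborel (\<lambda>s. A * \<eta>0 s)" using \<eta>0_int by simp
    have "\<bar>q s\<bar> * \<eta>0 s \<le> \<bar>A\<bar> * \<eta>0 s" for s
      using that(2)[of s] \<eta>0_nn by (intro mult_right_mono) auto
    then show "AE s in lborel. norm (q s * \<eta>0 s) \<le> norm (A * \<eta>0 s)"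
      using \<eta>0_nn by (simp add: abs_mult)
  qed measurable
  have w'B: "\<bar>w' b c y\<bar> \<le> B" if y: "inn y" for b c y
  proof -
    have "\<bar>w' b c y\<bar> \<le> (\<integral>s. \<bar>w b c (y - s) * \<eta>0 s\<bar> \<partial>lborel)"
      unfolding w'eq[OF y] by (rule integral_abs_bound)
    also have "\<dots> \<le> (\<integral>s. B * \<eta>0 s \<partial>lborel)"
    proof (rule integral_mono)
      show "integrable lborel (\<lambda>s. \<bar>w b c (y - s) * \<eta>0 s\<bar>)"
        using wB by (intro integrable_abs int_w\<eta>[where A=B]) auto
      show "integrable lborel (\<lambda>s. B * \<eta>0 s)" using \<eta>0_int by simp
      show "\<bar>w b c (y - s) * \<eta>0 s\<bar> \<le> B * \<eta>0 s" for s
        using mult_right_mono[OF wB[of b c "y - s"] \<eta>0_nn[of s]] \<eta>0_nn[of s] by (simp add: abs_mult)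
    qed
    also have "\<dots> = B" using \<eta>0_int by simp
    finally show ?thesis .
  qed
  have w'div: "(\<Sum>c\<in>?B. partial c (w' b c) y) = 0" if y: "inn y" and b: "b \<in> ?B" for b y
  proof -
    define a where "a t = (1 / N) * time_bump \<delta> (fst y - t)" for t
    define \<beta> where "\<beta> x = space_bump \<delta> (snd y - x)" for x
    have asm: "smooth a"
    proof -
      have "smooth (\<lambda>t. (1 / N) * time_bump \<delta> (fst y + (-1) *\<^sub>R t))"
        by (intro smooth_mult smooth_const smooth_affine smooth_time_bump)
      then show ?thesis by (simp add: a_def[abs_def])
    qed
    have \<beta>sm: "smooth \<beta>"
    proof -
      have "smooth (\<lambda>x. space_bump \<delta> (snd y + (-1) *\<^sub>R x))" by (intro smooth_affine smooth_space_bump)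
      then show ?thesis by (simp add: \<beta>_def[abs_def])
    qed
    have a0: "a t = 0" if t: "t < fst y - \<delta> \<or> fst y + \<delta> < t" for t
    proof (rule ccontr)
      assume "a t \<noteq> 0"
      then have "\<bar>fst y - t\<bar> < \<delta>" using time_bump_support[OF \<delta>(1)] by (auto simp: a_def)
      with t show False by auto
    qed
    have "0 < fst y - \<delta>" "fst y + \<delta> < T" using y \<delta>(3) by (auto simp: inn_def)
    with a0 asm have "interior_time T a" unfolding interior_time_def by blast
    moreover have "periodic \<beta>"
      unfolding periodic_def \<beta>_def
    proof (intro allI ballI)
      fix x c :: "real^'n" assume c: "c \<in> Basis"
      have "snd y - (x + c) = (snd y - x) + (-1) *\<^sub>R c" by simp
      then show "space_bump \<delta> (snd y - (x + c)) = space_bump \<delta> (snd y - x)"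
        using space_bump_periodic[of "-1" c \<delta> "snd y - x"] c by (simp only:) simp
    qed
    ultimately have z: "(\<Sum>c\<in>?B. \<integral>y'. w b c y' * partial c (\<lambda>p. a (fst p) * \<beta> (snd p)) y' \<partial>cyl T) = 0"
      using div b \<beta>sm unfolding weakly_div_free_def by blast
    \<comment> \<open>As a function of y' the kernel centred at y is itself a product test function;
      differentiating in y instead of y' changes only the sign.\<close>
    have \<theta>: "(\<lambda>p. a (fst p) * \<beta> (snd p)) = (\<lambda>y'. \<eta> (y + (-1) *\<^sub>R y'))"
      by (auto simp: a_def \<beta>_def \<eta>_def bump_def)
    have "partial c (w' b c) y = - (\<integral>y'. w b c y' * partial c (\<lambda>p. a (fst p) * \<beta> (snd p)) y' \<partial>cyl T)" if c: "c \<in> ?B" for c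
    proof -
      have "partial c (w' b c) y = (\<integral>y'. w b c y' * partial c \<eta> (y + - y') \<partial>cyl T)"
        unfolding w'conv bounded_shift.partial_conv[OF shift sm c] bounded_shift.conv_def[OF shift] by (rule refl)
      moreover have "partial c (\<lambda>p. a (fst p) * \<beta> (snd p)) y' = - partial c \<eta> (y + - y')" for y'
        unfolding \<theta> partial_affine[OF sm] by simp
      ultimately show ?thesis by simp
    qed
    then show ?thesis using z by (simp add: sum_negf)
  qed
  have close: "(\<integral>x. \<bar>w' b c (y0 + r *\<^sub>R x) - w b c (y0 + r *\<^sub>R x)\<bar> \<partial>torus) \<le> \<epsilon>" if b: "b \<in> ?B" and c: "c \<in> ?B" for b c
  proof -
    have [measurable]: "w' b c \<in> borel_measurable borel"
      by (intro borel_measurable_continuous_onI smooth_continuous w'sm)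
    define g where "g s x = \<bar>w b c (y0 + r *\<^sub>R x - s) - w b c (y0 + r *\<^sub>R x)\<bar>" for s x
    have gB: "\<bar>g s x\<bar> \<le> 2 * B" for s x
      unfolding g_def using wB[of b c "y0 + r *\<^sub>R x - s"] wB[of b c "y0 + r *\<^sub>R x"] by linarith
    have [measurable]: "(\<lambda>x. g s x) \<in> borel_measurable borel" "(\<lambda>s. g s x) \<in> borel_measurable borel" for s x
      unfolding g_def by measurable
    have pw: "\<bar>w' b c (y0 + r *\<^sub>R x) - w b c (y0 + r *\<^sub>R x)\<bar> \<le> (\<integral>s. g s x * \<eta>0 s \<partial>lborel)" if x: "x \<in> unit_cell" for x
    proof -
      let ?y = "y0 + r *\<^sub>R x"
      have i: "integrable lborel (\<lambda>s. w b c (?y - s) * \<eta>0 s)" using wB by (intro int_w\<eta>[where A=B]) auto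
      have e: "w b c (?y - s) * \<eta>0 s - w b c ?y * \<eta>0 s = (w b c (?y - s) - w b c ?y) * \<eta>0 s" for s
        by (rule left_diff_distrib[symmetric])
      have "w' b c ?y - w b c ?y = (\<integral>s. w b c (?y - s) * \<eta>0 s \<partial>lborel) - (\<integral>s. w b c ?y * \<eta>0 s \<partial>lborel)"
        unfolding w'eq[OF inn[OF x]] using \<eta>0_int by simp
      also have "\<dots> = (\<integral>s. w b c (?y - s) * \<eta>0 s - w b c ?y * \<eta>0 s \<partial>lborel)"
        by (intro Bochner_Integration.integral_diff[symmetric] i integrable_mult_right \<eta>0_int)
      finally have "\<bar>w' b c ?y - w b c ?y\<bar> \<le> (\<integral>s. \<bar>(w b c (?y - s) - w b c ?y) * \<eta>0 s\<bar> \<partial>lborel)"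
        unfolding e using integral_abs_bound by (simp only:)
      then show ?thesis by (simp add: abs_mult g_def \<eta>0_nn)
    qed
    have gx: "(\<integral>\<^sup>+x. ennreal (indicator unit_cell x * g s x) \<partial>lborel) \<le> ennreal \<epsilon>" if s: "\<eta>0 s \<noteq> 0" for s
    proof -
      have it: "integrable torus (g s)" using gB by (intro integrable_torus_bounded[where B="2 * B"]) auto
      then have "(\<integral>\<^sup>+x. ennreal (indicator unit_cell x * g s x) \<partial>lborel) = ennreal (\<integral>x. indicator unit_cell x * g s x \<partial>lborel)"
        by (intro nn_integral_eq_integral) (auto simp: lebesgue_on_eq_lborel(2) g_def)
      also have "(\<integral>x. indicator unit_cell x * g s x \<partial>lborel) = (\<integral>x. g s x \<partial>torus)"
        by (subst lebesgue_on_eq_lborel(1)) auto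
      also have "\<dots> = (\<integral>x. \<bar>w b c (y0 + r *\<^sub>R x - s) - w b c (y0 + r *\<^sub>R x)\<bar> * 1 \<partial>torus)" by (simp add: g_def)
      also have "\<dots> = (1 / r ^ DIM(real \<times> (real^'n))) * (\<integral>y. \<bar>w b c (y - s) - w b c y\<bar> * (indicator unit_cell ((1 / r) *\<^sub>R (y - y0)) * 1) \<partial>lborel)"
        by (rule torus_rescale[OF r, of "\<lambda>y. \<bar>w b c (y - s) - w b c y\<bar>"]) measurable
      also have "\<dots> \<le> (1 / r ^ DIM(real \<times> (real^'n))) * (\<integral>y. \<bar>w b c (y + - s) - w b c y\<bar> \<partial>lborel)"
      proof (intro mult_left_mono integral_mono)
        have wi: "integrable lborel (w b c)" by (rule bdd_supp_integrable[OF supp])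
        then show i: "integrable lborel (\<lambda>y. \<bar>w b c (y + - s) - w b c y\<bar>)"
          using lborel_translate'(2)[of "w b c" "- s"] by auto
        show "integrable lborel (\<lambda>y. \<bar>w b c (y - s) - w b c y\<bar> * (indicator unit_cell ((1 / r) *\<^sub>R (y - y0)) * 1))"
          by (rule Bochner_Integration.integrable_bound[OF i]) (auto simp: indicator_def)
      qed (use r in \<open>auto simp: indicator_def\<close>)
      also have "\<dots> \<le> (1 / r ^ DIM(real \<times> (real^'n))) * \<epsilon>'"
      proof (rule mult_left_mono)
        have "norm (- s) < d (b, c)" using \<eta>0_norm[OF s] d0(2)[OF b c] by simp
        from d(2)[OF this] show "(\<integral>y. \<bar>w b c (y + - s) - w b c y\<bar> \<partial>lborel) \<le> \<epsilon>'" by simp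
      qed (use r in simp)
      also have "\<dots> = \<epsilon>" using r by (simp add: \<epsilon>'_def)
      finally show ?thesis by (simp add: ennreal_leI)
    qed
    have it: "integrable torus (\<lambda>x. \<bar>w' b c (y0 + r *\<^sub>R x) - w b c (y0 + r *\<^sub>R x)\<bar>)"
    proof (rule integrable_torus_bounded[where B="2 * B"])
      fix x :: "real \<times> (real^'n)" assume "x \<in> unit_cell"
      from w'B[OF inn[OF this], of b c] wB[of b c "y0 + r *\<^sub>R x"]
      show "\<bar>\<bar>w' b c (y0 + r *\<^sub>R x) - w b c (y0 + r *\<^sub>R x)\<bar>\<bar> \<le> 2 * B" by linarith
    qed measurable
    have "ennreal (\<integral>x. \<bar>w' b c (y0 + r *\<^sub>R x) - w b c (y0 + r *\<^sub>R x)\<bar> \<partial>torus)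
        = (\<integral>\<^sup>+x. ennreal (indicator unit_cell x * \<bar>w' b c (y0 + r *\<^sub>R x) - w b c (y0 + r *\<^sub>R x)\<bar>) \<partial>lborel)"
      using it by (subst nn_integral_eq_integral) (auto simp: lebesgue_on_eq_lborel)
    also have "\<dots> \<le> (\<integral>\<^sup>+x. (\<integral>\<^sup>+s. ennreal (\<eta>0 s) * ennreal (indicator unit_cell x * g s x) \<partial>lborel) \<partial>lborel)"
    proof (rule nn_integral_mono)
      fix x :: "real \<times> (real^'n)"
      show "ennreal (indicator unit_cell x * \<bar>w' b c (y0 + r *\<^sub>R x) - w b c (y0 + r *\<^sub>R x)\<bar>)
          \<le> (\<integral>\<^sup>+s. ennreal (\<eta>0 s) * ennreal (indicator unit_cell x * g s x) \<partial>lborel)"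
      proof (cases "x \<in> unit_cell")
        case True
        have "ennreal \<bar>w' b c (y0 + r *\<^sub>R x) - w b c (y0 + r *\<^sub>R x)\<bar> \<le> ennreal (\<integral>s. g s x * \<eta>0 s \<partial>lborel)"
          by (rule ennreal_leI[OF pw[OF True]])
        also have "\<dots> = (\<integral>\<^sup>+s. ennreal (g s x * \<eta>0 s) \<partial>lborel)"
        proof (rule nn_integral_eq_integral[symmetric])
          show "integrable lborel (\<lambda>s. g s x * \<eta>0 s)" by (rule int_w\<eta>[where A="2 * B"]) (auto intro: gB)
        qed (use \<eta>0_nn in \<open>auto simp: g_def\<close>)
        finally show ?thesis using True by (simp add: ennreal_mult[symmetric] \<eta>0_nn g_def mult.commute)
      qed simp
    qed
    also have "\<dots> = (\<integral>\<^sup>+s. (\<integral>\<^sup>+x. ennreal (\<eta>0 s) * ennreal (indicator unit_cell x * g s x) \<partial>lborel) \<partial>lborel)"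
      unfolding g_def by (rule lborel_pair.Fubini') measurable
    also have "\<dots> \<le> (\<integral>\<^sup>+s. ennreal (\<eta>0 s) * ennreal \<epsilon> \<partial>lborel)"
    proof (rule nn_integral_mono)
      fix s :: "real \<times> (real^'n)"
      have "(\<integral>\<^sup>+x. ennreal (\<eta>0 s) * ennreal (indicator unit_cell x * g s x) \<partial>lborel)
          = ennreal (\<eta>0 s) * (\<integral>\<^sup>+x. ennreal (indicator unit_cell x * g s x) \<partial>lborel)"
        by (rule nn_integral_cmult) measurable
      also have "\<dots> \<le> ennreal (\<eta>0 s) * ennreal \<epsilon>"
        using gx[of s] by (cases "\<eta>0 s = 0") (auto intro: mult_left_mono)
      finally show "(\<integral>\<^sup>+x. ennreal (\<eta>0 s) * ennreal (indicator unit_cell x * g s x) \<partial>lborel) \<le> ennreal (\<eta>0 s) * ennreal \<epsilon>" .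
    qed
    also have "\<dots> = (\<integral>\<^sup>+s. ennreal (\<eta>0 s) \<partial>lborel) * ennreal \<epsilon>" by (rule nn_integral_multc) measurable
    also have "(\<integral>\<^sup>+s. ennreal (\<eta>0 s) \<partial>lborel) = 1"
      using \<eta>0_int \<eta>0_nn by (subst nn_integral_eq_integral) auto
    finally show ?thesis using \<epsilon> by (simp add: ennreal_le_iff)
  qed
  define W where "W b c x = w' b c (y0 + r *\<^sub>R x)" for b c x
  show ?thesis
  proof (intro exI[of _ W] conjI allI ballI)
    show "smooth (W b c)" for b c unfolding W_def[abs_def] by (rule smooth_affine[OF w'sm])
    show "W b c = W c b" for b c unfolding W_def[abs_def] w'_def sym[of b c] by (rule refl)
    show "\<bar>W b c x\<bar> \<le> B" if "x \<in> unit_cell" for b c x unfolding W_def by (rule w'B[OF inn[OF that]])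
    show "(\<Sum>c\<in>?B. partial c (W b c) x) = 0" if "b \<in> ?B" "x \<in> unit_cell" for b x
      unfolding W_def[abs_def] partial_affine[OF w'sm] using w'div[OF inn[OF that(2)] that(1)]
      by (simp add: sum_distrib_left[symmetric])
    show "(\<integral>x. \<bar>W b c x - w b c (y0 + r *\<^sub>R x)\<bar> \<partial>torus) \<le> \<epsilon>" if "b \<in> ?B" "c \<in> ?B" for b c
      unfolding W_def by (rule close[OF that])
  qed
qed

section \<open>Jensen's inequality for Young measures generated by weakly divergence-free fields\<close>

lemma cylinder_iff: "y \<in> cylinder T \<longleftrightarrow> 0 < fst y \<and> fst y < T \<and> (\<forall>i. 0 \<le> snd y $ i \<and> snd y $ i < 1)"
  for y :: "real \<times> (real^'n::finite)"
proof -
  have "snd y \<in> unit_cell \<longleftrightarrow> (\<forall>i. 0 \<le> snd y $ i \<and> snd y $ i < 1)"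
    by (auto simp: unit_cell_def Basis_vec_def inner_axis)
  then show ?thesis by (cases y) (auto simp: cylinder_def)
qed

lemma unit_cell_space_time:
  fixes x :: "real \<times> (real^'n::finite)"
  assumes "x \<in> unit_cell"
  shows "0 \<le> fst x" "fst x < 1" "0 \<le> snd x $ i" "snd x $ i < 1"
proof -
  have "0 \<le> x \<bullet> e_t \<and> x \<bullet> e_t < 1" using assms e_basis(1) unfolding unit_cell_def by blast
  then show "0 \<le> fst x" "fst x < 1" by (auto simp: inner_prod_def)
  have "0 \<le> x \<bullet> e_x i \<and> x \<bullet> e_x i < 1" using assms e_basis(2) unfolding unit_cell_def by blast
  then show "0 \<le> snd x $ i" "snd x $ i < 1" by (auto simp: inner_prod_def inner_axis)
qed

text \<open>The cell is half open: small cubes at a point on one of its faces may not have the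
  required margin inside the cylinder. These faces are null sets and are discarded.\<close>

lemma AE_cylinder_interior:
  "AE y in cyl T. \<forall>i. 0 < snd (y :: real \<times> (real^'n::finite)) $ i"
proof -
  have "AE y in (lebesgue :: (real \<times> (real^'n)) measure). \<forall>i\<in>UNIV. snd y $ i \<noteq> 0"
  proof (subst AE_finite_all[OF finite], rule ballI)
    fix i :: 'n
    have "negligible {y :: real \<times> (real^'n). y \<bullet> e_x i = 0}"
      by (rule negligible_standard_hyperplane[OF e_basis(2)])
    then show "AE y in (lebesgue :: (real \<times> (real^'n)) measure). snd y $ i \<noteq> 0"
      by (intro AE_I'[of "{y. y \<bullet> e_x i = 0}"]) (auto simp: negligible_iff_null_sets inner_prod_def inner_axis)
  qed
  then have "AE y in (lebesgue :: (real \<times> (real^'n)) measure). y \<in> cylinder T \<longrightarrow> (\<forall>i. 0 < snd y $ i)"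
    by eventually_elim (auto simp: cylinder_iff order_less_le)
  then show ?thesis by (subst AE_restrict_space_iff) auto
qed

lemma open_cylinder_interior:
  fixes y :: "real \<times> (real^'n::finite)"
  assumes "y \<in> cylinder T" "\<And>i. 0 < snd y $ i"
  shows "y \<in> interior (cylinder T)"
proof -
  let ?S = "{y :: real \<times> (real^'n). 0 < fst y} \<inter> {y. fst y < T} \<inter> (\<Inter>i. {y. 0 < snd y $ i} \<inter> {y. snd y $ i < 1})"
  have "open ?S" by (intro open_Int open_INT ballI finite open_Collect_less continuous_intros)
  moreover have "?S \<subseteq> cylinder T" by (auto simp: cylinder_iff less_imp_le)
  moreover have "y \<in> ?S" using assms by (auto simp: cylinder_iff)
  ultimately show ?thesis by (meson interiorI)
qed

text \<open>Of the distance of \<open>y0\<close> to the boundary, one third is spent on the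
  displacement; more than one third is left as margin.\<close>

lemma cylinder_margin:
  fixes y0 :: "real \<times> (real^'n::finite)"
  assumes "y0 \<in> cylinder T" "\<And>i. 0 < snd y0 $ i"
  obtains d where "d > 0"
    "\<And>r x. 0 < r \<Longrightarrow> r < d \<Longrightarrow> x \<in> unit_cell \<Longrightarrow> d < fst (y0 + r *\<^sub>R x) \<and> fst (y0 + r *\<^sub>R x) < T - d"
    "\<And>r x i. 0 < r \<Longrightarrow> r < d \<Longrightarrow> x \<in> unit_cell \<Longrightarrow> d < snd (y0 + r *\<^sub>R x) $ i \<and> snd (y0 + r *\<^sub>R x) $ i < 1 - d"
proof -
  define m where "m = Min (insert (fst y0) (insert (T - fst y0) (range (\<lambda>i. snd y0 $ i) \<union> range (\<lambda>i. 1 - snd y0 $ i))))"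
  have m: "m > 0" using assms by (auto simp: m_def cylinder_iff)
  have le: "m \<le> fst y0" "m \<le> T - fst y0" "\<And>i. m \<le> snd y0 $ i" "\<And>i. m \<le> 1 - snd y0 $ i"
    unfolding m_def by (rule Min_le; simp)+
  have small: "0 \<le> r * u \<and> r * u < m / 3" if "0 < r" "r < m / 3" "0 \<le> u" "u < 1" for r u :: real
  proof -
    have "r * u \<le> r * 1" using that by (intro mult_left_mono) auto
    then have "r * u < m / 3" using that(2) by linarith
    then show ?thesis using that by simp
  qed
  show ?thesis
  proof (rule that[of "m / 3"])
    show "m / 3 > 0" using m by simp
    fix r and x :: "real \<times> (real^'n)" assume r: "0 < r" "r < m / 3" and x: "x \<in> unit_cell"
    show "m / 3 < fst (y0 + r *\<^sub>R x) \<and> fst (y0 + r *\<^sub>R x) < T - m / 3"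
      using small[OF r unit_cell_space_time(1,2)[OF x]] le(1,2) m by simp
    show "m / 3 < snd (y0 + r *\<^sub>R x) $ i \<and> snd (y0 + r *\<^sub>R x) $ i < 1 - m / 3" for i
      using small[OF r unit_cell_space_time(3,4)[OF x, of i]] le(3,4)[of i] m by simp
  qed
qed

lemma lift_S_measurable:
  assumes "sets m = sets borel"
  shows "lift_S \<in> m \<rightarrow>\<^sub>M restrict_space borel (lifted_space :: ('n::finite) state set)"
proof (rule measurable_restrict_space2)
  show "lift_S \<in> space m \<rightarrow> (lifted_space :: 'n state set)"
    unfolding lift_S_to_state[abs_def] by (auto intro!: to_state_lifted lift_entry_sym)
  have "continuous_on UNIV (lift_S :: (real^'n) \<times> real \<Rightarrow> 'n state)"
    unfolding lift_S_to_state[abs_def] by (rule continuous_to_state[OF continuous_lift_entry])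
  then show "lift_S \<in> m \<rightarrow>\<^sub>M (borel :: 'n state measure)"
    using borel_measurable_continuous_onI by (simp add: measurable_cong_sets[OF assms refl])
qed

text \<open>Blow-up at \<open>y0\<close> and mollification of the fluxes at the same scale feed
  \<open>homogeneous_limit\<close>. The fields \<open>W\<close> approximate the fluxes within
  1/(k+1), and these differ from the lifts by \<open>dl (n k)\<close>, which tends to zero because
  \<open>n k \<ge> k\<close>.\<close>

theorem jensen_generated:
  fixes \<mu> :: "real \<times> (real^'n::finite) \<Rightarrow> ((real^'n) \<times> real) measure"
    and z :: "nat \<Rightarrow> real \<times> (real^'n) \<Rightarrow> (real^'n) \<times> real"
    and w :: "nat \<Rightarrow> real \<times> (real^'n) \<Rightarrow> real \<times> (real^'n) \<Rightarrow> real \<times> (real^'n) \<Rightarrow> real"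
  assumes ym: "young_measure T \<mu>"
    and z: "\<And>n. z n \<in> borel_measurable borel" "\<And>n y. norm (z n y) \<le> C"
    and gen: "\<And>F g. C0 F \<Longrightarrow> integrable (cyl T) g \<Longrightarrow>
      (\<lambda>n. \<integral>y. F (z n y) * g y \<partial>cyl T) \<longlonglongrightarrow> (\<integral>y. pairing \<mu> F y * g y \<partial>cyl T)"
    and w: "\<And>n b c. w n b c \<in> borel_measurable borel" "\<And>n b c y. \<bar>w n b c y\<bar> \<le> B"
      "\<And>n b c y. y \<notin> cylinder T \<Longrightarrow> w n b c y = 0" "\<And>n b c. w n b c = w n c b" "\<And>n. weakly_div_free T (w n)"
    and dl: "\<And>n b c y. b \<in> Basis \<Longrightarrow> c \<in> Basis \<Longrightarrow> y \<in> cylinder T \<Longrightarrow> \<bar>w n b c y - lift_entry (z n y) b c\<bar> \<le> dl n"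
      "dl \<longlonglongrightarrow> 0"
  shows "\<exists>E\<subseteq>cylinder T. E \<in> sets (cyl T) \<and> cylinder T - E \<in> null_sets (cyl T) \<and>
           (\<forall>y\<in>E. integrable (pushforward_S \<mu> y) (\<lambda>z. z) \<and>
              (\<forall>f. continuous_on lifted_space f \<longrightarrow>
                 integrable (pushforward_S \<mu> y) f \<and>
                 ereal (pairing (pushforward_S \<mu>) f y)
                   \<ge> Q_env f (pairing (pushforward_S \<mu>) (\<lambda>z. z) y)))"
proof -
  interpret generated "cylinder T" z \<mu> C
  proof (rule generated.intro)
    show "cylinder T \<in> sets borel" by (rule cylinder_borel)
    show "bounded (cylinder T)" by (rule bounded_cylinder)
    show "prob_space (\<mu> y)" "sets (\<mu> y) = sets borel" if "y \<in> cylinder T" for y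
      using ym that by (auto simp: young_measure_def)
    show "pairing \<mu> F \<in> borel_measurable (cyl T)" if "C0 F" for F
      using ym that by (simp add: young_measure_def)
  qed (use z gen in auto)
  define Lim where "Lim r y0 n \<longleftrightarrow> (\<forall>k. n k \<ge> (k::nat)) \<and> (\<forall>F :: ((real^'n) \<times> real) \<times> (real \<times> (real^'n)) \<Rightarrow> real. continuous_on UNIV F \<longrightarrow>
      (\<lambda>k. \<integral>x. F (z (n k) (y0 + r k *\<^sub>R x), x) \<partial>torus) \<longlonglongrightarrow> (\<integral>x. (\<integral>v. F (v, x) \<partial>\<mu> y0) \<partial>torus))" for r y0 n
  obtain r :: "nat \<Rightarrow> real" where r: "\<And>k. r k > 0" "r \<longlonglongrightarrow> 0"
    and ae: "AE y0 in cyl T. y0 \<in> interior (cylinder T) \<longrightarrow> (AE v in \<mu> y0. norm v \<le> C) \<and> (\<exists>n. Lim r y0 n)"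
    by (rule blowup) (rule that, assumption+, unfold Lim_def, assumption)
  have "AE y0 in cyl T. (\<forall>i. 0 < snd y0 $ i) \<and> (y0 \<in> interior (cylinder T) \<longrightarrow> (AE v in \<mu> y0. norm v \<le> C) \<and> (\<exists>n. Lim r y0 n))"
    using AE_cylinder_interior[of T] ae by (rule eventually_conj)
  then obtain N where N: "{y0 \<in> space (cyl T). \<not> ((\<forall>i. 0 < snd y0 $ i) \<and>
      (y0 \<in> interior (cylinder T) \<longrightarrow> (AE v in \<mu> y0. norm v \<le> C) \<and> (\<exists>n. Lim r y0 n)))} \<subseteq> N" "N \<in> null_sets (cyl T)"
    unfolding eventually_ae_filter by blast
  have NS: "N \<in> sets (cyl T)" using N(2) by blast
  have "integrable (pushforward_S \<mu> y0) (\<lambda>z. z) \<and>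
      (\<forall>f. continuous_on lifted_space f \<longrightarrow> integrable (pushforward_S \<mu> y0) f \<and>
         ereal (pairing (pushforward_S \<mu>) f y0) \<ge> Q_env f (pairing (pushforward_S \<mu>) (\<lambda>z. z) y0))"
    if y0: "y0 \<in> cylinder T - N" for y0
  proof -
    have y0c: "y0 \<in> cylinder T" using y0 by simp
    have pos: "0 < snd y0 $ i" for i using y0 N(1) by auto
    have inter: "y0 \<in> interior (cylinder T)" by (rule open_cylinder_interior[OF y0c pos])
    have "\<not> (y0 \<in> space (cyl T) \<and> \<not> ((\<forall>i. 0 < snd y0 $ i) \<and>
      (y0 \<in> interior (cylinder T) \<longrightarrow> (AE v in \<mu> y0. norm v \<le> C) \<and> (\<exists>n. Lim r y0 n))))"
      using y0 N(1) by blast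
    with inter y0c have supp: "AE v in \<mu> y0. norm v \<le> C" and exn: "\<exists>n. Lim r y0 n" by auto
    obtain n where n: "\<And>k. n k \<ge> (k::nat)" and lim: "\<And>F :: ((real^'n) \<times> real) \<times> (real \<times> (real^'n)) \<Rightarrow> real. continuous_on UNIV F \<Longrightarrow>
      (\<lambda>k. \<integral>x. F (z (n k) (y0 + r k *\<^sub>R x), x) \<partial>torus) \<longlonglongrightarrow> (\<integral>x. (\<integral>v. F (v, x) \<partial>\<mu> y0) \<partial>torus)"
      using exn unfolding Lim_def by blast
    obtain d where d: "d > 0"
      "\<And>r x. 0 < r \<Longrightarrow> r < d \<Longrightarrow> x \<in> unit_cell \<Longrightarrow> d < fst (y0 + r *\<^sub>R x) \<and> fst (y0 + r *\<^sub>R x) < T - d"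
      "\<And>r x i. 0 < r \<Longrightarrow> r < d \<Longrightarrow> x \<in> unit_cell \<Longrightarrow> d < snd (y0 + r *\<^sub>R x) $ i \<and> snd (y0 + r *\<^sub>R x) $ i < 1 - d"
      using cylinder_margin[OF y0c pos] by metis
    \<comment> \<open>From \<open>k0\<close> on the blown-up cells lie in the cylinder with margin
      \<open>d\<close>; all sequences below start there, since the locale demands its properties for
      every index.\<close>
    obtain k0 where k0: "\<And>k. k \<ge> k0 \<Longrightarrow> r k < d"
      using order_tendstoD(2)[OF r(2) d(1)] by (auto simp: eventually_sequentially)
    define V where "V k x = z (n (k + k0)) (y0 + r (k + k0) *\<^sub>R x)" for k x
    define ok where "ok k W \<longleftrightarrow> (\<forall>b c. smooth (W b c)) \<and> (\<forall>b c. W b c = W c b) \<and>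
      (\<forall>b c. \<forall>x\<in>unit_cell. \<bar>W b c x\<bar> \<le> B) \<and>
      (\<forall>b\<in>Basis. \<forall>x\<in>unit_cell. (\<Sum>c\<in>Basis. partial c (W b c) x) = 0) \<and>
      (\<forall>b\<in>Basis. \<forall>c\<in>Basis. (\<integral>x. \<bar>W b c x - w (n (k + k0)) b c (y0 + r (k + k0) *\<^sub>R x)\<bar> \<partial>torus) \<le> 1 / real (Suc k))" for k W
    have rk: "0 < r (k + k0)" "r (k + k0) < d" for k using r(1) k0[of "k + k0"] by auto
    have "\<exists>W. ok k W" for k
      unfolding ok_def by (rule mollify[OF w(1,2,3,4,5) rk(1) d(1) d(2)[OF rk] d(3)[OF rk]]) auto
    then have "\<exists>W. \<forall>k. ok k (W k)" by (intro choice allI)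
    then obtain W where W: "\<And>k. ok k (W k)" by blast
    have incyl: "y0 + r (k + k0) *\<^sub>R x \<in> cylinder T" if x: "x \<in> unit_cell" for k x
    proof -
      let ?y = "y0 + r (k + k0) *\<^sub>R x"
      have "0 < fst ?y" "fst ?y < T" using d(2)[OF rk[of k] x] d(1) by linarith+
      moreover have "0 \<le> snd ?y $ i" "snd ?y $ i < 1" for i using d(3)[OF rk[of k] x, of i] d(1) by linarith+
      ultimately show ?thesis unfolding cylinder_iff by blast
    qed
    interpret H: homogeneous_limit "\<mu> y0" V W C B
    proof (rule homogeneous_limit.intro)
      show "sets (\<mu> y0) = sets borel" by (rule sets_\<mu>[OF y0c])
      show "AE z in \<mu> y0. norm z \<le> C" by (rule supp)
      show "V k \<in> borel_measurable borel" for k unfolding V_def by measurable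
      show "norm (V k x) \<le> C" for k x by (simp add: V_def z)
      show "smooth (W k b c)" "W k b c = W k c b" for k b c using W[of k] unfolding ok_def by blast+
      show "\<bar>W k b c x\<bar> \<le> B" if "x \<in> unit_cell" for k b c x using W[of k] that unfolding ok_def by blast
      show "(\<Sum>c\<in>Basis. partial c (W k b c) x) = 0" if "b \<in> Basis" "x \<in> unit_cell" for k b x
        using W[of k] that unfolding ok_def by blast
      show "(\<lambda>k. \<integral>x. F (V k x, x) \<partial>torus) \<longlonglongrightarrow> (\<integral>x. (\<integral>z. F (z, x) \<partial>\<mu> y0) \<partial>torus)"
        if "continuous_on UNIV F" for F :: "((real^'n) \<times> real) \<times> (real \<times> (real^'n)) \<Rightarrow> real"
        unfolding V_def using LIMSEQ_ignore_initial_segment[OF lim[OF that], of k0] .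
      show "(\<lambda>k. \<integral>x. \<bar>W k b c x - lift_entry (V k x) b c\<bar> \<partial>torus) \<longlonglongrightarrow> 0" if b: "b \<in> Basis" and c: "c \<in> Basis" for b c
      proof (rule Lim_null_comparison)
        have nk: "filterlim (\<lambda>k. n (k + k0)) at_top sequentially"
          by (rule filterlim_at_top_mono[OF filterlim_add_const_nat_at_top[of k0]]) (use n in simp)
        have "(\<lambda>k. dl (n (k + k0))) \<longlonglongrightarrow> 0" by (rule filterlim_compose[OF dl(2) nk])
        from tendsto_add[OF LIMSEQ_inverse_real_of_nat this]
        show "(\<lambda>k. inverse (real (Suc k)) + dl (n (k + k0))) \<longlonglongrightarrow> 0" by simp
        show "eventually (\<lambda>k. norm (\<integral>x. \<bar>W k b c x - lift_entry (V k x) b c\<bar> \<partial>torus) \<le> inverse (real (Suc k)) + dl (n (k + k0))) sequentially"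
        proof (rule always_eventually, rule allI)
          fix k
          let ?w = "\<lambda>x. w (n (k + k0)) b c (y0 + r (k + k0) *\<^sub>R x)"
          have [measurable]: "W k b c \<in> borel_measurable borel"
            using W[of k] unfolding ok_def by (intro borel_measurable_continuous_onI smooth_continuous) blast
          have [measurable]: "w (n (k + k0)) b c \<in> borel_measurable borel" by (rule w(1))
          have Wb: "\<bar>W k b c x\<bar> \<le> B" if "x \<in> unit_cell" for x using W[of k] that unfolding ok_def by blast
          have [measurable]: "V k \<in> borel_measurable borel" unfolding V_def by measurable
          have [measurable]: "(\<lambda>x. lift_entry (V k x) b c) \<in> borel_measurable borel"
            by (rule measurable_compose[OF _ borel_measurable_continuous_onI[OF continuous_lift_entry]]) measurable
          have i1: "integrable torus (\<lambda>x. \<bar>W k b c x - ?w x\<bar>)"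
          proof (rule integrable_torus_bounded[where B="2 * B"])
            fix x :: "real \<times> (real^'n)" assume "x \<in> unit_cell"
            from Wb[OF this] w(2)[of "n (k + k0)" b c "y0 + r (k + k0) *\<^sub>R x"]
            show "\<bar>\<bar>W k b c x - ?w x\<bar>\<bar> \<le> 2 * B" by linarith
          qed measurable
          have pw: "\<bar>W k b c x - lift_entry (V k x) b c\<bar> \<le> \<bar>W k b c x - ?w x\<bar> + dl (n (k + k0))" if "x \<in> unit_cell" for x
            using dl(1)[OF b c incyl[OF that], of "n (k + k0)" k] unfolding V_def by linarith
          have i2: "integrable torus (\<lambda>x. \<bar>W k b c x - lift_entry (V k x) b c\<bar>)"
          proof (rule integrable_torus_bounded[where B="2 * B + dl (n (k + k0))"])
            fix x :: "real \<times> (real^'n)" assume x: "x \<in> unit_cell"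
            from Wb[OF this] w(2)[of "n (k + k0)" b c "y0 + r (k + k0) *\<^sub>R x"] pw[OF x]
            show "\<bar>\<bar>W k b c x - lift_entry (V k x) b c\<bar>\<bar> \<le> 2 * B + dl (n (k + k0))" by linarith
          qed measurable
          have "(\<integral>x. \<bar>W k b c x - lift_entry (V k x) b c\<bar> \<partial>torus) \<le> (\<integral>x. \<bar>W k b c x - ?w x\<bar> + dl (n (k + k0)) \<partial>torus)"
            using i1 i2 pw by (intro integral_mono) auto
          also have "\<dots> = (\<integral>x. \<bar>W k b c x - ?w x\<bar> \<partial>torus) + dl (n (k + k0))"
            using i1 torus.prob_space[where 'a="real \<times> (real^'n)"] by simp
          also have "\<dots> \<le> inverse (real (Suc k)) + dl (n (k + k0))"
            using W[of k] b c unfolding ok_def by (simp add: inverse_eq_divide)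
          finally show "norm (\<integral>x. \<bar>W k b c x - lift_entry (V k x) b c\<bar> \<partial>torus) \<le> inverse (real (Suc k)) + dl (n (k + k0))"
            by (simp add: integral_nonneg_AE)
        qed
      qed
    qed (use prob[OF y0c] in auto)
    note L = lift_S_measurable[OF sets_\<mu>[OF y0c]]
    have idm: "(\<lambda>z. z) \<in> borel_measurable (restrict_space borel (lifted_space :: 'n state set))"
      by (rule measurable_restrict_space1) simp
    have p1: "integrable (pushforward_S \<mu> y0) (\<lambda>z. z)"
      unfolding pushforward_S_def integrable_distr_eq[OF L idm] by (rule H.integral_lift_S(1))
    have p2: "pairing (pushforward_S \<mu>) (\<lambda>z. z) y0 = to_state H.bar"
      unfolding pairing_def pushforward_S_def integral_distr[OF L idm] by (rule H.integral_lift_S(2))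
    have "integrable (pushforward_S \<mu> y0) f \<and> ereal (pairing (pushforward_S \<mu>) f y0) \<ge> Q_env f (pairing (pushforward_S \<mu>) (\<lambda>z. z) y0)"
      if f: "continuous_on lifted_space f" for f :: "'n state \<Rightarrow> real"
    proof
      have fm: "f \<in> borel_measurable (restrict_space borel lifted_space)"
        by (rule borel_measurable_continuous_on_restrict[OF f])
      show "integrable (pushforward_S \<mu> y0) f"
        unfolding pushforward_S_def integrable_distr_eq[OF L fm]
        by (rule H.integrable_mu0[OF H.continuous_f_lift[OF f]])
      show "ereal (pairing (pushforward_S \<mu>) f y0) \<ge> Q_env f (pairing (pushforward_S \<mu>) (\<lambda>z. z) y0)"
        unfolding p2 unfolding pairing_def pushforward_S_def integral_distr[OF L fm] by (rule H.jensen[OF f])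
    qed
    with p1 show ?thesis by blast
  qed
  moreover have "cylinder T - N \<in> sets (cyl T)" using NS by (intro sets.Diff) auto
  moreover have "cylinder T - (cylinder T - N) \<in> null_sets (cyl T)"
  proof -
    have "N \<subseteq> cylinder T" using sets.sets_into_space[OF NS] by simp
    then have "cylinder T - (cylinder T - N) = N" by blast
    then show ?thesis using N(2) by simp
  qed
  ultimately show ?thesis by (intro exI[of _ "cylinder T - N"]) blast
qed

text \<open>The data are Lebesgue measurable with essential bounds, while translating, rescaling and
  Fubini on \<open>lborel\<close> are carried out for Borel functions bounded everywhere.\<close>

lemma borel_representative:
  fixes f :: "'a::euclidean_space \<Rightarrow> 'b::euclidean_space"
  assumes S [measurable]: "S \<in> sets borel" and f: "f \<in> borel_measurable (lebesgue_on S)"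
    and C: "AE y in lebesgue_on S. norm (f y) \<le> C" "C \<ge> 0"
  shows "\<exists>g. g \<in> borel_measurable borel \<and> (\<forall>y. norm (g y) \<le> C) \<and> (AE y in lebesgue_on S. g y = f y)"
proof -
  have "\<exists>g. g \<in> borel_measurable lborel \<and> (AE y in lborel. (if y \<in> S then f y \<bullet> b else 0) = g y)" for b
  proof -
    have "(\<lambda>y. f y \<bullet> b) \<in> borel_measurable (lebesgue_on S)" using f by (intro borel_measurable_inner) auto
    then have "(\<lambda>y. if y \<in> S then f y \<bullet> b else 0) \<in> borel_measurable lebesgue"
      by (subst borel_measurable_if) auto
    then show ?thesis using completion_ex_borel_measurable_real by blast
  qed
  then have "\<exists>g. \<forall>b. g b \<in> borel_measurable lborel \<and> (AE y in lborel. (if y \<in> S then f y \<bullet> b else 0) = g b y)"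
    by (intro choice allI)
  then obtain g where g: "\<forall>b. g b \<in> borel_measurable lborel \<and> (AE y in lborel. (if y \<in> S then f y \<bullet> b else 0) = g b y)" ..
  have gm [measurable]: "g b \<in> borel_measurable borel" for b using spec[OF g, of b] by simp
  define g0 where "g0 y = (\<Sum>b\<in>Basis. g b y *\<^sub>R b)" for y
  have [measurable]: "g0 \<in> borel_measurable borel" unfolding g0_def by measurable
  have "AE y in lborel. \<forall>b\<in>Basis. (if y \<in> S then f y \<bullet> b else 0) = g b y"
    using g by (subst AE_finite_all) auto
  then have "AE y in lebesgue. \<forall>b\<in>Basis. (if y \<in> S then f y \<bullet> b else 0) = g b y"
    by (simp add: AE_completion_iff)
  then have "AE y in lebesgue. y \<in> S \<longrightarrow> g0 y = f y"
  proof eventually_elim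
    fix y assume eq: "\<forall>b\<in>Basis. (if y \<in> S then f y \<bullet> b else 0) = g b y"
    show "y \<in> S \<longrightarrow> g0 y = f y"
    proof
      assume "y \<in> S"
      then have "g0 y = (\<Sum>b\<in>Basis. (f y \<bullet> b) *\<^sub>R b)" unfolding g0_def using eq by (intro sum.cong) auto
      then show "g0 y = f y" by (simp add: euclidean_representation)
    qed
  qed
  then have ae: "AE y in lebesgue_on S. g0 y = f y" by (subst AE_restrict_space_iff) auto
  show ?thesis
  proof (intro exI[of _ "\<lambda>y. if norm (g0 y) \<le> C then g0 y else 0"] conjI allI)
    show "AE y in lebesgue_on S. (if norm (g0 y) \<le> C then g0 y else 0) = f y"
      using ae C(1) by eventually_elim simp
  qed (use C(2) in \<open>auto intro!: measurable_If\<close>)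
qed

abbreviation product_test :: "(real \<Rightarrow> real) \<Rightarrow> (real^'n::finite \<Rightarrow> real) \<Rightarrow> real \<times> (real^'n) \<Rightarrow> real" where
  "product_test a \<beta> \<equiv> (\<lambda>p. a (fst p) * \<beta> (snd p))"

lemma smooth_product_test: "interior_time T a \<Longrightarrow> smooth \<beta> \<Longrightarrow> smooth (product_test a \<beta>)"
  unfolding interior_time_def by (intro smooth_mult smooth_fst smooth_snd) auto

lemma lift_factor_bound:
  assumes "norm (z :: (real^'n::finite) \<times> real) \<le> C" "b \<in> Basis"
  shows "\<bar>(1::real, fst z) \<bullet> b\<bar> \<le> 1 + C"
proof -
  have "norm (fst z) \<le> C" using assms(1) norm_fst_le[of "fst z" "snd z"] by simp
  then have "norm (1::real, fst z) \<le> 1 + C" using norm_Pair_le[of "1::real" "fst z"] by simp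
  then show ?thesis using Basis_le_norm[OF assms(2), of "(1::real, fst z)"] by linarith
qed

text \<open>Common form of both systems: \<sigma> = 1 gives the lift of (u,P), and \<sigma> =
  \<rho>/\<rho>bar the density, momentum and momentum flux of the isentropic system divided by
  \<rho>bar.\<close>

definition flux :: "real \<Rightarrow> real^'n::finite \<Rightarrow> real \<Rightarrow> real \<times> (real^'n) \<Rightarrow> real \<times> (real^'n) \<Rightarrow> real" where
  "flux s u P b c = s * (((1, u) \<bullet> b) * ((1, u) \<bullet> c)) + P * (snd b \<bullet> snd c)"

lemma flux_sym: "flux s u P b c = flux s u P c b"
  by (simp add: flux_def mult.commute inner_commute)

lemma flux_simps [simp]:
  "flux s u P e_t e_t = s" "flux s u P e_t (e_x i) = s * u $ i" "flux s u P (e_x i) e_t = s * u $ i"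
  "flux s u P (e_x i) (e_x j) = s * (u $ i * u $ j) + (if i = j then P else 0)"
  by (auto simp: flux_def inner_axis inner_axis_axis) (auto simp: axis_def)

text \<open>The factor \<sigma> acts on the tensor part only, so flux and lift differ by \<sigma> -
  1 times \<open>(1,u) \<otimes> (1,u)\<close>, entrywise at most
  \<open>(1 + C)\<^sup>2 * dl n\<close>. The pressures agree exactly.\<close>

theorem jensen_generated_AE:
  fixes \<mu> :: "real \<times> (real^'n::finite) \<Rightarrow> ((real^'n) \<times> real) measure"
    and u :: "nat \<Rightarrow> real \<times> (real^'n) \<Rightarrow> real^'n" and P \<sigma> :: "nat \<Rightarrow> real \<times> (real^'n) \<Rightarrow> real"
  assumes ym: "young_measure T \<mu>" and C: "C \<ge> 0" and dl0: "\<And>n. dl n \<ge> 0" and dl: "dl \<longlonglongrightarrow> 0"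
    and meas: "\<And>n. u n \<in> borel_measurable (cyl T)" "\<And>n. P n \<in> borel_measurable (cyl T)" "\<And>n. \<sigma> n \<in> borel_measurable (cyl T)"
    and bound: "\<And>n. AE y in cyl T. norm (u n y, P n y) \<le> C" "\<And>n. AE y in cyl T. \<bar>\<sigma> n y - 1\<bar> \<le> dl n"
    and gen: "generates T (\<lambda>n y. (u n y, P n y)) \<mu>"
    and weak: "\<And>n b a \<beta>. b \<in> Basis \<Longrightarrow> interior_time T a \<Longrightarrow> smooth \<beta> \<Longrightarrow> periodic \<beta> \<Longrightarrow>
      (\<integral>y. (\<Sum>c\<in>Basis. flux (\<sigma> n y) (u n y) (P n y) b c * partial c (product_test a \<beta>) y) \<partial>cyl T) = 0"
  shows "\<exists>E\<subseteq>cylinder T. E \<in> sets (cyl T) \<and> cylinder T - E \<in> null_sets (cyl T) \<and>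
           (\<forall>y\<in>E. integrable (pushforward_S \<mu> y) (\<lambda>z. z) \<and>
              (\<forall>f. continuous_on lifted_space f \<longrightarrow>
                 integrable (pushforward_S \<mu> y) f \<and>
                 ereal (pairing (pushforward_S \<mu>) f y)
                   \<ge> Q_env f (pairing (pushforward_S \<mu>) (\<lambda>z. z) y)))"
proof -
  interpret fin: finite_measure "cyl T :: (real \<times> (real^'n)) measure"
    by (intro finite_measure_lebesgue_on_bounded bounded_cylinder cylinder_borel)
  have "\<exists>g. g \<in> borel_measurable borel \<and> (\<forall>y. norm (g y) \<le> C) \<and> (AE y in cyl T. g y = (u n y, P n y))" for n
    by (rule borel_representative[OF cylinder_borel borel_measurable_Pair[OF meas(1,2)] bound(1) C])
  then have "\<exists>z. \<forall>n. z n \<in> borel_measurable borel \<and> (\<forall>y. norm (z n y) \<le> C) \<and> (AE y in cyl T. z n y = (u n y, P n y))"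
    by (intro choice allI)
  then obtain z where z: "\<forall>n. z n \<in> borel_measurable borel \<and> (\<forall>y. norm (z n y) \<le> C) \<and> (AE y in cyl T. z n y = (u n y, P n y))" ..
  have zm [measurable]: "z n \<in> borel_measurable borel" and zb: "norm (z n y) \<le> C"
    and zae: "AE y in cyl T. z n y = (u n y, P n y)" for n y
    by (rule spec[OF z, THEN conjunct1], rule spec[OF spec[OF z, THEN conjunct2, THEN conjunct1]],
        rule spec[OF z, THEN conjunct2, THEN conjunct2])
  have "\<exists>g. g \<in> borel_measurable borel \<and> (\<forall>y. norm (g y) \<le> dl n) \<and> (AE y in cyl T. g y = \<sigma> n y - 1)" for n
    using bound(2)[of n] by (intro borel_representative[OF cylinder_borel _ _ dl0] borel_measurable_diff meas) simp_all
  then have "\<exists>s. \<forall>n. s n \<in> borel_measurable borel \<and> (\<forall>y. norm (s n y) \<le> dl n) \<and> (AE y in cyl T. s n y = \<sigma> n y - 1)"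
    by (intro choice allI)
  then obtain s where s: "\<forall>n. s n \<in> borel_measurable borel \<and> (\<forall>y. norm (s n y) \<le> dl n) \<and> (AE y in cyl T. s n y = \<sigma> n y - 1)" ..
  have smeas [measurable]: "s n \<in> borel_measurable borel" and sb': "norm (s n y) \<le> dl n"
    and sae: "AE y in cyl T. s n y = \<sigma> n y - 1" for n y
    by (rule spec[OF s, THEN conjunct1], rule spec[OF spec[OF s, THEN conjunct2, THEN conjunct1]],
        rule spec[OF s, THEN conjunct2, THEN conjunct2])
  have sb: "\<bar>s n y\<bar> \<le> dl n" for n y using sb'[of n y] by simp
  obtain M where M: "\<And>n. dl n \<le> M"
    using convergent_imp_Bseq[OF convergentI[OF dl]] unfolding Bseq_def by (metis abs_le_D1 real_norm_def)
  have M0: "M \<ge> 0" using dl0[of 0] M[of 0] by linarith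
  let ?B = "Basis :: (real \<times> (real^'n)) set"
  \<comment> \<open>Zero outside the cylinder, as \<open>mollify\<close> wants; zero at index pairs
    outside the basis, so that one bound holds for all indices.\<close>
  define w where "w n b c y = (if b \<in> ?B \<and> c \<in> ?B \<and> y \<in> cylinder T
    then flux (1 + s n y) (fst (z n y)) (snd (z n y)) b c else 0)" for n b c y
  define D where "D = (1 + C)\<^sup>2"
  have prod_bound: "\<bar>((1::real, fst (z n y)) \<bullet> b) * ((1::real, fst (z n y)) \<bullet> c)\<bar> \<le> D"
    if "b \<in> ?B" "c \<in> ?B" for n y b c
    unfolding abs_mult D_def power2_eq_square
    using lift_factor_bound[OF zb that(1), of n y] lift_factor_bound[OF zb that(2), of n y] C by (intro mult_mono) auto
  have close: "\<bar>w n b c y - lift_entry (z n y) b c\<bar> \<le> D * dl n"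
    if "b \<in> ?B" "c \<in> ?B" "y \<in> cylinder T" for n b c y
  proof -
    have "w n b c y - lift_entry (z n y) b c = s n y * (((1::real, fst (z n y)) \<bullet> b) * ((1::real, fst (z n y)) \<bullet> c))"
      using that by (simp add: w_def flux_def lift_entry_def algebra_simps)
    also have "\<bar>\<dots>\<bar> \<le> dl n * D"
      unfolding abs_mult[of "s n y"] using sb[of n y] prod_bound[OF that(1,2), of n y] dl0[of n] by (intro mult_mono) auto
    finally show ?thesis by (simp add: mult.commute)
  qed
  have D0: "D \<ge> 0" by (simp add: D_def)
  have wB: "\<bar>w n b c y\<bar> \<le> D * M + (D + C)" for n b c y
  proof (cases "b \<in> ?B \<and> c \<in> ?B \<and> y \<in> cylinder T")
    case True
    have "\<bar>lift_entry (z n y) b c\<bar> \<le> D + C" unfolding D_def using lift_entry_bound[OF zb] True by blast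
    moreover have "\<bar>w n b c y - lift_entry (z n y) b c\<bar> \<le> D * dl n" using close True by blast
    moreover have "D * dl n \<le> D * M" using D0 M by (intro mult_left_mono) auto
    ultimately show ?thesis by linarith
  next
    case False
    then have "w n b c y = 0" by (auto simp: w_def)
    then show ?thesis using D0 M0 C by (simp add: add_nonneg_nonneg)
  qed
  have wm: "w n b c \<in> borel_measurable borel" for n b c
  proof -
    have [measurable]: "(\<lambda>y. fst (z n y)) \<in> borel_measurable borel" "(\<lambda>y. snd (z n y)) \<in> borel_measurable borel"
      using measurable_compose[OF zm borel_measurable_continuous_onI[OF continuous_on_fst[OF continuous_on_id]]]
        measurable_compose[OF zm borel_measurable_continuous_onI[OF continuous_on_snd[OF continuous_on_id]]] by auto
    have "(\<lambda>y. (1::real, fst (z n y)) \<bullet> b) \<in> borel_measurable borel" for b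
      by (intro borel_measurable_inner borel_measurable_Pair) measurable
    then have [measurable]: "(\<lambda>y. flux (1 + s n y) (fst (z n y)) (snd (z n y)) b c) \<in> borel_measurable borel"
      unfolding flux_def by (intro borel_measurable_add borel_measurable_times) measurable
    have "w n b c = (\<lambda>y. if b \<in> ?B \<and> c \<in> ?B then indicator (cylinder T) y * flux (1 + s n y) (fst (z n y)) (snd (z n y)) b c else 0)"
      by (auto simp: w_def indicator_def)
    also have "\<dots> \<in> borel_measurable borel" by measurable
    finally show ?thesis .
  qed
  have div: "weakly_div_free T (w n)" for n
    unfolding weakly_div_free_def
  proof (intro ballI allI impI)
    fix b a and \<beta> :: "real^'n \<Rightarrow> real"
    assume b: "b \<in> ?B" and a: "interior_time T a" and \<beta>: "smooth \<beta>" "periodic \<beta>"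
    let ?\<theta> = "product_test a \<beta>"
    note \<theta> = smooth_product_test[OF a \<beta>(1)]
    have pm: "partial c ?\<theta> \<in> borel_measurable (cyl T)" if "c \<in> ?B" for c
      by (intro measurable_lebesgue_on_borel borel_measurable_continuous_onI smooth_continuous smooth_partial \<theta> that)
    have wint: "integrable (cyl T) (\<lambda>y. w n b c y * partial c ?\<theta> y)" if c: "c \<in> ?B" for c
    proof -
      obtain R where R: "\<And>y. y \<in> (cylinder T :: (real \<times> (real^'n)) set) \<Longrightarrow> norm y \<le> R"
        using bounded_cylinder[of T] by (auto simp: bounded_iff)
      obtain A where A: "A \<ge> 0" "\<And>y. norm (y - 0) \<le> R \<Longrightarrow> \<bar>partial c ?\<theta> y\<bar> \<le> A"
        using continuous_bounded_cball[OF smooth_continuous[OF smooth_partial[OF \<theta> c]], of 0 R] by blast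
      have "\<bar>w n b c y * partial c ?\<theta> y\<bar> \<le> (D * M + (D + C)) * A" if "y \<in> cylinder T" for y
        unfolding abs_mult using wB[of n b c y] A R[OF that] by (intro mult_mono) auto
      then show ?thesis
        by (intro fin.integrable_const_bound[where B="(D * M + (D + C)) * A"] borel_measurable_times
            measurable_lebesgue_on_borel wm pm c AE_I2) auto
    qed
    have "(\<Sum>c\<in>?B. \<integral>y. w n b c y * partial c ?\<theta> y \<partial>cyl T) = (\<integral>y. (\<Sum>c\<in>?B. w n b c y * partial c ?\<theta> y) \<partial>cyl T)"
      by (rule Bochner_Integration.integral_sum[symmetric]) (rule wint)
    also have "\<dots> = (\<integral>y. (\<Sum>c\<in>?B. flux (\<sigma> n y) (u n y) (P n y) b c * partial c ?\<theta> y) \<partial>cyl T)"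
    proof (rule integral_cong_AE)
      show "(\<lambda>y. \<Sum>c\<in>?B. w n b c y * partial c ?\<theta> y) \<in> borel_measurable (cyl T)"
        by (intro borel_measurable_sum borel_measurable_times measurable_lebesgue_on_borel[OF wm] pm)
      show "(\<lambda>y. \<Sum>c\<in>?B. flux (\<sigma> n y) (u n y) (P n y) b c * partial c ?\<theta> y) \<in> borel_measurable (cyl T)"
        unfolding flux_def
        by (intro borel_measurable_sum borel_measurable_times borel_measurable_add pm meas borel_measurable_inner
            borel_measurable_Pair borel_measurable_const)
      have "AE y in cyl T. y \<in> space (cyl T)" by (rule AE_space)
      then show "AE y in cyl T. (\<Sum>c\<in>?B. w n b c y * partial c ?\<theta> y) = (\<Sum>c\<in>?B. flux (\<sigma> n y) (u n y) (P n y) b c * partial c ?\<theta> y)"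
        using zae[of n] sae[of n]
      proof eventually_elim
        fix y assume y: "y \<in> space (cyl T)" and 1: "z n y = (u n y, P n y)" and 2: "s n y = \<sigma> n y - 1"
        show "(\<Sum>c\<in>?B. w n b c y * partial c ?\<theta> y) = (\<Sum>c\<in>?B. flux (\<sigma> n y) (u n y) (P n y) b c * partial c ?\<theta> y)"
          using y b by (intro sum.cong refl) (simp add: w_def 1 2)
      qed
    qed
    also have "\<dots> = 0" by (rule weak[OF b a \<beta>])
    finally show "(\<Sum>c\<in>?B. \<integral>y. w n b c y * partial c ?\<theta> y \<partial>cyl T) = 0" .
  qed
  show ?thesis
  proof (rule jensen_generated[OF ym zm zb _ wm wB _ _ div close])
    fix F :: "(real^'n) \<times> real \<Rightarrow> real" and g :: "real \<times> (real^'n) \<Rightarrow> real"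
    assume F: "C0 F" and g: "integrable (cyl T) g"
    have Fm: "F \<in> borel_measurable borel" using F borel_measurable_continuous_onI by (auto simp: C0_def)
    have "(\<integral>y. F (z n y) * g y \<partial>cyl T) = (\<integral>y. F (u n y, P n y) * g y \<partial>cyl T)" for n
    proof (rule integral_cong_AE)
      show "(\<lambda>y. F (z n y) * g y) \<in> borel_measurable (cyl T)"
        by (intro borel_measurable_times borel_measurable_integrable[OF g] measurable_compose[OF _ Fm]
            measurable_lebesgue_on_borel zm)
      show "(\<lambda>y. F (u n y, P n y) * g y) \<in> borel_measurable (cyl T)"
        by (intro borel_measurable_times borel_measurable_integrable[OF g] measurable_compose[OF _ Fm]
            borel_measurable_Pair meas)
      show "AE y in cyl T. F (z n y) * g y = F (u n y, P n y) * g y"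
        using zae[of n] by eventually_elim simp
    qed
    then show "(\<lambda>n. \<integral>y. F (z n y) * g y \<partial>cyl T) \<longlonglongrightarrow> (\<integral>y. pairing \<mu> F y * g y \<partial>cyl T)"
      using gen F g unfolding generates_def by simp
  next
    show "w n b c y = 0" if "y \<notin> cylinder T" for n b c y using that by (simp add: w_def)
    show "w n b c = w n c b" for n b c
      by (rule ext) (auto simp: w_def flux_sym)
    show "(\<lambda>n. D * dl n) \<longlonglongrightarrow> 0" using tendsto_mult_left[OF dl, of D] by simp
  qed
qed

section \<open>The two ways of generating\<close>

lemma cylinder_slab:
  fixes i :: "'n::finite" and T :: real
  defines "S0 \<equiv> {y :: real \<times> (real^'n). 0 < fst y \<and> fst y < T \<and> (\<forall>j. j \<noteq> i \<longrightarrow> 0 \<le> snd y $ j \<and> snd y $ j < 1)}"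
  shows "cylinder T = {y\<in>S0. 0 \<le> y \<bullet> e_x i \<and> y \<bullet> e_x i < 1}" "S0 \<in> sets borel" "y + s *\<^sub>R e_x i \<in> S0 \<longleftrightarrow> y \<in> S0"
proof -
  have ip: "y \<bullet> e_x i = snd y $ i" for y :: "real \<times> (real^'n)" by (simp add: inner_prod_def inner_axis)
  show "cylinder T = {y\<in>S0. 0 \<le> y \<bullet> e_x i \<and> y \<bullet> e_x i < 1}"
    unfolding ip S0_def by (auto simp: cylinder_iff)
  show "y + s *\<^sub>R e_x i \<in> S0 \<longleftrightarrow> y \<in> S0"
    by (auto simp: S0_def axis_def)
  have o: "{y :: real \<times> (real^'n). 0 < fst y} \<in> sets borel" "{y :: real \<times> (real^'n). fst y < T} \<in> sets borel"
    "{y :: real \<times> (real^'n). snd y $ j < 1} \<in> sets borel" for j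
    by (intro borel_open open_Collect_less continuous_intros)+
  have c: "{y :: real \<times> (real^'n). 0 \<le> snd y $ j} \<in> sets borel" for j
    by (intro borel_closed closed_Collect_le continuous_intros)
  have f: "(if j = i then UNIV else {y :: real \<times> (real^'n). 0 \<le> snd y $ j} \<inter> {y. snd y $ j < 1}) \<in> sets borel" for j
    using o(3)[of j] c[of j] by auto
  have "S0 = {y. 0 < fst y} \<inter> {y. fst y < T} \<inter> (\<Inter>j. if j = i then UNIV else {y. 0 \<le> snd y $ j} \<inter> {y. snd y $ j < 1})"
    by (auto simp: S0_def split: if_splits)
  also have "\<dots> \<in> sets borel"
    by (intro sets.Int o(1,2) sets.finite_INT f) auto
  finally show "S0 \<in> sets borel" .
qed

lemma product_test_shift:
  assumes "periodic \<beta>"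
  shows "product_test a \<beta> (y + e_x i) = product_test a \<beta> y"
  using assms by (simp add: periodic_def axis_in_Basis_iff)

lemma cyl_partial_space:
  fixes \<beta> :: "real^'n::finite \<Rightarrow> real"
  assumes "interior_time T a" "smooth \<beta>" "periodic \<beta>"
  shows "(\<integral>y. partial (e_x i) (product_test a \<beta>) y \<partial>cyl T) = 0"
  by (rule slab_partial[OF e_basis(2) cylinder_slab bounded_cylinder smooth_product_test[OF assms(1,2)]
        product_test_shift[OF assms(3)]])

text \<open>There is no periodicity in time, but a short time shift keeps the support inside the
  cylinder, so the integral of the translates is locally constant. Needed in the incompressible
  case, where the density entry is the constant 1.\<close>

lemma cyl_partial_time:
  fixes \<beta> :: "real^'n::finite \<Rightarrow> real"
  assumes a: "interior_time T a" and \<beta>: "smooth \<beta>"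
  shows "(\<integral>y. partial e_t (product_test a \<beta>) y \<partial>cyl T) = 0"
proof -
  let ?\<theta> = "product_test a \<beta>"
  have sm: "smooth ?\<theta>" by (rule smooth_product_test[OF a \<beta>])
  have [measurable]: "?\<theta> \<in> borel_measurable borel" by (intro borel_measurable_continuous_onI smooth_continuous sm)
  obtain s1 s2 where s: "0 < s1" "s2 < T" "\<And>t. t < s1 \<or> s2 < t \<Longrightarrow> a t = 0"
    using a unfolding interior_time_def by blast
  obtain R where R: "\<And>y. y \<in> (cylinder T :: (real \<times> (real^'n)) set) \<Longrightarrow> norm y \<le> R"
    using bounded_cylinder[of T] by (auto simp: bounded_iff)
  interpret fin: finite_measure "cyl T :: (real \<times> (real^'n)) measure"
    by (intro finite_measure_lebesgue_on_bounded bounded_cylinder cylinder_borel)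
  interpret C: bounded_shift "cyl T :: (real \<times> (real^'n)) measure" "\<lambda>_. 1" "\<lambda>y. y" 1 R
    by unfold_locales (use R in \<open>auto simp: id_measurable_lebesgue_on\<close>)
  have C: "C.conv ?\<theta> x = (\<integral>y. indicator (cylinder T) y * ?\<theta> (x + y) \<partial>lborel)" for x
    unfolding C.conv_def
    by (subst lebesgue_on_eq_lborel(1))
      (auto intro!: cylinder_borel borel_measurable_continuous_onI continuous_on_compose2[OF smooth_continuous[OF sm]] continuous_intros
        simp del: fst_add snd_add)
  define d where "d = min s1 (T - s2)"
  have d: "d > 0" using s by (simp add: d_def)
  have const: "C.conv ?\<theta> (h *\<^sub>R e_t) = C.conv ?\<theta> 0" if h: "\<bar>h\<bar> < d" for h
  proof -
    have "C.conv ?\<theta> (h *\<^sub>R e_t) = (\<integral>y. indicator (cylinder T) (- (h *\<^sub>R e_t) + y) * ?\<theta> (h *\<^sub>R e_t + (- (h *\<^sub>R e_t) + y)) \<partial>lborel)"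
      unfolding C by (rule lborel_translate(1)[symmetric]) measurable
    also have "\<dots> = (\<integral>y. indicator (cylinder T) y * ?\<theta> y \<partial>lborel)"
    proof (rule Bochner_Integration.integral_cong[OF refl])
      fix y :: "real \<times> (real^'n)"
      show "indicator (cylinder T) (- (h *\<^sub>R e_t) + y) * ?\<theta> (h *\<^sub>R e_t + (- (h *\<^sub>R e_t) + y))
          = indicator (cylinder T) y * ?\<theta> y"
      proof (cases "a (fst y) = 0")
        case False
        then have "s1 \<le> fst y" "fst y \<le> s2" using s(3) by (meson not_le)+
        then have "- (h *\<^sub>R e_t) + y \<in> cylinder T \<longleftrightarrow> y \<in> cylinder T"
          using h s unfolding cylinder_iff d_def by auto
        then show ?thesis by (simp add: indicator_def)
      qed simp
    qed
    finally show ?thesis unfolding C by simp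
  qed
  have "((\<lambda>h. C.conv ?\<theta> (0 + h *\<^sub>R e_t)) has_derivative (\<lambda>h. frechet_derivative (C.conv ?\<theta>) (at (0 + 0 *\<^sub>R e_t)) (h *\<^sub>R e_t))) (at 0)"
    by (rule has_derivative_compose[where g="C.conv ?\<theta>" and f="\<lambda>h. 0 + h *\<^sub>R e_t"])
      (auto intro!: derivative_eq_intros has_frechet_derivative smooth_differentiable C.conv_smooth sm)
  then have D: "((\<lambda>h. C.conv ?\<theta> (h *\<^sub>R e_t)) has_derivative (\<lambda>h. frechet_derivative (C.conv ?\<theta>) (at 0) (h *\<^sub>R e_t))) (at 0)"
    by (simp only: add_0 scaleR_zero_left)
  have "((\<lambda>h::real. C.conv ?\<theta> 0) has_derivative (\<lambda>h. frechet_derivative (C.conv ?\<theta>) (at 0) (h *\<^sub>R e_t))) (at 0)"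
    by (rule has_derivative_transform_within_open[OF D, of "ball 0 d"]) (use d const in \<open>auto simp: dist_real_def\<close>)
  from has_derivative_unique[OF this has_derivative_const]
  have "frechet_derivative (C.conv ?\<theta>) (at 0) (1 *\<^sub>R e_t) = 0" by metis
  then have "partial e_t (C.conv ?\<theta>) 0 = 0" by (simp add: partial_def)
  then show ?thesis
    unfolding C.partial_conv[OF sm e_basis(1)] C.conv_def by simp
qed

text \<open>The last claim makes the initial terms of the weak formulations disappear: the test
  functions vanish at time 0.\<close>

lemma test_function_product:
  fixes \<beta> :: "real^'n::finite \<Rightarrow> real"
  assumes a: "interior_time T a" and \<beta>: "smooth \<beta>" "periodic \<beta>"
  shows "test_function T (product_test a \<beta>)" "test_function T (\<lambda>p. product_test a \<beta> p *\<^sub>R axis i (1::real))"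
    "a 0 = 0"
proof -
  obtain s1 s2 where s: "0 < s1" "s2 < T" "\<And>t. t < s1 \<or> s2 < t \<Longrightarrow> a t = 0"
    using a unfolding interior_time_def by blast
  have ex: "\<exists>s<T. \<forall>t\<ge>s. a t = 0"
    \<comment> \<open>Strictly between \<open>s2\<close> and \<open>T\<close>, since
      \<open>a\<close> need not vanish at \<open>s2\<close> itself.\<close>
    using s by (intro exI[of _ "(s2 + T) / 2"]) auto
  have sm: "smooth (product_test a \<beta>)" by (rule smooth_product_test[OF a \<beta>(1)])
  show "test_function T (product_test a \<beta>)"
    unfolding test_function_def using sm ex \<beta>(2) by (auto simp: periodic_def)
  show "test_function T (\<lambda>p. product_test a \<beta> p *\<^sub>R axis i (1::real))"
    unfolding test_function_def using smooth_scaleR_vec[OF sm] ex \<beta>(2) by (auto simp: periodic_def)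
  show "a 0 = 0" using s by auto
qed

lemma vector_test:
  fixes \<theta> :: "real \<times> (real^'n::finite) \<Rightarrow> real" and i :: 'n
  assumes \<theta>: "smooth \<theta>"
  defines "\<phi> \<equiv> (\<lambda>p. \<theta> p *\<^sub>R axis i (1::real))"
  shows "dt \<phi> y \<bullet> v = partial e_t \<theta> y * v $ i" "jac_x \<phi> y \<bullet> M = (\<Sum>j\<in>UNIV. partial (e_x j) \<theta> y * M $ i $ j)"
    "div_x \<phi> y = partial (e_x i) \<theta> y"
proof -
  have "(\<phi> has_derivative (\<lambda>v. frechet_derivative \<theta> (at y) v *\<^sub>R axis i 1)) (at y)"
    unfolding \<phi>_def by (intro has_derivative_scaleR_left has_frechet_derivative smooth_differentiable \<theta>)
  then have "dt \<phi> y = partial e_t \<theta> y *\<^sub>R axis i 1"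
    unfolding dt_def partial_def by (simp add: frechet_derivative_at[symmetric])
  then show "dt \<phi> y \<bullet> v = partial e_t \<theta> y * v $ i" by (simp add: inner_axis')
  have comp: "dx j (\<lambda>q. \<phi> q $ k) y = (if k = i then partial (e_x j) \<theta> y else 0)" for j k
  proof (cases "k = i")
    case True
    then have "(\<lambda>q. \<phi> q $ k) = \<theta>" by (simp add: \<phi>_def)
    then show ?thesis using True by (simp add: dx_def partial_def)
  next
    case False
    then have "(\<lambda>q. \<phi> q $ k) = (\<lambda>q. 0)" by (simp add: \<phi>_def axis_def)
    then show ?thesis using False by (simp add: dx_def)
  qed
  have "jac_x \<phi> y \<bullet> M = (\<Sum>k\<in>UNIV. \<Sum>j\<in>UNIV. (if k = i then partial (e_x j) \<theta> y else 0) * M $ k $ j)"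
    by (simp add: inner_vec_def jac_x_def comp)
  also have "\<dots> = (\<Sum>k\<in>UNIV. if k = i then \<Sum>j\<in>UNIV. partial (e_x j) \<theta> y * M $ k $ j else 0)"
    by (intro sum.cong) auto
  finally show "jac_x \<phi> y \<bullet> M = (\<Sum>j\<in>UNIV. partial (e_x j) \<theta> y * M $ i $ j)" by simp
  show "div_x \<phi> y = partial (e_x i) \<theta> y" by (simp add: div_x_def comp)
qed

lemma flux_rows:
  fixes F :: "real \<times> (real^'n::finite) \<Rightarrow> real"
  shows "(\<Sum>c\<in>Basis. flux s u P e_t c * F c) = s * F e_t + (\<Sum>j\<in>UNIV. s * u $ j * F (e_x j))"
    "(\<Sum>c\<in>Basis. flux s u P (e_x i) c * F c)
      = s * u $ i * F e_t + (\<Sum>j\<in>UNIV. s * (u $ i * u $ j) * F (e_x j)) + P * F (e_x i)"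
proof -
  show "(\<Sum>c\<in>Basis. flux s u P e_t c * F c) = s * F e_t + (\<Sum>j\<in>UNIV. s * u $ j * F (e_x j))"
    by (simp add: sum_space_time)
  have "(\<Sum>j\<in>UNIV. (s * (u $ i * u $ j) + (if i = j then P else 0)) * F (e_x j))
      = (\<Sum>j\<in>UNIV. s * (u $ i * u $ j) * F (e_x j) + (if i = j then P * F (e_x i) else 0))"
    by (intro sum.cong) (auto simp: algebra_simps)
  then show "(\<Sum>c\<in>Basis. flux s u P (e_x i) c * F c)
      = s * u $ i * F e_t + (\<Sum>j\<in>UNIV. s * (u $ i * u $ j) * F (e_x j)) + P * F (e_x i)"
    by (simp add: sum_space_time sum.distrib)
qed

lemma momentum_integrand:
  fixes \<theta> :: "real \<times> (real^'n::finite) \<Rightarrow> real" and i :: 'n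
  assumes \<theta>: "smooth \<theta>"
  defines "\<phi> \<equiv> (\<lambda>p. \<theta> p *\<^sub>R axis i (1::real))"
  shows "dt \<phi> y \<bullet> (s *\<^sub>R u) + jac_x \<phi> y \<bullet> (s *\<^sub>R outer u u) + P * div_x \<phi> y
    = (\<Sum>c\<in>Basis. flux s u P (e_x i) c * partial c \<theta> y)"
  unfolding \<phi>_def vector_test[OF \<theta>] flux_rows by (simp add: outer_def mult_ac)

text \<open>On either side of 1 the power with exponent \<gamma> > 1 lies farther from 1 than
  \<open>x\<close> does. Hence pressure bounds pass to the density with constant 1.\<close>

lemma abs_diff_1_le_powr:
  fixes x :: real
  assumes "x \<ge> 0" "\<gamma> > 1"
  shows "\<bar>x - 1\<bar> \<le> \<bar>x powr \<gamma> - 1\<bar>"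
proof (cases "x \<ge> 1")
  case True
  then have "x powr 1 \<le> x powr \<gamma>" using assms by (intro powr_mono) auto
  then show ?thesis using True by simp
next
  case False
  show ?thesis
  proof (cases "x = 0")
    case True then show ?thesis by simp
  next
    case False
    then have "x powr \<gamma> \<le> x powr 1" using assms \<open>\<not> x \<ge> 1\<close> by (intro powr_mono') auto
    then show ?thesis using \<open>\<not> x \<ge> 1\<close> assms False by simp
  qed
qed

text \<open>The incompressibility constraint is given for almost every time separately; multiplied
  by a function of time it becomes a space-time identity by Fubini.\<close>

lemma cyl_integral_slices:
  fixes k :: "real \<times> (real^'n::finite) \<Rightarrow> real"
  assumes k: "k \<in> borel_measurable (cyl T)" "AE y in cyl T. norm (k y) \<le> K" "K \<ge> 0"
    and a: "continuous_on UNIV a"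
    and slices: "AE t in lebesgue_on {0<..<T}. integrable torus (\<lambda>x. k (t, x)) \<and> (\<integral>x. k (t, x) \<partial>torus) = 0"
  shows "(\<integral>y. a (fst y) * k y \<partial>cyl T) = 0"
proof -
  \<comment> \<open>Fubini is applied to a Borel representative; for almost every \<open>t\<close>
    its slice agrees almost everywhere with that of \<open>k\<close>.\<close>
  obtain g where gm: "g \<in> borel_measurable borel" and gK: "\<And>y. norm (g y) \<le> K" and gk: "AE y in cyl T. g y = k y"
    using borel_representative[OF cylinder_borel k] by (elim exE conjE) (rule that, blast+)
  have [measurable]: "g \<in> borel_measurable borel" by (rule gm)
  have [measurable]: "a \<in> borel_measurable borel" using a by (rule borel_measurable_continuous_onI)
  have fstm [measurable]: "(\<lambda>y :: real \<times> (real^'n). a (fst y)) \<in> borel_measurable borel"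
    by (intro borel_measurable_continuous_onI continuous_on_compose2[OF a] continuous_intros) auto
  define q where "q y = indicator (cylinder T) y * (a (fst y) * g y)" for y
  have [measurable]: "q \<in> borel_measurable borel" unfolding q_def by measurable
  have "(\<integral>y. a (fst y) * k y \<partial>cyl T) = (\<integral>y. a (fst y) * g y \<partial>cyl T)"
  proof (rule integral_cong_AE)
    show "(\<lambda>y. a (fst y) * k y) \<in> borel_measurable (cyl T)"
      by (intro borel_measurable_times measurable_lebesgue_on_borel[OF fstm] k)
    show "(\<lambda>y. a (fst y) * g y) \<in> borel_measurable (cyl T)"
      by (intro measurable_lebesgue_on_borel) measurable
    show "AE y in cyl T. a (fst y) * k y = a (fst y) * g y" using gk by eventually_elim simp
  qed
  also have "\<dots> = (\<integral>y. q y \<partial>lborel)"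
    unfolding q_def by (subst lebesgue_on_eq_lborel(1)) auto
  also have "\<dots> = (\<integral>t. (\<integral>x. q (t, x) \<partial>lborel) \<partial>lborel)"
  proof -
    obtain R where R: "\<And>y. y \<in> (cylinder T :: (real \<times> (real^'n)) set) \<Longrightarrow> norm y \<le> R"
      using bounded_cylinder[of T] by (auto simp: bounded_iff)
    obtain A where A: "A \<ge> 0" "\<And>t. norm (t - 0) \<le> R \<Longrightarrow> \<bar>a t\<bar> \<le> A"
      using continuous_bounded_cball[OF a, of 0 R] by blast
    have "bdd_supp q"
      unfolding bdd_supp_def
    proof (intro conjI)
      have "\<bar>q y\<bar> \<le> A * K" for y
      proof (cases "y \<in> cylinder T")
        case True
        have "\<bar>fst y\<bar> \<le> R" using R[OF True] norm_fst_le[of "fst y" "snd y"] by simp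
        then have "\<bar>a (fst y)\<bar> * \<bar>g y\<bar> \<le> A * K" using A gK[of y] by (intro mult_mono) auto
        then show ?thesis using True by (simp add: q_def abs_mult)
      qed (use A k(3) in \<open>simp add: q_def\<close>)
      then show "\<exists>B. \<forall>y. \<bar>q y\<bar> \<le> B" by blast
      show "\<exists>R. \<forall>y. norm y > R \<longrightarrow> q y = 0" using R by (intro exI[of _ R]) (force simp: q_def indicator_def)
    qed measurable
    then have "integrable (lborel \<Otimes>\<^sub>M lborel) q" using bdd_supp_integrable by (simp add: lborel_prod)
    then have "integrable (lborel \<Otimes>\<^sub>M lborel) (\<lambda>(t, x). q (t, x))" by (simp add: case_prod_eta)
    from lborel_pair.integral_fst[OF this] show ?thesis by (simp add: lborel_prod case_prod_eta)
  qed
  also have "\<dots> = (\<integral>t. 0 \<partial>(lborel :: real measure))"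
  proof (rule integral_cong_AE)
    show "(\<lambda>t. \<integral>x. q (t, x) \<partial>lborel) \<in> borel_measurable lborel"
    proof -
      have "(\<lambda>(t, x). q (t, x)) \<in> borel_measurable (lborel \<Otimes>\<^sub>M lborel)" by (simp add: lborel_prod case_prod_eta)
      then show ?thesis by (rule lborel.borel_measurable_lebesgue_integral)
    qed
    have "AE y in lebesgue. y \<in> cylinder T \<longrightarrow> g y = k y"
      using gk by (subst (asm) AE_restrict_space_iff) auto
    then have "AE y in lborel. y \<in> cylinder T \<longrightarrow> g y = k y"
      by (simp only: AE_completion_iff)
    then have "AE y in (lborel :: real measure) \<Otimes>\<^sub>M (lborel :: (real^'n) measure). y \<in> cylinder T \<longrightarrow> g y = k y"
      unfolding lborel_prod .
    then have 1: "AE t in lborel. AE x in lborel. (t, x) \<in> cylinder T \<longrightarrow> g (t, x) = k (t, x)"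
      by (rule lborel_pair.AE_pair)
    have "AE t in lebesgue. t \<in> {0<..<T} \<longrightarrow> integrable torus (\<lambda>x. k (t, x)) \<and> (\<integral>x. k (t, x) \<partial>torus) = 0"
      using slices by (subst (asm) AE_restrict_space_iff) auto
    then have 2: "AE t in lborel. t \<in> {0<..<T} \<longrightarrow> integrable torus (\<lambda>x. k (t, x)) \<and> (\<integral>x. k (t, x) \<partial>torus) = 0"
      by (simp only: AE_completion_iff)
    show "AE t in lborel. (\<integral>x. q (t, x) \<partial>lborel) = 0"
      using 1 2
    proof eventually_elim
      fix t assume 1: "AE x in lborel. (t, x) \<in> cylinder T \<longrightarrow> g (t, x) = k (t, x)"
        and 2: "t \<in> {0<..<T} \<longrightarrow> integrable torus (\<lambda>x. k (t, x)) \<and> (\<integral>x. k (t, x) \<partial>torus) = 0"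
      show "(\<integral>x. q (t, x) \<partial>lborel) = 0"
      proof (cases "t \<in> {0<..<T}")
        case False
        then have "q (t, x) = 0" for x by (auto simp: q_def cylinder_def indicator_def)
        then show ?thesis by simp
      next
        case True
        have gt: "(\<lambda>x. g (t, x)) \<in> borel_measurable borel"
          by (rule measurable_compose[OF _ gm]) (intro borel_measurable_continuous_onI continuous_intros)
        have "(\<integral>x. q (t, x) \<partial>lborel) = (\<integral>x. a t * (indicator unit_cell x *\<^sub>R g (t, x)) \<partial>lborel)"
          using True by (intro Bochner_Integration.integral_cong) (auto simp: q_def cylinder_def indicator_def)
        also have "\<dots> = a t * (\<integral>x. indicator unit_cell x *\<^sub>R g (t, x) \<partial>lborel)" by (rule integral_mult_right_zero)
        also have "(\<integral>x. indicator unit_cell x *\<^sub>R g (t, x) \<partial>lborel) = (\<integral>x. g (t, x) \<partial>torus)"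
          by (rule lebesgue_on_eq_lborel(1)[OF unit_cell_borel gt, symmetric])
        also have "\<dots> = (\<integral>x. k (t, x) \<partial>torus)"
        proof (rule integral_cong_AE)
          show "(\<lambda>x. g (t, x)) \<in> borel_measurable torus" by (rule measurable_lebesgue_on_borel[OF gt])
          show "(\<lambda>x. k (t, x)) \<in> borel_measurable torus" using 2 True by (simp add: borel_measurable_integrable)
          have "AE x in lebesgue. (t, x) \<in> cylinder T \<longrightarrow> g (t, x) = k (t, x)"
            using 1 by (simp only: AE_completion_iff)
          then have "AE x in lebesgue. x \<in> unit_cell \<longrightarrow> g (t, x) = k (t, x)"
            by eventually_elim (use True in \<open>auto simp: cylinder_def\<close>)
          then show "AE x in torus. g (t, x) = k (t, x)" by (subst AE_restrict_space_iff) auto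
        qed
        also have "\<dots> = 0" using 2 True by simp
        finally show ?thesis by simp
      qed
    qed
  qed simp
  finally show ?thesis by simp
qed

text \<open>The pressure lift differs from the physical pressure, up to the factor \<rho>bar, by a
  constant; the constant meets a spatial derivative of the test function, whose integral over the
  cylinder is zero.\<close>

lemma isentropic_flux:
  fixes \<rho> :: "real \<times> (real^'n::finite) \<Rightarrow> real"
  assumes sol: "isentropic_weak_solution T \<gamma> \<epsilon> \<rho> u" and \<rho>bar: "\<rho>bar > 0" and \<epsilon>: "\<epsilon> > 0"
    and b: "b \<in> Basis" and a: "interior_time T a" and \<beta>: "smooth \<beta>" "periodic \<beta>"
  defines "P \<equiv> \<lambda>y. 1 / (\<epsilon> * \<rho>bar) * (\<rho> y powr \<gamma> - \<rho>bar powr \<gamma>)"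
  shows "(\<integral>y. (\<Sum>c\<in>Basis. flux (\<rho> y / \<rho>bar) (u y) (P y) b c * partial c (product_test a \<beta>) y) \<partial>cyl T) = 0"
proof -
  let ?\<theta> = "product_test a \<beta>"
  have sm: "smooth ?\<theta>" by (rule smooth_product_test[OF a \<beta>(1)])
  note tf = test_function_product[OF a \<beta>]
  obtain \<rho>0 u0 where mom: "\<And>\<phi> :: real \<times> (real^'n) \<Rightarrow> real^'n. test_function T \<phi> \<Longrightarrow>
        integrable (cyl T) (\<lambda>y. dt \<phi> y \<bullet> (\<rho> y *\<^sub>R u y) + jac_x \<phi> y \<bullet> (\<rho> y *\<^sub>R outer (u y) (u y)) + 1 / \<epsilon> * \<rho> y powr \<gamma> * div_x \<phi> y) \<and>
        (\<integral>y. dt \<phi> y \<bullet> (\<rho> y *\<^sub>R u y) + jac_x \<phi> y \<bullet> (\<rho> y *\<^sub>R outer (u y) (u y)) + 1 / \<epsilon> * \<rho> y powr \<gamma> * div_x \<phi> y \<partial>cyl T)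
          = - (\<integral>x. \<phi> (0, x) \<bullet> (\<rho>0 x *\<^sub>R u0 x) \<partial>torus)"
    and mass: "\<And>\<psi> :: real \<times> (real^'n) \<Rightarrow> real. test_function T \<psi> \<Longrightarrow>
        (\<integral>y. \<rho> y * dt \<psi> y + grad_x \<psi> y \<bullet> (\<rho> y *\<^sub>R u y) \<partial>cyl T) = - (\<integral>x. \<rho>0 x * \<psi> (0, x) \<partial>torus)"
    using sol unfolding isentropic_weak_solution_def Let_def by blast
  have scale: "(\<Sum>c\<in>Basis. flux (\<rho> y / \<rho>bar) (u y) (P y) b c * partial c ?\<theta> y)
      = (1 / \<rho>bar) * (\<Sum>c\<in>Basis. flux (\<rho> y) (u y) (\<rho>bar * P y) b c * partial c ?\<theta> y)" for y
  \<comment> \<open>Division by \<rho>bar normalises the density entry; the pressure entry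
    compensates with the factor \<rho>bar, the origin of \<rho>bar in the denominator of the
    pressure lift.\<close>
  proof -
    have "flux (\<rho> y / \<rho>bar) (u y) (P y) b c = (1 / \<rho>bar) * flux (\<rho> y) (u y) (\<rho>bar * P y) b c" for c
      using \<rho>bar by (simp add: flux_def field_simps)
    then show ?thesis by (simp add: sum_distrib_left mult_ac)
  qed
  have "(\<integral>y. (\<Sum>c\<in>Basis. flux (\<rho> y) (u y) (\<rho>bar * P y) b c * partial c ?\<theta> y) \<partial>cyl T) = 0"
    using b
  proof (cases rule: Basis_space_time_cases)
    case 1
    have "\<rho> y * dt ?\<theta> y + grad_x ?\<theta> y \<bullet> (\<rho> y *\<^sub>R u y) = (\<Sum>c\<in>Basis. flux (\<rho> y) (u y) (\<rho>bar * P y) b c * partial c ?\<theta> y)" for y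
      unfolding 1 flux_rows by (simp add: inner_vec_def grad_x_def dx_def dt_def partial_def mult_ac)
    then show ?thesis using mass[OF tf(1)] tf(3) by simp
  next
    case (2 i)
    let ?\<phi> = "\<lambda>p. ?\<theta> p *\<^sub>R axis i (1::real)"
    let ?I = "\<lambda>y. dt ?\<phi> y \<bullet> (\<rho> y *\<^sub>R u y) + jac_x ?\<phi> y \<bullet> (\<rho> y *\<^sub>R outer (u y) (u y)) + 1 / \<epsilon> * \<rho> y powr \<gamma> * div_x ?\<phi> y"
    have P: "\<rho>bar * P y = 1 / \<epsilon> * \<rho> y powr \<gamma> - \<rho>bar powr \<gamma> / \<epsilon>" for y
      using \<rho>bar \<epsilon> by (simp add: P_def field_simps)
    have eq: "(\<Sum>c\<in>Basis. flux (\<rho> y) (u y) (\<rho>bar * P y) b c * partial c ?\<theta> y)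
        = ?I y - \<rho>bar powr \<gamma> / \<epsilon> * partial (e_x i) ?\<theta> y" for y
      unfolding 2 momentum_integrand[OF sm, symmetric] P vector_test(3)[OF sm] by (simp only: left_diff_distrib)
    have int: "integrable (cyl T) (partial (e_x i) ?\<theta>)"
    proof -
      interpret fin: finite_measure "cyl T :: (real \<times> (real^'n)) measure"
        by (intro finite_measure_lebesgue_on_bounded bounded_cylinder cylinder_borel)
      obtain R where R: "\<And>y. y \<in> (cylinder T :: (real \<times> (real^'n)) set) \<Longrightarrow> norm y \<le> R"
        using bounded_cylinder[of T] by (auto simp: bounded_iff)
      have c: "continuous_on UNIV (partial (e_x i) ?\<theta>)" by (intro smooth_continuous smooth_partial sm e_basis)
      obtain A where "\<And>y. norm (y - 0) \<le> R \<Longrightarrow> \<bar>partial (e_x i) ?\<theta> y\<bar> \<le> A"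
        using continuous_bounded_cball[OF c, of 0 R] by blast
      with R show ?thesis
        by (intro fin.integrable_const_bound[where B=A] measurable_lebesgue_on_borel borel_measurable_continuous_onI c AE_I2) auto
    qed
    have "(\<integral>y. ?I y \<partial>cyl T) = 0" using mom[OF tf(2)[of i]] tf(3) by simp
    then show ?thesis
      unfolding eq using mom[OF tf(2)[of i]] int cyl_partial_space[OF a \<beta>, of i] by simp
  qed
  then show ?thesis unfolding scale by simp
qed

lemma pairing_return:
  assumes "f \<in> borel_measurable borel"
  shows "pairing (\<lambda>y. return borel (v y)) f y = f (v y)"
  using assms by (simp add: pairing_def integral_return)

text \<open>The row \<open>e_t\<close> states that (1,u) is divergence-free: its time part is the
  integral of a pure time derivative, its space part the constraint on almost every time slice. The
  other rows are the momentum equation tested with one coordinate vector.\<close>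

lemma incompressible_flux:
  fixes u :: "real \<times> (real^'n::finite) \<Rightarrow> real^'n"
  assumes sol: "incompressible_weak_solution T v0 u P" and ub: "AE y in cyl T. norm (u y) \<le> C" "C \<ge> 0"
    and b: "b \<in> Basis" and a: "interior_time T a" and \<beta>: "smooth \<beta>" "periodic \<beta>"
  shows "(\<integral>y. (\<Sum>c\<in>Basis. flux 1 (u y) (P y) b c * partial c (product_test a \<beta>) y) \<partial>cyl T) = 0"
proof -
  let ?\<theta> = "product_test a \<beta>"
  have sm: "smooth ?\<theta>" by (rule smooth_product_test[OF a \<beta>(1)])
  note tf = test_function_product[OF a \<beta>]
  let ?m = "\<lambda>y. return borel (u y, P y)"
  have um: "u \<in> borel_measurable (cyl T)" using sol by (auto simp: incompressible_weak_solution_def)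
  have oc: "continuous_on UNIV (\<lambda>(v :: real^'n, q :: real). outer v v)"
    unfolding outer_def case_prod_beta by (intro continuous_intros)
  have pr: "pairing ?m (\<lambda>(v, q). v) y = u y" "pairing ?m (\<lambda>(v, q). outer v v) y = outer (u y) (u y)"
    "pairing ?m (\<lambda>(v, q). q) y = P y" for y
    by (subst pairing_return; (simp; fail)?,
        (intro borel_measurable_continuous_onI oc; (simp add: case_prod_beta; intro continuous_intros)?; fail)?)+
  have mvs: "augmented_mvs T v0 ?m" using sol by (simp add: incompressible_weak_solution_def)
  have mom: "(\<integral>y. dt \<phi> y \<bullet> u y + jac_x \<phi> y \<bullet> outer (u y) (u y) + P y * div_x \<phi> y \<partial>cyl T) = - (\<integral>x. \<phi> (0, x) \<bullet> v0 x \<partial>torus)"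
    if "test_function T \<phi>" for \<phi> :: "real \<times> (real^'n) \<Rightarrow> real^'n"
    using mvs that unfolding augmented_mvs_def Let_def pr by blast
  have div: "AE t in lebesgue_on {0<..<T}. integrable torus (\<lambda>x. space_grad \<beta> x \<bullet> u (t, x)) \<and> (\<integral>x. space_grad \<beta> x \<bullet> u (t, x) \<partial>torus) = 0"
    using mvs \<beta> unfolding augmented_mvs_def Let_def pr by blast
  from b show ?thesis
  proof (cases rule: Basis_space_time_cases)
    case 1
    define k where "k y = space_grad \<beta> (snd y) \<bullet> u y" for y
    have sg: "space_grad \<beta> x = (\<chi> i. partial (axis i 1) \<beta> x)" for x by (simp add: space_grad_def partial_def)
    have bi: "axis i 1 \<in> (Basis :: (real^'n) set)" for i by (auto simp: Basis_vec_def)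
    have sgc: "continuous_on UNIV (\<lambda>y :: real \<times> (real^'n). space_grad \<beta> (snd y))"
      unfolding sg by (intro continuous_on_vec_lambda continuous_on_compose2[OF smooth_continuous[OF smooth_partial[OF \<beta>(1) bi], of UNIV]] continuous_intros) auto
    have km: "k \<in> borel_measurable (cyl T)"
      unfolding k_def by (intro borel_measurable_inner um measurable_lebesgue_on_borel borel_measurable_continuous_onI sgc)
    have "\<exists>A. \<forall>x. \<bar>partial (axis i 1) \<beta> x\<bar> \<le> A" for i
      using periodic_bounded[OF periodic_partial[OF \<beta>(2,1)] smooth_continuous[OF smooth_partial[OF \<beta>(1) bi]]] by metis
    then obtain A where A: "\<And>i x. \<bar>partial (axis i 1) \<beta> x\<bar> \<le> A i" by metis
    have A0: "A i \<ge> 0" for i using A[of i 0] by linarith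
    have kb: "AE y in cyl T. norm (k y) \<le> (\<Sum>i\<in>UNIV. A i) * C"
      using ub(1)
    proof eventually_elim
      fix y assume y: "norm (u y) \<le> C"
      have "norm (space_grad \<beta> (snd y)) \<le> (\<Sum>i\<in>UNIV. A i)"
        by (rule order_trans[OF norm_le_l1_cart sum_mono]) (simp add: sg A)
      then have "norm (space_grad \<beta> (snd y)) * norm (u y) \<le> (\<Sum>i\<in>UNIV. A i) * C"
        using y A0 by (intro mult_mono sum_nonneg) auto
      then show "norm (k y) \<le> (\<Sum>i\<in>UNIV. A i) * C"
        unfolding k_def real_norm_def by (rule order_trans[OF Cauchy_Schwarz_ineq2])
    qed
    have ac: "continuous_on UNIV a" using a by (auto simp: interior_time_def intro: smooth_continuous)
    have z: "(\<integral>y. a (fst y) * k y \<partial>cyl T) = 0"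
      by (rule cyl_integral_slices[OF km kb _ ac]) (use A0 ub(2) div in \<open>auto simp: k_def intro!: mult_nonneg_nonneg sum_nonneg\<close>)
    interpret fin: finite_measure "cyl T :: (real \<times> (real^'n)) measure"
      by (intro finite_measure_lebesgue_on_bounded bounded_cylinder cylinder_borel)
    obtain R where R: "\<And>y. y \<in> (cylinder T :: (real \<times> (real^'n)) set) \<Longrightarrow> norm y \<le> R"
      using bounded_cylinder[of T] by (auto simp: bounded_iff)
    have tc: "continuous_on UNIV (partial e_t ?\<theta>)" by (intro smooth_continuous smooth_partial sm e_basis)
    obtain B where B: "\<And>y. norm (y - 0) \<le> R \<Longrightarrow> \<bar>partial e_t ?\<theta> y\<bar> \<le> B"
      using continuous_bounded_cball[OF tc, of 0 R] by blast
    have i1: "integrable (cyl T) (partial e_t ?\<theta>)"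
      using B R by (intro fin.integrable_const_bound[where B=B] measurable_lebesgue_on_borel borel_measurable_continuous_onI tc AE_I2) auto
    obtain A' where A': "A' \<ge> 0" "\<And>t. norm (t - 0) \<le> R \<Longrightarrow> \<bar>a t\<bar> \<le> A'"
      using continuous_bounded_cball[OF ac, of 0 R] by blast
    have i2: "integrable (cyl T) (\<lambda>y. a (fst y) * k y)"
    proof (rule fin.integrable_const_bound[where B="A' * ((\<Sum>i\<in>UNIV. A i) * C)"])
      have "AE y in cyl T. y \<in> space (cyl T)" by (rule AE_space)
      then show "AE y in cyl T. norm (a (fst y) * k y) \<le> A' * ((\<Sum>i\<in>UNIV. A i) * C)"
        using kb
      proof eventually_elim
        fix y :: "real \<times> (real^'n)" assume "y \<in> space (cyl T)" and kb: "norm (k y) \<le> (\<Sum>i\<in>UNIV. A i) * C"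
        then have "\<bar>fst y\<bar> \<le> R" using R[of y] norm_fst_le[of "fst y" "snd y"] by simp
        then show "norm (a (fst y) * k y) \<le> A' * ((\<Sum>i\<in>UNIV. A i) * C)"
          unfolding norm_mult using A' kb by (intro mult_mono) auto
      qed
      show "(\<lambda>y. a (fst y) * k y) \<in> borel_measurable (cyl T)"
        by (intro borel_measurable_times km measurable_lebesgue_on_borel borel_measurable_continuous_onI
            continuous_on_compose2[OF ac] continuous_intros) auto
    qed
    have \<theta>x: "partial (e_x j) ?\<theta> y = a (fst y) * partial (axis j 1) \<beta> (snd y)" for j y
      using a \<beta>(1) by (simp add: interior_time_def partial_mult smooth_fst smooth_snd partial_fst partial_snd)
    have "(\<Sum>c\<in>Basis. flux 1 (u y) (P y) b c * partial c ?\<theta> y) = partial e_t ?\<theta> y + a (fst y) * k y" for y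
      unfolding 1 flux_rows \<theta>x k_def sg by (simp add: inner_vec_def sum_distrib_left mult_ac)
    then show ?thesis using i1 i2 z cyl_partial_time[OF a \<beta>(1)] by simp
  next
    case (2 i)
    let ?\<phi> = "\<lambda>p. ?\<theta> p *\<^sub>R axis i (1::real)"
    have "(\<Sum>c\<in>Basis. flux 1 (u y) (P y) b c * partial c ?\<theta> y)
        = dt ?\<phi> y \<bullet> u y + jac_x ?\<phi> y \<bullet> outer (u y) (u y) + P y * div_x ?\<phi> y" for y
      unfolding 2 momentum_integrand[OF sm, symmetric] by simp
    then show ?thesis using mom[OF tf(2)[of i]] tf(3) by simp
  qed
qed

theorem theorem1p1:
  fixes T \<gamma> :: real
    and u0 :: "real^'n \<Rightarrow> real^'n"
    and \<mu> :: "real \<times> (real^'n) \<Rightarrow> ((real^'n) \<times> real) measure"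
  assumes "T > 0" and "\<gamma> > 1"
    and "augmented_mvs T u0 \<mu>"
    and "(\<exists>\<rho>bar \<epsilon> \<rho> u. \<rho>bar > 0 \<and> (\<forall>n. \<epsilon> n > 0) \<and> \<epsilon> \<longlonglongrightarrow> 0 \<and>
             (\<forall>n. isentropic_weak_solution T \<gamma> (\<epsilon> n) (\<rho> n) (u n)) \<and>
             bounded_in_Linfty T (\<lambda>n y. pressure_lift \<gamma> \<rho>bar (\<epsilon> n) (\<rho> n y) (u n y)) \<and>
             generates T (\<lambda>n y. pressure_lift \<gamma> \<rho>bar (\<epsilon> n) (\<rho> n y) (u n y)) \<mu>)
         \<or> (\<exists>v0 u P. (\<forall>n. incompressible_weak_solution T (v0 n) (u n) (P n)) \<and>
             bounded_in_Linfty T u \<and> bounded_in_Linfty T P \<and>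
             generates T (\<lambda>n y. (u n y, P n y)) \<mu>)"
  shows "\<exists>E\<subseteq>cylinder T. E \<in> sets (cyl T) \<and> cylinder T - E \<in> null_sets (cyl T) \<and>
           (\<forall>y\<in>E. integrable (pushforward_S \<mu> y) (\<lambda>z. z) \<and>
              (\<forall>f. continuous_on lifted_space f \<longrightarrow>
                 integrable (pushforward_S \<mu> y) f \<and>
                 ereal (pairing (pushforward_S \<mu>) f y)
                   \<ge> Q_env f (pairing (pushforward_S \<mu>) (\<lambda>z. z) y)))"
proof -
  have ym: "young_measure T \<mu>" using assms(3) by (simp add: augmented_mvs_def)
  from assms(4) show ?thesis
  proof (elim disjE exE conjE)
    fix \<rho>bar :: real and \<epsilon> :: "nat \<Rightarrow> real" and \<rho> and u :: "nat \<Rightarrow> real \<times> (real^'n) \<Rightarrow> real^'n"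
    assume \<rho>bar: "\<rho>bar > 0" and \<epsilon>: "\<forall>n. \<epsilon> n > 0" "\<epsilon> \<longlonglongrightarrow> 0"
      and sol: "\<forall>n. isentropic_weak_solution T \<gamma> (\<epsilon> n) (\<rho> n) (u n)"
      and bd: "bounded_in_Linfty T (\<lambda>n y. pressure_lift \<gamma> \<rho>bar (\<epsilon> n) (\<rho> n y) (u n y))"
      and gen: "generates T (\<lambda>n y. pressure_lift \<gamma> \<rho>bar (\<epsilon> n) (\<rho> n y) (u n y)) \<mu>"
    define P where "P n y = 1 / (\<epsilon> n * \<rho>bar) * (\<rho> n y powr \<gamma> - \<rho>bar powr \<gamma>)" for n y
    have lift: "pressure_lift \<gamma> \<rho>bar (\<epsilon> n) (\<rho> n y) (u n y) = (u n y, P n y)" for n y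
      by (simp add: pressure_lift_def P_def)
    obtain C0 where C0: "\<And>n. AE y in cyl T. norm (u n y, P n y) \<le> C0"
      and m: "\<And>n. (\<lambda>y. (u n y, P n y)) \<in> borel_measurable (cyl T)"
      using bd unfolding bounded_in_Linfty_def lift by blast
    define C where "C = max 0 C0"
    have Cb: "AE y in cyl T. norm (u n y, P n y) \<le> C" for n
      using C0[of n] by eventually_elim (simp add: C_def)
    have um: "u n \<in> borel_measurable (cyl T)" and Pm: "P n \<in> borel_measurable (cyl T)" for n
      using measurable_compose[OF m borel_measurable_continuous_onI[OF continuous_on_fst[OF continuous_on_id]], of n]
        measurable_compose[OF m borel_measurable_continuous_onI[OF continuous_on_snd[OF continuous_on_id]], of n] by simp_all
    have \<rho>i: "integrable (cyl T) (\<rho> n)" and \<rho>0: "AE y in cyl T. 0 \<le> \<rho> n y" for n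
      using spec[OF sol, of n] by (simp_all add: isentropic_weak_solution_def)
    \<comment> \<open>From (\<rho>/\<rho>bar)^\<gamma> - 1 = \<epsilon> \<rho>bar P /
      \<rho>bar^\<gamma>, by the definition of the pressure lift, with |P| \<le> C.\<close>
    define dl where "dl n = \<epsilon> n * (\<rho>bar * C / \<rho>bar powr \<gamma>)" for n
    have dl: "dl \<longlonglongrightarrow> 0" unfolding dl_def by (rule tendsto_mult_left_zero[OF \<epsilon>(2)])
    have \<sigma>: "AE y in cyl T. \<bar>\<rho> n y / \<rho>bar - 1\<bar> \<le> dl n" for n
      using \<rho>0[of n] Cb[of n]
    proof eventually_elim
      fix y assume \<rho>: "0 \<le> \<rho> n y" and P: "norm (u n y, P n y) \<le> C"
      have PC: "\<bar>P n y\<bar> \<le> C" using P norm_snd_le[of "P n y" "u n y"] by simp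
      have "\<bar>\<rho> n y / \<rho>bar - 1\<bar> \<le> \<bar>(\<rho> n y / \<rho>bar) powr \<gamma> - 1\<bar>"
        using \<rho> \<rho>bar assms(2) by (intro abs_diff_1_le_powr) auto
      also have "(\<rho> n y / \<rho>bar) powr \<gamma> - 1 = \<epsilon> n * (\<rho>bar * P n y / \<rho>bar powr \<gamma>)"
      proof -
        have e: "\<epsilon> n > 0" using \<epsilon>(1) by blast
        have p: "\<rho>bar powr \<gamma> > 0" using \<rho>bar by simp
        have "\<epsilon> n * (\<rho>bar * P n y) = \<rho> n y powr \<gamma> - \<rho>bar powr \<gamma>"
          using e \<rho>bar by (simp add: P_def)
        then show ?thesis using p \<rho> \<rho>bar by (simp add: powr_divide field_simps)
      qed
      also have "\<bar>\<dots>\<bar> = \<epsilon> n * (\<rho>bar * \<bar>P n y\<bar> / \<rho>bar powr \<gamma>)"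
        using \<epsilon>(1) \<rho>bar by (simp add: abs_mult less_imp_le)
      also have "\<dots> \<le> dl n"
        unfolding dl_def using \<epsilon>(1) \<rho>bar PC by (intro mult_left_mono divide_right_mono) (auto intro: less_imp_le)
      finally show "\<bar>\<rho> n y / \<rho>bar - 1\<bar> \<le> dl n" .
    qed
    show ?thesis
    proof (rule jensen_generated_AE[OF ym _ _ dl um Pm _ Cb \<sigma>])
      show "C \<ge> 0" by (simp add: C_def)
      show "dl n \<ge> 0" for n
        unfolding dl_def C_def using spec[OF \<epsilon>(1), of n] \<rho>bar by (intro mult_nonneg_nonneg divide_nonneg_nonneg) auto
      show "(\<lambda>y. \<rho> n y / \<rho>bar) \<in> borel_measurable (cyl T)" for n
        by (intro borel_measurable_divide borel_measurable_integrable[OF \<rho>i] borel_measurable_const)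
      show "generates T (\<lambda>n y. (u n y, P n y)) \<mu>" using gen unfolding lift .
      fix n a and b :: "real \<times> (real^'n)" and \<beta> :: "real^'n \<Rightarrow> real"
      assume "b \<in> Basis" "interior_time T a" "smooth \<beta>" "periodic \<beta>"
      from isentropic_flux[OF spec[OF sol] \<rho>bar spec[OF \<epsilon>(1)] this, of n]
      show "(\<integral>y. (\<Sum>c\<in>Basis. flux (\<rho> n y / \<rho>bar) (u n y) (P n y) b c * partial c (product_test a \<beta>) y) \<partial>cyl T) = 0"
        unfolding P_def .
    qed
  next
    fix v0 and u :: "nat \<Rightarrow> real \<times> (real^'n) \<Rightarrow> real^'n" and P
    assume sol: "\<forall>n. incompressible_weak_solution T (v0 n) (u n) (P n)"
      and ub: "bounded_in_Linfty T u" and Pb: "bounded_in_Linfty T P"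
      and gen: "generates T (\<lambda>n y. (u n y, P n y)) \<mu>"
    obtain C1 where C1: "\<And>n. AE y in cyl T. norm (u n y) \<le> C1" and um: "\<And>n. u n \<in> borel_measurable (cyl T)"
      using ub unfolding bounded_in_Linfty_def by blast
    obtain C2 where C2: "\<And>n. AE y in cyl T. norm (P n y) \<le> C2" and Pm: "\<And>n. P n \<in> borel_measurable (cyl T)"
      using Pb unfolding bounded_in_Linfty_def by blast
    have C1': "AE y in cyl T. norm (u n y) \<le> max 0 C1" for n using C1[of n] by eventually_elim simp
    have Cb: "AE y in cyl T. norm (u n y, P n y) \<le> max 0 C1 + max 0 C2" for n
      using C1[of n] C2[of n]
    proof eventually_elim
      fix y assume "norm (u n y) \<le> C1" "norm (P n y) \<le> C2"
      then show "norm (u n y, P n y) \<le> max 0 C1 + max 0 C2"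
        using norm_Pair_le[of "u n y" "P n y"] by linarith
    qed
    show ?thesis
    \<comment> \<open>Here the lifts themselves satisfy the weak constraint, so there is no density
      perturbation.\<close>
    proof (rule jensen_generated_AE[OF ym _ _ _ um Pm _ Cb _ gen, where \<sigma>="\<lambda>_ _. 1" and dl="\<lambda>_. 0"])
      fix n a and b :: "real \<times> (real^'n)" and \<beta> :: "real^'n \<Rightarrow> real"
      assume "b \<in> Basis" "interior_time T a" "smooth \<beta>" "periodic \<beta>"
      from incompressible_flux[OF spec[OF sol] C1' _ this]
      show "(\<integral>y. (\<Sum>c\<in>Basis. flux 1 (u n y) (P n y) b c * partial c (product_test a \<beta>) y) \<partial>cyl T) = 0" by simp
    qed auto
  qed
qed

end
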